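(* Let $k$ be an algebraically closed field of characteristic $p>0$ and let $\epsilon\in\{0,1\}$. Let $H$ be a pointed Hopf algebra over $k$ of dimension $p^3$ whose associated graded Hopf algebra $\operatorname{gr}H$ (with respect to the coradical filtration) is isomorphic to $$k\langle a,g_1,g_2\rangle/(g_1^p=g_2^p=1,\ g_1g_2=g_2g_1,\ a^p=0,\ g_ia=ag_i\ (i=1,2))$$ with $\Delta(g_i)=g_i\otimes g_i$, $\Delta(a)=a\otimes1+g_1^{\epsilon}\otimes a$. Then $H$ is isomorphic, as a Hopf algebra, to a quotient of the free algebra $k\langle g_1,g_2,x\rangle$ with $\Delta(g_i)=g_i\otimes g_i$, $\Delta(x)=x\otimes 1+g_1^{\epsilon}\otimes x$, by the relations $g_1^p=g_2^p=1$, $g_1g_2=g_2g_1$ together with: (a) if $\epsilon=0$: $g_1x=xg_1$, $g_2x=xg_2$, $x^p=\epsilon_2x$ with $\epsilon_2\in\{0,1\}$ (two classes); (b) if $\epsilon=1$: $g_1x-xg_1=\epsilon_1g_1(1-g_1)$, $g_2x-xg_2=\tau g_2(1-g_1)$, $x^p=\epsilon_1x$, where either $\epsilon_1=0$ and $\tau\in\{0,1\}$ (two classes), or $\epsilon_1=1$ and $\tau\in k$ (one infinite family). Conversely, for each such choice of parameters the corresponding quotient is a pointed Hopf algebra of dimension $p^3$ whose associated graded Hopf algebra is the one above.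
   Context: A Hopf algebra $H$ is pointed if its coradical $H_0$ (the sum of all simple subcoalgebras) is the group algebra of its group $G(H)$ of grouplike elements. The coradical filtration is $H_0\subseteq H_1\subseteq\cdots$ with $H_n=\Delta^{-1}(H\otimes H_{n-1}+H_0\otimes H)$, and $\operatorname{gr}H=\bigoplus_{n\ge0}H_n/H_{n-1}$ (with $H_{-1}=0$), a graded Hopf algebra when $H$ is pointed. Counits are given by $\varepsilon(g_i)=1$ and $\varepsilon=0$ on the other generators; antipodes are then determined. "Class" means a member of the listed representatives. *)

theory Defs
  imports
    "HOL-Algebra.Algebra"
    "HOL-Algebra.Algebraic_Closure_Type"
    "HOL-Library.Poly_Mapping"
begin

section \<open>Linear algebra over a field given as a type\<close>

text \<open>
  The ground field is a type \<open>'k\<close> of class \<^class>\<open>field\<close>; vector spaces and algebras are records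
  of HOL-Algebra with an explicit carrier.  The \<open>mult\<close> and \<open>one\<close> components of a record that is
  only used as a vector space are irrelevant.
\<close>

locale k_algebra = module "ring_of_type_algebra :: 'k ring" A + ring A
  for A :: "('k::field, 'a, 'm) module_scheme" (structure) +
  assumes smult_mult_left:
      "\<lbrakk>x \<in> carrier A; y \<in> carrier A\<rbrakk> \<Longrightarrow> (c \<odot> x) \<otimes> y = c \<odot> (x \<otimes> y)"
    and smult_mult_right:
      "\<lbrakk>x \<in> carrier A; y \<in> carrier A\<rbrakk> \<Longrightarrow> x \<otimes> (c \<odot> y) = c \<odot> (x \<otimes> y)"

definition ground_algebra :: "('k::field, 'k) module" where
  "ground_algebra =
    \<lparr>carrier = UNIV, monoid.mult = (*), one = 1, ring.zero = 0, add = (+), module.smult = (*)\<rparr>"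

definition k_linear ::
  "('k::field, 'v, 'm) module_scheme \<Rightarrow> ('k, 'w, 'n) module_scheme \<Rightarrow> ('v \<Rightarrow> 'w) \<Rightarrow> bool" where
  "k_linear V W f \<longleftrightarrow>
     f \<in> carrier V \<rightarrow> carrier W \<and>
     (\<forall>x\<in>carrier V. \<forall>y\<in>carrier V. f (x \<oplus>\<^bsub>V\<^esub> y) = f x \<oplus>\<^bsub>W\<^esub> f y) \<and>
     (\<forall>c. \<forall>x\<in>carrier V. f (c \<odot>\<^bsub>V\<^esub> x) = c \<odot>\<^bsub>W\<^esub> f x)"

definition k_span :: "('k::field, 'v, 'm) module_scheme \<Rightarrow> 'v set \<Rightarrow> 'v set" where
  "k_span V S = \<Inter>{N. submodule N (ring_of_type_algebra :: 'k ring) V \<and> S \<subseteq> N}"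

definition has_dimension :: "('k::field, 'v, 'm) module_scheme \<Rightarrow> nat \<Rightarrow> bool" where
  "has_dimension V n \<longleftrightarrow>
     (\<exists>B. finite B \<and> card B = n \<and> B \<subseteq> carrier V \<and>
        (\<forall>v\<in>carrier V. \<exists>!c. c \<in> B \<rightarrow>\<^sub>E (UNIV :: 'k set) \<and>
            v = (\<Oplus>\<^bsub>V\<^esub>b\<in>B. c b \<odot>\<^bsub>V\<^esub> b)))"

definition list_sum :: "('a, 'm) ring_scheme \<Rightarrow> 'a list \<Rightarrow> 'a" where
  "list_sum M xs = foldr (add M) xs \<zero>\<^bsub>M\<^esub>"

text \<open>
  The quotient of a vector space by a subspace, or of an algebra by a two-sided ideal: this is the
  library's \<^const>\<open>FactRing\<close> together with the induced scalar multiplication.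
\<close>

definition quotient_module ::
  "('k::field, 'v, 'm) module_scheme \<Rightarrow> 'v set \<Rightarrow> ('k, 'v set) module" where
  "quotient_module V N =
     \<lparr>carrier = a_rcosets\<^bsub>V\<^esub> N, monoid.mult = rcoset_mult V N, one = N +>\<^bsub>V\<^esub> \<one>\<^bsub>V\<^esub>,
      ring.zero = N, add = set_add V,
      module.smult = (\<lambda>c C. \<Union>x\<in>C. N +>\<^bsub>V\<^esub> (c \<odot>\<^bsub>V\<^esub> x))\<rparr>"

definition pm_scale :: "'k \<Rightarrow> ('s \<Rightarrow>\<^sub>0 'k) \<Rightarrow> ('s \<Rightarrow>\<^sub>0 'k::field)" where
  "pm_scale c f = Poly_Mapping.map ((*) c) f"

definition free_module :: "'s set \<Rightarrow> ('k::field, 's \<Rightarrow>\<^sub>0 'k) module" where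
  "free_module S =
     \<lparr>carrier = {f. Poly_Mapping.keys f \<subseteq> S}, monoid.mult = undefined, one = undefined,
      ring.zero = 0, add = (+), module.smult = pm_scale\<rparr>"


section \<open>Tensor products over the ground field\<close>

type_synonym ('v, 'w, 'k) tensor = "('v \<times> 'w \<Rightarrow>\<^sub>0 'k) set"

definition bilinear_relations ::
  "('k::field, 'v, 'm) module_scheme \<Rightarrow> ('k, 'w, 'n) module_scheme \<Rightarrow> ('v \<times> 'w \<Rightarrow>\<^sub>0 'k) set" where
  "bilinear_relations V W =
     {Poly_Mapping.single (v \<oplus>\<^bsub>V\<^esub> v', w) 1
        - Poly_Mapping.single (v, w) 1 - Poly_Mapping.single (v', w) 1 | v v' w.
        v \<in> carrier V \<and> v' \<in> carrier V \<and> w \<in> carrier W} \<union>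
     {Poly_Mapping.single (v, w \<oplus>\<^bsub>W\<^esub> w') 1
        - Poly_Mapping.single (v, w) 1 - Poly_Mapping.single (v, w') 1 | v w w'.
        v \<in> carrier V \<and> w \<in> carrier W \<and> w' \<in> carrier W} \<union>
     {Poly_Mapping.single (c \<odot>\<^bsub>V\<^esub> v, w) 1 - Poly_Mapping.single (v, w) c | c v w.
        v \<in> carrier V \<and> w \<in> carrier W} \<union>
     {Poly_Mapping.single (v, c \<odot>\<^bsub>W\<^esub> w) 1 - Poly_Mapping.single (v, w) c | c v w.
        v \<in> carrier V \<and> w \<in> carrier W}"

definition tensor_null ::
  "('k::field, 'v, 'm) module_scheme \<Rightarrow> ('k, 'w, 'n) module_scheme \<Rightarrow> ('v \<times> 'w \<Rightarrow>\<^sub>0 'k) set" where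
  "tensor_null V W = k_span (free_module (carrier V \<times> carrier W)) (bilinear_relations V W)"

definition tensor_space ::
  "('k::field, 'v, 'm) module_scheme \<Rightarrow> ('k, 'w, 'n) module_scheme
     \<Rightarrow> ('k, ('v, 'w, 'k) tensor) module" where
  "tensor_space V W =
     quotient_module (free_module (carrier V \<times> carrier W)) (tensor_null V W)"

definition pure_tensor ::
  "('k::field, 'v, 'm) module_scheme \<Rightarrow> ('k, 'w, 'n) module_scheme
     \<Rightarrow> 'v \<Rightarrow> 'w \<Rightarrow> ('v, 'w, 'k) tensor" where
  "pure_tensor V W v w =
     tensor_null V W +>\<^bsub>free_module (carrier V \<times> carrier W)\<^esub> Poly_Mapping.single (v, w) 1"

text \<open>
  The linear map from a tensor product to \<open>U\<close> induced by a bilinear map \<open>b\<close>; bilinearity of \<open>b\<close>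
  makes the image of a coset a singleton.
\<close>

definition tensor_lift ::
  "('k::field, 'u, 'm) module_scheme \<Rightarrow> ('v \<Rightarrow> 'w \<Rightarrow> 'u) \<Rightarrow> ('v, 'w, 'k) tensor \<Rightarrow> 'u" where
  "tensor_lift U b t =
     the_elem ((\<lambda>f. \<Oplus>\<^bsub>U\<^esub>z\<in>Poly_Mapping.keys f.
                  Poly_Mapping.lookup f z \<odot>\<^bsub>U\<^esub> b (fst z) (snd z)) ` t)"

definition tensor_map ::
  "('k::field, 'v, 'm) module_scheme \<Rightarrow> ('k, 'w, 'n) module_scheme
     \<Rightarrow> ('a \<Rightarrow> 'v) \<Rightarrow> ('b \<Rightarrow> 'w) \<Rightarrow> ('a, 'b, 'k) tensor \<Rightarrow> ('v, 'w, 'k) tensor" where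
  "tensor_map V W f g = tensor_lift (tensor_space V W) (\<lambda>a b. pure_tensor V W (f a) (g b))"

text \<open>For algebras, multiplication in \<open>V \<otimes> W\<close> is \<open>(a \<otimes> b)(c \<otimes> d) = ac \<otimes> bd\<close>.\<close>

definition tensor ::
  "('k::field, 'v, 'm) module_scheme \<Rightarrow> ('k, 'w, 'n) module_scheme
     \<Rightarrow> ('k, ('v, 'w, 'k) tensor) module" where
  "tensor V W = (tensor_space V W)
     \<lparr>monoid.mult := (\<lambda>s t.
        tensor_lift (tensor_space V W) (\<lambda>a b.
          tensor_lift (tensor_space V W) (\<lambda>c d.
            pure_tensor V W (a \<otimes>\<^bsub>V\<^esub> c) (b \<otimes>\<^bsub>W\<^esub> d)) t) s),
      one := pure_tensor V W \<one>\<^bsub>V\<^esub> \<one>\<^bsub>W\<^esub>\<rparr>"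

text \<open>The associativity isomorphism \<open>(U \<otimes> V) \<otimes> W \<rightarrow> U \<otimes> (V \<otimes> W)\<close>.\<close>

definition tensor_assoc ::
  "('k::field, 'u, 'l) module_scheme \<Rightarrow> ('k, 'v, 'm) module_scheme \<Rightarrow> ('k, 'w, 'n) module_scheme
     \<Rightarrow> (('u, 'v, 'k) tensor, 'w, 'k) tensor \<Rightarrow> ('u, ('v, 'w, 'k) tensor, 'k) tensor" where
  "tensor_assoc U V W =
     (let T = tensor U (tensor V W) in
      tensor_lift T (\<lambda>s w. tensor_lift T (\<lambda>u v.
        pure_tensor U (tensor V W) u (pure_tensor V W v w)) s))"


section \<open>Hopf algebras\<close>

record (overloaded) ('k::zero, 'h) bialg = "('k, 'h) module" +
  comult :: "'h \<Rightarrow> ('h, 'h, 'k) tensor"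
  counit :: "'h \<Rightarrow> 'k"

locale bialgebra = k_algebra H for H :: "('k::field, 'h) bialg" (structure) +
  assumes comult_linear: "k_linear H (tensor H H) (comult H)"
    and counit_linear: "k_linear H ground_algebra (counit H)"
    and coassoc: "h \<in> carrier H \<Longrightarrow>
      tensor_assoc H H H (tensor_map (tensor H H) H (comult H) id (comult H h)) =
      tensor_map H (tensor H H) id (comult H) (comult H h)"
    and counit_left: "h \<in> carrier H \<Longrightarrow> tensor_lift H (\<lambda>a b. counit H a \<odot> b) (comult H h) = h"
    and counit_right: "h \<in> carrier H \<Longrightarrow> tensor_lift H (\<lambda>a b. counit H b \<odot> a) (comult H h) = h"
    and comult_mult: "comult H \<in> ring_hom H (tensor H H)"
    and counit_mult: "counit H \<in> ring_hom H ground_algebra"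

text \<open>
  An antipode is unique if it exists and is preserved by every bialgebra map, so it is treated as a
  property of a bialgebra and not as part of the structure.
\<close>

locale hopf_algebra = bialgebra +
  assumes antipode_exists: "\<exists>S. k_linear H H S \<and> (\<forall>h\<in>carrier H.
      tensor_lift H (\<lambda>a b. S a \<otimes> b) (comult H h) = counit H h \<odot> \<one> \<and>
      tensor_lift H (\<lambda>a b. a \<otimes> S b) (comult H h) = counit H h \<odot> \<one>)"

definition hopf_iso :: "('k::field, 'a) bialg \<Rightarrow> ('k, 'b) bialg \<Rightarrow> bool" where
  "hopf_iso A B \<longleftrightarrow>
     (\<exists>f. f \<in> ring_iso A B \<and> k_linear A B f \<and>
       (\<forall>x\<in>carrier A. comult B (f x) = tensor_map B B f f (comult A x)) \<and>
       (\<forall>x\<in>carrier A. counit B (f x) = counit A x))"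

text \<open>The image of \<open>V \<otimes> W\<close> in \<open>H \<otimes> H\<close>, for subspaces \<open>V\<close> and \<open>W\<close> of \<open>H\<close>.\<close>

definition sub_tensor ::
  "('k::field, 'h) bialg \<Rightarrow> 'h set \<Rightarrow> 'h set \<Rightarrow> ('h, 'h, 'k) tensor set" where
  "sub_tensor H V W = k_span (tensor H H) {pure_tensor H H v w | v w. v \<in> V \<and> w \<in> W}"

definition grouplikes :: "('k::field, 'h) bialg \<Rightarrow> 'h set" where
  "grouplikes H = {g \<in> carrier H. comult H g = pure_tensor H H g g \<and> counit H g = 1}"

definition subcoalgebra :: "'h set \<Rightarrow> ('k::field, 'h) bialg \<Rightarrow> bool" where
  "subcoalgebra C H \<longleftrightarrow>
     submodule C (ring_of_type_algebra :: 'k ring) H \<and> comult H ` C \<subseteq> sub_tensor H C C"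

definition simple_subcoalgebra :: "'h set \<Rightarrow> ('k::field, 'h) bialg \<Rightarrow> bool" where
  "simple_subcoalgebra C H \<longleftrightarrow>
     subcoalgebra C H \<and> C \<noteq> {\<zero>\<^bsub>H\<^esub>} \<and>
     (\<forall>D. subcoalgebra D H \<and> D \<subseteq> C \<longrightarrow> D = {\<zero>\<^bsub>H\<^esub>} \<or> D = C)"

definition coradical :: "('k::field, 'h) bialg \<Rightarrow> 'h set" where
  "coradical H = k_span H (\<Union>{C. simple_subcoalgebra C H})"

definition pointed_hopf_algebra :: "('k::field, 'h) bialg \<Rightarrow> bool" where
  "pointed_hopf_algebra H \<longleftrightarrow> hopf_algebra H \<and> coradical H = k_span H (grouplikes H)"


section \<open>The coradical filtration and the associated graded Hopf algebra\<close>

primrec corad_filt :: "('k::field, 'h) bialg \<Rightarrow> nat \<Rightarrow> 'h set" where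
  "corad_filt H 0 = coradical H"
| "corad_filt H (Suc n) =
     {h \<in> carrier H. comult H h \<in>
        sub_tensor H (carrier H) (corad_filt H n)
          <+>\<^bsub>tensor H H\<^esub> sub_tensor H (coradical H) (carrier H)}"

text \<open>\<open>H\<^bsub>n-1\<^esub>\<close>, with \<open>H\<^bsub>-1\<^esub> = 0\<close>.\<close>

definition corad_below :: "('k::field, 'h) bialg \<Rightarrow> nat \<Rightarrow> 'h set" where
  "corad_below H n = (case n of 0 \<Rightarrow> {\<zero>\<^bsub>H\<^esub>} | Suc m \<Rightarrow> corad_filt H m)"

text \<open>
  An element of \<open>gr H\<close> is a finitely supported family whose \<open>n\<close>-th member is a coset in
  \<open>H\<^bsub>n\<^esub>/H\<^bsub>n-1\<^esub>\<close>.  As in \<^const>\<open>rcoset_mult\<close>, operations on cosets are written as unions over all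
  choices of representatives.
\<close>

definition gr_algebra :: "('k::field, 'h) bialg \<Rightarrow> ('k, nat \<Rightarrow> 'h set) module" where
  "gr_algebra H =
     \<lparr>carrier = {f. (\<forall>n. f n \<in> (\<lambda>h. corad_below H n +>\<^bsub>H\<^esub> h) ` corad_filt H n) \<and>
                    finite {n. f n \<noteq> corad_below H n}},
      monoid.mult = (\<lambda>f g n. \<Union>a\<in>Pi UNIV f. \<Union>b\<in>Pi UNIV g.
                corad_below H n +>\<^bsub>H\<^esub> (\<Oplus>\<^bsub>H\<^esub>i\<in>{..n}. a i \<otimes>\<^bsub>H\<^esub> b (n - i))),
      one = (\<lambda>n. if n = 0 then corad_below H n +>\<^bsub>H\<^esub> \<one>\<^bsub>H\<^esub> else corad_below H n),
      ring.zero = corad_below H,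
      add = (\<lambda>f g n. f n <+>\<^bsub>H\<^esub> g n),
      module.smult = (\<lambda>c f n. \<Union>x\<in>f n. corad_below H n +>\<^bsub>H\<^esub> (c \<odot>\<^bsub>H\<^esub> x))\<rparr>"

text \<open>The class in \<open>gr H\<close>, concentrated in degree \<open>i\<close>, of \<open>v \<in> H\<^bsub>i\<^esub>\<close>.\<close>

definition gr_class :: "('k::field, 'h) bialg \<Rightarrow> nat \<Rightarrow> 'h \<Rightarrow> nat \<Rightarrow> 'h set" where
  "gr_class H i v = (\<lambda>n. if n = i then corad_below H n +>\<^bsub>H\<^esub> v else corad_below H n)"

text \<open>
  Since \<open>\<Delta>(H\<^bsub>n\<^esub>)\<close> lies in the sum of the \<open>H\<^bsub>i\<^esub> \<otimes> H\<^bsub>j\<^esub>\<close> with \<open>i + j = n\<close>, an element of degree \<open>n\<close> has a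
  representative \<open>h\<close> with \<open>\<Delta>(h) = \<Sum> v \<otimes> w\<close>, where \<open>v \<in> H\<^bsub>i\<^esub>\<close>, \<open>w \<in> H\<^bsub>j\<^esub>\<close> and \<open>i + j = n\<close> in each
  summand; its coproduct in \<open>gr H\<close> is the sum of the corresponding \<open>[v] \<otimes> [w]\<close>, with the classes
  taken in degrees \<open>i\<close> and \<open>j\<close>.  The list \<open>xs\<close> collects the summands of all degrees.
\<close>

definition gr_comult ::
  "('k::field, 'h) bialg \<Rightarrow> (nat \<Rightarrow> 'h set) \<Rightarrow> (nat \<Rightarrow> 'h set, nat \<Rightarrow> 'h set, 'k) tensor" where
  "gr_comult H f = (THE t. \<exists>xs :: (nat \<times> nat \<times> 'h \<times> 'h) list.
      (\<forall>(i, j, v, w)\<in>set xs. v \<in> corad_filt H i \<and> w \<in> corad_filt H j) \<and>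
      (\<forall>n. \<exists>h\<in>f n. comult H h = list_sum (tensor H H)
          (map (\<lambda>(i, j, v, w). pure_tensor H H v w) (filter (\<lambda>(i, j, v, w). i + j = n) xs))) \<and>
      t = list_sum (tensor (gr_algebra H) (gr_algebra H))
          (map (\<lambda>(i, j, v, w). pure_tensor (gr_algebra H) (gr_algebra H)
                  (gr_class H i v) (gr_class H j w)) xs))"

text \<open>In degree \<open>0\<close> the cosets are singletons, because \<open>H\<^bsub>-1\<^esub> = 0\<close>.\<close>

definition gr_hopf :: "('k::field, 'h) bialg \<Rightarrow> ('k, nat \<Rightarrow> 'h set) bialg" where
  "gr_hopf H = module.extend (gr_algebra H)
     (bialg.fields (gr_comult H) (\<lambda>f. counit H (the_elem (f 0))))"


section \<open>Free algebras and presentations\<close>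

text \<open>
  Words under concatenation are written additively, so that \<open>'s list \<Rightarrow>\<^sub>0 'k\<close> with the multiplication
  of HOL-Library.Poly_Mapping is the free algebra on \<open>'s\<close>.
\<close>

instantiation list :: (type) monoid_add
begin
definition zero_list_def: "0 = []"
definition plus_list_def: "xs + ys = xs @ ys"
instance by standard (simp_all add: zero_list_def plus_list_def)
end

definition free_algebra :: "('k::field, 's list \<Rightarrow>\<^sub>0 'k) module" where
  "free_algebra =
     \<lparr>carrier = UNIV, monoid.mult = (*), one = 1, ring.zero = 0, add = (+), module.smult = pm_scale\<rparr>"

definition presented_algebra ::
  "('s list \<Rightarrow>\<^sub>0 'k::field) set \<Rightarrow> ('k, ('s list \<Rightarrow>\<^sub>0 'k) set) module" where
  "presented_algebra R = quotient_module free_algebra (Idl\<^bsub>free_algebra\<^esub> R)"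

definition presented_class ::
  "('s list \<Rightarrow>\<^sub>0 'k::field) set \<Rightarrow> ('s list \<Rightarrow>\<^sub>0 'k) \<Rightarrow> ('s list \<Rightarrow>\<^sub>0 'k) set" where
  "presented_class R f = (Idl\<^bsub>free_algebra\<^esub> R) +>\<^bsub>free_algebra\<^esub> f"

text \<open>
  The algebra map to \<open>A\<close> sending each generator \<open>s\<close> to \<open>a s\<close>, first on the free algebra and then on a
  quotient of it (whose elements are cosets).
\<close>

definition free_eval ::
  "('k::field, 'a, 'm) module_scheme \<Rightarrow> ('s \<Rightarrow> 'a) \<Rightarrow> ('s list \<Rightarrow>\<^sub>0 'k) \<Rightarrow> 'a" where
  "free_eval A a f = (\<Oplus>\<^bsub>A\<^esub>w\<in>Poly_Mapping.keys f.
     Poly_Mapping.lookup f w \<odot>\<^bsub>A\<^esub> foldr (\<lambda>s y. a s \<otimes>\<^bsub>A\<^esub> y) w \<one>\<^bsub>A\<^esub>)"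

definition presented_lift ::
  "('k::field, 'a, 'm) module_scheme \<Rightarrow> ('s \<Rightarrow> 'a) \<Rightarrow> ('s list \<Rightarrow>\<^sub>0 'k) set \<Rightarrow> 'a" where
  "presented_lift A a C = the_elem (free_eval A a ` C)"

text \<open>
  The algebra with relations \<open>R\<close> and the coproduct and counit determined multiplicatively by
  \<open>\<Delta>(s) = \<Sum> u \<otimes> v\<close> over the pairs \<open>(u, v)\<close> listed in \<open>d s\<close>, and \<open>\<epsilon>(s) = e s\<close>.
\<close>

definition presented_bialgebra ::
  "('s list \<Rightarrow>\<^sub>0 'k::field) set \<Rightarrow> ('s \<Rightarrow> (('s list \<Rightarrow>\<^sub>0 'k) \<times> ('s list \<Rightarrow>\<^sub>0 'k)) list) \<Rightarrow> ('s \<Rightarrow> 'k)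
     \<Rightarrow> ('k, ('s list \<Rightarrow>\<^sub>0 'k) set) bialg" where
  "presented_bialgebra R d e =
     (let Q = presented_algebra R in
      module.extend Q (bialg.fields
        (presented_lift (tensor Q Q) (\<lambda>s. list_sum (tensor Q Q)
           (map (\<lambda>(u, v). pure_tensor Q Q (presented_class R u) (presented_class R v)) (d s))))
        (presented_lift ground_algebra e)))"


section \<open>The Hopf algebras of the classification\<close>

datatype gen = Gen_g1 | Gen_g2 | Gen_x

type_synonym 'k free3 = "gen list \<Rightarrow>\<^sub>0 'k"

definition gen_elem :: "gen \<Rightarrow> 'k::field free3" where
  "gen_elem s = Poly_Mapping.single [s] 1"

abbreviation g1 :: "'k::field free3" where "g1 \<equiv> gen_elem Gen_g1"
abbreviation g2 :: "'k::field free3" where "g2 \<equiv> gen_elem Gen_g2"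
abbreviation xx :: "'k::field free3" where "xx \<equiv> gen_elem Gen_x"

definition gen_comult :: "nat \<Rightarrow> gen \<Rightarrow> ('k::field free3 \<times> 'k free3) list" where
  "gen_comult e s = (case s of
       Gen_g1 \<Rightarrow> [(g1, g1)]
     | Gen_g2 \<Rightarrow> [(g2, g2)]
     | Gen_x \<Rightarrow> [(xx, 1), (g1 ^ e, xx)])"

definition gen_counit :: "gen \<Rightarrow> 'k::field" where
  "gen_counit s = (case s of Gen_g1 \<Rightarrow> 1 | Gen_g2 \<Rightarrow> 1 | Gen_x \<Rightarrow> 0)"

definition group_relations :: "nat \<Rightarrow> 'k::field free3 set" where
  "group_relations p = {g1 ^ p - 1, g2 ^ p - 1, g1 * g2 - g2 * g1}"

text \<open>The prescribed associated graded Hopf algebra; \<open>Gen_x\<close> plays the role of \<open>a\<close>.\<close>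

definition graded_model :: "nat \<Rightarrow> nat \<Rightarrow> ('k::field, 'k free3 set) bialg" where
  "graded_model p e = presented_bialgebra
     (group_relations p \<union> {xx ^ p, g1 * xx - xx * g1, g2 * xx - xx * g2})
     (gen_comult e) gen_counit"

definition lifting_primitive :: "nat \<Rightarrow> 'k \<Rightarrow> ('k::field, 'k free3 set) bialg" where
  "lifting_primitive p e2 = presented_bialgebra
     (group_relations p \<union> {g1 * xx - xx * g1, g2 * xx - xx * g2, xx ^ p - pm_scale e2 xx})
     (gen_comult 0) gen_counit"

definition lifting_skew :: "nat \<Rightarrow> 'k \<Rightarrow> 'k \<Rightarrow> ('k::field, 'k free3 set) bialg" where
  "lifting_skew p e1 t = presented_bialgebra
     (group_relations p \<union>
       {g1 * xx - xx * g1 - pm_scale e1 (g1 * (1 - g1)),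
        g2 * xx - xx * g2 - pm_scale t (g2 * (1 - g1)),
        xx ^ p - pm_scale e1 xx})
     (gen_comult 1) gen_counit"

definition pointed_lifting :: "nat \<Rightarrow> nat \<Rightarrow> ('k::field, 'h) bialg \<Rightarrow> bool" where
  "pointed_lifting p e H \<longleftrightarrow>
     pointed_hopf_algebra H \<and> has_dimension H (p ^ 3) \<and> hopf_iso (gr_hopf H) (graded_model p e)"

end

theory Submission
  imports Defs
begin

text \<open>
 Write \<open>g = g1^e\<close>.  All the Hopf algebras of the statement are the members \<open>L(e, s, t)\<close>, with \<open>s\<close> equal to \<open>0\<close> or \<open>1\<close>,
 of one family: \<open>g1 x - x g1 = s g1 (1 - g)\<close>, \<open>g2 x - x g2 = t g2 (1 - g)\<close>, \<open>x^p = s x\<close>.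
 The falling factorials \<open>X_n = x (x - s) \<dots> (x - (n-1) s)\<close> satisfy
 \<open>\<Delta>(X_n) = \<Sum>k. (n choose k) X_{n-k} g^k \<otimes> X_k\<close>, and \<open>X_p = x^p - s x\<close> in characteristic \<open>p\<close>.  Hence the elements
 \<open>X_n g1^i g2^j\<close> with \<open>n, i, j < p\<close>, which are independent because \<open>L(e, s, t)\<close> acts on the functions on \<open>(\<int>/p)^2\<close>,
 behave in every \<open>L(e, s, t)\<close> as in \<open>L(e, 0, 0)\<close>: the coradical filtration is the filtration by \<open>n\<close>, and passing
 to the associated graded algebra only removes \<open>s\<close> and \<open>t\<close>.

 Conversely, if \<open>gr H\<close> is the given algebra, then its degree \<open>0\<close> part determines the group \<open>G(H)\<close>.  A representative \<open>h\<close> of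
 the degree \<open>1\<close> generator fails to be skew primitive by a 2-cocycle on \<open>G(H)\<close>; it is a coboundary, so that \<open>h\<close> can be
 corrected to a skew primitive \<open>x\<close>.  For a grouplike \<open>u\<close> the commutator \<open>u x - x u\<close> is skew primitive and lies in \<open>H\<^sub>0\<close>, and
 is therefore a multiple of \<open>u (1 - g)\<close>.  After rescaling \<open>x\<close>, the element \<open>x^p - s x\<close> is primitive, hence a multiple of \<open>x\<close>,
 which vanishes if \<open>g \<noteq> 1\<close> and is removed by a second rescaling if \<open>g = 1\<close>.
\<close>

text \<open>A tensor product is a quotient of a huge free module and has no basis at hand. Its
  elements are tested by the forms \<phi> \<otimes> \<psi>, so statements about \<Delta> become
  statements about the convolution algebra of linear forms on H. There the annihilator J of H_0 is
  an ideal, and H_(n+1) is what J times the annihilator of H_n kills. The product of the x - i s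
  over i < p is x^p - s^(p-1) x, which is x^p - s x for s in {0, 1}: hence the shape of the last
  relation. Independence has two sources. The functions on (Z/p)^2 are the module L / L x, which
  separates the group elements but may kill x; a two-dimensional module keeps x out of the span of
  the group. The coproduct carries independence from degree 1 to every n < p, because it produces
  the factor n, which is not zero in k. The cocycle is a coboundary because the forms on H_0 have a
  basis of orthogonal idempotents, one for each grouplike: the cocycle becomes a matrix subject to
  Kronecker-delta equations.\<close>

abbreviation "keys \<equiv> Poly_Mapping.keys"
abbreviation "single \<equiv> Poly_Mapping.single"
abbreviation "lookup \<equiv> Poly_Mapping.lookup"

section \<open>Vector spaces, subspaces and linear maps\<close>

lemma rota_simps [simp]:
 "carrier (ring_of_type_algebra :: 'k::comm_ring_1 ring) = UNIV"
 "x \<otimes>\<^bsub>(ring_of_type_algebra :: 'k ring)\<^esub> y = x * y"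
 "x \<oplus>\<^bsub>(ring_of_type_algebra :: 'k ring)\<^esub> y = x + y"
 "\<one>\<^bsub>(ring_of_type_algebra :: 'k ring)\<^esub> = 1"
 "\<zero>\<^bsub>(ring_of_type_algebra :: 'k ring)\<^esub> = 0"
 by (simp_all add: ring_of_type_algebra_def)

lemma cring_rota: "cring (ring_of_type_algebra :: 'k::comm_ring_1 ring)"
 by (rule cring_from_type_algebra)

lemma rota_minus [simp]: "\<ominus>\<^bsub>(ring_of_type_algebra :: 'k::comm_ring_1 ring)\<^esub> x = - x"
proof -
 interpret cring "ring_of_type_algebra :: 'k ring" by (rule cring_rota)
 show ?thesis using sum_zero_eq_neg[of x "-x"] minus_equality[of "-x" x] by simp
qed

abbreviation k_subspace :: "('k::field, 'v, 'm) module_scheme \<Rightarrow> 'v set \<Rightarrow> bool" where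
 "k_subspace V N \<equiv> submodule N (ring_of_type_algebra :: 'k ring) V"

locale kvs = module "ring_of_type_algebra :: 'k ring" V
 for V :: "('k::field, 'v, 'm) module_scheme" (structure)
begin

lemma sm_closed [simp, intro]: "x \<in> carrier V \<Longrightarrow> c \<odot> x \<in> carrier V"
 using smult_closed[of c x] by simp

lemma sm_add_l: "x \<in> carrier V \<Longrightarrow> (a + b) \<odot> x = a \<odot> x \<oplus> b \<odot> x"
 using smult_l_distr[of a b x] by simp

lemma sm_add_r: "x \<in> carrier V \<Longrightarrow> y \<in> carrier V \<Longrightarrow> a \<odot> (x \<oplus> y) = a \<odot> x \<oplus> a \<odot> y"
 using smult_r_distr[of a x y] by simp

lemma sm_assoc: "x \<in> carrier V \<Longrightarrow> a \<odot> (b \<odot> x) = (a * b) \<odot> x"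
 using smult_assoc1[of a b x] by simp

lemma sm_one [simp]: "x \<in> carrier V \<Longrightarrow> 1 \<odot> x = x"
 using smult_one[of x] by simp

lemma sm_0 [simp]: "x \<in> carrier V \<Longrightarrow> 0 \<odot> x = \<zero>"
 using smult_l_null[of x] by simp

lemma sm_zero [simp]: "c \<odot> \<zero> = \<zero>"
 using smult_r_null[of c] by simp

lemma sm_neg: "x \<in> carrier V \<Longrightarrow> (- 1) \<odot> x = \<ominus> x"
 using smult_l_minus[of 1 x] by simp

lemma sm_minus: "x \<in> carrier V \<Longrightarrow> (- c) \<odot> x = \<ominus> (c \<odot> x)"
 using smult_l_minus[of c x] by simp

lemma sm_minus_r: "x \<in> carrier V \<Longrightarrow> c \<odot> (\<ominus> x) = \<ominus> (c \<odot> x)"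
 using smult_r_minus[of c x] by simp

lemma sm_diff: "x \<in> carrier V \<Longrightarrow> y \<in> carrier V \<Longrightarrow> c \<odot> (x \<ominus> y) = c \<odot> x \<ominus> c \<odot> y"
 by (simp add: a_minus_def sm_add_r sm_minus_r)

lemma add4:
 assumes "a \<in> carrier V" "b \<in> carrier V" "c \<in> carrier V" "d \<in> carrier V"
 shows "(a \<oplus> b) \<oplus> (c \<oplus> d) = (a \<oplus> c) \<oplus> (b \<oplus> d)"
 using assms by (simp add: M.add.m_assoc M.add.m_lcomm)

lemma ksubI:
 assumes "N \<subseteq> carrier V" "\<zero> \<in> N" "\<And>a b. a \<in> N \<Longrightarrow> b \<in> N \<Longrightarrow> a \<oplus> b \<in> N"
  "\<And>c a. a \<in> N \<Longrightarrow> c \<odot> a \<in> N"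
 shows "k_subspace V N"
proof (rule submoduleI)
 fix a assume "a \<in> N" then show "\<ominus> a \<in> N" using assms(4)[of a "-1"] assms(1) sm_neg[of a] by auto
qed (use assms in auto)

lemma ksubD:
 assumes "k_subspace V N"
 shows "N \<subseteq> carrier V" "\<zero> \<in> N" "\<And>a b. a \<in> N \<Longrightarrow> b \<in> N \<Longrightarrow> a \<oplus> b \<in> N"
  "\<And>c a. a \<in> N \<Longrightarrow> c \<odot> a \<in> N" "\<And>a. a \<in> N \<Longrightarrow> \<ominus> a \<in> N"
  "\<And>a b. a \<in> N \<Longrightarrow> b \<in> N \<Longrightarrow> a \<ominus> b \<in> N"
proof -
 note E = submoduleE[OF assms]
 show 1: "N \<subseteq> carrier V" by (rule E(1))
 show 3: "\<And>a b. a \<in> N \<Longrightarrow> b \<in> N \<Longrightarrow> a \<oplus> b \<in> N" by (rule E(5))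
 show 4: "\<And>c a. a \<in> N \<Longrightarrow> c \<odot> a \<in> N" using E(4) by simp
 show "\<zero> \<in> N"
 proof -
  obtain a where "a \<in> N" using E(2) by blast
  then have "0 \<odot> a \<in> N" "a \<in> carrier V" using 4 1 by auto
  then show ?thesis by simp
 qed
 show 5: "\<And>a. a \<in> N \<Longrightarrow> \<ominus> a \<in> N" by (rule E(3))
 show "\<And>a b. a \<in> N \<Longrightarrow> b \<in> N \<Longrightarrow> a \<ominus> b \<in> N" using 3 5 by (simp add: a_minus_def)
qed

lemma ksub_finsum:
 assumes N: "k_subspace V N" and "\<And>i. i \<in> A \<Longrightarrow> f i \<in> N"
 shows "finsum V f A \<in> N"
proof (cases "finite A")
 case True
 then show ?thesis using assms(2)
 proof (induction A)
  case (insert i A)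
  have "f \<in> A \<rightarrow> carrier V" "f i \<in> carrier V" using insert(4) ksubD(1)[OF N] by auto
  then show ?case using insert ksubD(3)[OF N] by (simp add: finsum_insert)
 qed (simp add: ksubD(2)[OF N])
qed (simp add: finsum_infinite ksubD(2)[OF N])

lemma list_sum_Nil [simp]: "list_sum V [] = \<zero>"
 and list_sum_Cons [simp]: "list_sum V (x # xs) = x \<oplus> list_sum V xs"
 by (simp_all add: list_sum_def)

lemma ksub_list_sum:
 assumes N: "k_subspace V N" and "set xs \<subseteq> N"
 shows "list_sum V xs \<in> N"
 using assms(2) by (induction xs) (auto simp: ksubD[OF N])

lemma carrier_ksub: "k_subspace V (carrier V)"
 by (rule carrier_is_submodule)

lemma zero_ksub: "k_subspace V {\<zero>}"
 by (rule ksubI) auto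

lemma list_sum_closed [simp]: "set xs \<subseteq> carrier V \<Longrightarrow> list_sum V xs \<in> carrier V"
 by (rule ksub_list_sum[OF carrier_ksub])

lemma list_sum_append:
 "set xs \<subseteq> carrier V \<Longrightarrow> set ys \<subseteq> carrier V \<Longrightarrow>
  list_sum V (xs @ ys) = list_sum V xs \<oplus> list_sum V ys"
 by (induction xs) (auto simp: a_assoc)

lemma list_sum_distinct:
 "distinct xs \<Longrightarrow> f ` set xs \<subseteq> carrier V \<Longrightarrow> list_sum V (map f xs) = finsum V f (set xs)"
proof (induction xs)
 case (Cons x xs)
 have "f \<in> set xs \<rightarrow> carrier V" "f x \<in> carrier V" using Cons(3) by auto
 then show ?case using Cons by (simp add: finsum_insert)
qed simp

lemma span_ksub:
 assumes "S \<subseteq> carrier V"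
 shows "k_subspace V (k_span V S)"
proof (rule ksubI)
 show "k_span V S \<subseteq> carrier V" unfolding k_span_def using carrier_ksub assms by auto
qed (auto simp: k_span_def intro: ksubD)

lemma span_incl: "S \<subseteq> k_span V S"
 by (auto simp: k_span_def)

lemma span_min: "k_subspace V N \<Longrightarrow> S \<subseteq> N \<Longrightarrow> k_span V S \<subseteq> N"
 by (auto simp: k_span_def)

lemma span_closed: "S \<subseteq> carrier V \<Longrightarrow> k_span V S \<subseteq> carrier V"
 using ksubD(1)[OF span_ksub] by simp

lemma span_mono: "S \<subseteq> T \<Longrightarrow> k_span V S \<subseteq> k_span V T"
 by (auto simp: k_span_def)

lemma ksub_sum:
 assumes "k_subspace V M" "k_subspace V N"
 shows "k_subspace V (M <+>\<^bsub>V\<^esub> N)"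
proof -
 note M = ksubD[OF assms(1)] and N = ksubD[OF assms(2)]
 have E: "M <+>\<^bsub>V\<^esub> N = {a \<oplus> b |a b. a \<in> M \<and> b \<in> N}"
  by (auto simp: set_add_def set_mult_def)
 show ?thesis unfolding E
 proof (rule ksubI)
  show "\<zero> \<in> {a \<oplus> b |a b. a \<in> M \<and> b \<in> N}" using M(2) N(2) by force
 next
  fix x y assume "x \<in> {a \<oplus> b |a b. a \<in> M \<and> b \<in> N}" "y \<in> {a \<oplus> b |a b. a \<in> M \<and> b \<in> N}"
  then obtain a b c d where xy: "x = a \<oplus> b" "y = c \<oplus> d" and m: "a \<in> M" "c \<in> M" "b \<in> N" "d \<in> N" by blast
  have "x \<oplus> y = (a \<oplus> c) \<oplus> (b \<oplus> d)" using add4[of a b c d] M(1) N(1) xy m by auto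
  then show "x \<oplus> y \<in> {a \<oplus> b |a b. a \<in> M \<and> b \<in> N}" using M(3)[OF m(1,2)] N(3)[OF m(3,4)] by blast
 next
  fix c x assume "x \<in> {a \<oplus> b |a b. a \<in> M \<and> b \<in> N}"
  then obtain a b where xy: "x = a \<oplus> b" and m: "a \<in> M" "b \<in> N" by blast
  then have "c \<odot> x = c \<odot> a \<oplus> c \<odot> b" using M(1) N(1) sm_add_r[of a b c] by auto
  then show "c \<odot> x \<in> {a \<oplus> b |a b. a \<in> M \<and> b \<in> N}" using M(4)[OF m(1)] N(4)[OF m(2)] by blast
 qed (use M(1) N(1) in auto)
qed

lemma ksub_sum_iff:
 "x \<in> M <+>\<^bsub>V\<^esub> N \<longleftrightarrow> (\<exists>a b. a \<in> M \<and> b \<in> N \<and> x = a \<oplus> b)"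
 by (auto simp: set_add_def set_mult_def)

end

lemma k_algebra_kvs: "k_algebra A \<Longrightarrow> kvs A"
 by (simp add: k_algebra_def kvs_def)

lemma k_algebra_ring: "k_algebra A \<Longrightarrow> ring A"
 by (simp add: k_algebra_def)

lemma kvsI:
 fixes V :: "('k::field, 'v, 'm) module_scheme" (structure)
 assumes "abelian_group V"
  and "\<And>c x. x \<in> carrier V \<Longrightarrow> c \<odot> x \<in> carrier V"
  and "\<And>a b x. x \<in> carrier V \<Longrightarrow> (a + b) \<odot> x = a \<odot> x \<oplus> b \<odot> x"
  and "\<And>a x y. x \<in> carrier V \<Longrightarrow> y \<in> carrier V \<Longrightarrow> a \<odot> (x \<oplus> y) = a \<odot> x \<oplus> a \<odot> y"
  and "\<And>a b x. x \<in> carrier V \<Longrightarrow> (a * b) \<odot> x = a \<odot> (b \<odot> x)"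
  and "\<And>x. x \<in> carrier V \<Longrightarrow> 1 \<odot> x = x"
 shows "kvs V"
 unfolding kvs_def by (rule moduleI) (use assms in \<open>auto intro: cring_rota\<close>)

lemma ground_simps [simp]:
 "carrier ground_algebra = UNIV" "x \<otimes>\<^bsub>ground_algebra\<^esub> y = x * y" "x \<oplus>\<^bsub>ground_algebra\<^esub> y = x + y"
 "\<one>\<^bsub>ground_algebra\<^esub> = 1" "\<zero>\<^bsub>ground_algebra\<^esub> = 0" "c \<odot>\<^bsub>ground_algebra\<^esub> x = c * x"
 by (simp_all add: ground_algebra_def)

lemma ground_k_algebra: "k_algebra (ground_algebra :: ('k::field,'k) module)"
proof -
 have a: "abelian_group (ground_algebra :: ('k,'k) module)"
 proof (rule abelian_groupI)
  fix x assume "x \<in> carrier (ground_algebra :: ('k,'k) module)"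
  show "\<exists>y\<in>carrier (ground_algebra :: ('k,'k) module). y \<oplus>\<^bsub>ground_algebra\<^esub> x = \<zero>\<^bsub>ground_algebra\<^esub>"
   by (rule bexI[of _ "- x"]) auto
 qed (auto simp: algebra_simps)
 have "ring (ground_algebra :: ('k,'k) module)"
  by (rule ringI[OF a]) (auto intro!: monoidI simp: algebra_simps)
 moreover have "kvs (ground_algebra :: ('k,'k) module)"
  by (rule kvsI[OF a]) (auto simp: algebra_simps)
 ultimately show ?thesis
  unfolding k_algebra_def kvs_def k_algebra_axioms_def by (auto simp: algebra_simps)
qed

lemma ground_kvs: "kvs ground_algebra"
 by (rule k_algebra_kvs[OF ground_k_algebra])

lemma k_linearD:
 assumes "k_linear V W f"
 shows "x \<in> carrier V \<Longrightarrow> f x \<in> carrier W"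
  "x \<in> carrier V \<Longrightarrow> y \<in> carrier V \<Longrightarrow> f (x \<oplus>\<^bsub>V\<^esub> y) = f x \<oplus>\<^bsub>W\<^esub> f y"
  "x \<in> carrier V \<Longrightarrow> f (c \<odot>\<^bsub>V\<^esub> x) = c \<odot>\<^bsub>W\<^esub> f x"
 using assms by (auto simp: k_linear_def)

lemma k_linearI:
 assumes "\<And>x. x \<in> carrier V \<Longrightarrow> f x \<in> carrier W"
  "\<And>x y. x \<in> carrier V \<Longrightarrow> y \<in> carrier V \<Longrightarrow> f (x \<oplus>\<^bsub>V\<^esub> y) = f x \<oplus>\<^bsub>W\<^esub> f y"
  "\<And>c x. x \<in> carrier V \<Longrightarrow> f (c \<odot>\<^bsub>V\<^esub> x) = c \<odot>\<^bsub>W\<^esub> f x"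
 shows "k_linear V W f"
 using assms by (auto simp: k_linear_def)

lemma k_linear_comp: "k_linear U V f \<Longrightarrow> k_linear V W g \<Longrightarrow> k_linear U W (\<lambda>x. g (f x))"
 by (rule k_linearI) (auto simp: k_linearD)

lemma k_linear_id: "k_linear V V (\<lambda>x. x)"
 by (rule k_linearI) auto

lemma (in kvs) k_linear_zero:
 assumes "k_linear V W f" "kvs W" shows "f \<zero> = \<zero>\<^bsub>W\<^esub>"
proof -
 interpret W: kvs W by fact
 have "f (0 \<odot> \<zero>) = 0 \<odot>\<^bsub>W\<^esub> f \<zero>" by (rule k_linearD(3)[OF assms(1)]) simp
 moreover have "f \<zero> \<in> carrier W" using k_linearD(1)[OF assms(1)] by simp
 ultimately show ?thesis by simp
qed

lemma (in kvs) k_linear_neg: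
 assumes "k_linear V W f" "kvs W" "x \<in> carrier V" shows "f (\<ominus> x) = \<ominus>\<^bsub>W\<^esub> f x"
proof -
 interpret W: kvs W by fact
 show ?thesis using k_linearD(3)[OF assms(1,3), of "-1"] k_linearD(1)[OF assms(1,3)]
  by (simp add: sm_neg W.sm_neg assms(3))
qed

lemma (in kvs) k_linear_diff:
 assumes "k_linear V W f" "kvs W" "x \<in> carrier V" "y \<in> carrier V" shows "f (x \<ominus> y) = f x \<ominus>\<^bsub>W\<^esub> f y"
 using k_linearD(2)[OF assms(1,3), of "\<ominus> y"] assms by (simp add: a_minus_def k_linear_neg)

lemma (in kvs) k_linear_finsum:
 assumes "k_linear V W f" "kvs W" "g \<in> A \<rightarrow> carrier V"
 shows "f (finsum V g A) = finsum W (\<lambda>i. f (g i)) A"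
proof -
 interpret W: kvs W by fact
 show ?thesis
 proof (cases "finite A")
  case True
  then show ?thesis using assms(3)
  proof (induction A)
   case empty then show ?case using k_linear_zero[OF assms(1,2)] by simp
  next
   case (insert a A)
   have "g a \<in> carrier V" "g \<in> A \<rightarrow> carrier V" using insert by auto
   then show ?case using insert k_linearD[OF assms(1)]
    by (subst finsum_insert; (subst W.finsum_insert)?) (auto simp: Pi_iff)
  qed
 qed (simp add: finsum_infinite W.finsum_infinite k_linear_zero[OF assms(1,2)])
qed

lemma (in kvs) k_linear_list_sum:
 assumes "k_linear V W f" "kvs W" "set xs \<subseteq> carrier V"
 shows "f (list_sum V xs) = list_sum W (map f xs)"
proof -
 interpret W: kvs W by fact
 show ?thesis using assms(3) by (induction xs) (auto simp: k_linear_zero[OF assms(1,2)] k_linearD[OF assms(1)])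
qed

lemma ground_finsum [simp]: "finsum ground_algebra f A = sum f A"
proof -
 interpret kvs ground_algebra by (rule ground_kvs)
 show ?thesis
 proof (cases "finite A")
  case True then show ?thesis by (induction A) (auto simp: finsum_insert)
 qed (simp add: finsum_infinite)
qed

lemma ground_list_sum [simp]: "list_sum ground_algebra xs = sum_list xs"
 by (induction xs) (auto simp: list_sum_def)

lemma ground_minus [simp]: "\<ominus>\<^bsub>ground_algebra\<^esub> x = - x" "x \<ominus>\<^bsub>ground_algebra\<^esub> y = x - y"
proof -
 interpret kvs ground_algebra by (rule ground_kvs)
 show *: "\<ominus>\<^bsub>ground_algebra\<^esub> x = - x" for x using sm_neg[of x] by simp
 show "x \<ominus>\<^bsub>ground_algebra\<^esub> y = x - y" by (simp add: a_minus_def *)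
qed

section \<open>Linear forms: extension and separation\<close>

abbreviation lin_form :: "('k::field, 'v, 'm) module_scheme \<Rightarrow> ('v \<Rightarrow> 'k) \<Rightarrow> bool" where
 "lin_form V \<equiv> k_linear V ground_algebra"

context kvs begin

lemma form_simps:
 assumes "lin_form V \<phi>"
 shows "\<phi> \<zero> = 0" "x \<in> carrier V \<Longrightarrow> y \<in> carrier V \<Longrightarrow> \<phi> (x \<oplus> y) = \<phi> x + \<phi> y"
  "x \<in> carrier V \<Longrightarrow> \<phi> (c \<odot> x) = c * \<phi> x" "x \<in> carrier V \<Longrightarrow> \<phi> (\<ominus> x) = - \<phi> x"
  "x \<in> carrier V \<Longrightarrow> y \<in> carrier V \<Longrightarrow> \<phi> (x \<ominus> y) = \<phi> x - \<phi> y"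
  "g \<in> A \<rightarrow> carrier V \<Longrightarrow> \<phi> (finsum V g A) = (\<Sum>i\<in>A. \<phi> (g i))"
  "set xs \<subseteq> carrier V \<Longrightarrow> \<phi> (list_sum V xs) = sum_list (map \<phi> xs)"
 using k_linear_zero[OF assms ground_kvs] k_linearD[OF assms] k_linear_neg[OF assms ground_kvs]
  k_linear_diff[OF assms ground_kvs] k_linear_finsum[OF assms ground_kvs] k_linear_list_sum[OF assms ground_kvs]
 by auto

end

text \<open>The linear extension of \<open>b\<close> to formal combinations. It serves tensor lifts,
  the evaluation of words in an algebra, and coordinates over a finite spanning set alike.\<close>

definition pm_eval :: "('k::field, 'v, 'm) module_scheme \<Rightarrow> ('s \<Rightarrow> 'v) \<Rightarrow> ('s \<Rightarrow>\<^sub>0 'k) \<Rightarrow> 'v" where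
 "pm_eval V b f = (\<Oplus>\<^bsub>V\<^esub>z\<in>keys f. lookup f z \<odot>\<^bsub>V\<^esub> b z)"

lemma lookup_pm_scale [simp]: "lookup (pm_scale c f) z = c * lookup f z"
 by (simp add: pm_scale_def Poly_Mapping.map.rep_eq when_def)

lemma keys_pm_scale: "keys (pm_scale c f) \<subseteq> keys f"
 by (auto simp: in_keys_iff)

lemma pm_scale_simps:
 "pm_scale c (f + g) = pm_scale c f + pm_scale c g" "pm_scale (a + b) f = pm_scale a f + pm_scale b f"
 "pm_scale a (pm_scale b f) = pm_scale (a * b) f" "pm_scale 1 f = f"
 "pm_scale c (f - g) = pm_scale c f - pm_scale c g" "pm_scale 0 f = 0" "pm_scale c 0 = 0"
 by (rule poly_mapping_eqI; simp add: lookup_add lookup_minus algebra_simps)+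

lemma pm_scale_single [simp]: "pm_scale c (single x d) = single x (c * d)"
 by (rule poly_mapping_eqI) (simp add: lookup_single when_def)

text \<open>Formal combinations form a vector space on a whole type, where bases and linear
  extension from independent sets are available. Results about spaces with a carrier are obtained by
  lifting the problem to formal combinations and descending again.\<close>

interpretation pmvs: vector_space "pm_scale :: 'k::field \<Rightarrow> ('s \<Rightarrow>\<^sub>0 'k) \<Rightarrow> _"
 by unfold_locales (simp_all add: pm_scale_simps)

context kvs begin

lemma pm_eval_superset:
 assumes "finite K" "keys f \<subseteq> K" "b \<in> K \<rightarrow> carrier V"
 shows "pm_eval V b f = (\<Oplus>z\<in>K. lookup f z \<odot> b z)"
 unfolding pm_eval_def
 by (rule M.add.finprod_mono_neutral_cong_left) (use assms in \<open>auto simp: in_keys_iff Pi_iff\<close>)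

lemma pm_eval_closed:
 assumes "b \<in> keys f \<rightarrow> carrier V" shows "pm_eval V b f \<in> carrier V"
 unfolding pm_eval_def by (rule M.finsum_closed) (use assms in auto)

lemma pm_eval_add:
 assumes "keys f \<subseteq> S" "keys g \<subseteq> S" "b \<in> S \<rightarrow> carrier V"
 shows "pm_eval V b (f + g) = pm_eval V b f \<oplus> pm_eval V b g"
proof -
 let ?K = "keys f \<union> keys g"
 have b: "b \<in> ?K \<rightarrow> carrier V" using assms by auto
 have "pm_eval V b (f + g) = (\<Oplus>z\<in>?K. (lookup f z + lookup g z) \<odot> b z)"
  by (subst pm_eval_superset[where K = ?K])
   (use b in \<open>auto simp: lookup_add keys_add intro!: M.finsum_cong\<close>)
 also have "\<dots> = (\<Oplus>z\<in>?K. lookup f z \<odot> b z \<oplus> lookup g z \<odot> b z)"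
  by (rule M.finsum_cong') (use b in \<open>auto simp: sm_add_l Pi_iff\<close>)
 also have "\<dots> = (\<Oplus>z\<in>?K. lookup f z \<odot> b z) \<oplus> (\<Oplus>z\<in>?K. lookup g z \<odot> b z)"
  by (rule M.finsum_addf) (use b in auto)
 also have "\<dots> = pm_eval V b f \<oplus> pm_eval V b g"
  using b by (simp add: pm_eval_superset[where K = ?K])
 finally show ?thesis .
qed

lemma finsum_sm:
 assumes "g \<in> A \<rightarrow> carrier V"
 shows "c \<odot> finsum V g A = (\<Oplus>i\<in>A. c \<odot> g i)"
proof -
 have "k_linear V V (\<lambda>x. c \<odot> x)"
  by (rule k_linearI) (auto simp: sm_add_r sm_assoc mult.commute)
 from k_linear_finsum[OF this _ assms] show ?thesis using kvs_axioms by simp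
qed

lemma pm_eval_scale:
 assumes "b \<in> keys f \<rightarrow> carrier V"
 shows "pm_eval V b (pm_scale c f) = c \<odot> pm_eval V b f"
proof -
 have "pm_eval V b (pm_scale c f) = (\<Oplus>z\<in>keys f. c \<odot> (lookup f z \<odot> b z))"
  by (subst pm_eval_superset[where K = "keys f"])
   (use assms keys_pm_scale[of c f] in \<open>auto simp: sm_assoc Pi_iff intro!: M.finsum_cong'\<close>)
 also have "\<dots> = c \<odot> pm_eval V b f"
  unfolding pm_eval_def by (rule finsum_sm[symmetric]) (use assms in auto)
 finally show ?thesis .
qed

lemma pm_eval_single [simp]:
 assumes "b x \<in> carrier V" shows "pm_eval V b (single x c) = c \<odot> b x"
 using assms by (subst pm_eval_superset[where K = "{x}"]) (auto simp: M.finsum_insert)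

lemma pm_eval_zero [simp]: "pm_eval V b 0 = \<zero>"
 by (simp add: pm_eval_def)

text \<open>Let U be the formal combinations whose value lies in N. On a basis of U the functional
  \<theta> after evaluation is prescribed and extended to a linear L on all formal combinations.
  Combinations of value zero lie in U, because zero is in N, so L kills them and descends to a form
  on V.\<close>

lemma extend_form:
 assumes N: "k_subspace V N"
  and add: "\<And>x y. x \<in> N \<Longrightarrow> y \<in> N \<Longrightarrow> \<theta> (x \<oplus> y) = \<theta> x + \<theta> y"
  and sm: "\<And>c x. x \<in> N \<Longrightarrow> \<theta> (c \<odot> x) = c * \<theta> x"
 obtains \<phi> where "lin_form V \<phi>" "\<And>x. x \<in> N \<Longrightarrow> \<phi> x = \<theta> x"
proof -
 define U where "U = {f. keys f \<subseteq> carrier V \<and> pm_eval V (\<lambda>x. x) f \<in> N}"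
 note ND = ksubD[OF N]
 have sub: "pmvs.subspace U"
  unfolding pmvs.subspace_def
 proof (intro conjI allI ballI)
  show "0 \<in> U" by (simp add: U_def ND)
  fix x y assume "x \<in> U" "y \<in> U"
  then show "x + y \<in> U"
   unfolding U_def using keys_add[of x y] pm_eval_add[of x "carrier V" y "\<lambda>x. x"] ND(3) by auto
 next
  fix c x assume "x \<in> U"
  then show "pm_scale c x \<in> U"
   unfolding U_def using keys_pm_scale[of c x] ND(4) by (subst (1) mem_Collect_eq, subst pm_eval_scale) auto
 qed
 obtain B where B: "B \<subseteq> U" "pmvs.independent B" "U \<subseteq> pmvs.span B"
  using pmvs.maximal_independent_subset by blast
 interpret vp: vector_space_pair "pm_scale :: 'k \<Rightarrow> ('v \<Rightarrow>\<^sub>0 'k) \<Rightarrow> _" "(*) :: 'k \<Rightarrow> 'k \<Rightarrow> 'k"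
  by unfold_locales (simp_all add: algebra_simps)
 obtain L where L: "Vector_Spaces.linear pm_scale (*) L" "\<forall>x\<in>B. L x = \<theta> (pm_eval V (\<lambda>x. x) x)"
  using vp.linear_independent_extend[OF B(2), of "\<lambda>x. \<theta> (pm_eval V (\<lambda>x. x) x)"] by blast
 interpret L: Vector_Spaces.linear pm_scale "(*)" L by (rule L(1))
 have LU: "L f = \<theta> (pm_eval V (\<lambda>x. x) f)" if "f \<in> U" for f
 proof -
  have t0: "\<theta> \<zero> = 0" using sm[OF ND(2), of 0] by simp
  have "f \<in> pmvs.span B" using that B(3) by blast
  then have "f \<in> U \<and> L f = \<theta> (pm_eval V (\<lambda>x. x) f)"
  proof (induction rule: pmvs.span_induct_alt)
   case base then show ?case using sub t0 by (simp add: L.zero pmvs.subspace_def)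
  next
   case (step c x y)
   then have xU: "x \<in> U" "y \<in> U" using B(1) by auto
   then have "pm_scale c x \<in> U" using sub by (simp add: pmvs.subspace_def)
   then have "pm_scale c x + y \<in> U" using xU(2) sub by (simp add: pmvs.subspace_def)
   moreover have "pm_eval V (\<lambda>x. x) (pm_scale c x + y) = c \<odot> pm_eval V (\<lambda>x. x) x \<oplus> pm_eval V (\<lambda>x. x) y"
    using xU keys_pm_scale[of c x]
    by (subst pm_eval_add[where S = "carrier V"]; (subst pm_eval_scale)?) (auto simp: U_def)
   ultimately show ?case using xU step ND(4) L(2) add sm by (simp add: U_def L.add L.scale)
  qed
  then show ?thesis by simp
 qed
 define \<phi> where "\<phi> x = L (single x 1)" for x
 have ker: "L f = 0" if "keys f \<subseteq> carrier V" "pm_eval V (\<lambda>x. x) f = \<zero>" for f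
  using LU[of f] that ND(2) sm[OF ND(2), of 0] by (simp add: U_def)
 let ?d = "single :: 'v \<Rightarrow> 'k \<Rightarrow> _"
 \<comment> \<open>Replacing \<open>f\<close> by the single term given by its value changes it by a
   combination of value zero, which \<open>ker\<close> handles.\<close>
 have Lev: "L f = \<phi> (pm_eval V (\<lambda>x. x) f)" if f: "keys f \<subseteq> carrier V" for f
 proof -
  let ?x = "pm_eval V (\<lambda>x. x) f"
  have x: "?x \<in> carrier V" by (rule pm_eval_closed) (use f in auto)
  have k: "keys (f + ?d ?x (- 1)) \<subseteq> carrier V"
   by (rule order_trans[OF keys_add]) (use f x in auto)
  have "pm_eval V (\<lambda>x. x) (f + ?d ?x (- 1)) = \<zero>"
   by (subst pm_eval_add[where S = "carrier V"]) (use f x in \<open>auto simp: sm_minus M.r_neg\<close>)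
  from ker[OF k this] have "L f + L (pm_scale (- 1) (?d ?x 1)) = 0" by (simp add: L.add)
  then show ?thesis unfolding L.scale \<phi>_def by simp
 qed
 have "lin_form V \<phi>"
 proof (rule k_linearI; simp)
  fix x y assume xy: "x \<in> carrier V" "y \<in> carrier V"
  have "keys (?d x 1 + ?d y 1) \<subseteq> carrier V"
   by (rule order_trans[OF keys_add]) (use xy in auto)
  moreover have "pm_eval V (\<lambda>x. x) (?d x 1 + ?d y 1) = x \<oplus> y"
   by (subst pm_eval_add[where S = "carrier V"]) (use xy in auto)
  ultimately show "\<phi> (x \<oplus> y) = \<phi> x + \<phi> y" using Lev[of "?d x 1 + ?d y 1"] by (simp add: L.add \<phi>_def)
 next
  fix c x assume x: "x \<in> carrier V"
  show "\<phi> (c \<odot> x) = c * \<phi> x" using Lev[of "?d x c"] L.scale[of c "?d x 1"] x by (simp add: \<phi>_def)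
 qed
 moreover have "\<phi> x = \<theta> x" if "x \<in> N" for x
 proof -
  have "x \<in> carrier V" using that ND(1) by auto
  then show ?thesis using LU[of "single x 1"] that by (simp add: U_def \<phi>_def)
 qed
 ultimately show ?thesis by (rule that)
qed

text \<open>Since v is not in N, the coefficient of v is well defined on N + k v. It is a linear
  functional there that vanishes on N, and \<open>extend_form\<close> extends it to V.\<close>

lemma separate:
 assumes N: "k_subspace V N" and v: "v \<in> carrier V" "v \<notin> N"
 obtains \<phi> where "lin_form V \<phi>" "\<And>x. x \<in> N \<Longrightarrow> \<phi> x = 0" "\<phi> v = 1"
proof -
 note ND = ksubD[OF N]
 have uniq: "c = d" if cd: "x \<oplus> c \<odot> v = y \<oplus> d \<odot> v" "x \<in> N" "y \<in> N" for x y c d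
 proof (rule ccontr)
  assume ne: "c \<noteq> d"
  have car: "x \<in> carrier V" "y \<in> carrier V" using that ND(1) by auto
  have "(c - d) \<odot> v = y \<ominus> x"
  proof -
   have "x \<oplus> (c - d) \<odot> v \<oplus> d \<odot> v = x \<oplus> c \<odot> v"
    using car v by (simp add: M.a_assoc sm_add_l[symmetric])
   also have "\<dots> = y \<oplus> d \<odot> v" by (rule cd)
   finally have "x \<oplus> (c - d) \<odot> v = y" using car v by simp
   moreover have "y \<ominus> x = (c - d) \<odot> v \<oplus> x \<ominus> x" if "x \<oplus> (c - d) \<odot> v = y"
    using car v that by (simp add: M.a_comm)
   ultimately show ?thesis using car v by (simp add: M.a_assoc a_minus_def M.r_neg)
  qed
  then have "(c - d) \<odot> v \<in> N" using that ND(6) by simp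
  then have "inverse (c - d) \<odot> ((c - d) \<odot> v) \<in> N" by (rule ND(4))
  then show False using v ne by (simp add: sm_assoc)
 qed
 define W where "W = {x \<oplus> c \<odot> v | x c. x \<in> N}"
 define \<theta> where "\<theta> w = (THE c. \<exists>x\<in>N. w = x \<oplus> c \<odot> v)" for w
 have th: "\<theta> (x \<oplus> c \<odot> v) = c" if "x \<in> N" for x c
  unfolding \<theta>_def by (rule the_equality) (use that uniq in \<open>blast+\<close>)
 have car: "x \<in> carrier V" if "x \<in> N" for x using that ND(1) by auto
 have W1: "(x \<oplus> c \<odot> v) \<oplus> (y \<oplus> d \<odot> v) = (x \<oplus> y) \<oplus> (c + d) \<odot> v" if "x \<in> N" "y \<in> N" for x y c d
  using car that v by (subst add4) (auto simp: sm_add_l)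
 have W2: "a \<odot> (x \<oplus> c \<odot> v) = a \<odot> x \<oplus> (a * c) \<odot> v" if "x \<in> N" for x a c
  using car that v by (simp add: sm_add_r sm_assoc)
 have Wsub: "k_subspace V W"
 proof (rule ksubI)
  show "W \<subseteq> carrier V" using car v by (auto simp: W_def)
  have "\<zero> = \<zero> \<oplus> 0 \<odot> v" using v by simp
  then show "\<zero> \<in> W" unfolding W_def using ND(2) by blast
 next
  fix a b assume "a \<in> W" "b \<in> W"
  then show "a \<oplus> b \<in> W" unfolding W_def using W1 ND(3) by blast
 next
  fix c a assume "a \<in> W"
  then show "c \<odot> a \<in> W" unfolding W_def using W2 ND(4) by blast
 qed
 obtain \<phi> where \<phi>: "lin_form V \<phi>" "\<And>x. x \<in> W \<Longrightarrow> \<phi> x = \<theta> x"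
 proof (rule extend_form[OF Wsub, of \<theta>])
  fix x y assume "x \<in> W" "y \<in> W"
  then obtain a b c d where e: "x = a \<oplus> c \<odot> v" "y = b \<oplus> d \<odot> v" "a \<in> N" "b \<in> N"
   unfolding W_def by blast
  show "\<theta> (x \<oplus> y) = \<theta> x + \<theta> y"
   unfolding e W1[OF e(3,4)] th[OF e(3)] th[OF e(4)] th[OF ND(3)[OF e(3,4)]] ..
 next
  fix c x assume "x \<in> W"
  then obtain a d where e: "x = a \<oplus> d \<odot> v" "a \<in> N" unfolding W_def by blast
  show "\<theta> (c \<odot> x) = c * \<theta> x"
   unfolding e W2[OF e(2)] th[OF e(2)] th[OF ND(4)[OF e(2)]] ..
 next
  fix \<phi> assume "lin_form V \<phi>" "\<And>x. x \<in> W \<Longrightarrow> \<phi> x = \<theta> x"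
  then show thesis by (rule that)
 qed
 have m: "x \<oplus> c \<odot> v \<in> W" if "x \<in> N" for x c using that by (auto simp: W_def)
 show ?thesis
 proof
  show "lin_form V \<phi>" by fact
  show "\<phi> x = 0" if "x \<in> N" for x
   using \<phi>(2)[OF m[OF that, of 0]] th[OF that, of 0] car[OF that] v by simp
  show "\<phi> v = 1" using \<phi>(2)[OF m[OF ND(2), of 1]] th[OF ND(2), of 1] v by simp
 qed
qed

text \<open>Separation of the difference from the zero subspace. Most identities in algebras below
  are proved this way: an arbitrary form is applied and the calculation is left to the
  field.\<close>

lemma form_eqI:
 assumes "x \<in> carrier V" "y \<in> carrier V" "\<And>\<phi>. lin_form V \<phi> \<Longrightarrow> \<phi> x = \<phi> y"
 shows "x = y"
proof (rule ccontr)
 assume ne: "x \<noteq> y"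
 have "x \<ominus> y \<notin> {\<zero>}" using ne assms by (simp add: M.minus_eq) (metis M.minus_equality M.minus_minus M.a_inv_closed)
 then obtain \<phi> where p: "lin_form V \<phi>" "\<phi> (x \<ominus> y) = 1"
  using separate[OF zero_ksub, of "x \<ominus> y"] assms by auto
 then show False using assms(3)[OF p(1)] assms(1,2) by (simp add: form_simps[OF p(1)])
qed

subsection \<open>Quotients\<close>

lemma ksub_abelian_subgroup:
 assumes "k_subspace V N" shows "abelian_subgroup N V"
proof (rule abelian_subgroupI3)
 show "additive_subgroup N V"
  by (rule additive_subgroup.intro) (use assms in \<open>simp add: submodule_def\<close>)
qed (rule M.abelian_group_axioms)

lemma coset_eq:
 assumes "k_subspace V N" "x \<in> carrier V" "y \<in> carrier V"
 shows "N +> x = N +> y \<longleftrightarrow> x \<ominus> y \<in> N"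
proof -
 interpret N: abelian_subgroup N V by (rule ksub_abelian_subgroup[OF assms(1)])
 show ?thesis
 proof
  assume "N +> x = N +> y"
  then have "x \<in> N +> y" using N.a_rcos_self[OF assms(2)] by simp
  then obtain n where "n \<in> N" "x = n \<oplus> y" by (auto simp: a_r_coset_def r_coset_def)
  then show "x \<ominus> y \<in> N" using assms ksubD(1)[OF assms(1)]
   by (auto simp: a_minus_def M.a_assoc M.r_neg subset_iff)
 next
  assume a: "x \<ominus> y \<in> N"
  have "x = (x \<ominus> y) \<oplus> y" using assms by (simp add: a_minus_def M.a_assoc M.l_neg)
  then have "x \<in> N +> y" using a by (auto simp: a_r_coset_def r_coset_def)
  then show "N +> x = N +> y" using M.a_repr_independence[OF _ assms(3)] assms(1) by (auto simp: submodule_def)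
 qed
qed

lemma coset_mem:
 assumes "k_subspace V N" "x \<in> carrier V" "y \<in> N +> x"
 shows "y \<in> carrier V" "N +> y = N +> x"
proof -
 interpret N: abelian_subgroup N V by (rule ksub_abelian_subgroup[OF assms(1)])
 show "y \<in> carrier V" using assms ksubD(1)[OF assms(1)] by (auto simp: a_r_coset_def r_coset_def)
 show "N +> y = N +> x" using M.a_repr_independence[OF assms(3,2)] assms(1) by (auto simp: submodule_def)
qed

lemma coset_self:
 assumes "k_subspace V N" "x \<in> carrier V"
 shows "x \<in> N +> x"
 using abelian_subgroup.a_rcos_self[OF ksub_abelian_subgroup[OF assms(1)] assms(2)] .

lemma coset_zero:
 assumes "k_subspace V N"
 shows "N +> \<zero> = N"
 using ksubD(1)[OF assms] by (force simp: a_r_coset_def r_coset_def)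

lemma coset_add:
 assumes "k_subspace V N" "x \<in> carrier V" "y \<in> carrier V"
 shows "(N +> x) <+>\<^bsub>V\<^esub> (N +> y) = N +> (x \<oplus> y)"
 using abelian_subgroup.a_rcos_sum[OF ksub_abelian_subgroup[OF assms(1)] assms(2,3)] .

lemma coset_smult:
 assumes "k_subspace V N" "x \<in> carrier V"
 shows "(\<Union>y\<in>N +> x. N +> (c \<odot> y)) = N +> (c \<odot> x)"
proof -
 have "N +> (c \<odot> y) = N +> (c \<odot> x)" if "y \<in> N +> x" for y
 proof -
  have y: "y \<in> carrier V" "N +> y = N +> x" using coset_mem[OF assms that] by auto
  then have "c \<odot> (y \<ominus> x) \<in> N" using coset_eq[OF assms(1) y(1) assms(2)] ksubD(4)[OF assms(1)] by auto
  then show ?thesis using coset_eq[OF assms(1), of "c \<odot> y" "c \<odot> x"] y assms by (simp add: sm_diff)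
 qed
 then show ?thesis using coset_self[OF assms] by blast
qed

lemma quotient_simps:
 assumes "k_subspace V N"
 shows "carrier (quotient_module V N) = (\<lambda>x. N +> x) ` carrier V"
  "\<zero>\<^bsub>quotient_module V N\<^esub> = N +> \<zero>"
  "x \<in> carrier V \<Longrightarrow> y \<in> carrier V \<Longrightarrow>
   (N +> x) \<oplus>\<^bsub>quotient_module V N\<^esub> (N +> y) = N +> (x \<oplus> y)"
  "x \<in> carrier V \<Longrightarrow> c \<odot>\<^bsub>quotient_module V N\<^esub> (N +> x) = N +> (c \<odot> x)"
 using coset_zero[OF assms] coset_add[OF assms] coset_smult[OF assms]
 by (auto simp: quotient_module_def A_RCOSETS_def' a_r_coset_def)

lemma quotient_kvs:
 assumes "k_subspace V N"
 shows "kvs (quotient_module V N)"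
proof -
 note q = quotient_simps[OF assms]
 have ag: "abelian_group (quotient_module V N)"
 proof (rule abelian_groupI)
  fix x assume "x \<in> carrier (quotient_module V N)"
  then obtain a where "x = N +> a" "a \<in> carrier V" using q(1) by auto
  then show "\<exists>y\<in>carrier (quotient_module V N). y \<oplus>\<^bsub>quotient_module V N\<^esub> x = \<zero>\<^bsub>quotient_module V N\<^esub>"
   by (intro bexI[of _ "N +> (\<ominus> a)"]) (auto simp: q M.l_neg)
 qed (auto simp: q M.a_assoc M.a_comm M.a_lcomm)
 show ?thesis
  by (rule kvsI[OF ag]) (auto simp: q sm_add_l sm_add_r sm_assoc)
qed

end

section \<open>Tensor products of vector spaces\<close>

lemma free_module_simps [simp]:
 "carrier (free_module S) = {f. keys f \<subseteq> S}"
 "f \<oplus>\<^bsub>free_module S\<^esub> g = f + g" "\<zero>\<^bsub>free_module S\<^esub> = 0" "c \<odot>\<^bsub>free_module S\<^esub> f = pm_scale c f"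
 by (simp_all add: free_module_def)

lemma keys_add_sub: "keys f \<subseteq> S \<Longrightarrow> keys g \<subseteq> S \<Longrightarrow> keys (f + g) \<subseteq> S"
 by (rule order_trans[OF keys_add]) simp

lemma keys_diff_sub: "keys f \<subseteq> S \<Longrightarrow> keys g \<subseteq> S \<Longrightarrow> keys (f - g) \<subseteq> S"
 by (rule order_trans[OF keys_diff]) simp

lemma keys_scale_sub: "keys f \<subseteq> S \<Longrightarrow> keys (pm_scale c f) \<subseteq> S"
 by (rule order_trans[OF keys_pm_scale])

lemma free_module_kvs: "kvs (free_module S :: ('k::field, 's \<Rightarrow>\<^sub>0 'k) module)"
proof (rule kvsI)
 show "abelian_group (free_module S :: ('k, 's \<Rightarrow>\<^sub>0 'k) module)"
 proof (rule abelian_groupI)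
  fix x :: "'s \<Rightarrow>\<^sub>0 'k" assume "x \<in> carrier (free_module S)"
  then show "\<exists>y\<in>carrier (free_module S). y \<oplus>\<^bsub>free_module S\<^esub> x = \<zero>\<^bsub>free_module S\<^esub>"
   by (intro bexI[of _ "- x"]) auto
 qed (simp_all add: keys_add_sub add.assoc add.commute)
qed (simp_all add: pm_scale_simps keys_scale_sub)

lemma free_module_minus:
 assumes "keys f \<subseteq> S" "keys g \<subseteq> S"
 shows "f \<ominus>\<^bsub>free_module S\<^esub> g = f - (g :: 's \<Rightarrow>\<^sub>0 'k::field)"
proof -
 interpret kvs "free_module S :: ('k, 's \<Rightarrow>\<^sub>0 'k) module" by (rule free_module_kvs)
 have "\<ominus>\<^bsub>free_module S\<^esub> g = pm_scale (-1) g" using sm_neg[of g] assms by simp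
 also have "\<dots> = - g" by (rule poly_mapping_eqI) simp
 finally show ?thesis by (simp add: a_minus_def)
qed

lemma pm_keys_induct [consumes 1, case_names zero single add]:
 assumes "keys (f :: 's \<Rightarrow>\<^sub>0 'a::comm_monoid_add) \<subseteq> S"
  and "P 0" and "\<And>x c. x \<in> S \<Longrightarrow> P (single x c)"
  and "\<And>f g. keys f \<subseteq> S \<Longrightarrow> keys g \<subseteq> S \<Longrightarrow> P f \<Longrightarrow> P g \<Longrightarrow> P (f + g)"
 shows "P f"
 using assms(1)
proof (induction f rule: update_induct)
 case (update f a b)
 have e: "Poly_Mapping.update a b f = single a b + f"
  using update(1) by (intro poly_mapping_eqI) (auto simp: lookup_update lookup_add lookup_single when_def in_keys_iff)
 have k: "a \<in> S" "keys f \<subseteq> S"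
  using update by (simp_all add: keys_update)
 show ?case unfolding e by (intro assms(4) assms(3) update(3) k) (use k in auto)
qed (rule assms(2))

text \<open>The vector space axioms do not see multiplication and unit, so they pass between records
  that differ only there, such as \<open>tensor_space V W\<close> and
  \<open>tensor V W\<close>.\<close>

lemma kvs_cong:
 assumes "kvs V" "carrier W = carrier V" "add W = add V" "ring.zero W = ring.zero V"
  "module.smult W = module.smult V"
 shows "kvs W"
proof -
 interpret kvs V by fact
 have "abelian_group W"
 proof (rule abelian_groupI)
  fix x assume "x \<in> carrier W"
  then show "\<exists>y\<in>carrier W. y \<oplus>\<^bsub>W\<^esub> x = \<zero>\<^bsub>W\<^esub>"
   by (intro bexI[of _ "\<ominus>\<^bsub>V\<^esub> x"]) (auto simp: assms M.l_neg)
 qed (simp_all add: assms M.add.m_assoc M.add.m_comm M.add.m_lcomm)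
 then show ?thesis by (rule kvsI) (auto simp: assms sm_add_l sm_add_r sm_assoc)
qed

lemma add_monoid_cong:
 assumes "carrier W = carrier V" "add W = add V" "ring.zero W = ring.zero V"
 shows "finsum W = finsum V" "list_sum W = list_sum V"
 by (intro ext; simp add: finsum_def finprod_def list_sum_def assms)+

lemma tensor_simps [simp]:
 "carrier (tensor V W) = carrier (tensor_space V W)" "add (tensor V W) = add (tensor_space V W)"
 "ring.zero (tensor V W) = ring.zero (tensor_space V W)" "module.smult (tensor V W) = module.smult (tensor_space V W)"
 "one (tensor V W) = pure_tensor V W \<one>\<^bsub>V\<^esub> \<one>\<^bsub>W\<^esub>"
 by (simp_all add: tensor_def)

lemma tensor_lift_tensor_space [simp]: "tensor_lift (tensor V W) = tensor_lift (tensor_space V W)"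
 by (intro ext) (simp add: tensor_lift_def add_monoid_cong(1)[of "tensor V W" "tensor_space V W"])

lemma list_sum_tensor_space [simp]: "list_sum (tensor V W) = list_sum (tensor_space V W)"
 by (rule add_monoid_cong(2)) simp_all

lemma k_linear_tensor_space [simp]:
 "k_linear U (tensor V W) f \<longleftrightarrow> k_linear U (tensor_space V W) f"
 "k_linear (tensor V W) U g \<longleftrightarrow> k_linear (tensor_space V W) U g"
 by (simp_all add: k_linear_def)

definition k_bilinear ::
 "('k::field, 'v, 'm) module_scheme \<Rightarrow> ('k, 'w, 'n) module_scheme \<Rightarrow> ('k, 'u, 'l) module_scheme
  \<Rightarrow> ('v \<Rightarrow> 'w \<Rightarrow> 'u) \<Rightarrow> bool" where
 "k_bilinear V W U b \<longleftrightarrow> (\<forall>w\<in>carrier W. k_linear V U (\<lambda>v. b v w)) \<and> (\<forall>v\<in>carrier V. k_linear W U (b v))"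

locale kvs_pair = V: kvs V + W: kvs W
 for V :: "('k::field, 'v, 'm) module_scheme" and W :: "('k, 'w, 'n) module_scheme"
begin

abbreviation "F \<equiv> free_module (carrier V \<times> carrier W) :: ('k, 'v \<times> 'w \<Rightarrow>\<^sub>0 'k) module"
abbreviation "null \<equiv> tensor_null V W"
abbreviation "T \<equiv> tensor_space V W"
abbreviation "pt \<equiv> pure_tensor V W"

sublocale F: kvs F by (rule free_module_kvs)

lemma single_keys: "v \<in> carrier V \<Longrightarrow> w \<in> carrier W \<Longrightarrow>
  keys (single (v, w) (c::'k)) \<subseteq> carrier V \<times> carrier W"
 by simp

lemma single_carrier: "v \<in> carrier V \<Longrightarrow> w \<in> carrier W \<Longrightarrow> single (v, w) c \<in> carrier F"
 by simp

lemma relations_carrier: "bilinear_relations V W \<subseteq> carrier F"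
proof
 fix r assume "r \<in> bilinear_relations V W"
 then have "keys r \<subseteq> carrier V \<times> carrier W"
  unfolding bilinear_relations_def
  by (elim UnE CollectE exE conjE)
   (simp_all only:, (intro keys_diff_sub single_keys V.M.a_closed W.M.a_closed V.sm_closed W.sm_closed; assumption)+)
 then show "r \<in> carrier F" by simp
qed

lemma null_sub: "k_subspace F null"
 unfolding tensor_null_def by (rule F.span_ksub[OF relations_carrier])

lemma T_kvs: "kvs T"
 unfolding tensor_space_def by (rule F.quotient_kvs[OF null_sub])

lemma tensor_kvs: "kvs (tensor V W)"
 by (rule kvs_cong[OF T_kvs]) simp_all

sublocale T: kvs T by (rule T_kvs)

lemma T_carrier: "carrier T = (\<lambda>f. null +>\<^bsub>F\<^esub> f) ` carrier F"
 unfolding tensor_space_def F.quotient_simps[OF null_sub] ..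

lemma T_add: "f \<in> carrier F \<Longrightarrow> g \<in> carrier F \<Longrightarrow>
  (null +>\<^bsub>F\<^esub> f) \<oplus>\<^bsub>T\<^esub> (null +>\<^bsub>F\<^esub> g) = null +>\<^bsub>F\<^esub> (f \<oplus>\<^bsub>F\<^esub> g)"
 unfolding tensor_space_def by (rule F.quotient_simps(3)[OF null_sub])

lemma T_scale: "f \<in> carrier F \<Longrightarrow> c \<odot>\<^bsub>T\<^esub> (null +>\<^bsub>F\<^esub> f) = null +>\<^bsub>F\<^esub> (c \<odot>\<^bsub>F\<^esub> f)"
 unfolding tensor_space_def by (rule F.quotient_simps(4)[OF null_sub])

lemma pure_closed [simp]: "v \<in> carrier V \<Longrightarrow> w \<in> carrier W \<Longrightarrow> pt v w \<in> carrier T"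
 unfolding T_carrier pure_tensor_def by (rule imageI[OF single_carrier])

lemma relI: "f \<in> bilinear_relations V W \<Longrightarrow> f \<in> null"
 unfolding tensor_null_def using F.span_incl by blast

lemma coset_eqI:
 assumes "f \<in> carrier F" "g \<in> carrier F" "f - g \<in> bilinear_relations V W"
 shows "null +>\<^bsub>F\<^esub> f = null +>\<^bsub>F\<^esub> g"
 using assms F.coset_eq[OF null_sub assms(1,2)] relI by (simp add: free_module_minus)

lemma pure_add_left:
 assumes "v \<in> carrier V" "v' \<in> carrier V" "w \<in> carrier W"
 shows "pt (v \<oplus>\<^bsub>V\<^esub> v') w = pt v w \<oplus>\<^bsub>T\<^esub> pt v' w"
proof -
 note c = single_carrier[OF assms(1,3), of 1] single_carrier[OF assms(2,3), of 1]
 show ?thesis unfolding pure_tensor_def T_add[OF c]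
 proof (rule coset_eqI[OF single_carrier[OF V.M.a_closed[OF assms(1,2)] assms(3)] F.M.a_closed[OF c]])
  show "single (v \<oplus>\<^bsub>V\<^esub> v', w) 1 - (single (v, w) 1 \<oplus>\<^bsub>F\<^esub> single (v', w) 1)
   \<in> bilinear_relations V W"
   using assms unfolding bilinear_relations_def free_module_simps diff_diff_add[symmetric] by blast
 qed
qed

lemma pure_add_right:
 assumes "v \<in> carrier V" "w \<in> carrier W" "w' \<in> carrier W"
 shows "pt v (w \<oplus>\<^bsub>W\<^esub> w') = pt v w \<oplus>\<^bsub>T\<^esub> pt v w'"
proof -
 note c = single_carrier[OF assms(1,2), of 1] single_carrier[OF assms(1,3), of 1]
 show ?thesis unfolding pure_tensor_def T_add[OF c]
 proof (rule coset_eqI[OF single_carrier[OF assms(1) W.M.a_closed[OF assms(2,3)]] F.M.a_closed[OF c]])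
  show "single (v, w \<oplus>\<^bsub>W\<^esub> w') 1 - (single (v, w) 1 \<oplus>\<^bsub>F\<^esub> single (v, w') 1)
   \<in> bilinear_relations V W"
   using assms unfolding bilinear_relations_def free_module_simps diff_diff_add[symmetric] by blast
 qed
qed

lemma single_scale:
 assumes "v \<in> carrier V" "w \<in> carrier W"
 shows "null +>\<^bsub>F\<^esub> single (v, w) c = c \<odot>\<^bsub>T\<^esub> pt v w"
 unfolding pure_tensor_def T_scale[OF single_carrier[OF assms]] by simp

lemma pure_scale_left:
 assumes "v \<in> carrier V" "w \<in> carrier W"
 shows "pt (c \<odot>\<^bsub>V\<^esub> v) w = c \<odot>\<^bsub>T\<^esub> pt v w"
 unfolding single_scale[OF assms, symmetric] unfolding pure_tensor_def
proof (rule coset_eqI[OF single_carrier[OF V.sm_closed[OF assms(1)] assms(2)] single_carrier[OF assms]])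
 show "single (c \<odot>\<^bsub>V\<^esub> v, w) 1 - single (v, w) c \<in> bilinear_relations V W"
  using assms unfolding bilinear_relations_def by blast
qed

lemma pure_scale_right:
 assumes "v \<in> carrier V" "w \<in> carrier W"
 shows "pt v (c \<odot>\<^bsub>W\<^esub> w) = c \<odot>\<^bsub>T\<^esub> pt v w"
 unfolding single_scale[OF assms, symmetric] unfolding pure_tensor_def
proof (rule coset_eqI[OF single_carrier[OF assms(1) W.sm_closed[OF assms(2)]] single_carrier[OF assms]])
 show "single (v, c \<odot>\<^bsub>W\<^esub> w) 1 - single (v, w) c \<in> bilinear_relations V W"
  using assms unfolding bilinear_relations_def by blast
qed

lemma pure_linear_left: "w \<in> carrier W \<Longrightarrow> k_linear V T (\<lambda>v. pt v w)"
 by (rule k_linearI) (auto simp: pure_add_left pure_scale_left)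

lemma pure_linear_right: "v \<in> carrier V \<Longrightarrow> k_linear W T (pt v)"
 by (rule k_linearI) (auto simp: pure_add_right pure_scale_right)

lemma pure_zero [simp]: "w \<in> carrier W \<Longrightarrow> pt \<zero>\<^bsub>V\<^esub> w = \<zero>\<^bsub>T\<^esub>" "v \<in> carrier V \<Longrightarrow> pt v \<zero>\<^bsub>W\<^esub> = \<zero>\<^bsub>T\<^esub>"
 using V.k_linear_zero[OF pure_linear_left T_kvs] W.k_linear_zero[OF pure_linear_right T_kvs] by auto

text \<open>A scalar can be moved into the left factor, so sums of pure tensors already exhaust the
  space and no case for scalars appears.\<close>

lemma tensor_induct [consumes 1, case_names pure add]:
 assumes "t \<in> carrier T"
  and pure: "\<And>v w. v \<in> carrier V \<Longrightarrow> w \<in> carrier W \<Longrightarrow> P (pt v w)"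
  and add: "\<And>s t. s \<in> carrier T \<Longrightarrow> t \<in> carrier T \<Longrightarrow> P s \<Longrightarrow> P t \<Longrightarrow> P (s \<oplus>\<^bsub>T\<^esub> t)"
 shows "P t"
proof -
 obtain f where f: "t = null +>\<^bsub>F\<^esub> f" "keys f \<subseteq> carrier V \<times> carrier W"
  using assms(1) unfolding T_carrier by auto
 from f(2) have "P (null +>\<^bsub>F\<^esub> f)"
 proof (induction f rule: pm_keys_induct)
  case zero
  have "null +>\<^bsub>F\<^esub> \<zero>\<^bsub>F\<^esub> = pt \<zero>\<^bsub>V\<^esub> \<zero>\<^bsub>W\<^esub>"
   using F.quotient_simps(2)[OF null_sub] by (simp add: tensor_space_def)
  then show ?case using pure[of "\<zero>\<^bsub>V\<^esub>" "\<zero>\<^bsub>W\<^esub>"] by simp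
 next
  case (single x c)
  then obtain v w where x: "x = (v, w)" "v \<in> carrier V" "w \<in> carrier W" by auto
  then show ?case using single_scale[OF x(2,3)] pure_scale_left[OF x(2,3)] pure[of "c \<odot>\<^bsub>V\<^esub> v" w] by simp
 next
  case (add f g)
  have c: "f \<in> carrier F" "g \<in> carrier F" using add by auto
  have "null +>\<^bsub>F\<^esub> f \<in> carrier T" "null +>\<^bsub>F\<^esub> g \<in> carrier T"
   unfolding T_carrier using c by blast+
  from assms(3)[OF this add(3,4)] show ?case unfolding T_add[OF c] by simp
 qed
 then show ?thesis using f by simp
qed

text \<open>Evaluation kills the bilinear relations and hence their span. It is therefore constant
  on a coset, so that the image in the definition of \<open>tensor_lift\<close> is a singleton and
  \<open>the_elem\<close> returns its member.\<close>

lemma lift_coset: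
 assumes U: "kvs U" and b: "k_bilinear V W U b" and f: "f \<in> carrier F"
 shows "tensor_lift U b (null +>\<^bsub>F\<^esub> f) = pm_eval U (\<lambda>z. b (fst z) (snd z)) f"
proof -
 interpret U: kvs U by fact
 let ?e = "pm_eval U (\<lambda>z. b (fst z) (snd z))"
 have lv: "k_linear V U (\<lambda>v. b v w)" if "w \<in> carrier W" for w using b that by (simp add: k_bilinear_def)
 have lw: "k_linear W U (b v)" if "v \<in> carrier V" for v using b that by (simp add: k_bilinear_def)
 have bc: "(\<lambda>z. b (fst z) (snd z)) \<in> carrier V \<times> carrier W \<rightarrow> carrier U"
  using k_linearD(1)[OF lv] by auto
 have e: "k_linear F U ?e"
 proof (rule k_linearI)
  fix f assume "f \<in> carrier F" then show "?e f \<in> carrier U"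
   using bc by (intro U.pm_eval_closed) auto
 next
  fix f g assume "f \<in> carrier F" "g \<in> carrier F"
  then show "?e (f \<oplus>\<^bsub>F\<^esub> g) = ?e f \<oplus>\<^bsub>U\<^esub> ?e g" using bc by (simp add: U.pm_eval_add)
 next
  fix c f assume "f \<in> carrier F"
  then show "?e (c \<odot>\<^bsub>F\<^esub> f) = c \<odot>\<^bsub>U\<^esub> ?e f" using bc
   by (simp, subst U.pm_eval_scale) auto
 qed
 have sg: "?e (single (v, w) c) = c \<odot>\<^bsub>U\<^esub> b v w" if "v \<in> carrier V" "w \<in> carrier W" for v w c
  using U.pm_eval_single[of "\<lambda>z. b (fst z) (snd z)" "(v,w)" c] k_linearD(1)[OF lv] that by simp
 define K where "K = {f \<in> carrier F. ?e f = \<zero>\<^bsub>U\<^esub>}"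
 have K: "k_subspace F K"
  unfolding K_def
  by (rule F.ksubI) (use k_linearD[OF e] F.k_linear_zero[OF e U] F.M.a_closed F.sm_closed in \<open>auto simp del: free_module_simps\<close>)
 have minus: "?e (f - g) = ?e f \<ominus>\<^bsub>U\<^esub> ?e g" if "f \<in> carrier F" "g \<in> carrier F" for f g
  using F.k_linear_diff[OF e U that] free_module_minus[of f _ g] that by simp
 have mc: "f - g \<in> carrier F" if "f \<in> carrier F" "g \<in> carrier F" for f g
  using keys_diff_sub that by simp
 note sc = single_carrier
 have can: "(x \<oplus>\<^bsub>U\<^esub> y) \<ominus>\<^bsub>U\<^esub> x \<ominus>\<^bsub>U\<^esub> y = \<zero>\<^bsub>U\<^esub>" if "x \<in> carrier U" "y \<in> carrier U" for x y
  using that by (simp add: a_minus_def U.M.a_assoc[of "x \<oplus>\<^bsub>U\<^esub> y"] U.M.minus_add[symmetric] U.M.r_neg)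
 have can2: "x \<ominus>\<^bsub>U\<^esub> x = \<zero>\<^bsub>U\<^esub>" if "x \<in> carrier U" for x using that by (simp add: a_minus_def U.M.r_neg)
 have "bilinear_relations V W \<subseteq> K"
 proof
  fix r assume r: "r \<in> bilinear_relations V W"
  then have "?e r = \<zero>\<^bsub>U\<^esub>"
   unfolding bilinear_relations_def
   by (elim UnE CollectE exE conjE)
    (simp_all add: k_linearD[OF lv] k_linearD[OF lw] minus mc sc sg can can2 del: free_module_simps)
  then show "r \<in> K" using r relations_carrier by (auto simp: K_def)
 qed
 then have nK: "null \<subseteq> K" unfolding tensor_null_def by (rule F.span_min[OF K])
 have "?e g = ?e f" if g: "g \<in> null +>\<^bsub>F\<^esub> f" for g
 proof -
  obtain n where n: "n \<in> null" "g = n \<oplus>\<^bsub>F\<^esub> f" using g unfolding a_r_coset_def r_coset_def by auto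
  then have "n \<in> carrier F" "?e n = \<zero>\<^bsub>U\<^esub>" using nK unfolding K_def by blast+
  then show ?thesis using n k_linearD(2)[OF e _ f] k_linearD(1)[OF e f] by simp
 qed
 moreover have "f \<in> null +>\<^bsub>F\<^esub> f" by (rule F.coset_self[OF null_sub f])
 ultimately have "?e ` (null +>\<^bsub>F\<^esub> f) = {?e f}" by blast
 then show ?thesis unfolding tensor_lift_def pm_eval_def by simp
qed

lemma lift_pure:
 assumes U: "kvs U" and b: "k_bilinear V W U b" and "v \<in> carrier V" "w \<in> carrier W"
 shows "tensor_lift U b (pt v w) = b v w"
proof -
 interpret U: kvs U by fact
 have "b v w \<in> carrier U" using b assms k_linearD(1)[of W U "b v" w] unfolding k_bilinear_def by blast
 then show ?thesis unfolding pure_tensor_def lift_coset[OF U b single_carrier[OF assms(3,4)]]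
  using U.pm_eval_single[of "\<lambda>z. b (fst z) (snd z)" "(v,w)" 1] by simp
qed

lemma lift_linear:
 assumes U: "kvs U" and b: "k_bilinear V W U b"
 shows "k_linear T U (tensor_lift U b)"
proof -
 interpret U: kvs U by fact
 have bc: "(\<lambda>z. b (fst z) (snd z)) \<in> carrier V \<times> carrier W \<rightarrow> carrier U"
  using b k_linearD(1)[of W U "b v" w for v w] unfolding k_bilinear_def by auto
 show ?thesis
 proof (rule k_linearI)
  fix x assume "x \<in> carrier T"
  then obtain f where f: "x = null +>\<^bsub>F\<^esub> f" "f \<in> carrier F" unfolding T_carrier by blast
  show "tensor_lift U b x \<in> carrier U"
   unfolding f(1) lift_coset[OF U b f(2)] by (rule U.pm_eval_closed) (use f bc in auto)
 next
  fix x y assume "x \<in> carrier T" "y \<in> carrier T"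
  then obtain f g where h: "x = null +>\<^bsub>F\<^esub> f" "y = null +>\<^bsub>F\<^esub> g" "f \<in> carrier F" "g \<in> carrier F" unfolding T_carrier by blast
  show "tensor_lift U b (x \<oplus>\<^bsub>T\<^esub> y) = tensor_lift U b x \<oplus>\<^bsub>U\<^esub> tensor_lift U b y"
   unfolding h(1,2) T_add[OF h(3,4)] lift_coset[OF U b F.M.a_closed[OF h(3,4)]] lift_coset[OF U b h(3)] lift_coset[OF U b h(4)]
   using h bc by (simp add: U.pm_eval_add)
 next
  fix c x assume "x \<in> carrier T"
  then obtain f where h: "x = null +>\<^bsub>F\<^esub> f" "f \<in> carrier F" unfolding T_carrier by blast
  show "tensor_lift U b (c \<odot>\<^bsub>T\<^esub> x) = c \<odot>\<^bsub>U\<^esub> tensor_lift U b x"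
   unfolding h(1) T_scale[OF h(2)] lift_coset[OF U b F.sm_closed[OF h(2)]] lift_coset[OF U b h(2)]
   using h bc by (simp, subst U.pm_eval_scale) auto
 qed
qed

lemma linear_eqI:
 assumes "k_linear T U f" "k_linear T U g"
  and "\<And>v w. v \<in> carrier V \<Longrightarrow> w \<in> carrier W \<Longrightarrow> f (pt v w) = g (pt v w)" and "t \<in> carrier T"
 shows "f t = g t"
 using assms(4) by (induction t rule: tensor_induct) (simp_all add: assms(3) k_linearD(2)[OF assms(1)] k_linearD(2)[OF assms(2)])

lemma tensor_list:
 assumes "t \<in> carrier T"
 obtains xs where "set xs \<subseteq> carrier V \<times> carrier W" "t = list_sum T (map (\<lambda>(v, w). pt v w) xs)"
proof -
 have c: "set (map (\<lambda>(v, w). pt v w) xs) \<subseteq> carrier T" if "set xs \<subseteq> carrier V \<times> carrier W" for xs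
  using that by auto
 from assms have "\<exists>xs. set xs \<subseteq> carrier V \<times> carrier W \<and> t = list_sum T (map (\<lambda>(v, w). pt v w) xs)"
 proof (induction t rule: tensor_induct)
  case (pure v w)
  then show ?case by (intro exI[of _ "[(v, w)]"]) simp
 next
  case (add s t)
  then obtain xs ys where "set xs \<subseteq> carrier V \<times> carrier W" "s = list_sum T (map (\<lambda>(v, w). pt v w) xs)"
   "set ys \<subseteq> carrier V \<times> carrier W" "t = list_sum T (map (\<lambda>(v, w). pt v w) ys)" by blast
  then show ?case using c[of xs] c[of ys] by (intro exI[of _ "xs @ ys"]) (simp add: T.list_sum_append)
 qed
 then show ?thesis using that by blast
qed

section \<open>Forms and slices on a tensor product\<close>

definition tf :: "('v \<Rightarrow> 'k) \<Rightarrow> ('w \<Rightarrow> 'k) \<Rightarrow> ('v, 'w, 'k) tensor \<Rightarrow> 'k" where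
 "tf \<phi> \<psi> = tensor_lift ground_algebra (\<lambda>a b. \<phi> a * \<psi> b)"

lemma tf_bilinear: "lin_form V \<phi> \<Longrightarrow> lin_form W \<psi> \<Longrightarrow> k_bilinear V W ground_algebra (\<lambda>a b. \<phi> a * \<psi> b)"
 unfolding k_bilinear_def
 by (auto intro!: k_linearI simp: V.form_simps W.form_simps algebra_simps)

lemma tf_linear: "lin_form V \<phi> \<Longrightarrow> lin_form W \<psi> \<Longrightarrow> lin_form T (tf \<phi> \<psi>)"
 unfolding tf_def by (rule lift_linear[OF ground_kvs tf_bilinear])

lemma tf_pure [simp]:
 "lin_form V \<phi> \<Longrightarrow> lin_form W \<psi> \<Longrightarrow> v \<in> carrier V \<Longrightarrow> w \<in> carrier W \<Longrightarrow> tf \<phi> \<psi> (pt v w) = \<phi> v * \<psi> w"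
 unfolding tf_def by (rule lift_pure[OF ground_kvs tf_bilinear])

lemma tf_simps:
 assumes "lin_form V \<phi>" "lin_form W \<psi>"
 shows "v \<in> carrier V \<Longrightarrow> w \<in> carrier W \<Longrightarrow> tf \<phi> \<psi> (pt v w) = \<phi> v * \<psi> w"
  "u \<in> carrier T \<Longrightarrow> u' \<in> carrier T \<Longrightarrow> tf \<phi> \<psi> (u \<oplus>\<^bsub>T\<^esub> u') = tf \<phi> \<psi> u + tf \<phi> \<psi> u'"
  "u \<in> carrier T \<Longrightarrow> u' \<in> carrier T \<Longrightarrow> tf \<phi> \<psi> (u \<ominus>\<^bsub>T\<^esub> u') = tf \<phi> \<psi> u - tf \<phi> \<psi> u'"
  "u \<in> carrier T \<Longrightarrow> tf \<phi> \<psi> (c \<odot>\<^bsub>T\<^esub> u) = c * tf \<phi> \<psi> u"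
  "g \<in> A \<rightarrow> carrier T \<Longrightarrow> tf \<phi> \<psi> (finsum T g A) = (\<Sum>i\<in>A. tf \<phi> \<psi> (g i))"
 using assms by (simp_all add: T.form_simps[OF tf_linear])

text \<open>The slice \<phi> \<otimes> id, and below its mirror image id \<otimes> \<psi>. Slices
  turn a tensor back into a vector of one factor, which makes it possible to ask in which subspace
  that factor lies.\<close>

definition lsl :: "('v \<Rightarrow> 'k) \<Rightarrow> ('v, 'w, 'k) tensor \<Rightarrow> 'w" where
 "lsl \<phi> = tensor_lift W (\<lambda>a b. \<phi> a \<odot>\<^bsub>W\<^esub> b)"

definition rsl :: "('w \<Rightarrow> 'k) \<Rightarrow> ('v, 'w, 'k) tensor \<Rightarrow> 'v" where
 "rsl \<psi> = tensor_lift V (\<lambda>a b. \<psi> b \<odot>\<^bsub>V\<^esub> a)"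

lemma lsl_bilinear: "lin_form V \<phi> \<Longrightarrow> k_bilinear V W W (\<lambda>a b. \<phi> a \<odot>\<^bsub>W\<^esub> b)"
 unfolding k_bilinear_def
 by (auto intro!: k_linearI simp: V.form_simps W.sm_add_r W.sm_add_l W.sm_assoc mult.commute)

lemma rsl_bilinear: "lin_form W \<psi> \<Longrightarrow> k_bilinear V W V (\<lambda>a b. \<psi> b \<odot>\<^bsub>V\<^esub> a)"
 unfolding k_bilinear_def
 by (auto intro!: k_linearI simp: W.form_simps V.sm_add_r V.sm_add_l V.sm_assoc mult.commute)

lemma lsl_linear: "lin_form V \<phi> \<Longrightarrow> k_linear T W (lsl \<phi>)"
 unfolding lsl_def by (rule lift_linear[OF W.kvs_axioms lsl_bilinear])

lemma rsl_linear: "lin_form W \<psi> \<Longrightarrow> k_linear T V (rsl \<psi>)"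
 unfolding rsl_def by (rule lift_linear[OF V.kvs_axioms rsl_bilinear])

lemma lsl_pure [simp]: "lin_form V \<phi> \<Longrightarrow> v \<in> carrier V \<Longrightarrow> w \<in> carrier W \<Longrightarrow> lsl \<phi> (pt v w) = \<phi> v \<odot>\<^bsub>W\<^esub> w"
 unfolding lsl_def by (rule lift_pure[OF W.kvs_axioms lsl_bilinear])

lemma rsl_pure [simp]: "lin_form W \<psi> \<Longrightarrow> v \<in> carrier V \<Longrightarrow> w \<in> carrier W \<Longrightarrow> rsl \<psi> (pt v w) = \<psi> w \<odot>\<^bsub>V\<^esub> v"
 unfolding rsl_def by (rule lift_pure[OF V.kvs_axioms rsl_bilinear])

lemma form_lsl: "lin_form V \<phi> \<Longrightarrow> lin_form W \<psi> \<Longrightarrow> t \<in> carrier T \<Longrightarrow> \<psi> (lsl \<phi> t) = tf \<phi> \<psi> t"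
 by (rule linear_eqI[of ground_algebra "\<lambda>t. \<psi> (lsl \<phi> t)" "tf \<phi> \<psi>"])
  (auto intro: k_linear_comp[OF lsl_linear] tf_linear simp: W.form_simps)

lemma form_rsl: "lin_form V \<phi> \<Longrightarrow> lin_form W \<psi> \<Longrightarrow> t \<in> carrier T \<Longrightarrow> \<phi> (rsl \<psi> t) = tf \<phi> \<psi> t"
 by (rule linear_eqI[of ground_algebra "\<lambda>t. \<phi> (rsl \<psi> t)" "tf \<phi> \<psi>"])
  (auto intro: k_linear_comp[OF rsl_linear] tf_linear simp: V.form_simps mult.commute)

end

lemma (in kvs) span_insertE:
 assumes "s \<in> k_span V (insert v S)" "v \<in> carrier V" "S \<subseteq> carrier V"
 obtains c s' where "s' \<in> k_span V S" "s = c \<odot> v \<oplus> s'"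
proof -
 have N1: "k_subspace V {c \<odot> v |c. True}"
 proof (rule ksubI)
  show "\<zero> \<in> {c \<odot> v |c. True}" using sm_0[OF assms(2), symmetric] by blast
  show "a \<oplus> b \<in> {c \<odot> v |c. True}" if "a \<in> {c \<odot> v |c. True}" "b \<in> {c \<odot> v |c. True}" for a b
   using that sm_add_l[OF assms(2), symmetric] by blast
  show "d \<odot> a \<in> {c \<odot> v |c. True}" if "a \<in> {c \<odot> v |c. True}" for a d
   using that sm_assoc[OF assms(2)] by blast
 qed (use assms in auto)
 note N2 = span_ksub[OF assms(3)]
 have "insert v S \<subseteq> {c \<odot> v |c. True} <+>\<^bsub>V\<^esub> k_span V S"
 proof (rule insert_subsetI)
  have "v = 1 \<odot> v \<oplus> \<zero>" using assms by simp
  then show "v \<in> {c \<odot> v |c. True} <+>\<^bsub>V\<^esub> k_span V S" unfolding ksub_sum_iff using ksubD(2)[OF N2] by blast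
  show "S \<subseteq> {c \<odot> v |c. True} <+>\<^bsub>V\<^esub> k_span V S"
  proof
   fix x assume "x \<in> S"
   then have "x = 0 \<odot> v \<oplus> x" "x \<in> k_span V S" using assms span_incl by auto
   then show "x \<in> {c \<odot> v |c. True} <+>\<^bsub>V\<^esub> k_span V S" unfolding ksub_sum_iff by blast
  qed
 qed
 from subsetD[OF span_min[OF ksub_sum[OF N1 N2] this] assms(1)]
 show ?thesis unfolding ksub_sum_iff using that by blast
qed

lemma (in kvs) span_empty: "k_span V {} = {\<zero>}"
 using span_min[OF zero_ksub, of "{}"] ksubD(2)[OF span_ksub, of "{}"] by auto

lemma k_linear_add:
 assumes "kvs W" "k_linear V W f" "k_linear V W g"
 shows "k_linear V W (\<lambda>x. f x \<oplus>\<^bsub>W\<^esub> g x)"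
proof -
 interpret W: kvs W by fact
 show ?thesis by (rule k_linearI) (simp_all add: k_linearD[OF assms(2)] k_linearD[OF assms(3)] W.sm_add_r W.add4)
qed

lemma k_linear_scale:
 assumes "kvs W" "k_linear V W f"
 shows "k_linear V W (\<lambda>x. c \<odot>\<^bsub>W\<^esub> f x)"
proof -
 interpret W: kvs W by fact
 show ?thesis by (rule k_linearI) (simp_all add: k_linearD[OF assms(2)] W.sm_add_r W.sm_assoc mult.commute)
qed

section \<open>Tensors adapted to flags of subspaces\<close>

context kvs_pair begin

abbreviation pts :: "('v \<times> 'w) list \<Rightarrow> ('v, 'w, 'k) tensor" where
 "pts xs \<equiv> list_sum T (map (\<lambda>(v, w). pt v w) xs)"

lemma pts_closed: "set xs \<subseteq> carrier V \<times> carrier W \<Longrightarrow> pts xs \<in> carrier T"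
 by (rule T.list_sum_closed) auto

text \<open>If s is a combination of left factors already present, then s \<otimes> w is distributed
  over the existing summands by changing their right factors. That the list does not become longer
  is what allows \<open>flag\<close> to use induction on its length.\<close>

lemma absorb:
 assumes "set xs \<subseteq> carrier V \<times> carrier W" "s \<in> k_span V (fst ` set xs)" "w \<in> carrier W"
 shows "\<exists>ys. length ys = length xs \<and> set ys \<subseteq> carrier V \<times> carrier W \<and> pts ys = pts xs \<oplus>\<^bsub>T\<^esub> pt s w"
 using assms(1,2)
proof (induction xs arbitrary: s)
 case Nil
 then show ?case using V.span_empty assms(3) by simp
next
 case (Cons x xs)
 obtain v u where x: "x = (v, u)" "v \<in> carrier V" "u \<in> carrier W" using Cons(2) by auto
 have sub: "fst ` set xs \<subseteq> carrier V" "set xs \<subseteq> carrier V \<times> carrier W" using Cons(2) by auto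
 have "s \<in> k_span V (insert v (fst ` set xs))" using Cons(3) x by simp
 then obtain c s' where s: "s' \<in> k_span V (fst ` set xs)" "s = c \<odot>\<^bsub>V\<^esub> v \<oplus>\<^bsub>V\<^esub> s'"
  by (rule V.span_insertE[OF _ x(2) sub(1)])
 have s'c: "s' \<in> carrier V" using s(1) V.span_closed[OF sub(1)] by auto
 obtain ys where ys: "length ys = length xs" "set ys \<subseteq> carrier V \<times> carrier W" "pts ys = pts xs \<oplus>\<^bsub>T\<^esub> pt s' w"
  using Cons(1)[OF sub(2) s(1)] by blast
 have "pts ((v, u \<oplus>\<^bsub>W\<^esub> c \<odot>\<^bsub>W\<^esub> w) # ys) = (pt v u \<oplus>\<^bsub>T\<^esub> c \<odot>\<^bsub>T\<^esub> pt v w) \<oplus>\<^bsub>T\<^esub> (pts xs \<oplus>\<^bsub>T\<^esub> pt s' w)"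
  using x assms(3) ys by (simp add: pure_add_right pure_scale_right)
 also have "\<dots> = (pt v u \<oplus>\<^bsub>T\<^esub> pts xs) \<oplus>\<^bsub>T\<^esub> (c \<odot>\<^bsub>T\<^esub> pt v w \<oplus>\<^bsub>T\<^esub> pt s' w)"
  by (rule T.add4) (use x assms(3) s'c pts_closed[OF sub(2)] in auto)
 also have "\<dots> = pts (x # xs) \<oplus>\<^bsub>T\<^esub> pt s w"
  using x assms(3) s'c s by (simp add: pure_add_left pure_scale_left)
 finally show ?case
  by (intro exI[of _ "(v, u \<oplus>\<^bsub>W\<^esub> c \<odot>\<^bsub>W\<^esub> w) # ys"]) (use ys x assms(3) in simp)
qed

lemma tf_pts:
 assumes "lin_form V \<phi>" "lin_form W \<psi>" "set xs \<subseteq> carrier V \<times> carrier W"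
 shows "tf \<phi> \<psi> (pts xs) = (\<Sum>(v, w)\<leftarrow>xs. \<phi> v * \<psi> w)"
 using assms(3)
proof (induction xs)
 case Nil then show ?case using T.form_simps(1)[OF tf_linear[OF assms(1,2)]] by simp
next
 case (Cons x xs)
 then show ?case
  using T.form_simps(2)[OF tf_linear[OF assms(1,2)] _ pts_closed[of xs]] assms by (auto split: prod.splits)
qed

text \<open>Induction on the length of a list representing t. With S the span of the other left
  factors and m least such that the first left factor v lies in A_m + S, the S-part of v is absorbed
  by the rest, and the hypothesis forces the right factor into the matching member of B. This is the
  dual form of the fact that the intersection of all A_i \<otimes> W + V \<otimes> B_(N-i) is the
  sum of the A_(i+1) \<otimes> B_(j+1) with i + j + 1 = N.\<close>

lemma flag:
 assumes A: "\<And>i. k_subspace V (A i)" "\<And>i. A i \<subseteq> A (Suc i)" "A 0 = {\<zero>\<^bsub>V\<^esub>}"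
  and B: "\<And>i. k_subspace W (B i)" "\<And>i. B i \<subseteq> B (Suc i)" "B 0 = {\<zero>\<^bsub>W\<^esub>}"
  and t: "t \<in> carrier T"
  and kill: "\<And>i \<phi> \<psi>. i \<le> N \<Longrightarrow> lin_form V \<phi> \<Longrightarrow> lin_form W \<psi> \<Longrightarrow> (\<And>x. x \<in> A i \<Longrightarrow> \<phi> x = 0) \<Longrightarrow>
   (\<And>y. y \<in> B (N - i) \<Longrightarrow> \<psi> y = 0) \<Longrightarrow> tf \<phi> \<psi> t = 0"
 shows "\<exists>ys. (\<forall>(i, j, v, w)\<in>set ys. i + j + 1 = N \<and> v \<in> A (Suc i) \<and> w \<in> B (Suc j)) \<and>
  t = list_sum T (map (\<lambda>(i, j, v, w). pt v w) ys)"
proof -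
 have Am: "A i \<subseteq> A j" if "i \<le> j" for i j by (rule lift_Suc_mono_le[of A, OF A(2) that])
 have Bm: "B i \<subseteq> B j" if "i \<le> j" for i j by (rule lift_Suc_mono_le[of B, OF B(2) that])
 obtain xs where xs: "set xs \<subseteq> carrier V \<times> carrier W" "t = pts xs" using tensor_list[OF t] .
 show ?thesis using xs t kill
 proof (induction "length xs" arbitrary: xs t)
  case 0
  then show ?case by (intro exI[of _ "[]"]) simp
 next
  case (Suc n)
  obtain v w r where xr: "xs = (v, w) # r" using Suc(2) by (cases xs) auto
  have c: "v \<in> carrier V" "w \<in> carrier W" "set r \<subseteq> carrier V \<times> carrier W" using Suc(3) xr by auto
  have n: "n = length r" using Suc(2) xr by simp
  let ?S = "k_span V (fst ` set r)"
  have fr: "fst ` set r \<subseteq> carrier V" using c(3) by auto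
  note S = V.span_ksub[OF fr]
  \<comment> \<open>A form that is 1 on v and 0 on A_i + S sees only the first summand of t. If w
    were outside, pairing with a form that separates w would give the value 1 on t instead of
    0.\<close>
  have key: "w \<in> B (N - i)" if i: "i \<le> N" and nv: "v \<notin> A i <+>\<^bsub>V\<^esub> ?S" for i
  proof (rule ccontr)
   assume nw: "w \<notin> B (N - i)"
   obtain \<phi> where f: "lin_form V \<phi>" "\<And>x. x \<in> A i <+>\<^bsub>V\<^esub> ?S \<Longrightarrow> \<phi> x = 0" "\<phi> v = 1"
    using V.separate[OF V.ksub_sum[OF A(1) S] c(1) nv] by blast
   obtain \<psi> where g: "lin_form W \<psi>" "\<And>x. x \<in> B (N - i) \<Longrightarrow> \<psi> x = 0" "\<psi> w = 1"
    using W.separate[OF B(1) c(2) nw] by blast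
   have "\<phi> x = 0" if x: "x \<in> A i" for x
   proof (rule f(2))
    have "x = x \<oplus>\<^bsub>V\<^esub> \<zero>\<^bsub>V\<^esub>" using subsetD[OF V.ksubD(1)[OF A(1)] x] by simp
    then show "x \<in> A i <+>\<^bsub>V\<^esub> ?S" unfolding V.ksub_sum_iff using x V.ksubD(2)[OF S] by blast
   qed
   then have t0: "tf \<phi> \<psi> t = 0" using Suc(6)[OF i f(1) g(1) _ g(2)] by blast
   have r0: "\<phi> x = 0" if x: "(x, y) \<in> set r" for x y
   proof (rule f(2))
    have "x \<in> fst ` set r" using x by force
    then have "x \<in> ?S" "x \<in> carrier V" using subsetD[OF V.span_incl] subsetD[OF fr] by blast+
    then have "x = \<zero>\<^bsub>V\<^esub> \<oplus>\<^bsub>V\<^esub> x" "x \<in> ?S" by auto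
    then show "x \<in> A i <+>\<^bsub>V\<^esub> ?S" unfolding V.ksub_sum_iff using V.ksubD(2)[OF A(1)] by blast
   qed
   have "(\<Sum>(v, w)\<leftarrow>r. \<phi> v * \<psi> w) = (\<Sum>(v, w)\<leftarrow>r. 0)"
    by (rule arg_cong[of _ _ sum_list], rule map_cong) (use r0 in auto)
   then have "tf \<phi> \<psi> t = 1"
    using tf_pts[OF f(1) g(1) Suc(3)] Suc(4) f(3) g(3) by (simp add: xr case_prod_unfold)
   then show False using t0 by simp
  qed
  have drop: ?case if "w = \<zero>\<^bsub>W\<^esub>"
  proof -
   have "t = pts r" using Suc(4) xr that c pts_closed[OF c(3)] by simp
   then show ?thesis using Suc(1)[OF n c(3), of t] Suc(5,6) by blast
  qed
  show ?case
  proof (cases "v \<in> A N <+>\<^bsub>V\<^esub> ?S")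
   case False
   then show ?thesis using key[of N] B(3) drop by auto
  next
   case True
   \<comment> \<open>Minimality gives \<open>key\<close> at m - 1, which is the strongest
     information about w that is available.\<close>
   define m where "m = (LEAST i. v \<in> A i <+>\<^bsub>V\<^esub> ?S)"
   have m: "v \<in> A m <+>\<^bsub>V\<^esub> ?S" "m \<le> N" unfolding m_def using LeastI[of "\<lambda>i. v \<in> A i <+>\<^bsub>V\<^esub> ?S", OF True] Least_le[of "\<lambda>i. v \<in> A i <+>\<^bsub>V\<^esub> ?S", OF True] by auto
   obtain u s where us: "u \<in> A m" "s \<in> ?S" "v = u \<oplus>\<^bsub>V\<^esub> s" using m(1) unfolding V.ksub_sum_iff by blast
   have usc: "u \<in> carrier V" "s \<in> carrier V" using us V.ksubD(1)[OF A(1)] V.ksubD(1)[OF S] by auto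
   obtain r' where r': "length r' = length r" "set r' \<subseteq> carrier V \<times> carrier W" "pts r' = pts r \<oplus>\<^bsub>T\<^esub> pt s w"
    using absorb[OF c(3) us(2) c(2)] by blast
   have te: "t = pt u w \<oplus>\<^bsub>T\<^esub> pts r'"
    using Suc(4) usc c us pts_closed[OF c(3)]
    by (simp add: xr r' pure_add_left T.M.add.m_assoc T.M.add.m_comm[of "pts r"])
   note r'c = pts_closed[OF r'(2)]
   show ?thesis
   proof (cases m)
    case 0
    \<comment> \<open>Here v lies in S, so its component u in A_0 is zero and the whole summand has
      been absorbed.\<close>
    then have "t = pts r'" using te us(1) A(3) c r'c by simp
    show ?thesis
    proof (rule Suc.hyps(1)[OF _ r'(2) \<open>t = pts r'\<close> Suc.prems(3)])
     show "n = length r'" using n r'(1) by simp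
    qed (rule Suc.prems(4))
   next
    case (Suc i)
    have ni: "v \<notin> A i <+>\<^bsub>V\<^esub> ?S" using not_less_Least[of i "\<lambda>i. v \<in> A i <+>\<^bsub>V\<^esub> ?S"] Suc m_def by simp
    have iN: "i < N" using m(2) Suc by simp
    have wB: "w \<in> B (N - i)" using key[OF _ ni] iN by simp
    obtain j where j: "N - i = Suc j" using iN by (metis Suc_diff_Suc)
    have "\<exists>ys. (\<forall>(i, j, v, w)\<in>set ys. i + j + 1 = N \<and> v \<in> A (Suc i) \<and> w \<in> B (Suc j)) \<and>
     pts r' = list_sum T (map (\<lambda>(i, j, v, w). pt v w) ys)"
    proof (rule Suc.hyps(1)[OF _ r'(2) refl r'c])
     show "n = length r'" using n r'(1) by simp
     fix i' \<phi> \<psi>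
     assume h: "i' \<le> N" "lin_form V \<phi>" "lin_form W \<psi>" "\<And>x. x \<in> A i' \<Longrightarrow> \<phi> x = 0" "\<And>y. y \<in> B (N - i') \<Longrightarrow> \<psi> y = 0"
     \<comment> \<open>The split-off summand satisfies the hypothesis itself, u for large i' and w
       for small i', so the remainder inherits it from t.\<close>
     have "\<phi> u * \<psi> w = 0"
     proof (cases "Suc i \<le> i'")
      case True
      then show ?thesis using us(1) Am[OF True] h(4) Suc by auto
     next
      case False
      then have "B (N - i) \<subseteq> B (N - i')" by (intro Bm) auto
      then show ?thesis using wB h(5) by auto
     qed
     moreover have "tf \<phi> \<psi> t = 0" by (rule Suc.prems(4)[OF h])
     moreover have "tf \<phi> \<psi> t = \<phi> u * \<psi> w + tf \<phi> \<psi> (pts r')"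
      unfolding te using T.form_simps(2)[OF tf_linear[OF h(2,3)] _ r'c] usc c h by simp
     ultimately show "tf \<phi> \<psi> (pts r') = 0" by (metis add.left_neutral)
    qed
    then obtain ys where ys: "\<forall>(i, j, v, w)\<in>set ys. i + j + 1 = N \<and> v \<in> A (Suc i) \<and> w \<in> B (Suc j)"
     "pts r' = list_sum T (map (\<lambda>(i, j, v, w). pt v w) ys)" by blast
    show ?thesis
     by (rule exI[of _ "(i, j, u, w) # ys"]) (use ys te us wB j iN Suc in auto)
   qed
  qed
 qed
qed

text \<open>\<open>flag\<close> with zero flags and N = 0: no indices satisfy i + j + 1 = 0, so the
  list representing x - y is empty.\<close>

lemma tf_eqI:
 assumes "x \<in> carrier T" "y \<in> carrier T"
  and "\<And>\<phi> \<psi>. lin_form V \<phi> \<Longrightarrow> lin_form W \<psi> \<Longrightarrow> tf \<phi> \<psi> x = tf \<phi> \<psi> y"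
 shows "x = y"
proof -
 have "\<exists>ys. (\<forall>(i, j, v, w)\<in>set ys. i + j + (1::nat) = 0 \<and> v \<in> {\<zero>\<^bsub>V\<^esub>} \<and> w \<in> {\<zero>\<^bsub>W\<^esub>}) \<and>
  x \<ominus>\<^bsub>T\<^esub> y = list_sum T (map (\<lambda>(i, j, v, w). pt v w) ys)"
 proof (rule flag[where A = "\<lambda>_. {\<zero>\<^bsub>V\<^esub>}" and B = "\<lambda>_. {\<zero>\<^bsub>W\<^esub>}" and N = 0])
  show "x \<ominus>\<^bsub>T\<^esub> y \<in> carrier T" using assms by simp
  fix \<phi> \<psi> assume "lin_form V \<phi>" "lin_form W \<psi>"
  then show "tf \<phi> \<psi> (x \<ominus>\<^bsub>T\<^esub> y) = 0" using T.form_simps(5)[OF tf_linear assms(1,2)] assms(3) by simp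
 qed (auto intro: V.zero_ksub W.zero_ksub)
 then obtain ys where "\<forall>(i, j, v, w)\<in>set ys. i + j + (1::nat) = 0"
  "x \<ominus>\<^bsub>T\<^esub> y = list_sum T (map (\<lambda>(i :: nat, j :: nat, v, w). pt v w) ys)" by fast
 moreover then have "ys = []" by (cases ys) auto
 ultimately have "x \<ominus>\<^bsub>T\<^esub> y = \<zero>\<^bsub>T\<^esub>" by simp
 then show ?thesis using assms(1,2) by (metis T.M.minus_eq T.M.minus_equality T.M.minus_minus T.M.a_inv_closed)
qed

lemma tf_zero:
 assumes "lin_form V \<phi>" "lin_form W \<psi>" "t \<in> carrier T"
  "(\<forall>x\<in>carrier V. \<phi> x = 0) \<or> (\<forall>x\<in>carrier W. \<psi> x = 0)"
 shows "tf \<phi> \<psi> t = 0"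
 using assms(3) by (induction t rule: tensor_induct) (use assms in \<open>auto simp: T.form_simps(2)[OF tf_linear]\<close>)

text \<open>\<open>flag\<close> with N = 2 and the flags 0, V1, V and 0, W1, W: the summands it
  produces lie in V1 \<otimes> W or in V \<otimes> W1. The extreme indices i = 0 and i = 2 ask
  nothing, since there one of the two forms vanishes identically.\<close>

lemma perp_mem:
 assumes V1: "k_subspace V V1" and W1: "k_subspace W W1"
  and t: "t \<in> carrier T"
  and kill: "\<And>\<phi> \<psi>. lin_form V \<phi> \<Longrightarrow> lin_form W \<psi> \<Longrightarrow> (\<And>x. x \<in> V1 \<Longrightarrow> \<phi> x = 0) \<Longrightarrow>
   (\<And>y. y \<in> W1 \<Longrightarrow> \<psi> y = 0) \<Longrightarrow> tf \<phi> \<psi> t = 0"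
  and N: "k_subspace T N"
  and mem: "\<And>v w. v \<in> V1 \<Longrightarrow> w \<in> carrier W \<Longrightarrow> pt v w \<in> N" "\<And>v w. v \<in> carrier V \<Longrightarrow> w \<in> W1 \<Longrightarrow> pt v w \<in> N"
 shows "t \<in> N"
proof -
 define A where "A i = (if i = 0 then {\<zero>\<^bsub>V\<^esub>} else if i = Suc 0 then V1 else carrier V)" for i
 define B where "B i = (if i = 0 then {\<zero>\<^bsub>W\<^esub>} else if i = Suc 0 then W1 else carrier W)" for i
 have "\<exists>ys. (\<forall>(i, j, v, w)\<in>set ys. i + j + 1 = 2 \<and> v \<in> A (Suc i) \<and> w \<in> B (Suc j)) \<and>
  t = list_sum T (map (\<lambda>(i, j, v, w). pt v w) ys)"
 proof (rule flag[where A = A and B = B and N = 2])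
  fix i \<phi> \<psi> assume h: "i \<le> 2" "lin_form V \<phi>" "lin_form W \<psi>" "\<And>x. x \<in> A i \<Longrightarrow> \<phi> x = 0" "\<And>y. y \<in> B (2 - i) \<Longrightarrow> \<psi> y = 0"
  consider "i = 0" | "i = 1" | "i = 2" using h(1) by linarith
  then show "tf \<phi> \<psi> t = 0"
  proof cases
   case 1 then show ?thesis using tf_zero[OF h(2,3) t] h(5) by (auto simp: B_def)
  next
   case 2 then show ?thesis using kill[OF h(2,3)] h(4,5) by (auto simp: A_def B_def)
  next
   case 3 then show ?thesis using tf_zero[OF h(2,3) t] h(4) by (auto simp: A_def)
  qed
 qed (use V1 W1 V.ksubD[OF V1] W.ksubD[OF W1] t in \<open>auto simp: A_def B_def intro: V.zero_ksub W.zero_ksub V.carrier_ksub W.carrier_ksub\<close>)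
 then obtain ys where ys: "\<And>i j v w. (i, j, v, w) \<in> set ys \<Longrightarrow> i + j + 1 = 2 \<and> v \<in> A (Suc i) \<and> w \<in> B (Suc j)"
  "t = list_sum T (map (\<lambda>(i, j, v, w). pt v w) ys)" by fast
 show ?thesis unfolding ys(2)
 proof (rule T.ksub_list_sum[OF N])
  show "set (map (\<lambda>(i, j, v, w). pt v w) ys) \<subseteq> N"
  proof
   fix x assume "x \<in> set (map (\<lambda>(i, j, v, w). pt v w) ys)"
   then obtain i j v w where m: "(i, j, v, w) \<in> set ys" "x = pt v w" by auto
   from ys(1)[OF m(1)] show "x \<in> N" unfolding m(2) using mem by (cases i) (auto simp: A_def B_def)
  qed
 qed
qed

end

subsection \<open>The tensor product of two algebras\<close>

sublocale k_algebra \<subseteq> kvs A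
 by (simp add: kvs_def module_axioms)

lemma (in k_algebra) lmult_linear: "a \<in> carrier A \<Longrightarrow> k_linear A A (\<lambda>x. a \<otimes> x)"
 by (rule k_linearI) (simp_all add: ring.ring_simprules[OF k_algebra_ring[OF k_algebra_axioms]] smult_mult_right)

lemma (in k_algebra) rmult_linear: "a \<in> carrier A \<Longrightarrow> k_linear A A (\<lambda>x. x \<otimes> a)"
 by (rule k_linearI) (simp_all add: ring.ring_simprules[OF k_algebra_ring[OF k_algebra_axioms]] smult_mult_left)

locale k_algebra_pair = V: k_algebra V + W: k_algebra W
 for V :: "('k::field, 'v, 'm) module_scheme" and W :: "('k, 'w, 'n) module_scheme"
begin

sublocale kvs_pair V W ..

definition "tm = (\<lambda>s t. s \<otimes>\<^bsub>tensor V W\<^esub> t)"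
text \<open>Left multiplication by a \<otimes> b: the inner of the two nested lifts that make up the
  product.\<close>

definition "ti a b t = tensor_lift T (\<lambda>c d. pt (a \<otimes>\<^bsub>V\<^esub> c) (b \<otimes>\<^bsub>W\<^esub> d)) t"

lemma tm_ti: "tm s t = tensor_lift T (\<lambda>a b. ti a b t) s"
 by (simp add: tm_def ti_def tensor_def)

lemma Vm [simp]: "x \<in> carrier V \<Longrightarrow> y \<in> carrier V \<Longrightarrow> x \<otimes>\<^bsub>V\<^esub> y \<in> carrier V"
 using k_linearD(1)[OF V.lmult_linear] by auto

lemma Wm [simp]: "x \<in> carrier W \<Longrightarrow> y \<in> carrier W \<Longrightarrow> x \<otimes>\<^bsub>W\<^esub> y \<in> carrier W"
 using k_linearD(1)[OF W.lmult_linear] by auto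

lemma ti_bilinear: "a \<in> carrier V \<Longrightarrow> b \<in> carrier W \<Longrightarrow> k_bilinear V W T (\<lambda>c d. pt (a \<otimes>\<^bsub>V\<^esub> c) (b \<otimes>\<^bsub>W\<^esub> d))"
 unfolding k_bilinear_def
 using k_linear_comp[OF V.lmult_linear[of a] pure_linear_left] k_linear_comp[OF W.lmult_linear[of b] pure_linear_right] by auto

lemma ti_linear: "a \<in> carrier V \<Longrightarrow> b \<in> carrier W \<Longrightarrow> k_linear T T (ti a b)"
 unfolding ti_def[abs_def] by (rule lift_linear[OF T_kvs ti_bilinear])

lemma ti_pure: "a \<in> carrier V \<Longrightarrow> b \<in> carrier W \<Longrightarrow> c \<in> carrier V \<Longrightarrow> d \<in> carrier W \<Longrightarrow>
  ti a b (pt c d) = pt (a \<otimes>\<^bsub>V\<^esub> c) (b \<otimes>\<^bsub>W\<^esub> d)"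
 unfolding ti_def by (rule lift_pure[OF T_kvs ti_bilinear])

lemma ti_bilinear2:
 assumes t: "t \<in> carrier T"
 shows "k_bilinear V W T (\<lambda>a b. ti a b t)"
 unfolding k_bilinear_def
proof (intro conjI ballI k_linearI)
 fix a b assume "a \<in> carrier V" "b \<in> carrier W" then show "ti a b t \<in> carrier T" using k_linearD(1)[OF ti_linear t] by blast
 then show "ti a b t \<in> carrier T" .
next
 fix w x y assume h: "w \<in> carrier W" "x \<in> carrier V" "y \<in> carrier V"
 show "ti (x \<oplus>\<^bsub>V\<^esub> y) w t = ti x w t \<oplus>\<^bsub>T\<^esub> ti y w t"
  by (rule linear_eqI[OF ti_linear k_linear_add[OF T_kvs ti_linear ti_linear] _ t])
   (use h in \<open>simp_all add: ti_pure pure_add_left k_linearD(2)[OF V.rmult_linear]\<close>)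
next
 fix w c x assume h: "w \<in> carrier W" "x \<in> carrier V"
 show "ti (c \<odot>\<^bsub>V\<^esub> x) w t = c \<odot>\<^bsub>T\<^esub> ti x w t"
  by (rule linear_eqI[OF ti_linear k_linear_scale[OF T_kvs ti_linear] _ t])
   (use h in \<open>simp_all add: ti_pure pure_scale_left k_linearD(3)[OF V.rmult_linear]\<close>)
next
 fix v x y assume h: "v \<in> carrier V" "x \<in> carrier W" "y \<in> carrier W"
 show "ti v (x \<oplus>\<^bsub>W\<^esub> y) t = ti v x t \<oplus>\<^bsub>T\<^esub> ti v y t"
  by (rule linear_eqI[OF ti_linear k_linear_add[OF T_kvs ti_linear ti_linear] _ t])
   (use h in \<open>simp_all add: ti_pure pure_add_right k_linearD(2)[OF W.rmult_linear]\<close>)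
next
 fix v c x assume h: "v \<in> carrier V" "x \<in> carrier W"
 show "ti v (c \<odot>\<^bsub>W\<^esub> x) t = c \<odot>\<^bsub>T\<^esub> ti v x t"
  by (rule linear_eqI[OF ti_linear k_linear_scale[OF T_kvs ti_linear] _ t])
   (use h in \<open>simp_all add: ti_pure pure_scale_right k_linearD(3)[OF W.rmult_linear]\<close>)
qed

lemma tm_linear_left: "t \<in> carrier T \<Longrightarrow> k_linear T T (\<lambda>s. tm s t)"
 unfolding tm_ti by (rule lift_linear[OF T_kvs ti_bilinear2])

lemma tm_pure_left: "t \<in> carrier T \<Longrightarrow> a \<in> carrier V \<Longrightarrow> b \<in> carrier W \<Longrightarrow> tm (pt a b) t = ti a b t"
 unfolding tm_ti by (rule lift_pure[OF T_kvs ti_bilinear2])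

lemma tm_linear_right:
 assumes "s \<in> carrier T" shows "k_linear T T (tm s)"
 using assms
proof (induction s rule: tensor_induct)
 case (pure v w)
 show ?case by (rule k_linearI) (use pure in \<open>simp_all add: tm_pure_left k_linearD[OF ti_linear]\<close>)
next
 case (add r s)
 have l: "k_linear T T (\<lambda>t. tm r t \<oplus>\<^bsub>T\<^esub> tm s t)" by (rule k_linear_add[OF T_kvs add(3,4)])
 have e: "tm (r \<oplus>\<^bsub>T\<^esub> s) t = tm r t \<oplus>\<^bsub>T\<^esub> tm s t" if "t \<in> carrier T" for t
  using k_linearD(2)[OF tm_linear_left[OF that] add(1,2)] .
 show ?case by (rule k_linearI) (simp_all add: e k_linearD[OF l])
qed

lemma tm_pure: "a \<in> carrier V \<Longrightarrow> b \<in> carrier W \<Longrightarrow> c \<in> carrier V \<Longrightarrow> d \<in> carrier W \<Longrightarrow>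
  tm (pt a b) (pt c d) = pt (a \<otimes>\<^bsub>V\<^esub> c) (b \<otimes>\<^bsub>W\<^esub> d)"
 by (simp add: tm_pure_left ti_pure)

lemma tm_closed: "s \<in> carrier T \<Longrightarrow> t \<in> carrier T \<Longrightarrow> tm s t \<in> carrier T"
 using k_linearD(1)[OF tm_linear_right] by blast

text \<open>Linearity in each factor reduces the claim to pure tensors, one factor at a time and
  starting from the right end.\<close>

lemma tm_assoc:
 assumes r: "r \<in> carrier T" and s: "s \<in> carrier T" and t: "t \<in> carrier T"
 shows "tm (tm r s) t = tm r (tm s t)"
proof -
 note VR = ring.ring_simprules[OF k_algebra_ring[OF V.k_algebra_axioms]] and WR = ring.ring_simprules[OF k_algebra_ring[OF W.k_algebra_axioms]]
 have 1: "tm (tm (pt a b) (pt c d)) t = tm (pt a b) (tm (pt c d) t)"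
  if "a \<in> carrier V" "b \<in> carrier W" "c \<in> carrier V" "d \<in> carrier W" for a b c d
  by (rule linear_eqI[OF tm_linear_right k_linear_comp[OF tm_linear_right tm_linear_right] _ t])
   (use that in \<open>simp_all add: tm_pure VR(11) WR(11) tm_closed\<close>)
 have 2: "tm (tm (pt a b) s) t = tm (pt a b) (tm s t)" if "a \<in> carrier V" "b \<in> carrier W" for a b
  by (rule linear_eqI[OF k_linear_comp[OF tm_linear_right tm_linear_left] k_linear_comp[OF tm_linear_left tm_linear_right] _ s])
   (use that t 1 in simp_all)
 show ?thesis
  by (rule linear_eqI[OF k_linear_comp[OF tm_linear_left tm_linear_left] tm_linear_left _ r])
   (use s t 2 tm_closed in simp_all)
qed

lemma tensor_algebra: "k_algebra (tensor V W)"
proof -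
 have one: "\<one>\<^bsub>V\<^esub> \<in> carrier V" "\<one>\<^bsub>W\<^esub> \<in> carrier W"
  using ring.ring_simprules(6)[OF k_algebra_ring[OF V.k_algebra_axioms]]
   ring.ring_simprules(6)[OF k_algebra_ring[OF W.k_algebra_axioms]] by auto
 note VR = ring.ring_simprules[OF k_algebra_ring[OF V.k_algebra_axioms]] and WR = ring.ring_simprules[OF k_algebra_ring[OF W.k_algebra_axioms]]
 have l1: "tm (pt \<one>\<^bsub>V\<^esub> \<one>\<^bsub>W\<^esub>) t = t" if "t \<in> carrier T" for t
  by (rule linear_eqI[OF tm_linear_right k_linear_id _ that]) (use one VR WR in \<open>simp_all add: tm_pure\<close>)
 have r1: "tm t (pt \<one>\<^bsub>V\<^esub> \<one>\<^bsub>W\<^esub>) = t" if "t \<in> carrier T" for t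
  by (rule linear_eqI[OF tm_linear_left k_linear_id _ that])
   (use one in \<open>simp_all add: tm_pure monoid.r_one[OF ring.is_monoid[OF k_algebra_ring[OF V.k_algebra_axioms]]]
    monoid.r_one[OF ring.is_monoid[OF k_algebra_ring[OF W.k_algebra_axioms]]]\<close>)
 interpret TT: kvs "tensor V W" by (rule tensor_kvs)
 have "ring (tensor V W)"
 proof (rule ringI[OF TT.M.abelian_group_axioms])
  show "monoid (tensor V W)"
   by (rule monoidI) (use tm_closed tm_assoc l1 r1 one in \<open>simp_all add: tm_def\<close>)
 qed (use k_linearD(2)[OF tm_linear_left] k_linearD(2)[OF tm_linear_right] in \<open>simp_all add: tm_def\<close>)
 then show ?thesis
  unfolding k_algebra_def k_algebra_axioms_def
  using TT.kvs_axioms k_linearD(3)[OF tm_linear_left] k_linearD(3)[OF tm_linear_right]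
  by (simp add: tm_def kvs_def)
qed

lemma tensor_mult_pure: "a \<in> carrier V \<Longrightarrow> b \<in> carrier W \<Longrightarrow> c \<in> carrier V \<Longrightarrow> d \<in> carrier W \<Longrightarrow>
  pt a b \<otimes>\<^bsub>tensor V W\<^esub> pt c d = pt (a \<otimes>\<^bsub>V\<^esub> c) (b \<otimes>\<^bsub>W\<^esub> d)"
 using tm_pure by (simp add: tm_def)

end

subsection \<open>Functoriality and associativity\<close>

lemma tensor_map_linear:
 assumes "kvs A" "kvs B" "kvs V" "kvs W" "k_linear A V f" "k_linear B W g"
 shows "k_linear (tensor_space A B) (tensor_space V W) (tensor_map V W f g)"
  and "a \<in> carrier A \<Longrightarrow> b \<in> carrier B \<Longrightarrow> tensor_map V W f g (pure_tensor A B a b) = pure_tensor V W (f a) (g b)"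
proof -
 interpret D: kvs_pair A B using assms by (simp add: kvs_pair_def)
 interpret R: kvs_pair V W using assms by (simp add: kvs_pair_def)
 have b: "k_bilinear A B (tensor_space V W) (\<lambda>a b. pure_tensor V W (f a) (g b))"
  unfolding k_bilinear_def
  using k_linear_comp[OF assms(5) R.pure_linear_left] k_linear_comp[OF assms(6) R.pure_linear_right]
   k_linearD(1)[OF assms(5)] k_linearD(1)[OF assms(6)] by auto
 show "k_linear (tensor_space A B) (tensor_space V W) (tensor_map V W f g)"
  unfolding tensor_map_def by (rule D.lift_linear[OF R.T_kvs b])
 show "a \<in> carrier A \<Longrightarrow> b \<in> carrier B \<Longrightarrow> tensor_map V W f g (pure_tensor A B a b) = pure_tensor V W (f a) (g b)"
  unfolding tensor_map_def by (rule D.lift_pure[OF R.T_kvs b])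
qed

lemma tf_tensor_map:
 assumes "kvs A" "kvs B" "kvs V" "kvs W" "k_linear A V f" "k_linear B W g"
  and "lin_form V \<phi>" "lin_form W \<psi>" "t \<in> carrier (tensor_space A B)"
 shows "kvs_pair.tf \<phi> \<psi> (tensor_map V W f g t) = kvs_pair.tf (\<lambda>x. \<phi> (f x)) (\<lambda>x. \<psi> (g x)) t"
proof -
 interpret D: kvs_pair A B using assms by (simp add: kvs_pair_def)
 interpret R: kvs_pair V W using assms by (simp add: kvs_pair_def)
 note m = tensor_map_linear[OF assms(1-6)]
 note c = k_linear_comp[OF assms(5,7)] k_linear_comp[OF assms(6,8)]
 show ?thesis
  by (rule D.linear_eqI[OF k_linear_comp[OF m(1) R.tf_linear[OF assms(7,8)]] D.tf_linear[OF c] _ assms(9)])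
   (use c assms in \<open>simp add: m(2) k_linearD(1)[OF assms(5)] k_linearD(1)[OF assms(6)]\<close>)
qed

locale kvs_triple = U: kvs U + V: kvs V + W: kvs W
 for U :: "('k::field, 'u, 'l) module_scheme" and V :: "('k, 'v, 'm) module_scheme" and W :: "('k, 'w, 'n) module_scheme"
begin

sublocale UV: kvs_pair U V ..
sublocale VW: kvs_pair V W ..
sublocale L: kvs_pair "tensor U V" W using UV.tensor_kvs W.kvs_axioms by (simp add: kvs_pair_def)
sublocale R: kvs_pair U "tensor V W" using VW.tensor_kvs U.kvs_axioms by (simp add: kvs_pair_def)

lemma assoc_inner:
 assumes "w \<in> carrier W"
 shows "k_bilinear U V R.T (\<lambda>u v. R.pt u (VW.pt v w))"
 unfolding k_bilinear_def
 using k_linear_comp[OF VW.pure_linear_left[OF assms] R.pure_linear_right[unfolded k_linear_tensor_space]]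
  R.pure_linear_left VW.pure_closed assms by simp

text \<open>The inner lift of \<open>tensor_assoc\<close>: reassociation of s \<otimes> w for fixed
  w.\<close>

definition "ai w = tensor_lift R.T (\<lambda>u v. R.pt u (VW.pt v w))"

lemma ai_linear: "w \<in> carrier W \<Longrightarrow> k_linear UV.T R.T (ai w)"
 unfolding ai_def by (rule UV.lift_linear[OF R.T_kvs assoc_inner])

lemma ai_pure: "w \<in> carrier W \<Longrightarrow> u \<in> carrier U \<Longrightarrow> v \<in> carrier V \<Longrightarrow> ai w (UV.pt u v) = R.pt u (VW.pt v w)"
 unfolding ai_def by (rule UV.lift_pure[OF R.T_kvs assoc_inner])

lemma assoc_outer: "k_bilinear (tensor U V) W R.T (\<lambda>s w. ai w s)"
 unfolding k_bilinear_def
proof (intro conjI ballI)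
 fix w assume "w \<in> carrier W" then show "k_linear (tensor U V) R.T (ai w)" using ai_linear by simp
next
 fix s assume "s \<in> carrier (tensor U V)"
 then have s: "s \<in> carrier UV.T" by simp
 show "k_linear W R.T (\<lambda>w. ai w s)"
 proof (rule k_linearI)
  fix w assume "w \<in> carrier W" then show "ai w s \<in> carrier R.T" using k_linearD(1)[OF ai_linear s] by blast
 next
  fix x y assume h: "x \<in> carrier W" "y \<in> carrier W"
  show "ai (x \<oplus>\<^bsub>W\<^esub> y) s = ai x s \<oplus>\<^bsub>R.T\<^esub> ai y s"
   by (rule UV.linear_eqI[OF ai_linear k_linear_add[OF R.T_kvs ai_linear ai_linear] _ s])
    (use h R.pure_add_right in \<open>simp_all add: ai_pure VW.pure_add_right\<close>)
 next
  fix c x assume h: "x \<in> carrier W"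
  show "ai (c \<odot>\<^bsub>W\<^esub> x) s = c \<odot>\<^bsub>R.T\<^esub> ai x s"
   by (rule UV.linear_eqI[OF ai_linear k_linear_scale[OF R.T_kvs ai_linear] _ s])
    (use h R.pure_scale_right in \<open>simp_all add: ai_pure VW.pure_scale_right\<close>)
 qed
qed

lemma tensor_assoc_ai: "tensor_assoc U V W = tensor_lift R.T (\<lambda>s w. ai w s)"
 by (simp add: tensor_assoc_def Let_def ai_def)

lemma assoc_linear: "k_linear L.T R.T (tensor_assoc U V W)"
 unfolding tensor_assoc_ai by (rule L.lift_linear[OF R.T_kvs assoc_outer])

lemma assoc_pure: "s \<in> carrier UV.T \<Longrightarrow> w \<in> carrier W \<Longrightarrow> tensor_assoc U V W (L.pt s w) = ai w s"
 unfolding tensor_assoc_ai using L.lift_pure[OF R.T_kvs assoc_outer] by simp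

lemma tf_assoc:
 assumes "lin_form U \<phi>" "lin_form V \<psi>" "lin_form W \<chi>" "t \<in> carrier L.T"
 shows "R.tf \<phi> (VW.tf \<psi> \<chi>) (tensor_assoc U V W t) = L.tf (UV.tf \<phi> \<psi>) \<chi> t"
proof -
 have f1: "lin_form (tensor U V) (UV.tf \<phi> \<psi>)" "lin_form (tensor V W) (VW.tf \<psi> \<chi>)"
  using UV.tf_linear VW.tf_linear assms by simp_all
 note rl = R.tf_linear[OF assms(1) f1(2)]
 show ?thesis
 proof (rule L.linear_eqI[OF k_linear_comp[OF assoc_linear rl] L.tf_linear[OF f1(1) assms(3)] _ assms(4)])
  fix s w assume h: "s \<in> carrier (tensor U V)" "w \<in> carrier W"
  then have s: "s \<in> carrier UV.T" by simp
  have "R.tf \<phi> (VW.tf \<psi> \<chi>) (ai w s) = \<chi> w * UV.tf \<phi> \<psi> s"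
  proof (rule UV.linear_eqI[OF k_linear_comp[OF ai_linear[OF h(2)] rl] _ _ s])
   show "lin_form UV.T (\<lambda>s. \<chi> w * UV.tf \<phi> \<psi> s)"
    using k_linear_scale[OF ground_kvs UV.tf_linear[OF assms(1,2)]] by simp
   fix u v assume "u \<in> carrier U" "v \<in> carrier V"
   then show "R.tf \<phi> (VW.tf \<psi> \<chi>) (ai w (UV.pt u v)) = \<chi> w * UV.tf \<phi> \<psi> (UV.pt u v)"
    using h assms f1 R.tf_pure[OF assms(1) f1(2), of u "VW.pt v w"] by (simp add: ai_pure)
  qed
  then show "R.tf \<phi> (VW.tf \<psi> \<chi>) (tensor_assoc U V W (L.pt s w)) = L.tf (UV.tf \<phi> \<psi>) \<chi> (L.pt s w)"
   using h s L.tf_pure[OF f1(1) assms(3) h] by (simp add: assoc_pure mult.commute)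
 qed
qed

text \<open>A form on V \<otimes> W need not be a product of forms. Slicing by \<phi> first leaves
  two elements of V \<otimes> W, and these are compared by product forms; afterwards any form on V
  \<otimes> W may be applied.\<close>

lemma tf3_eqI:
 assumes "x \<in> carrier R.T" "y \<in> carrier R.T"
  and "\<And>\<phi> \<psi> \<chi>. lin_form U \<phi> \<Longrightarrow> lin_form V \<psi> \<Longrightarrow> lin_form W \<chi> \<Longrightarrow>
   R.tf \<phi> (VW.tf \<psi> \<chi>) x = R.tf \<phi> (VW.tf \<psi> \<chi>) y"
 shows "x = y"
proof (rule R.tf_eqI[OF assms(1,2)])
 fix \<phi> \<Omega> assume h: "lin_form U \<phi>" "lin_form (tensor V W) \<Omega>"
 have c: "R.lsl \<phi> z \<in> carrier VW.T" if "z \<in> carrier R.T" for z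
  using k_linearD(1)[OF R.lsl_linear[OF h(1)] that] by simp
 have "R.lsl \<phi> x = R.lsl \<phi> y"
 proof (rule VW.tf_eqI[OF c[OF assms(1)] c[OF assms(2)]])
  fix \<psi> \<chi> assume f: "lin_form V \<psi>" "lin_form W \<chi>"
  then have g: "lin_form (tensor V W) (VW.tf \<psi> \<chi>)" using VW.tf_linear by simp
  show "VW.tf \<psi> \<chi> (R.lsl \<phi> x) = VW.tf \<psi> \<chi> (R.lsl \<phi> y)"
   using R.form_lsl[OF h(1) g assms(1)] R.form_lsl[OF h(1) g assms(2)] assms(3)[OF h(1) f] by simp
 qed
 then show "R.tf \<phi> \<Omega> x = R.tf \<phi> \<Omega> y"
  using R.form_lsl[OF h assms(1)] R.form_lsl[OF h assms(2)] by simp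
qed

end

lemma ksub_tensor_iff:
 assumes "kvs V" "kvs W"
 shows "k_subspace (tensor V W) N \<longleftrightarrow>
  k_subspace (tensor_space V W) N"
proof -
 interpret kvs_pair V W using assms by (simp add: kvs_pair_def)
 interpret TT: kvs "tensor V W" by (rule tensor_kvs)
 show ?thesis
 proof
  assume "k_subspace (tensor V W) N"
  from TT.ksubD[OF this] show "k_subspace T N" by (intro T.ksubI) simp_all
 next
  assume "k_subspace T N"
  from T.ksubD[OF this] show "k_subspace (tensor V W) N" by (intro TT.ksubI) simp_all
 qed
qed

section \<open>Annihilators and the convolution of forms\<close>

definition perp :: "('k::field, 'v, 'm) module_scheme \<Rightarrow> 'v set \<Rightarrow> ('v \<Rightarrow> 'k) set" where
 "perp V S = {\<phi>. lin_form V \<phi> \<and> (\<forall>x\<in>S. \<phi> x = 0)}"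

lemma perpD: "\<phi> \<in> perp V S \<Longrightarrow> lin_form V \<phi>" "\<phi> \<in> perp V S \<Longrightarrow> x \<in> S \<Longrightarrow> \<phi> x = 0"
 by (auto simp: perp_def)

lemma perpI: "lin_form V \<phi> \<Longrightarrow> (\<And>x. x \<in> S \<Longrightarrow> \<phi> x = 0) \<Longrightarrow> \<phi> \<in> perp V S"
 by (auto simp: perp_def)

lemma perp_mono: "S \<subseteq> S' \<Longrightarrow> perp V S' \<subseteq> perp V S"
 by (auto simp: perp_def)

context kvs begin

lemma ker_ksub: "lin_form V \<phi> \<Longrightarrow> k_subspace V {x \<in> carrier V. \<phi> x = 0}"
 by (rule ksubI) (auto simp: form_simps)

lemma perp_spanI:
 assumes "lin_form V \<phi>" "S \<subseteq> carrier V" "\<And>x. x \<in> S \<Longrightarrow> \<phi> x = 0"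
 shows "\<phi> \<in> perp V (k_span V S)"
 using span_min[OF ker_ksub[OF assms(1)], of S] assms by (intro perpI) auto

lemma form_list_sum_zero:
 assumes "lin_form V \<phi>" "\<And>x. x \<in> set xs \<Longrightarrow> x \<in> carrier V \<and> \<phi> x = 0"
 shows "\<phi> (list_sum V xs) = 0"
 using assms(2)
proof (induction xs)
 case (Cons a xs)
 then have "set xs \<subseteq> carrier V" "a \<in> carrier V" by auto
 then show ?case using Cons by (simp add: form_simps(2)[OF assms(1)])
qed (simp add: form_simps[OF assms(1)])

end

context bialgebra begin

sublocale HH: k_algebra_pair H H ..
sublocale H3: kvs_triple H H H ..

abbreviation "\<Delta> \<equiv> comult H"

lemma ring_H: "ring H" by (rule k_algebra_ring[OF k_algebra_axioms])

lemma comult_closed [simp]: "h \<in> carrier H \<Longrightarrow> \<Delta> h \<in> carrier HH.T"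
 using k_linearD(1)[OF comult_linear] by simp

lemma comult_lin: "k_linear H HH.T \<Delta>"
 using comult_linear by simp

lemma comult_mult': "x \<in> carrier H \<Longrightarrow> y \<in> carrier H \<Longrightarrow> \<Delta> (x \<otimes> y) = \<Delta> x \<otimes>\<^bsub>tensor H H\<^esub> \<Delta> y"
 using comult_mult by (simp add: ring_hom_def)

text \<open>The convolution product, that is, the multiplication of the dual algebra of H.
  Coassociativity becomes its associativity.\<close>

definition cv :: "('h \<Rightarrow> 'k) \<Rightarrow> ('h \<Rightarrow> 'k) \<Rightarrow> 'h \<Rightarrow> 'k" where
 "cv \<phi> \<psi> h = HH.tf \<phi> \<psi> (\<Delta> h)"

lemma cv_linear: "lin_form H \<phi> \<Longrightarrow> lin_form H \<psi> \<Longrightarrow> lin_form H (cv \<phi> \<psi>)"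
 unfolding cv_def[abs_def] by (rule k_linear_comp[OF comult_lin HH.tf_linear])

lemma cv_assoc:
 assumes "lin_form H \<phi>" "lin_form H \<psi>" "lin_form H \<chi>" "h \<in> carrier H"
 shows "cv (cv \<phi> \<psi>) \<chi> h = cv \<phi> (cv \<psi> \<chi>) h"
proof -
 have f1: "lin_form (tensor H H) (HH.tf \<phi> \<psi>)" "lin_form (tensor H H) (HH.tf \<psi> \<chi>)"
  using HH.tf_linear assms by simp_all
 have idl: "k_linear H H id" using k_linear_id by (simp add: id_def)
 note kv = HH.tensor_kvs kvs_axioms
 have "cv (cv \<phi> \<psi>) \<chi> h = H3.L.tf (HH.tf \<phi> \<psi>) \<chi> (tensor_map (tensor H H) H \<Delta> id (\<Delta> h))"
  using tf_tensor_map[OF kv(2,2) kv comult_linear idl f1(1) assms(3), of "\<Delta> h"] assms(4)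
  by (simp add: cv_def[abs_def])
 also have "\<dots> = H3.R.tf \<phi> (HH.tf \<psi> \<chi>) (tensor_assoc H H H (tensor_map (tensor H H) H \<Delta> id (\<Delta> h)))"
  by (rule H3.tf_assoc[symmetric])
   (use assms k_linearD(1)[OF tensor_map_linear(1)[OF kv(2,2) kv comult_linear idl]] in auto)
 also have "\<dots> = H3.R.tf \<phi> (HH.tf \<psi> \<chi>) (tensor_map H (tensor H H) id \<Delta> (\<Delta> h))"
  using coassoc[OF assms(4)] by simp
 also have "\<dots> = cv \<phi> (cv \<psi> \<chi>) h"
  using tf_tensor_map[OF kv(2,2) kv(2,1) idl comult_linear assms(1) f1(2), of "\<Delta> h"] assms(4)
  by (simp add: cv_def[abs_def])
 finally show ?thesis .
qed

lemma grouplikesD: "g \<in> grouplikes H \<Longrightarrow> g \<in> carrier H" "g \<in> grouplikes H \<Longrightarrow> \<Delta> g = HH.pt g g"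
 "g \<in> grouplikes H \<Longrightarrow> counit H g = 1"
 by (auto simp: grouplikes_def)

lemma cv_grouplike: "g \<in> grouplikes H \<Longrightarrow> lin_form H \<phi> \<Longrightarrow> lin_form H \<psi> \<Longrightarrow> cv \<phi> \<psi> g = \<phi> g * \<psi> g"
 by (simp add: cv_def grouplikesD)

lemma one_closed': "\<one> \<in> carrier H"
 using ring.ring_simprules(6)[OF ring_H] .

lemma one_grouplike: "\<one> \<in> grouplikes H"
 using comult_mult counit_mult one_closed' by (simp add: grouplikes_def ring_hom_def)

lemma mult_grouplike: "g \<in> grouplikes H \<Longrightarrow> h \<in> grouplikes H \<Longrightarrow> g \<otimes> h \<in> grouplikes H"
 using counit_mult by (simp add: grouplikes_def ring_hom_def comult_mult' HH.tensor_mult_pure)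

end

section \<open>The coradical filtration of a pointed bialgebra\<close>

locale pointed_bialgebra = bialgebra H for H :: "('k::field, 'h) bialg" (structure) +
 assumes pointed: "coradical H = k_span H (grouplikes H)"
begin

abbreviation "cf \<equiv> corad_filt H"
abbreviation "cb \<equiv> corad_below H"
abbreviation "ks N \<equiv> k_subspace H N"

lemma cb_simps [simp]: "cb 0 = {\<zero>}" "cb (Suc n) = cf n"
 by (simp_all add: corad_below_def)

lemma G_sub: "grouplikes H \<subseteq> carrier H"
 by (auto simp: grouplikes_def)

lemma cf0: "cf 0 = k_span H (grouplikes H)"
 by (simp add: pointed)

lemma cf0_ks: "ks (cf 0)" unfolding cf0 by (rule span_ksub[OF G_sub])

declare corad_filt.simps [simp del]

lemma pure_set_sub: "V \<subseteq> carrier H \<Longrightarrow> W \<subseteq> carrier H \<Longrightarrow> {HH.pt v w |v w. v \<in> V \<and> w \<in> W} \<subseteq> carrier (tensor H H)"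
 by (auto intro!: HH.pure_closed)

text \<open>This is \<open>perp_mem\<close> for V1 = H_0 and W1 = H_n: an element of H \<otimes> H
  lies in H_0 \<otimes> H + H \<otimes> H_n as soon as the products of annihilating forms kill it.
  That \<open>cf n\<close> is a subspace is a hypothesis because \<open>cf_ks\<close> is proved by
  induction from this description.\<close>

lemma cf_Suc_iff:
 assumes "ks (cf n)"
 shows "h \<in> cf (Suc n) \<longleftrightarrow> h \<in> carrier H \<and> (\<forall>\<alpha>\<in>perp H (cf 0). \<forall>\<beta>\<in>perp H (cf n). cv \<alpha> \<beta> h = 0)"
proof -
 let ?A = "{HH.pt v w |v w. v \<in> carrier H \<and> w \<in> cf n}" and ?B = "{HH.pt v w |v w. v \<in> cf 0 \<and> w \<in> carrier H}"
 have sub: "?A \<subseteq> carrier (tensor H H)" "?B \<subseteq> carrier (tensor H H)"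
  using ksubD(1)[OF assms] ksubD(1)[OF cf0_ks] by (intro pure_set_sub; simp)+
 let ?N = "k_span (tensor H H) ?A <+>\<^bsub>tensor H H\<^esub> k_span (tensor H H) ?B"
 have N: "k_subspace (tensor H H) ?N"
  by (rule H3.L.V.ksub_sum[OF H3.L.V.span_ksub[OF sub(1)] H3.L.V.span_ksub[OF sub(2)]])
 have N': "k_subspace HH.T ?N"
  using N ksub_tensor_iff[OF kvs_axioms kvs_axioms] by blast
 have e: "cf (Suc n) = {h \<in> carrier H. \<Delta> h \<in> ?N}"
  by (simp add: corad_filt.simps sub_tensor_def)
 show ?thesis
 proof
  assume "h \<in> cf (Suc n)"
  then have h: "h \<in> carrier H" "\<Delta> h \<in> ?N" by (auto simp: e)
  then obtain x y where xy: "x \<in> k_span (tensor H H) ?A" "y \<in> k_span (tensor H H) ?B" "\<Delta> h = x \<oplus>\<^bsub>HH.T\<^esub> y"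
   unfolding H3.L.V.ksub_sum_iff by auto
  have "cv \<alpha> \<beta> h = 0" if a: "\<alpha> \<in> perp H (cf 0)" and b: "\<beta> \<in> perp H (cf n)" for \<alpha> \<beta>
  proof -
   note l = perpD(1)[OF a] perpD(1)[OF b]
   have tl: "lin_form (tensor H H) (HH.tf \<alpha> \<beta>)" using HH.tf_linear[OF l] by simp
   have "HH.tf \<alpha> \<beta> \<in> perp (tensor H H) (k_span (tensor H H) ?A)"
    by (rule H3.L.V.perp_spanI[OF tl sub(1)]) (use l perpD(2)[OF b] subsetD[OF ksubD(1)[OF assms]] in auto)
   moreover have "HH.tf \<alpha> \<beta> \<in> perp (tensor H H) (k_span (tensor H H) ?B)"
    by (rule H3.L.V.perp_spanI[OF tl sub(2)]) (use l perpD(2)[OF a] subsetD[OF ksubD(1)[OF cf0_ks]] in auto)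
   ultimately show ?thesis
    using xy H3.L.V.form_simps(2)[OF tl, of x y] H3.L.V.span_closed[OF sub(1)] H3.L.V.span_closed[OF sub(2)]
    by (auto simp: cv_def perpD(2))
  qed
  then show "h \<in> carrier H \<and> (\<forall>\<alpha>\<in>perp H (cf 0). \<forall>\<beta>\<in>perp H (cf n). cv \<alpha> \<beta> h = 0)" using h by blast
 next
  assume r: "h \<in> carrier H \<and> (\<forall>\<alpha>\<in>perp H (cf 0). \<forall>\<beta>\<in>perp H (cf n). cv \<alpha> \<beta> h = 0)"
  note sA = H3.L.V.ksubD(2)[OF H3.L.V.span_ksub[OF sub(1)]] and sB = H3.L.V.ksubD(2)[OF H3.L.V.span_ksub[OF sub(2)]]
  have "\<Delta> h \<in> ?N"
  proof (rule HH.perp_mem[OF cf0_ks assms _ _ N'])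
   show "\<Delta> h \<in> carrier HH.T" using r by simp
   fix \<phi> \<psi> assume "lin_form H \<phi>" "lin_form H \<psi>" "\<And>x. x \<in> cf 0 \<Longrightarrow> \<phi> x = 0" "\<And>x. x \<in> cf n \<Longrightarrow> \<psi> x = 0"
   then have "\<phi> \<in> perp H (cf 0)" "\<psi> \<in> perp H (cf n)" by (simp_all add: perp_def)
   then have "cv \<phi> \<psi> h = 0" using r by blast
   then show "HH.tf \<phi> \<psi> (\<Delta> h) = 0" by (simp add: cv_def)
  next
   fix v w assume vw: "v \<in> cf 0" "w \<in> carrier H"
   then have "HH.pt v w \<in> k_span (tensor H H) ?B" using subsetD[OF H3.L.V.span_incl, of _ ?B] by blast
   moreover have "HH.pt v w = \<zero>\<^bsub>tensor H H\<^esub> \<oplus>\<^bsub>tensor H H\<^esub> HH.pt v w"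
    using vw ksubD(1)[OF cf0_ks] by (simp add: subset_iff)
   ultimately show "HH.pt v w \<in> ?N" unfolding H3.L.V.ksub_sum_iff using sA by blast
  next
   fix v w assume vw: "v \<in> carrier H" "w \<in> cf n"
   then have "HH.pt v w \<in> k_span (tensor H H) ?A" using subsetD[OF H3.L.V.span_incl, of _ ?A] by blast
   moreover have "HH.pt v w = HH.pt v w \<oplus>\<^bsub>tensor H H\<^esub> \<zero>\<^bsub>tensor H H\<^esub>"
    using vw ksubD(1)[OF assms] by (simp add: subset_iff)
   ultimately show "HH.pt v w \<in> ?N" unfolding H3.L.V.ksub_sum_iff using sB by blast
  qed
  then show "h \<in> cf (Suc n)" using r by (simp add: e)
 qed
qed

lemma cf_ks: "ks (cf n)"
proof (induction n)
 case (Suc n)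
 show ?case
  by (rule ksubI) (auto simp: cf_Suc_iff[OF Suc] form_simps[OF cv_linear] perpD(1))
qed (rule cf0_ks)

lemma cb_ks: "ks (cb n)"
 by (cases n) (auto intro: zero_ksub cf_ks)

lemmas cf_mem = cf_Suc_iff[OF cf_ks]

lemma cf_closed: "h \<in> cf n \<Longrightarrow> h \<in> carrier H"
 using ksubD(1)[OF cf_ks] by auto

lemma cb_closed: "h \<in> cb n \<Longrightarrow> h \<in> carrier H"
 using ksubD(1)[OF cb_ks] by auto

lemma cf0_perpI: "lin_form H \<phi> \<Longrightarrow> (\<And>g. g \<in> grouplikes H \<Longrightarrow> \<phi> g = 0) \<Longrightarrow> \<phi> \<in> perp H (cf 0)"
 unfolding cf0 by (rule perp_spanI[OF _ G_sub])

lemma grouplike_cf0: "g \<in> grouplikes H \<Longrightarrow> g \<in> cf 0"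
 unfolding cf0 using span_incl by blast

text \<open>Grouplikes span H_0, and a convolution product takes the value \<phi> g * \<psi> g at a
  grouplike g. So the annihilator of H_0 is a two-sided ideal.\<close>

lemma cv_ideal:
 assumes "\<alpha> \<in> perp H (cf 0)" "lin_form H \<phi>"
 shows "cv \<alpha> \<phi> \<in> perp H (cf 0)" "cv \<phi> \<alpha> \<in> perp H (cf 0)"
 using assms(2) perpD(1)[OF assms(1)] perpD(2)[OF assms(1) grouplike_cf0]
 by (auto intro!: cf0_perpI cv_linear simp: cv_grouplike)

text \<open>At the start the ideal property applies; afterwards a larger subspace has a smaller
  annihilator, so fewer products remain to be tested.\<close>

lemma cf_mono_Suc: "cf n \<subseteq> cf (Suc n)"
proof (induction n)
 case 0
 show ?case
  by (auto simp: cf_mem cf_closed intro!: perpD(2)[OF cv_ideal(1)[OF _ perpD(1)]])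
next
 case (Suc n)
 then show ?case using perp_mono[OF Suc, of H] unfolding cf_mem[of _ n] cf_mem[of _ "Suc n"] subset_iff by blast
qed

lemma cf_mono: "i \<le> j \<Longrightarrow> cf i \<subseteq> cf j"
 by (rule lift_Suc_mono_le[of cf, OF cf_mono_Suc])

lemma cb_mono_Suc: "cb n \<subseteq> cb (Suc n)"
 using cf_mono_Suc ksubD(2)[OF cf0_ks] by (cases n) auto

lemma cb_mono: "i \<le> j \<Longrightarrow> cb i \<subseteq> cb j"
 by (rule lift_Suc_mono_le[of cb, OF cb_mono_Suc])

lemma cf_cb: "i < j \<Longrightarrow> cf i \<subseteq> cb j"
 using cb_mono[of "Suc i" j] by simp

lemma cb_cf: "cb i \<subseteq> cf i"
 using cb_mono_Suc[of i] by simp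

text \<open>The slice (\<phi> \<otimes> id)(\<Delta> h) stays in the same step of the filtration:
  testing it with \<alpha>\<beta> means testing h with (\<phi>\<alpha>)\<beta>, and \<phi>\<alpha>
  again annihilates H_0.\<close>

lemma cv_vanish0:
 assumes "lin_form H \<phi>" "\<psi> \<in> perp H (cb j)" "h \<in> cb j"
 shows "cv \<phi> \<psi> h = 0"
proof (cases j)
 case 0
 then show ?thesis using assms form_simps(1)[OF cv_linear[OF assms(1) perpD(1)[OF assms(2)]]] by simp
next
 case (Suc m)
 show ?thesis
 proof (cases m)
  case 0
  then show ?thesis using Suc assms perpD(2)[OF cv_ideal(2)[of \<psi> \<phi>]] by simp
 next
  case m: (Suc n)
  have h: "h \<in> cf (Suc n)" "h \<in> carrier H" and p: "\<psi> \<in> perp H (cf (Suc n))" using assms Suc m cf_closed by auto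
  let ?h = "HH.lsl \<phi> (\<Delta> h)"
  have hc: "?h \<in> carrier H" using k_linearD(1)[OF HH.lsl_linear[OF assms(1)]] h by simp
  have "?h \<in> cf (Suc n)"
   unfolding cf_mem
  proof (intro conjI ballI hc)
   fix \<alpha> \<beta> assume ab: "\<alpha> \<in> perp H (cf 0)" "\<beta> \<in> perp H (cf n)"
   note l = perpD(1)[OF ab(1)] perpD(1)[OF ab(2)]
   have "cv \<alpha> \<beta> ?h = cv \<phi> (cv \<alpha> \<beta>) h"
    using HH.form_lsl[OF assms(1) cv_linear[OF l]] h by (simp add: cv_def[of \<phi>])
   also have "\<dots> = cv (cv \<phi> \<alpha>) \<beta> h" using cv_assoc[OF assms(1) l h(2)] by simp
   also have "\<dots> = 0" using h(1) cv_ideal(2)[OF ab(1) assms(1)] ab(2) by (simp add: cf_mem)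
   finally show "cv \<alpha> \<beta> ?h = 0" .
  qed
  then have "\<psi> ?h = 0" using perpD(2)[OF p] by simp
  then show ?thesis using HH.form_lsl[OF assms(1) perpD(1)[OF p]] h by (simp add: cv_def)
 qed
qed

text \<open>The dual form of \<open>\<Delta>(H\<^bsub>i+j-1\<^esub>) \<subseteq> H\<^bsub>i-1\<^esub> \<otimes> H + H \<otimes> H\<^bsub>j-1\<^esub>\<close>.\<close>

lemma cv_vanish:
 assumes "\<phi> \<in> perp H (cb i)" "\<psi> \<in> perp H (cb j)" "h \<in> cb (i + j)"
 shows "cv \<phi> \<psi> h = 0"
 using assms
proof (induction i arbitrary: \<phi> h)
 case 0
 then show ?case using cv_vanish0[of \<phi> \<psi> j h] perpD(1) by auto
next
 case (Suc i)
 note l = perpD(1)[OF Suc.prems(1)] perpD(1)[OF Suc.prems(2)]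
 have h: "h \<in> cf (i + j)" "h \<in> carrier H" using Suc.prems(3) cf_closed by auto
 show ?case
 proof (cases i)
  case 0
  show ?thesis
  proof (cases j)
   case j: 0
   then have "h \<in> cf 0" using h 0 by simp
   then show ?thesis using perpD(2)[OF cv_ideal(1)[of \<phi> \<psi>]] Suc.prems(1) 0 l by simp
  next
   case (Suc m)
   then show ?thesis using h 0 Suc.prems(1,2) by (auto simp: cf_mem)
  qed
 next
  case (Suc m)
  have p: "\<phi> \<in> perp H (cf (Suc m))" using Suc.prems(1) Suc by simp
  let ?h = "HH.rsl \<psi> (\<Delta> h)"
  have hc: "?h \<in> carrier H" using k_linearD(1)[OF HH.rsl_linear[OF l(2)]] h by simp
  \<comment> \<open>Slicing on the other side: testing with \<alpha>\<beta> means testing h with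
    \<alpha>(\<beta>\<psi>), and by induction \<beta>\<psi> annihilates the filtration step just
    below that of h.\<close>
  have "?h \<in> cf (Suc m)"
   unfolding cf_mem
  proof (intro conjI ballI hc)
   fix \<alpha> \<beta> assume ab: "\<alpha> \<in> perp H (cf 0)" "\<beta> \<in> perp H (cf m)"
   note l' = perpD(1)[OF ab(1)] perpD(1)[OF ab(2)]
   have "cv \<alpha> \<beta> ?h = cv (cv \<alpha> \<beta>) \<psi> h"
    using HH.form_rsl[OF cv_linear[OF l'] l(2)] h by (simp add: cv_def[of _ \<psi>])
   also have "\<dots> = cv \<alpha> (cv \<beta> \<psi>) h" using cv_assoc[OF l' l(2) h(2)] by simp
   also have "\<dots> = 0"
   proof -
    have "cv \<beta> \<psi> \<in> perp H (cf (m + j))"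
    proof (rule perpI[OF cv_linear[OF l'(2) l(2)]])
     fix x assume "x \<in> cf (m + j)"
     then show "cv \<beta> \<psi> x = 0" using Suc.IH[of \<beta> x] ab(2) Suc.prems(2) Suc by simp
    qed
    then show ?thesis using h(1) ab(1) Suc by (auto simp: cf_mem)
   qed
   finally show "cv \<alpha> \<beta> ?h = 0" .
  qed
  then have "\<phi> ?h = 0" using perpD(2)[OF p] by simp
  then show ?thesis using HH.form_rsl[OF l(1) l(2)] h by (simp add: cv_def)
 qed
qed

text \<open>\<open>flag\<close> for the flag \<open>cb\<close> in both factors, with
  \<open>cv_vanish\<close> as its hypothesis. The flag has to start with zero, whence
  \<open>cb\<close>; the shift by one between \<open>cb\<close> and \<open>cf\<close> turns i + j +
  1 = n + 1 into i + j = n.\<close>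

lemma comult_filtration:
 assumes "h \<in> cf n"
 shows "\<exists>ys. (\<forall>(i, j, v, w)\<in>set ys. i + j = n \<and> v \<in> cf i \<and> w \<in> cf j) \<and>
  \<Delta> h = list_sum HH.T (map (\<lambda>(i, j, v, w). HH.pt v w) ys)"
proof -
 have "\<exists>ys. (\<forall>(i, j, v, w)\<in>set ys. i + j + 1 = Suc n \<and> v \<in> cb (Suc i) \<and> w \<in> cb (Suc j)) \<and>
  \<Delta> h = list_sum HH.T (map (\<lambda>(i, j, v, w). HH.pt v w) ys)"
 proof (rule HH.flag)
  show "\<Delta> h \<in> carrier HH.T" using assms cf_closed by simp
  fix i \<phi> \<psi> assume h: "i \<le> Suc n" "lin_form H \<phi>" "lin_form H \<psi>" "\<And>x. x \<in> cb i \<Longrightarrow> \<phi> x = 0" "\<And>y. y \<in> cb (Suc n - i) \<Longrightarrow> \<psi> y = 0"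
  then have "cv \<phi> \<psi> h = 0" using assms by (intro cv_vanish[of _ i _ "Suc n - i"] perpI) auto
  then show "HH.tf \<phi> \<psi> (\<Delta> h) = 0" by (simp add: cv_def)
 qed (use cb_ks cb_mono_Suc in auto)
 then obtain ys where ys: "\<forall>(i, j, v, w)\<in>set ys. i + j + 1 = Suc n \<and> v \<in> cb (Suc i) \<and> w \<in> cb (Suc j)"
  "\<Delta> h = list_sum HH.T (map (\<lambda>(i, j, v, w). HH.pt v w) ys)" by blast
 show ?thesis by (rule exI[of _ ys]) (use ys in auto)
qed

lemma cf0_mult: "a \<in> cf 0 \<Longrightarrow> b \<in> cf 0 \<Longrightarrow> a \<otimes> b \<in> cf 0"
proof -
 assume a: "a \<in> cf 0" and b: "b \<in> cf 0"
 have K: "ks {x \<in> carrier H. x \<otimes> y \<in> cf 0}" if "y \<in> carrier H" for y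
  by (rule ksubI) (use that ksubD[OF cf0_ks] in \<open>auto simp: k_linearD[OF rmult_linear] k_linear_zero[OF rmult_linear kvs_axioms]\<close>)
 have K2: "ks {x \<in> carrier H. y \<otimes> x \<in> cf 0}" if "y \<in> carrier H" for y
  by (rule ksubI) (use that ksubD[OF cf0_ks] in \<open>auto simp: k_linearD[OF lmult_linear] k_linear_zero[OF lmult_linear kvs_axioms]\<close>)
 have 1: "g \<otimes> b \<in> cf 0" if g: "g \<in> grouplikes H" for g
 proof -
  have "k_span H (grouplikes H) \<subseteq> {x \<in> carrier H. g \<otimes> x \<in> cf 0}"
   by (rule span_min[OF K2]) (use g G_sub grouplike_cf0 mult_grouplike in auto)
  then show ?thesis using b cf0 by auto
 qed
 have "k_span H (grouplikes H) \<subseteq> {x \<in> carrier H. x \<otimes> b \<in> cf 0}"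
  by (rule span_min[OF K]) (use 1 G_sub b cf_closed in auto)
 then show ?thesis using a cf0 by auto
qed

text \<open>Tested with \<alpha>\<beta>, a summand of \<Delta> a \<Delta> b vanishes for one of two
  reasons. If both left factors have degree 0, their product lies in H_0, which \<alpha> kills.
  Otherwise the right factors have total degree below i + j, and the induction hypothesis puts their
  product where \<beta> vanishes.\<close>

lemma cf_mult: "a \<in> cf i \<Longrightarrow> b \<in> cf j \<Longrightarrow> a \<otimes> b \<in> cf (i + j)"
proof (induction "i + j" arbitrary: i j a b rule: less_induct)
 case less
 note c = cf_closed[OF less.prems(1)] cf_closed[OF less.prems(2)]
 show ?case
 proof (cases "i + j")
  case 0
  then show ?thesis using less.prems cf0_mult by simp
 next
  case (Suc n)
  obtain ys where ys: "\<And>r s v w. (r, s, v, w) \<in> set ys \<Longrightarrow> r + s = i \<and> v \<in> cf r \<and> w \<in> cf s"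
   "\<Delta> a = list_sum HH.T (map (\<lambda>(i, j, v, w). HH.pt v w) ys)" using comult_filtration[OF less.prems(1)] by fast
  obtain zs where zs: "\<And>r s v w. (r, s, v, w) \<in> set zs \<Longrightarrow> r + s = j \<and> v \<in> cf r \<and> w \<in> cf s"
   "\<Delta> b = list_sum HH.T (map (\<lambda>(i, j, v, w). HH.pt v w) zs)" using comult_filtration[OF less.prems(2)] by fast
  have "cv \<alpha> \<beta> (a \<otimes> b) = 0" if ab: "\<alpha> \<in> perp H (cf 0)" "\<beta> \<in> perp H (cf n)" for \<alpha> \<beta>
  proof -
   note l = perpD(1)[OF ab(1)] perpD(1)[OF ab(2)]
   have z: "HH.tf \<alpha> \<beta> (HH.tm (HH.pt v w) (HH.pt v' w')) = 0"
    if h: "(r, s, v, w) \<in> set ys" "(r', s', v', w') \<in> set zs" for r s v w r' s' v' w'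
   proof -
    note y = ys(1)[OF h(1)] and z = zs(1)[OF h(2)]
    have c: "v \<in> carrier H" "w \<in> carrier H" "v' \<in> carrier H" "w' \<in> carrier H"
     using y z cf_closed by blast+
    have "\<alpha> (v \<otimes> v') * \<beta> (w \<otimes> w') = 0"
    proof (cases "r = 0 \<and> r' = 0")
     case True
     then have "v \<otimes> v' \<in> cf 0" using y z cf0_mult by simp
     then show ?thesis using perpD(2)[OF ab(1)] by simp
    next
     case False
     then have lt: "s + s' < i + j" using y z by linarith
     then have "w \<otimes> w' \<in> cf (s + s')" using less.hyps y z by blast
     moreover have "s + s' \<le> n" using lt Suc by simp
     ultimately have "w \<otimes> w' \<in> cf n" using cf_mono by blast
     then show ?thesis using perpD(2)[OF ab(2)] by simp
    qed
    then show ?thesis using c l by (simp add: HH.tm_pure)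
   qed
   have zc: "HH.pt v' w' \<in> carrier HH.T" if "(r', s', v', w') \<in> set zs" for r' s' v' w'
    using zs(1)[OF that] cf_closed by auto
   have yc: "HH.pt v w \<in> carrier HH.T" if "(r, s, v, w) \<in> set ys" for r s v w
    using ys(1)[OF that] cf_closed by auto
   have 1: "HH.tf \<alpha> \<beta> (HH.tm (HH.pt v w) (\<Delta> b)) = 0" if h: "(r, s, v, w) \<in> set ys" for r s v w
    unfolding zs(2)
    by (rule HH.T.form_list_sum_zero[OF k_linear_comp[OF HH.tm_linear_right[OF yc[OF h]] HH.tf_linear[OF l]]])
     (use z[OF h] zc in auto)
   have "HH.tf \<alpha> \<beta> (HH.tm (\<Delta> a) (\<Delta> b)) = 0"
    unfolding ys(2)
    by (rule HH.T.form_list_sum_zero[OF k_linear_comp[OF HH.tm_linear_left[OF comult_closed[OF c(2)]] HH.tf_linear[OF l]]])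
     (use 1 yc in auto)
   then show ?thesis using c by (simp add: cv_def comult_mult' HH.tm_def)
  qed
  then show ?thesis unfolding Suc cf_mem using c by simp
 qed
qed

end

section \<open>The associated graded algebra\<close>

context kvs begin

lemma diff4:
 assumes "a \<in> carrier V" "b \<in> carrier V" "c \<in> carrier V" "d \<in> carrier V"
 shows "(a \<oplus> b) \<ominus> (c \<oplus> d) = (a \<ominus> c) \<oplus> (b \<ominus> d)"
 using assms by (simp add: a_minus_def M.minus_add add4)

lemma ksub_finsum_diff:
 assumes N: "k_subspace V N"
  and "f \<in> A \<rightarrow> carrier V" "g \<in> A \<rightarrow> carrier V" "\<And>i. i \<in> A \<Longrightarrow> f i \<ominus> g i \<in> N"
 shows "finsum V f A \<ominus> finsum V g A \<in> N"
proof (cases "finite A")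
 case True
 then show ?thesis using assms(2-4)
 proof (induction A)
  case empty then show ?case using ksubD(2)[OF N] by (simp add: a_minus_def M.r_neg)
 next
  case (insert i A)
  have c: "f i \<in> carrier V" "g i \<in> carrier V" "f \<in> A \<rightarrow> carrier V" "g \<in> A \<rightarrow> carrier V" using insert by auto
  then have "finsum V f (insert i A) \<ominus> finsum V g (insert i A) = (f i \<ominus> g i) \<oplus> (finsum V f A \<ominus> finsum V g A)"
   using insert by (simp add: M.finsum_insert diff4)
  then show ?case using insert c ksubD(3)[OF N] by simp
 qed
qed (use ksubD(2)[OF N] in \<open>simp add: M.finsum_infinite a_minus_def M.r_neg\<close>)

end

lemma concat_if_single:
 "concat (map (\<lambda>m. if m = n then ys n else []) [0..<M]) = (if n < M then ys n else [])"
 by (induction M) auto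

context pointed_bialgebra begin

abbreviation "gr \<equiv> gr_algebra H"

text \<open>Elements of gr H are handled through families of representatives. Taking the
  representative zero wherever a coset is trivial keeps the support of the family finite.\<close>

definition grs :: "(nat \<Rightarrow> 'h) set" where
 "grs = {r. (\<forall>n. r n \<in> cf n) \<and> finite {n. r n \<noteq> \<zero>}}"

definition gr_of :: "(nat \<Rightarrow> 'h) \<Rightarrow> nat \<Rightarrow> 'h set" where
 "gr_of r = (\<lambda>n. cb n +> r n)"

lemma grsD: "r \<in> grs \<Longrightarrow> r n \<in> cf n" "r \<in> grs \<Longrightarrow> r n \<in> carrier H" "r \<in> grs \<Longrightarrow> finite {n. r n \<noteq> \<zero>}"
 using cf_closed by (auto simp: grs_def)

lemma gr_carrier: "carrier gr = gr_of ` grs"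
proof
 show "carrier gr \<subseteq> gr_of ` grs"
 proof
  fix f assume "f \<in> carrier gr"
  then have f: "\<And>n. f n \<in> (\<lambda>h. cb n +> h) ` cf n" "finite {n. f n \<noteq> cb n}"
   by (auto simp: gr_algebra_def)
  define r where "r n = (if f n = cb n then \<zero> else (SOME h. h \<in> cf n \<and> f n = cb n +> h))" for n
  have s: "r n \<in> cf n \<and> f n = cb n +> r n" for n
  proof (cases "f n = cb n")
   case True then show ?thesis using ksubD(2)[OF cf_ks] coset_zero[OF cb_ks] by (simp add: r_def)
  next
   case False
   have "\<exists>h. h \<in> cf n \<and> f n = cb n +> h" using f(1)[of n] by auto
   from someI_ex[OF this] show ?thesis using False by (simp add: r_def)
  qed
  have "{n. r n \<noteq> \<zero>} \<subseteq> {n. f n \<noteq> cb n}" by (auto simp: r_def)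
  then have "r \<in> grs" using s f(2) finite_subset by (auto simp: grs_def)
  moreover have "f = gr_of r" using s by (auto simp: gr_of_def)
  ultimately show "f \<in> gr_of ` grs" by blast
 qed
 show "gr_of ` grs \<subseteq> carrier gr"
 proof
  fix f assume "f \<in> gr_of ` grs"
  then obtain r where r: "r \<in> grs" "f = gr_of r" by blast
  have "{n. gr_of r n \<noteq> cb n} \<subseteq> {n. r n \<noteq> \<zero>}" using coset_zero[OF cb_ks] by (auto simp: gr_of_def)
  then show "f \<in> carrier gr" using r grsD[OF r(1)] finite_subset by (auto simp: gr_algebra_def gr_of_def)
 qed
qed

lemma gr_ofI [simp]: "r \<in> grs \<Longrightarrow> gr_of r \<in> carrier gr"
 by (simp add: gr_carrier)

lemma gr_of_eq: "r \<in> grs \<Longrightarrow> r' \<in> grs \<Longrightarrow> gr_of r = gr_of r' \<longleftrightarrow> (\<forall>n. r n \<ominus> r' n \<in> cb n)"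
 using coset_eq[OF cb_ks grsD(2) grsD(2)] by (simp add: gr_of_def fun_eq_iff)

lemma grs_add: "r \<in> grs \<Longrightarrow> r' \<in> grs \<Longrightarrow> (\<lambda>n. r n \<oplus> r' n) \<in> grs"
proof -
 assume h: "r \<in> grs" "r' \<in> grs"
 have "{n. r n \<oplus> r' n \<noteq> \<zero>} \<subseteq> {n. r n \<noteq> \<zero>} \<union> {n. r' n \<noteq> \<zero>}" by auto
 then show ?thesis using grsD[OF h(1)] grsD[OF h(2)] ksubD(3)[OF cf_ks] finite_subset unfolding grs_def by blast
qed

lemma grs_scale: "r \<in> grs \<Longrightarrow> (\<lambda>n. c \<odot> r n) \<in> grs"
proof -
 assume h: "r \<in> grs"
 have "{n. c \<odot> r n \<noteq> \<zero>} \<subseteq> {n. r n \<noteq> \<zero>}" by auto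
 then show ?thesis using grsD[OF h(1)] ksubD(4)[OF cf_ks] finite_subset unfolding grs_def by blast
qed

lemma grs_zero: "(\<lambda>n. \<zero>) \<in> grs"
 using ksubD(2)[OF cf_ks] by (simp add: grs_def)

lemma gr_add: "r \<in> grs \<Longrightarrow> r' \<in> grs \<Longrightarrow> gr_of r \<oplus>\<^bsub>gr\<^esub> gr_of r' = gr_of (\<lambda>n. r n \<oplus> r' n)"
 using coset_add[OF cb_ks grsD(2) grsD(2)] by (simp add: gr_algebra_def gr_of_def)

lemma gr_smult: "r \<in> grs \<Longrightarrow> c \<odot>\<^bsub>gr\<^esub> gr_of r = gr_of (\<lambda>n. c \<odot> r n)"
 using coset_smult[OF cb_ks grsD(2)] by (simp add: gr_algebra_def gr_of_def)

lemma gr_zero: "\<zero>\<^bsub>gr\<^esub> = gr_of (\<lambda>n. \<zero>)"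
 using coset_zero[OF cb_ks] by (auto simp: gr_algebra_def gr_of_def)

lemma gr_kvs: "kvs gr"
proof (rule kvsI)
 note ss = gr_carrier gr_add gr_smult gr_zero grs_add grs_scale grs_zero
 show "abelian_group gr"
 proof (rule abelian_groupI)
  fix x assume "x \<in> carrier gr"
  then obtain r where r: "x = gr_of r" "r \<in> grs" by (auto simp: gr_carrier)
  have e: "(\<lambda>n. (-1) \<odot> r n \<oplus> r n) = (\<lambda>n. \<zero>)" using grsD(2)[OF r(2)] by (simp add: sm_neg M.l_neg)
  have "(-1) \<odot>\<^bsub>gr\<^esub> gr_of r \<oplus>\<^bsub>gr\<^esub> gr_of r = \<zero>\<^bsub>gr\<^esub>"
   unfolding gr_smult[OF r(2)] gr_add[OF grs_scale[OF r(2)] r(2)] e gr_zero ..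
  moreover have "(-1) \<odot>\<^bsub>gr\<^esub> gr_of r \<in> carrier gr" unfolding gr_smult[OF r(2)] by (rule gr_ofI[OF grs_scale[OF r(2)]])
  ultimately show "\<exists>y\<in>carrier gr. y \<oplus>\<^bsub>gr\<^esub> x = \<zero>\<^bsub>gr\<^esub>" using r by blast
 next
  fix x y assume "x \<in> carrier gr" "y \<in> carrier gr"
  then show "x \<oplus>\<^bsub>gr\<^esub> y \<in> carrier gr" using ss by auto
  show "x \<oplus>\<^bsub>gr\<^esub> y = y \<oplus>\<^bsub>gr\<^esub> x"
   using \<open>x \<in> carrier gr\<close> \<open>y \<in> carrier gr\<close> by (auto simp: ss grsD M.a_comm)
 next
  fix x y z assume "x \<in> carrier gr" "y \<in> carrier gr" "z \<in> carrier gr"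
  then show "x \<oplus>\<^bsub>gr\<^esub> y \<oplus>\<^bsub>gr\<^esub> z = x \<oplus>\<^bsub>gr\<^esub> (y \<oplus>\<^bsub>gr\<^esub> z)" by (auto simp: ss grsD M.a_assoc)
 qed (auto simp: ss grsD)
qed (auto simp: gr_carrier gr_add gr_smult grs_add grs_scale grsD sm_add_l sm_add_r sm_assoc)

sublocale GR: kvs gr by (rule gr_kvs)
sublocale GG: kvs_pair gr gr ..

lemma cb_cf_mult:
 assumes "a \<in> cb i" "b \<in> cf j" shows "a \<otimes> b \<in> cb (i + j)"
proof (cases i)
 case 0
 then have "a \<otimes> b = \<zero>" using assms cf_closed k_linear_zero[OF rmult_linear kvs_axioms] by simp
 then show ?thesis using ksubD(2)[OF cb_ks] by simp
next
 case (Suc m) then show ?thesis using cf_mult[of a m b j] assms by simp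
qed

lemma cf_cb_mult:
 assumes "a \<in> cf i" "b \<in> cb j" shows "a \<otimes> b \<in> cb (i + j)"
proof (cases j)
 case 0
 then have "a \<otimes> b = \<zero>" using assms cf_closed k_linear_zero[OF lmult_linear kvs_axioms] by simp
 then show ?thesis using ksubD(2)[OF cb_ks] by simp
next
 case (Suc m) then show ?thesis using cf_mult[of a i b m] assms by simp
qed

lemma gr_prod_closed: "r \<in> grs \<Longrightarrow> r' \<in> grs \<Longrightarrow> i \<le> n \<Longrightarrow> r i \<otimes> r' (n - i) \<in> cf n"
 using cf_mult[OF grsD(1) grsD(1), of r r' i "n - i"] by simp

lemma grs_mult:
 assumes "r \<in> grs" "r' \<in> grs"
 shows "(\<lambda>n. \<Oplus>i\<in>{..n}. r i \<otimes> r' (n - i)) \<in> grs"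
proof -
 obtain M M' where M: "\<And>n. r n \<noteq> \<zero> \<Longrightarrow> n \<le> M" "\<And>n. r' n \<noteq> \<zero> \<Longrightarrow> n \<le> M'"
  using grsD(3)[OF assms(1)] grsD(3)[OF assms(2)] unfolding finite_nat_set_iff_bounded_le by blast
 have z: "(\<Oplus>i\<in>{..n}. r i \<otimes> r' (n - i)) = \<zero>" if "n > M + M'" for n
 proof -
  have "r i \<otimes> r' (n - i) = \<zero>" if "i \<le> n" for i
  proof (cases "i > M")
   case True then show ?thesis using M(1)[of i] grsD(2)[OF assms(2)] k_linear_zero[OF rmult_linear kvs_axioms] by force
  next
   case False
   then have "n - i > M'" using \<open>n > M + M'\<close> by simp
   then show ?thesis using M(2)[of "n - i"] grsD(2)[OF assms(1)] k_linear_zero[OF lmult_linear kvs_axioms] by force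
  qed
  then have "(\<Oplus>i\<in>{..n}. r i \<otimes> r' (n - i)) = (\<Oplus>i\<in>{..n}. \<zero>)" by (intro M.finsum_cong') auto
  then show ?thesis by simp
 qed
 have "{n. (\<Oplus>i\<in>{..n}. r i \<otimes> r' (n - i)) \<noteq> \<zero>} \<subseteq> {..M + M'}" using z by (force simp: not_less)
 then have "finite {n. (\<Oplus>i\<in>{..n}. r i \<otimes> r' (n - i)) \<noteq> \<zero>}" by (rule finite_subset) simp
 then show ?thesis unfolding grs_def mem_Collect_eq
  by (intro conjI allI ksub_finsum[OF cf_ks]) (simp_all add: gr_prod_closed[OF assms])
qed

text \<open>Independence of representatives: a_i b_j - r_i r'_j equals (a_i - r_i) b_j + r_i (b_j -
  r'_j), and each term lies one step lower in the filtration. So the union in the definition is a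
  single coset.\<close>

lemma gr_mult:
 assumes "r \<in> grs" "r' \<in> grs"
 shows "gr_of r \<otimes>\<^bsub>gr\<^esub> gr_of r' = gr_of (\<lambda>n. \<Oplus>i\<in>{..n}. r i \<otimes> r' (n - i))"
proof (rule ext)
 fix n :: nat
 let ?s = "\<lambda>a b. \<Oplus>i\<in>{..n}. a i \<otimes> b (n - i)"
 note rr = ring.ring_simprules[OF ring_H]
 have self: "r \<in> Pi UNIV (gr_of r)" "r' \<in> Pi UNIV (gr_of r')"
  using coset_self[OF cb_ks grsD(2)] assms by (auto simp: gr_of_def)
 have "cb n +> ?s a b = cb n +> ?s r r'" if a: "a \<in> Pi UNIV (gr_of r)" and b: "b \<in> Pi UNIV (gr_of r')" for a b
 proof -
  have am: "a i \<in> cb i +> r i" "b i \<in> cb i +> r' i" for i using a b by (auto simp: gr_of_def)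
  have cc: "a i \<in> carrier H" "b i \<in> carrier H" for i
   using coset_mem(1)[OF cb_ks grsD(2)[OF assms(1)] am(1)] coset_mem(1)[OF cb_ks grsD(2)[OF assms(2)] am(2)] by auto
  have ca: "a i \<in> carrier H" "a i \<ominus> r i \<in> cb i" "b i \<in> carrier H" "b i \<ominus> r' i \<in> cb i" for i
   using coset_mem(2)[OF cb_ks grsD(2)[OF assms(1)] am(1)] coset_mem(2)[OF cb_ks grsD(2)[OF assms(2)] am(2)]
    coset_eq[OF cb_ks cc(1) grsD(2)[OF assms(1)]] coset_eq[OF cb_ks cc(2) grsD(2)[OF assms(2)]] cc
   by blast+
  have cfb: "b i \<in> cf i" for i
  proof -
   have "b i = (b i \<ominus> r' i) \<oplus> r' i" using ca grsD(2)[OF assms(2)] by (simp add: a_minus_def M.a_assoc M.l_neg)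
   then show ?thesis using ca(4)[of i] cb_cf[of i] grsD(1)[OF assms(2)] ksubD(3)[OF cf_ks, of "b i \<ominus> r' i" i "r' i"] by auto
  qed
  have "?s a b \<ominus> ?s r r' \<in> cb n"
  proof (rule ksub_finsum_diff[OF cb_ks])
   fix i assume i: "i \<in> {..n}"
   have c: "a i \<in> carrier H" "r i \<in> carrier H" "b (n - i) \<in> carrier H" "r' (n - i) \<in> carrier H" using ca grsD(2) assms by auto
   have "a i \<otimes> b (n - i) \<ominus> r i \<otimes> r' (n - i) =
    (a i \<ominus> r i) \<otimes> b (n - i) \<oplus> r i \<otimes> (b (n - i) \<ominus> r' (n - i))"
    using k_linear_diff[OF rmult_linear[OF c(3)] kvs_axioms c(1,2)]
     k_linear_diff[OF lmult_linear[OF c(2)] kvs_axioms c(3,4)] c rr(1,5)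
    by (simp add: a_minus_def M.a_assoc M.r_neg1)
   moreover have "(a i \<ominus> r i) \<otimes> b (n - i) \<in> cb n" using cb_cf_mult[OF ca(2) cfb, of i "n - i"] i by simp
   moreover have "r i \<otimes> (b (n - i) \<ominus> r' (n - i)) \<in> cb n" using cf_cb_mult[OF grsD(1)[OF assms(1)] ca(4), of i "n - i"] i by simp
   ultimately show "a i \<otimes> b (n - i) \<ominus> r i \<otimes> r' (n - i) \<in> cb n" using ksubD(3)[OF cb_ks] by simp
  qed (use ca grsD(2) assms rr(5) in auto)
  then show ?thesis using coset_eq[OF cb_ks] ca grsD(2) assms rr(5) by (simp add: Pi_iff)
 qed
 then have "(\<Union>a\<in>Pi UNIV (gr_of r). \<Union>b\<in>Pi UNIV (gr_of r'). cb n +> ?s a b) = cb n +> ?s r r'"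
  using self by blast
 then show "(gr_of r \<otimes>\<^bsub>gr\<^esub> gr_of r') n = gr_of (\<lambda>n. \<Oplus>i\<in>{..n}. r i \<otimes> r' (n - i)) n"
  by (simp add: gr_algebra_def gr_of_def)
qed

definition sgl :: "nat \<Rightarrow> 'h \<Rightarrow> nat \<Rightarrow> 'h" where
 "sgl i v = (\<lambda>n. if n = i then v else \<zero>)"

lemma sgl_grs: "v \<in> cf i \<Longrightarrow> sgl i v \<in> grs"
 using ksubD(2)[OF cf_ks] by (auto simp: sgl_def grs_def)

lemma gr_class_sgl: "gr_class H i v = gr_of (sgl i v)"
 by (intro ext) (simp add: gr_class_def gr_of_def sgl_def coset_zero[OF cb_ks])

lemma gr_class_closed: "v \<in> cf i \<Longrightarrow> gr_class H i v \<in> carrier gr"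
 by (simp add: gr_class_sgl sgl_grs)

lemma gr_one: "\<one>\<^bsub>gr\<^esub> = gr_class H 0 \<one>"
 by (simp add: gr_algebra_def gr_class_def)

lemma gr_class_linear:
 "v \<in> cf i \<Longrightarrow> w \<in> cf i \<Longrightarrow> gr_class H i (v \<oplus> w) = gr_class H i v \<oplus>\<^bsub>gr\<^esub> gr_class H i w"
 "v \<in> cf i \<Longrightarrow> gr_class H i (c \<odot> v) = c \<odot>\<^bsub>gr\<^esub> gr_class H i v"
 unfolding gr_class_sgl by (simp_all add: gr_add gr_smult sgl_grs) (intro ext; simp add: gr_of_def sgl_def)+

lemma gr_class_eq:
 assumes "v \<in> cf i" "w \<in> cf i"
 shows "gr_class H i v = gr_class H i w \<longleftrightarrow> v \<ominus> w \<in> cb i"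
 unfolding gr_class_sgl gr_of_eq[OF sgl_grs[OF assms(1)] sgl_grs[OF assms(2)]]
 using ksubD(2)[OF cb_ks] by (auto simp: sgl_def a_minus_def M.r_neg)

lemma gr_class_mult:
 assumes "v \<in> cf i" "w \<in> cf j"
 shows "gr_class H i v \<otimes>\<^bsub>gr\<^esub> gr_class H j w = gr_class H (i + j) (v \<otimes> w)"
proof -
 have c: "v \<in> carrier H" "w \<in> carrier H" using assms cf_closed by auto
 have l0: "\<zero> \<otimes> x = \<zero>" "x \<otimes> \<zero> = \<zero>" if "x \<in> carrier H" for x
  using that k_linear_zero[OF rmult_linear kvs_axioms] k_linear_zero[OF lmult_linear kvs_axioms] by auto
 have vw: "v \<otimes> w \<in> carrier H" using c k_linearD(1)[OF lmult_linear] by blast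
 have "(\<Oplus>k\<in>{..n}. sgl i v k \<otimes> sgl j w (n - k)) = sgl (i + j) (v \<otimes> w) n" for n
 proof -
  have e: "sgl i v k \<otimes> sgl j w (n - k) = (if k = i \<and> n = i + j then v \<otimes> w else \<zero>)" if "k \<le> n" for k
   using that c l0 by (auto simp: sgl_def)
  show ?thesis
  proof (cases "n = i + j")
   case True
   have "(\<Oplus>k\<in>{..n}. sgl i v k \<otimes> sgl j w (n - k)) = (\<Oplus>k\<in>{..n}. if i = k then v \<otimes> w else \<zero>)"
    by (rule M.finsum_cong') (use True e vw in auto)
   also have "\<dots> = v \<otimes> w" by (rule M.finsum_singleton) (use True vw in auto)
   finally show ?thesis using True by (simp add: sgl_def)
  next
   case False
   have "(\<Oplus>k\<in>{..n}. sgl i v k \<otimes> sgl j w (n - k)) = (\<Oplus>k\<in>{..n}. \<zero>)"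
    by (rule M.finsum_cong') (use False e in auto)
   then show ?thesis using False by (simp add: sgl_def)
  qed
 qed
 then show ?thesis unfolding gr_class_sgl gr_mult[OF sgl_grs[OF assms(1)] sgl_grs[OF assms(2)]] by simp
qed

text \<open>A form that annihilates \<open>cb i\<close> does not see which representative of the
  degree i coset is chosen, so it becomes a form on gr H. These are the homogeneous forms of degree
  i.\<close>

definition ev :: "nat \<Rightarrow> ('h \<Rightarrow> 'k) \<Rightarrow> (nat \<Rightarrow> 'h set) \<Rightarrow> 'k" where
 "ev i \<phi> f = \<phi> (SOME x. x \<in> f i)"

lemma ev_mem:
 assumes "\<phi> \<in> perp H (cb i)" "r \<in> grs" "x \<in> gr_of r i"
 shows "\<phi> x = \<phi> (r i)" "x \<in> cf i"
proof -
 have x: "x \<in> carrier H" "x \<ominus> r i \<in> cb i"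
  using coset_mem[OF cb_ks grsD(2)[OF assms(2)], of x i] assms(3) coset_eq[OF cb_ks _ grsD(2)[OF assms(2)], of x i i]
  by (auto simp: gr_of_def)
 then have "\<phi> (x \<ominus> r i) = 0" using perpD(2)[OF assms(1)] by simp
 then show "\<phi> x = \<phi> (r i)" using form_simps(5)[OF perpD(1)[OF assms(1)] x(1) grsD(2)[OF assms(2)]] by simp
 have "x = (x \<ominus> r i) \<oplus> r i" using x grsD(2)[OF assms(2)] by (simp add: a_minus_def M.a_assoc M.l_neg)
 then show "x \<in> cf i" using x cb_cf[of i] ksubD(3)[OF cf_ks, of "x \<ominus> r i" i "r i"] grsD(1)[OF assms(2)] by auto
qed

lemma ev_gr_of:
 assumes "\<phi> \<in> perp H (cb i)" "r \<in> grs"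
 shows "ev i \<phi> (gr_of r) = \<phi> (r i)"
proof -
 have "r i \<in> gr_of r i" using coset_self[OF cb_ks grsD(2)[OF assms(2)]] by (simp add: gr_of_def)
 then have "(SOME x. x \<in> gr_of r i) \<in> gr_of r i" by (rule someI)
 then show ?thesis unfolding ev_def by (rule ev_mem(1)[OF assms])
qed

lemma ev_linear: "\<phi> \<in> perp H (cb i) \<Longrightarrow> lin_form gr (ev i \<phi>)"
 by (rule k_linearI)
  (auto simp: gr_carrier gr_add gr_smult ev_gr_of grs_add grs_scale form_simps[OF perpD(1)] grsD)

lemma ev_class: "\<phi> \<in> perp H (cb i) \<Longrightarrow> v \<in> cf j \<Longrightarrow> ev i \<phi> (gr_class H j v) = (if i = j then \<phi> v else 0)"
 using form_simps(1)[OF perpD(1), of \<phi> "cb i"] by (simp add: gr_class_sgl ev_gr_of sgl_grs) (simp add: sgl_def)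

text \<open>In one degree a form on gr H is a functional on H_i that kills H_(i-1);
  \<open>extend_form\<close> extends it to H. Hence every form on gr H is homogeneous degree by
  degree.\<close>

lemma gr_form_extends:
 assumes "lin_form gr \<Phi>"
 shows "\<exists>\<phi>\<in>perp H (cb i). \<forall>v\<in>cf i. \<phi> v = \<Phi> (gr_class H i v)"
proof -
 obtain \<phi> where p: "lin_form H \<phi>" "\<And>v. v \<in> cf i \<Longrightarrow> \<phi> v = \<Phi> (gr_class H i v)"
  by (rule extend_form[OF cf_ks[of i], of "\<lambda>v. \<Phi> (gr_class H i v)"])
   (simp_all add: gr_class_linear gr_class_closed GR.form_simps[OF assms])
 have "\<phi> \<in> perp H (cb i)"
 proof (rule perpI[OF p(1)])
  fix x assume x: "x \<in> cb i"
  then have xc: "x \<in> cf i" "x \<in> carrier H" using cb_cf cb_closed by auto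
  have "gr_class H i x = gr_class H i \<zero>"
   using gr_class_eq[OF xc(1) ksubD(2)[OF cf_ks]] x xc by (simp add: a_minus_def)
  then have "\<phi> x = \<phi> \<zero>" using p(2) xc ksubD(2)[OF cf_ks] by simp
  then show "\<phi> x = 0" using form_simps(1)[OF p(1)] by simp
 qed
 then show ?thesis using p(2) by blast
qed

subsection \<open>The comultiplication of the associated graded coalgebra\<close>

text \<open>The body of \<open>gr_comult\<close>, taken apart: the admissible lists of summands for
  f and, below, the tensor that a list stands for. The choice by THE is justified by existence of
  such a list and by independence of its value.\<close>

definition gr_rel :: "(nat \<Rightarrow> 'h set) \<Rightarrow> (nat \<times> nat \<times> 'h \<times> 'h) list \<Rightarrow> bool" where
 "gr_rel f xs \<longleftrightarrow> (\<forall>(i, j, v, w)\<in>set xs. v \<in> cf i \<and> w \<in> cf j) \<and>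
   (\<forall>n. \<exists>h\<in>f n. \<Delta> h = list_sum HH.T
     (map (\<lambda>(i, j, v, w). HH.pt v w) (filter (\<lambda>(i, j, v, w). i + j = n) xs)))"

definition gr_val :: "(nat \<times> nat \<times> 'h \<times> 'h) list \<Rightarrow> (nat \<Rightarrow> 'h set, nat \<Rightarrow> 'h set, 'k) tensor" where
 "gr_val xs = list_sum GG.T (map (\<lambda>(i, j, v, w). GG.pt (gr_class H i v) (gr_class H j w)) xs)"

lemma gr_comult_THE: "gr_comult H f = (THE t. \<exists>xs. gr_rel f xs \<and> t = gr_val xs)"
 by (simp add: gr_comult_def gr_rel_def gr_val_def conj_assoc)

lemma gr_relD: "gr_rel f xs \<Longrightarrow> (i, j, v, w) \<in> set xs \<Longrightarrow> v \<in> cf i \<and> w \<in> cf j"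
 by (auto simp: gr_rel_def)

lemma gr_val_closed: "gr_rel f xs \<Longrightarrow> gr_val xs \<in> carrier GG.T"
 unfolding gr_val_def by (rule GG.T.list_sum_closed) (auto dest!: gr_relD intro!: GG.pure_closed gr_class_closed)

lemma tf_gr_val:
 assumes "gr_rel f xs" "lin_form gr \<Phi>" "lin_form gr \<Psi>"
 shows "GG.tf \<Phi> \<Psi> (gr_val xs) = (\<Sum>(i, j, v, w)\<leftarrow>xs. \<Phi> (gr_class H i v) * \<Psi> (gr_class H j w))"
proof -
 have c: "set (map (\<lambda>(i, j, v, w). GG.pt (gr_class H i v) (gr_class H j w)) xs) \<subseteq> carrier GG.T"
  by (auto dest!: gr_relD[OF assms(1)] intro!: GG.pure_closed gr_class_closed)
 show ?thesis
  unfolding gr_val_def GG.T.form_simps(7)[OF GG.tf_linear[OF assms(2,3)] c] map_map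
  by (rule arg_cong[of _ _ sum_list], rule map_cong)
   (auto dest!: gr_relD[OF assms(1)] simp: GG.tf_pure[OF assms(2,3)] gr_class_closed)
qed

text \<open>Among the summands of total degree i + j, those of another bidegree have a first degree
  below i or a second degree below j and are killed by \<phi> or \<psi>. So homogeneous forms see
  exactly \<phi>\<psi> on h, whatever list represents the coproduct.\<close>

lemma tf_gr_val_ev:
 assumes r: "gr_rel (gr_of r) xs" "r \<in> grs" and p: "\<phi> \<in> perp H (cb i)" "\<psi> \<in> perp H (cb j)"
  and h: "h \<in> gr_of r (i + j)"
 shows "GG.tf (ev i \<phi>) (ev j \<psi>) (gr_val xs) = cv \<phi> \<psi> h"
proof -
 note l = perpD(1)[OF p(1)] perpD(1)[OF p(2)]
 have "GG.tf (ev i \<phi>) (ev j \<psi>) (gr_val xs) = (\<Sum>(i', j', v, w)\<leftarrow>xs. if i' + j' = i + j then \<phi> v * \<psi> w else 0)"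
  unfolding tf_gr_val[OF r(1) ev_linear[OF p(1)] ev_linear[OF p(2)]]
 proof (rule arg_cong[of _ _ sum_list], rule map_cong[OF refl])
  fix z assume zx: "z \<in> set xs"
  obtain i' j' v w where z: "z = (i', j', v, w)" by (cases z)
  then have c: "v \<in> cf i'" "w \<in> cf j'" using gr_relD[OF r(1)] zx by auto
  have "ev i \<phi> (gr_class H i' v) * ev j \<psi> (gr_class H j' w) = (if i' + j' = i + j then \<phi> v * \<psi> w else 0)"
  proof (cases "i' + j' = i + j")
   case False
   then show ?thesis by (auto simp: ev_class[OF p(1) c(1)] ev_class[OF p(2) c(2)])
  next
   case True
   consider "i' = i" "j' = j" | "i' < i" | "j' < j" using True by linarith
   then show ?thesis
   proof cases
    case 2
    then have "\<phi> v = 0" using cf_cb c perpD(2)[OF p(1)] by blast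
    then show ?thesis using True 2 by (simp add: ev_class[OF p(1) c(1)])
   next
    case 3
    then have "\<psi> w = 0" using cf_cb c perpD(2)[OF p(2)] by blast
    then show ?thesis using True 3 by (simp add: ev_class[OF p(2) c(2)])
   qed (use ev_class[OF p(1) c(1)] ev_class[OF p(2) c(2)] True in simp)
  qed
  then show "(case z of (i', j', v, w) \<Rightarrow> ev i \<phi> (gr_class H i' v) * ev j \<psi> (gr_class H j' w)) =
   (case z of (i', j', v, w) \<Rightarrow> if i' + j' = i + j then \<phi> v * \<psi> w else 0)" unfolding z prod.case .
 qed
 also have "\<dots> = (\<Sum>(i', j', v, w)\<leftarrow>filter (\<lambda>(i', j', v, w). i' + j' = i + j) xs. \<phi> v * \<psi> w)"
  by (induction xs) auto
 also have "\<dots> = cv \<phi> \<psi> h"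
 proof -
  let ?ys = "filter (\<lambda>(i', j', v, w). i' + j' = i + j) xs"
  obtain h' where h': "h' \<in> gr_of r (i + j)" "\<Delta> h' = list_sum HH.T (map (\<lambda>(i, j, v, w). HH.pt v w) ?ys)"
   using r(1) unfolding gr_rel_def by blast
  have c: "set (map (\<lambda>(i, j, v, w). HH.pt v w) ?ys) \<subseteq> carrier HH.T"
   by (auto dest!: gr_relD[OF r(1)] intro!: HH.pure_closed cf_closed)
  have "cv \<phi> \<psi> h' = (\<Sum>(i', j', v, w)\<leftarrow>?ys. \<phi> v * \<psi> w)"
   unfolding cv_def h'(2) HH.T.form_simps(7)[OF HH.tf_linear[OF l] c] map_map
   by (rule arg_cong[of _ _ sum_list], rule map_cong)
    (auto dest!: gr_relD[OF r(1)] simp: HH.tf_pure[OF l] cf_closed)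
  moreover have "cv \<phi> \<psi> \<in> perp H (cb (i + j))"
   by (rule perpI[OF cv_linear[OF l]]) (rule cv_vanish[OF p])
  then have "cv \<phi> \<psi> h' = cv \<phi> \<psi> (r (i + j))" "cv \<phi> \<psi> h = cv \<phi> \<psi> (r (i + j))"
   using ev_mem(1)[OF _ r(2)] h h'(1) by blast+
  ultimately show ?thesis by simp
 qed
 finally show ?thesis .
qed

text \<open>Only finitely many degrees occur in the two lists. Below that bound arbitrary forms on
  gr H are sums of homogeneous ones, and for these \<open>tf_gr_val_ev\<close> gives a value that
  does not mention the list.\<close>

lemma gr_val_unique:
 assumes r: "r \<in> grs" "gr_rel (gr_of r) xs" "gr_rel (gr_of r) ys"
 shows "gr_val xs = gr_val ys"
proof (rule GG.tf_eqI[OF gr_val_closed[OF r(2)] gr_val_closed[OF r(3)]])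
 fix \<Phi> \<Psi> assume f: "lin_form gr \<Phi>" "lin_form gr \<Psi>"
 obtain \<phi> where ph: "\<And>i. \<phi> i \<in> perp H (cb i)" "\<And>i v. v \<in> cf i \<Longrightarrow> \<phi> i v = \<Phi> (gr_class H i v)"
  using gr_form_extends[OF f(1)] by metis
 obtain \<psi> where ps: "\<And>i. \<psi> i \<in> perp H (cb i)" "\<And>i v. v \<in> cf i \<Longrightarrow> \<psi> i v = \<Psi> (gr_class H i v)"
  using gr_form_extends[OF f(2)] by metis
 obtain M where M: "\<And>i j v w. (i, j, v, w) \<in> set xs \<union> set ys \<Longrightarrow> i \<le> M \<and> j \<le> M"
 proof -
  have "finite ((\<lambda>(i, j, v, w). max i j) ` (set xs \<union> set ys))" by simp
  then obtain M where "\<forall>m\<in>(\<lambda>(i, j, v, w). max i j) ` (set xs \<union> set ys). m \<le> M"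
   using finite_nat_set_iff_bounded_le by auto
  then have "i \<le> M \<and> j \<le> M" if "(i, j, v, w) \<in> set xs \<union> set ys" for i j v w using that by force
  then show ?thesis using that by blast
 qed
 \<comment> \<open>The bound M covers both lists, so the right-hand side is the same for both of
   them.\<close>
 have key: "GG.tf \<Phi> \<Psi> (gr_val zs) = (\<Sum>i\<le>M. \<Sum>j\<le>M. cv (\<phi> i) (\<psi> j) (r (i + j)))"
  if z: "gr_rel (gr_of r) zs" "set zs \<subseteq> set xs \<union> set ys" for zs
 proof -
  have "(\<Sum>i\<le>M. \<Sum>j\<le>M. cv (\<phi> i) (\<psi> j) (r (i + j))) = (\<Sum>i\<le>M. \<Sum>j\<le>M. GG.tf (ev i (\<phi> i)) (ev j (\<psi> j)) (gr_val zs))"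
   by (intro sum.cong refl tf_gr_val_ev[OF z(1) r(1) ph(1) ps(1), symmetric])
    (simp add: gr_of_def coset_self[OF cb_ks grsD(2)[OF r(1)]])
  also have "\<dots> = (\<Sum>i\<le>M. \<Sum>j\<le>M. \<Sum>(i', j', v, w)\<leftarrow>zs. ev i (\<phi> i) (gr_class H i' v) * ev j (\<psi> j) (gr_class H j' w))"
   by (simp add: tf_gr_val[OF z(1) ev_linear[OF ph(1)] ev_linear[OF ps(1)]])
  also have "\<dots> = (\<Sum>z\<leftarrow>zs. \<Sum>i\<le>M. \<Sum>j\<le>M. case z of (i', j', v, w) \<Rightarrow> ev i (\<phi> i) (gr_class H i' v) * ev j (\<psi> j) (gr_class H j' w))"
   by (induction zs) (simp_all add: sum.distrib)
  also have "\<dots> = (\<Sum>(i, j, v, w)\<leftarrow>zs. \<Phi> (gr_class H i v) * \<Psi> (gr_class H j w))"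
  proof (rule arg_cong[of _ _ sum_list], rule map_cong[OF refl])
   fix zz assume zm: "zz \<in> set zs"
   obtain i' j' v w where zz: "zz = (i', j', v, w)" by (cases zz)
   with zm have m: "(i', j', v, w) \<in> set zs" by simp
   then have c: "v \<in> cf i'" "w \<in> cf j'" using gr_relD[OF z(1)] by auto
   have le: "i' \<le> M" "j' \<le> M" using M m z(2) by blast+
   have "(\<Sum>i\<le>M. \<Sum>j\<le>M. ev i (\<phi> i) (gr_class H i' v) * ev j (\<psi> j) (gr_class H j' w)) =
    (\<Sum>i\<le>M. ev i (\<phi> i) (gr_class H i' v)) * (\<Sum>j\<le>M. ev j (\<psi> j) (gr_class H j' w))"
    by (simp add: sum_product)
   also have "\<dots> = \<phi> i' v * \<psi> j' w"
    using le by (simp add: ev_class[OF ph(1) c(1)] ev_class[OF ps(1) c(2)])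
   finally have "(\<Sum>i\<le>M. \<Sum>j\<le>M. ev i (\<phi> i) (gr_class H i' v) * ev j (\<psi> j) (gr_class H j' w)) =
    \<Phi> (gr_class H i' v) * \<Psi> (gr_class H j' w)" using ph(2) ps(2) c by simp
   then show "(\<Sum>i\<le>M. \<Sum>j\<le>M. case zz of (i', j', v, w) \<Rightarrow> ev i (\<phi> i) (gr_class H i' v) * ev j (\<psi> j) (gr_class H j' w)) =
    (case zz of (i, j, v, w) \<Rightarrow> \<Phi> (gr_class H i v) * \<Psi> (gr_class H j w))" unfolding zz prod.case .
  qed
  finally show ?thesis using tf_gr_val[OF z(1) f] by simp
 qed
 show "GG.tf \<Phi> \<Psi> (gr_val xs) = GG.tf \<Phi> \<Psi> (gr_val ys)" using key r by simp
qed

text \<open>Lists from \<open>comult_filtration\<close> for the single degrees are concatenated up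
  to the degree where r becomes zero. Each is homogeneous, so filtering by total degree recovers
  it.\<close>

lemma gr_rel_exists:
 assumes r: "r \<in> grs"
 shows "\<exists>xs. gr_rel (gr_of r) xs"
proof -
 have "\<forall>n. \<exists>y. (\<forall>(i, j, v, w)\<in>set y. i + j = n \<and> v \<in> cf i \<and> w \<in> cf j) \<and>
  \<Delta> (r n) = list_sum HH.T (map (\<lambda>(i, j, v, w). HH.pt v w) y)"
  by (rule allI) (rule comult_filtration[OF grsD(1)[OF r]])
 from choice[OF this] obtain ys where ys': "\<forall>n. (\<forall>(i, j, v, w)\<in>set (ys n). i + j = n \<and> v \<in> cf i \<and> w \<in> cf j) \<and>
  \<Delta> (r n) = list_sum HH.T (map (\<lambda>(i, j, v, w). HH.pt v w) (ys n))" ..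
 note ys = conjunct1[OF spec[OF ys']] conjunct2[OF spec[OF ys']]
 obtain M where M: "\<And>n. r n \<noteq> \<zero> \<Longrightarrow> n < M"
  using grsD(3)[OF r] unfolding finite_nat_set_iff_bounded by blast
 define xs where "xs = concat (map ys [0..<M])"
 have f1: "filter (\<lambda>(i, j, v, w). i + j = n) (ys m) = (if m = n then ys n else [])" for m n
  using ys(1)[of m] by (auto simp: filter_empty_conv filter_id_conv)
 have f: "filter (\<lambda>(i, j, v, w). i + j = n) xs = (if n < M then ys n else [])" for n
  unfolding xs_def filter_concat map_map by (simp add: comp_def f1 concat_if_single)
 have "gr_rel (gr_of r) xs"
  unfolding gr_rel_def
 proof (intro conjI allI)
  show "\<forall>(i, j, v, w)\<in>set xs. v \<in> cf i \<and> w \<in> cf j" using ys(1) by (fastforce simp: xs_def)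
  fix n
  have "\<Delta> (r n) = list_sum HH.T (map (\<lambda>(i, j, v, w). HH.pt v w) (filter (\<lambda>(i, j, v, w). i + j = n) xs))"
  proof (cases "n < M")
   case True then show ?thesis using ys(2) f by simp
  next
   case False
   then have "r n = \<zero>" using M by blast
   then show ?thesis using False f k_linear_zero[OF comult_lin HH.T_kvs] by simp
  qed
  moreover have "r n \<in> gr_of r n" using coset_self[OF cb_ks grsD(2)[OF r]] by (simp add: gr_of_def)
  ultimately show "\<exists>h\<in>gr_of r n. \<Delta> h = list_sum HH.T (map (\<lambda>(i, j, v, w). HH.pt v w) (filter (\<lambda>(i, j, v, w). i + j = n) xs))"
   by blast
 qed
 then show ?thesis by blast
qed

lemma gr_comult_eq:
 assumes "r \<in> grs" "gr_rel (gr_of r) xs"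
 shows "gr_comult H (gr_of r) = gr_val xs"
 unfolding gr_comult_THE by (rule the_equality) (use assms gr_val_unique in blast)+

lemma gr_comult_closed: "f \<in> carrier gr \<Longrightarrow> gr_comult H f \<in> carrier GG.T"
 using gr_rel_exists gr_comult_eq gr_val_closed by (auto simp: gr_carrier) metis

lemma tf_gr_comult:
 assumes "r \<in> grs" "\<phi> \<in> perp H (cb i)" "\<psi> \<in> perp H (cb j)"
 shows "GG.tf (ev i \<phi>) (ev j \<psi>) (gr_comult H (gr_of r)) = cv \<phi> \<psi> (r (i + j))"
proof -
 obtain xs where xs: "gr_rel (gr_of r) xs" using gr_rel_exists[OF assms(1)] by blast
 have "r (i + j) \<in> gr_of r (i + j)" using coset_self[OF cb_ks grsD(2)[OF assms(1)]] by (simp add: gr_of_def)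
 then show ?thesis using tf_gr_val_ev[OF xs assms(1-3)] gr_comult_eq[OF assms(1) xs] by simp
qed

end

section \<open>Free and presented algebras\<close>

lemma free_algebra_simps [simp]:
 "carrier free_algebra = UNIV" "f \<otimes>\<^bsub>free_algebra\<^esub> g = f * g" "f \<oplus>\<^bsub>free_algebra\<^esub> g = f + g"
 "\<one>\<^bsub>free_algebra\<^esub> = 1" "\<zero>\<^bsub>free_algebra\<^esub> = 0" "c \<odot>\<^bsub>free_algebra\<^esub> f = pm_scale c f"
 by (simp_all add: free_algebra_def)

text \<open>A scalar acts as a multiple of the empty word. Hence an ideal of the free algebra is
  automatically a subspace.\<close>

lemma pm_scale_mult_single: "pm_scale c f = single 0 c * (f :: 's list \<Rightarrow>\<^sub>0 'k::field)"
proof -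
 have "keys f \<subseteq> UNIV" by simp
 then show ?thesis by (induction f rule: pm_keys_induct) (simp_all add: mult_single pm_scale_simps distrib_left)
qed

lemma single_zero_central: "single 0 c * f = f * single 0 c" for f :: "'s list \<Rightarrow>\<^sub>0 'k::field"
proof -
 have "keys f \<subseteq> UNIV" by simp
 then show ?thesis
  by (induction f rule: pm_keys_induct) (simp_all add: mult_single distrib_left distrib_right mult.commute)
qed

lemma pm_scale_mult:
 "pm_scale c f * g = pm_scale c (f * g)" "f * pm_scale c g = pm_scale c (f * g)" for f g :: "'s list \<Rightarrow>\<^sub>0 'k::field"
 unfolding pm_scale_mult_single using single_zero_central[of c f] by (metis mult.assoc)+

lemma free_algebra_k_algebra: "k_algebra (free_algebra :: ('k::field, 's list \<Rightarrow>\<^sub>0 'k) module)"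
proof -
 have a: "abelian_group (free_algebra :: ('k, 's list \<Rightarrow>\<^sub>0 'k) module)"
 proof (rule abelian_groupI)
  fix x :: "'s list \<Rightarrow>\<^sub>0 'k"
  show "\<exists>y\<in>carrier free_algebra. y \<oplus>\<^bsub>free_algebra\<^esub> x = \<zero>\<^bsub>free_algebra\<^esub>"
   by (rule bexI[of _ "- x"]) auto
 qed (auto simp: algebra_simps)
 have r: "ring (free_algebra :: ('k, 's list \<Rightarrow>\<^sub>0 'k) module)"
  by (rule ringI[OF a]) (auto intro!: monoidI simp: algebra_simps)
 have k: "kvs (free_algebra :: ('k, 's list \<Rightarrow>\<^sub>0 'k) module)"
  by (rule kvsI[OF a]) (auto simp: pm_scale_simps)
 show ?thesis
  using r k unfolding k_algebra_def kvs_def k_algebra_axioms_def by (simp add: pm_scale_mult)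
qed

interpretation FA: k_algebra free_algebra by (rule free_algebra_k_algebra)

lemma free_algebra_minus [simp]: "f \<ominus>\<^bsub>free_algebra\<^esub> g = f - g"
proof -
 have "\<ominus>\<^bsub>free_algebra\<^esub> g = pm_scale (-1) g" using FA.sm_neg[of g] by simp
 also have "\<dots> = - g" by (rule poly_mapping_eqI) simp
 finally show ?thesis by (simp add: a_minus_def)
qed

lemma quotient_module_mult: "monoid.mult (quotient_module V N) = rcoset_mult V N"
 "\<one>\<^bsub>quotient_module V N\<^esub> = N +>\<^bsub>V\<^esub> \<one>\<^bsub>V\<^esub>"
 by (simp_all add: quotient_module_def)

locale presentation =
 fixes R :: "('s list \<Rightarrow>\<^sub>0 'k::field) set"
begin

abbreviation "I \<equiv> Idl\<^bsub>free_algebra\<^esub> R"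
abbreviation "Q \<equiv> presented_algebra R"
abbreviation "cl \<equiv> presented_class R"

lemma I_ideal: "ideal I free_algebra"
 by (rule ring.genideal_ideal[OF k_algebra_ring[OF free_algebra_k_algebra]]) simp

lemma I_incl: "r \<in> R \<Longrightarrow> r \<in> I"
 using ring.genideal_self[OF k_algebra_ring[OF free_algebra_k_algebra], of R] by auto

lemma I_ksub: "k_subspace free_algebra I"
proof -
 interpret I: ideal I free_algebra by (rule I_ideal)
 show ?thesis
 proof (rule FA.ksubI)
  show "c \<odot>\<^bsub>free_algebra\<^esub> a \<in> I" if "a \<in> I" for c a
   using I.I_l_closed[OF that, of "single 0 c"] by (simp add: pm_scale_mult_single)
 qed (use I.a_closed additive_subgroup.zero_closed[OF ideal.axioms(1)[OF I_ideal]] in auto)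
qed

lemma cl_simps:
 "carrier Q = range cl" "cl f \<oplus>\<^bsub>Q\<^esub> cl g = cl (f + g)" "c \<odot>\<^bsub>Q\<^esub> cl f = cl (pm_scale c f)"
 "\<zero>\<^bsub>Q\<^esub> = cl 0" "cl f \<otimes>\<^bsub>Q\<^esub> cl g = cl (f * g)" "\<one>\<^bsub>Q\<^esub> = cl 1"
 using FA.quotient_simps[OF I_ksub] ideal.rcoset_mult_add[OF I_ideal, of f g]
 by (auto simp: presented_algebra_def presented_class_def quotient_module_mult)

lemma cl_eq: "cl f = cl g \<longleftrightarrow> f - g \<in> I"
 using FA.coset_eq[OF I_ksub, of f g] by (simp add: presented_class_def)

lemma cl_rel: "f - g \<in> R \<Longrightarrow> cl f = cl g"
 using cl_eq I_incl by blast

lemma Q_k_algebra: "k_algebra Q"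
proof -
 have k: "kvs Q" unfolding presented_algebra_def by (rule FA.quotient_kvs[OF I_ksub])
 interpret k: kvs Q by (rule k)
 have "ring Q"
  by (rule ringI[OF k.M.abelian_group_axioms])
   (auto intro!: monoidI simp: cl_simps algebra_simps)
 then show ?thesis
  using k unfolding k_algebra_def kvs_def k_algebra_axioms_def
  by (auto simp: cl_simps pm_scale_mult)
qed

end

definition word_val :: "('k::field, 'a, 'm) module_scheme \<Rightarrow> ('s \<Rightarrow> 'a) \<Rightarrow> 's list \<Rightarrow> 'a" where
 "word_val A a w = foldr (\<lambda>s y. a s \<otimes>\<^bsub>A\<^esub> y) w \<one>\<^bsub>A\<^esub>"

lemma free_eval_pm_eval: "free_eval A a = pm_eval A (word_val A a)"
 by (rule ext) (simp add: free_eval_def pm_eval_def word_val_def)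

context k_algebra begin

lemma AR: "ring A" by (rule k_algebra_ring[OF k_algebra_axioms])

lemmas rr = ring.ring_simprules[OF AR]

lemma one_c [simp, intro]: "\<one> \<in> carrier A" and mult_c [simp, intro]: "x \<in> carrier A \<Longrightarrow> y \<in> carrier A \<Longrightarrow> x \<otimes> y \<in> carrier A"
 and mult_1 [simp]: "x \<in> carrier A \<Longrightarrow> \<one> \<otimes> x = x" "x \<in> carrier A \<Longrightarrow> x \<otimes> \<one> = x"
 and mult_0 [simp]: "x \<in> carrier A \<Longrightarrow> \<zero> \<otimes> x = \<zero>" "x \<in> carrier A \<Longrightarrow> x \<otimes> \<zero> = \<zero>"
 using ring.ring_simprules[OF AR] k_linear_zero[OF rmult_linear kvs_axioms] k_linear_zero[OF lmult_linear kvs_axioms]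
  monoid.r_one[OF ring.is_monoid[OF AR]] by auto

lemma mult_assoc': "x \<in> carrier A \<Longrightarrow> y \<in> carrier A \<Longrightarrow> z \<in> carrier A \<Longrightarrow> x \<otimes> y \<otimes> z = x \<otimes> (y \<otimes> z)"
 using monoid.m_assoc[OF ring.is_monoid[OF AR]] .

lemma word_val_simps: "word_val A a [] = \<one>" "word_val A a (s # w) = a s \<otimes> word_val A a w"
 by (simp_all add: word_val_def)

lemma word_val_closed:
 assumes "\<And>s. a s \<in> carrier A" shows "word_val A a w \<in> carrier A"
 by (induction w) (simp_all add: word_val_simps assms)

lemma word_val_append:
 assumes "\<And>s. a s \<in> carrier A" shows "word_val A a (v @ w) = word_val A a v \<otimes> word_val A a w"
 by (induction v) (simp_all add: word_val_simps mult_assoc' assms word_val_closed)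

context
 fixes a :: "'s \<Rightarrow> 'a"
 assumes a: "\<And>s. a s \<in> carrier A"
begin

lemma free_eval_closed: "free_eval A a f \<in> carrier A"
 unfolding free_eval_pm_eval by (rule pm_eval_closed) (simp add: word_val_closed a)

lemma free_eval_add: "free_eval A a (f + g) = free_eval A a f \<oplus> free_eval A a g"
 unfolding free_eval_pm_eval by (rule pm_eval_add[where S = UNIV]) (simp_all add: word_val_closed a)

lemma free_eval_scale: "free_eval A a (pm_scale c f) = c \<odot> free_eval A a f"
 unfolding free_eval_pm_eval by (rule pm_eval_scale) (simp add: word_val_closed a)

lemma free_eval_single: "free_eval A a (single w c) = c \<odot> word_val A a w"
 unfolding free_eval_pm_eval by (rule pm_eval_single) (simp add: word_val_closed a)

lemma free_eval_zero: "free_eval A a 0 = \<zero>"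
 unfolding free_eval_pm_eval by simp

lemma free_eval_linear: "k_linear free_algebra A (free_eval A a)"
 by (rule k_linearI) (simp_all add: free_eval_closed free_eval_add free_eval_scale)

lemma free_eval_diff: "free_eval A a (f - g) = free_eval A a f \<ominus> free_eval A a g"
 using FA.k_linear_diff[OF free_eval_linear kvs_axioms, of f g] by simp

lemma free_eval_mult: "free_eval A a (f * g) = free_eval A a f \<otimes> free_eval A a g"
proof -
 have 1: "free_eval A a (single v c * g) = c \<odot> word_val A a v \<otimes> free_eval A a g" for v c
 proof -
  have "keys g \<subseteq> UNIV" by simp
  then show ?thesis
  proof (induction g rule: pm_keys_induct)
   case zero then show ?case by (simp add: free_eval_zero word_val_closed a)
  next
   case (single w d)
   then show ?case
    by (simp add: mult_single free_eval_single plus_list_def word_val_append a word_val_closed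
      smult_mult_left smult_mult_right sm_assoc mult.commute)
  next
   case (add f g)
   then show ?case
    by (simp add: distrib_left free_eval_add free_eval_closed word_val_closed a
      k_linearD(2)[OF lmult_linear])
  qed
 qed
 have "keys f \<subseteq> UNIV" by simp
 then show ?thesis
 proof (induction f rule: pm_keys_induct)
  case zero then show ?case by (simp add: free_eval_zero free_eval_closed)
 next
  case (single v c) then show ?case by (simp add: 1 free_eval_single)
 next
  case (add f h)
  then show ?case by (simp add: distrib_right free_eval_add free_eval_closed k_linearD(2)[OF rmult_linear])
 qed
qed

lemma free_eval_one: "free_eval A a 1 = \<one>"
proof -
 have "(1 :: 's list \<Rightarrow>\<^sub>0 'k) = single [] 1" by (simp add: zero_list_def[symmetric])
 then show ?thesis using free_eval_single[of "[]" 1] by (simp add: word_val_simps)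
qed

lemma free_eval_power: "free_eval A a (f ^ n) = free_eval A a f [^] n"
 by (induction n) (simp_all add: free_eval_one free_eval_mult power_Suc2 free_eval_closed del: power_Suc)

lemma free_eval_gen: "free_eval A a (single [s] 1) = a s"
 by (simp add: free_eval_single word_val_simps a)

lemmas free_eval_simps = free_eval_add free_eval_scale free_eval_diff free_eval_mult free_eval_one free_eval_power
 free_eval_gen free_eval_zero

lemma free_eval_ker_ideal: "ideal {f. free_eval A a f = \<zero>} free_algebra"
proof (rule idealI[OF k_algebra_ring[OF free_algebra_k_algebra]])
 let ?K = "{f. free_eval A a f = \<zero>}"
 have "k_subspace free_algebra ?K"
  by (rule FA.ksubI) (auto simp: free_eval_simps)
 then show "subgroup ?K (add_monoid free_algebra)" by (simp add: submodule_def)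
qed (auto simp: free_eval_mult free_eval_closed)

lemma free_eval_ideal:
 assumes "\<And>r. r \<in> R \<Longrightarrow> free_eval A a r = \<zero>" "f \<in> Idl\<^bsub>free_algebra\<^esub> R"
 shows "free_eval A a f = \<zero>"
 using ring.genideal_minimal[OF k_algebra_ring[OF free_algebra_k_algebra] free_eval_ker_ideal, of R] assms by blast

text \<open>The kernel of the evaluation is an ideal that contains R, hence the ideal generated by
  R. So the evaluation is constant on a coset and \<open>the_elem\<close> is applied to a
  singleton.\<close>

lemma presented_lift_cl:
 assumes "\<And>r. r \<in> R \<Longrightarrow> free_eval A a r = \<zero>"
 shows "presented_lift A a (presented_class R f) = free_eval A a f"
proof -
 interpret presentation R .
 have "free_eval A a ` presented_class R f = {free_eval A a f}"
 proof -
  have "free_eval A a g = free_eval A a f" if "g \<in> presented_class R f" for g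
  proof -
   have "cl g = cl f" using FA.coset_mem(2)[OF I_ksub, of f g] that by (simp add: presented_class_def)
   then have "free_eval A a (g - f) = \<zero>" using free_eval_ideal[OF assms] cl_eq by blast
   then show ?thesis by (simp add: free_eval_diff free_eval_closed)
  qed
  moreover have "f \<in> presented_class R f" using FA.coset_self[OF I_ksub, of f] by (simp add: presented_class_def)
  ultimately show ?thesis by blast
 qed
 then show ?thesis by (simp add: presented_lift_def)
qed

lemma presented_lift_hom:
 assumes "\<And>r. r \<in> R \<Longrightarrow> free_eval A a r = \<zero>"
 shows "presented_lift A a \<in> ring_hom (presented_algebra R) A"
  "k_linear (presented_algebra R) A (presented_lift A a)"
proof -
 interpret presentation R .
 show "presented_lift A a \<in> ring_hom Q A"
  by (rule ring_hom_memI) (auto simp: cl_simps presented_lift_cl[OF assms] free_eval_simps free_eval_closed)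
 show "k_linear Q A (presented_lift A a)"
  by (rule k_linearI) (auto simp: cl_simps presented_lift_cl[OF assms] free_eval_simps free_eval_closed)
qed

end

end

section \<open>A noncommutative binomial formula\<close>

text \<open>If \<open>g x - x g = s g (1 - g)\<close>, then these falling factorials, and not the powers of \<open>x\<close>, satisfy a binomial formula.\<close>

primrec ff :: "('k::field, 'a, 'm) module_scheme \<Rightarrow> 'k \<Rightarrow> 'a \<Rightarrow> nat \<Rightarrow> 'a" where
 "ff A s x 0 = \<one>\<^bsub>A\<^esub>"
| "ff A s x (Suc n) = ff A s x n \<otimes>\<^bsub>A\<^esub> x \<ominus>\<^bsub>A\<^esub> (of_nat n * s) \<odot>\<^bsub>A\<^esub> ff A s x n"

context k_algebra begin

lemma diff_c [simp, intro]: "x \<in> carrier A \<Longrightarrow> y \<in> carrier A \<Longrightarrow> x \<ominus> y \<in> carrier A"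
 and add_c [simp, intro]: "x \<in> carrier A \<Longrightarrow> y \<in> carrier A \<Longrightarrow> x \<oplus> y \<in> carrier A"
 using rr by auto

lemma mult_linear:
 "x \<in> carrier A \<Longrightarrow> y \<in> carrier A \<Longrightarrow> z \<in> carrier A \<Longrightarrow> x \<otimes> (y \<oplus> z) = x \<otimes> y \<oplus> x \<otimes> z"
 "x \<in> carrier A \<Longrightarrow> y \<in> carrier A \<Longrightarrow> z \<in> carrier A \<Longrightarrow> (y \<oplus> z) \<otimes> x = y \<otimes> x \<oplus> z \<otimes> x"
 "x \<in> carrier A \<Longrightarrow> y \<in> carrier A \<Longrightarrow> z \<in> carrier A \<Longrightarrow> x \<otimes> (y \<ominus> z) = x \<otimes> y \<ominus> x \<otimes> z"
 "x \<in> carrier A \<Longrightarrow> y \<in> carrier A \<Longrightarrow> z \<in> carrier A \<Longrightarrow> (y \<ominus> z) \<otimes> x = y \<otimes> x \<ominus> z \<otimes> x"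
 using k_linearD(2)[OF lmult_linear] k_linearD(2)[OF rmult_linear]
  k_linear_diff[OF lmult_linear kvs_axioms] k_linear_diff[OF rmult_linear kvs_axioms] by auto

lemma pow_c [simp, intro]: "x \<in> carrier A \<Longrightarrow> x [^] (n::nat) \<in> carrier A"
 using monoid.nat_pow_closed[OF ring.is_monoid[OF AR]] .

lemma pow_Suc': "x [^] Suc n = x [^] n \<otimes> x" "x [^] (0::nat) = \<one>"
 by simp_all

lemma pow_add: "x \<in> carrier A \<Longrightarrow> x [^] (m + n :: nat) = x [^] m \<otimes> x [^] n"
 using monoid.nat_pow_mult[OF ring.is_monoid[OF AR]] by simp

lemma ff_c [simp, intro]: "x \<in> carrier A \<Longrightarrow> ff A s x n \<in> carrier A"
 by (induction n) auto

lemma pow_commute: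
 assumes "x \<in> carrier A" "y \<in> carrier A" "x \<otimes> y = y \<otimes> x"
 shows "x [^] (n::nat) \<otimes> y = y \<otimes> x [^] n"
proof (induction n)
 case (Suc n)
 have "x [^] Suc n \<otimes> y = x [^] n \<otimes> (y \<otimes> x)" using assms by (simp add: mult_assoc')
 also have "\<dots> = y \<otimes> x [^] Suc n" using assms Suc by (simp add: mult_assoc'[symmetric])
 finally show ?case .
qed (use assms in simp)

lemma ff_commute:
 assumes "x \<in> carrier A" "y \<in> carrier A" "x \<otimes> y = y \<otimes> x"
 shows "ff A s x n \<otimes> y = y \<otimes> ff A s x n"
proof (induction n)
 case (Suc n)
 have "ff A s x n \<otimes> x \<otimes> y = ff A s x n \<otimes> (y \<otimes> x)" using assms by (simp add: mult_assoc')
 also have "\<dots> = y \<otimes> (ff A s x n \<otimes> x)" using assms Suc by (simp add: mult_assoc'[symmetric])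
 finally show ?case using assms Suc by (simp add: mult_linear smult_mult_left smult_mult_right)
qed (use assms in simp)

text \<open>The commutator with x is a derivation that sends g to s (g - g^2), and g commutes with
  its own powers.\<close>

lemma pow_skew:
 assumes c: "g \<in> carrier A" "x \<in> carrier A" and r: "g \<otimes> x = x \<otimes> g \<oplus> s \<odot> (g \<ominus> g \<otimes> g)"
 shows "g [^] (k::nat) \<otimes> x = x \<otimes> g [^] k \<oplus> (of_nat k * s) \<odot> (g [^] k \<ominus> g [^] Suc k)"
proof (induction k)
 case 0 then show ?case using c by simp
next
 case (Suc k)
 have gg: "g \<otimes> g [^] k = g [^] k \<otimes> g" using pow_commute[of g g k] c by simp
 have "g [^] Suc k \<otimes> x = g [^] k \<otimes> (x \<otimes> g \<oplus> s \<odot> (g \<ominus> g \<otimes> g))"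
  using c r by (simp add: mult_assoc')
 also have "\<dots> = (g [^] k \<otimes> x) \<otimes> g \<oplus> s \<odot> (g [^] Suc k \<ominus> g [^] Suc (Suc k))"
  using c by (simp add: mult_linear smult_mult_right mult_assoc')
 also have "\<dots> = x \<otimes> g [^] Suc k \<oplus> (of_nat k * s) \<odot> (g [^] Suc k \<ominus> g [^] Suc (Suc k)) \<oplus> s \<odot> (g [^] Suc k \<ominus> g [^] Suc (Suc k))"
  unfolding Suc using c by (simp add: mult_linear smult_mult_left mult_assoc')
 also have "\<dots> = x \<otimes> g [^] Suc k \<oplus> ((of_nat k * s) \<odot> (g [^] Suc k \<ominus> g [^] Suc (Suc k)) \<oplus> s \<odot> (g [^] Suc k \<ominus> g [^] Suc (Suc k)))"
  by (rule rr(7)) (use c in auto)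
 also have "\<dots> = x \<otimes> g [^] Suc k \<oplus> (of_nat (Suc k) * s) \<odot> (g [^] Suc k \<ominus> g [^] Suc (Suc k))"
  using c by (subst sm_add_l[symmetric]) (auto simp: algebra_simps)
 finally show ?case .
qed

lemma ff_mult: "x \<in> carrier A \<Longrightarrow> ff A s x n \<otimes> x = ff A s x (Suc n) \<oplus> (of_nat n * s) \<odot> ff A s x n"
 by (simp add: a_minus_def rr(7) M.l_neg)

text \<open>With t m k = X_m g^k Y_k, multiplying by x + g y raises m or k by one and adds (m + k) s
  t m k. On the terms of degree n this addition is n s times the old sum, which the recursion of
  \<open>ff\<close> subtracts. What remains is Pascal's rule.\<close>

lemma binomial_ff:
 assumes c: "g \<in> carrier A" "x \<in> carrier A" "y \<in> carrier A"
  and r: "g \<otimes> x = x \<otimes> g \<oplus> s \<odot> (g \<ominus> g \<otimes> g)" and yx: "y \<otimes> x = x \<otimes> y" and yg: "y \<otimes> g = g \<otimes> y"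
 shows "ff A s (x \<oplus> g \<otimes> y) n = (\<Oplus>k\<in>{..n}. of_nat (n choose k) \<odot> (ff A s x (n - k) \<otimes> g [^] k \<otimes> ff A s y k))"
proof (induction n)
 case 0 then show ?case by (simp add: M.finsum_insert)
next
 case (Suc n)
 let ?X = "ff A s x" and ?Y = "ff A s y"
 define t where "t m k = ?X m \<otimes> g [^] k \<otimes> ?Y k" for m k :: nat
 have tc [simp]: "t m k \<in> carrier A" for m k using c by (simp add: t_def)
 \<comment> \<open>Moving x to the left past g^k produces - k s X_m g^(k+1) Y_k; splitting Y_k y
   into Y_(k+1) and k s Y_k produces the same term with the opposite sign. The two cancel.\<close>
 have key: "\<phi> (t m k \<otimes> (x \<oplus> g \<otimes> y)) = \<phi> (t (Suc m) k) + \<phi> (t m (Suc k)) + of_nat (m + k) * s * \<phi> (t m k)"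
  if f: "lin_form A \<phi>" for \<phi> m k
 proof -
  note fs = form_simps[OF f]
  have Yx: "?Y k \<otimes> x = x \<otimes> ?Y k" and Yg: "?Y k \<otimes> g = g \<otimes> ?Y k"
   using ff_commute[OF c(3,2) yx] ff_commute[OF c(3,1) yg] by auto
  have "t m k \<otimes> x = ?X m \<otimes> (g [^] k \<otimes> x) \<otimes> ?Y k"
   using c Yx by (simp add: t_def mult_assoc')
  also have "\<dots> = (?X m \<otimes> x) \<otimes> g [^] k \<otimes> ?Y k \<oplus> (of_nat k * s) \<odot> (t m k \<ominus> ?X m \<otimes> g [^] Suc k \<otimes> ?Y k)"
   unfolding pow_skew[OF c(1,2) r] t_def using c
   by (simp add: mult_linear smult_mult_left smult_mult_right mult_assoc' del: nat_pow_Suc)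
  also have "\<dots> = (t (Suc m) k \<oplus> (of_nat m * s) \<odot> t m k) \<oplus> (of_nat k * s) \<odot> (t m k \<ominus> ?X m \<otimes> g [^] Suc k \<otimes> ?Y k)"
   unfolding ff_mult[OF c(2)] t_def using c
   by (simp add: mult_linear(2) smult_mult_left del: ff.simps(2) nat_pow_Suc)
  finally have 1: "\<phi> (t m k \<otimes> x) = \<phi> (t (Suc m) k) + of_nat m * s * \<phi> (t m k) + of_nat k * s * (\<phi> (t m k) - \<phi> (?X m \<otimes> g [^] Suc k \<otimes> ?Y k))"
   using c by (simp add: fs del: ff.simps(2) nat_pow_Suc)
  have "t m k \<otimes> (g \<otimes> y) = ?X m \<otimes> g [^] Suc k \<otimes> (?Y k \<otimes> y)"
   using c Yg by (simp add: t_def mult_assoc') (metis Yg c ff_c mult_assoc' mult_c)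
  also have "\<dots> = t m (Suc k) \<oplus> (of_nat k * s) \<odot> (?X m \<otimes> g [^] Suc k \<otimes> ?Y k)"
   unfolding ff_mult[OF c(3)] t_def using c
   by (simp add: mult_linear(1) smult_mult_right del: ff.simps(2) nat_pow_Suc)
  finally have 2: "\<phi> (t m k \<otimes> (g \<otimes> y)) = \<phi> (t m (Suc k)) + of_nat k * s * \<phi> (?X m \<otimes> g [^] Suc k \<otimes> ?Y k)"
   using c by (simp add: fs del: ff.simps(2) nat_pow_Suc)
  have "\<phi> (t m k \<otimes> (x \<oplus> g \<otimes> y)) = \<phi> (t m k \<otimes> x) + \<phi> (t m k \<otimes> (g \<otimes> y))"
   using c by (simp add: mult_linear(1) fs)
  then show ?thesis unfolding 1 2 by (simp add: algebra_simps)
 qed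
 show ?case
 proof (rule form_eqI)
  show "ff A s (x \<oplus> g \<otimes> y) (Suc n) \<in> carrier A" using c by blast
  show "(\<Oplus>k\<in>{..Suc n}. of_nat (Suc n choose k) \<odot> (?X (Suc n - k) \<otimes> g [^] k \<otimes> ?Y k)) \<in> carrier A"
   using c by (intro M.finsum_closed) auto
  fix \<phi> assume f: "lin_form A \<phi>"
  note fs = form_simps[OF f]
  have fc: "(\<lambda>k. of_nat (n choose k) \<odot> t (n - k) k) \<in> {..n} \<rightarrow> carrier A" by simp
  have IH: "ff A s (x \<oplus> g \<otimes> y) n = (\<Oplus>k\<in>{..n}. of_nat (n choose k) \<odot> t (n - k) k)" using Suc by (simp add: t_def)
  have lin: "lin_form A (\<lambda>z. \<phi> (z \<otimes> (x \<oplus> g \<otimes> y)))"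
   by (rule k_linear_comp[OF rmult_linear f]) (use c in simp)
  have "\<phi> (ff A s (x \<oplus> g \<otimes> y) n \<otimes> (x \<oplus> g \<otimes> y)) = (\<Sum>k\<le>n. of_nat (n choose k) * \<phi> (t (n - k) k \<otimes> (x \<oplus> g \<otimes> y)))"
   unfolding IH using form_simps(6)[OF lin fc] by (simp add: form_simps(3)[OF lin])
  also have "\<dots> = (\<Sum>k\<le>n. of_nat (n choose k) * (\<phi> (t (Suc n - k) k) + \<phi> (t (n - k) (Suc k)) + of_nat n * s * \<phi> (t (n - k) k)))"
   by (intro sum.cong refl) (simp add: key[OF f] Suc_diff_le)
  finally have 1: "\<phi> (ff A s (x \<oplus> g \<otimes> y) n \<otimes> (x \<oplus> g \<otimes> y)) = \<dots>" .
  have 2: "\<phi> (ff A s (x \<oplus> g \<otimes> y) n) = (\<Sum>k\<le>n. of_nat (n choose k) * \<phi> (t (n - k) k))"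
   unfolding IH using form_simps(6)[OF f fc] by (simp add: fs)
  \<comment> \<open>The correction of \<open>key\<close>, with m + k = n, is cancelled here by the
    subtraction in the recursion of \<open>ff\<close>.\<close>
  have "\<phi> (ff A s (x \<oplus> g \<otimes> y) (Suc n)) =
    (\<Sum>k\<le>n. of_nat (n choose k) * (\<phi> (t (Suc n - k) k) + \<phi> (t (n - k) (Suc k))))"
   using c by (simp add: fs 1 2 distrib_left sum.distrib sum_distrib_left algebra_simps)
  also have "\<dots> = (\<Sum>k\<le>n. of_nat (n choose k) * \<phi> (t (Suc n - k) k)) + (\<Sum>k\<le>n. of_nat (n choose k) * \<phi> (t (Suc n - Suc k) (Suc k)))"
   by (simp add: distrib_left sum.distrib)
  also have "(\<Sum>k\<le>n. of_nat (n choose k) * \<phi> (t (Suc n - k) k)) = (\<Sum>k\<le>Suc n. of_nat (n choose k) * \<phi> (t (Suc n - k) k))"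
   by (simp add: binomial_eq_0)
  also have "\<dots> = \<phi> (t (Suc n) 0) + (\<Sum>k\<le>n. of_nat (n choose Suc k) * \<phi> (t (Suc n - Suc k) (Suc k)))"
   by (subst sum.atMost_Suc_shift) simp
  also have "\<dots> + (\<Sum>k\<le>n. of_nat (n choose k) * \<phi> (t (Suc n - Suc k) (Suc k))) =
    (\<Sum>k\<le>Suc n. of_nat (Suc n choose k) * \<phi> (t (Suc n - k) k))"
   by (simp add: sum.atMost_Suc_shift sum.distrib distrib_right algebra_simps del: sum.atMost_Suc)
  also have "\<dots> = \<phi> (\<Oplus>k\<in>{..Suc n}. of_nat (Suc n choose k) \<odot> t (Suc n - k) k)"
   by (subst fs(6)) (simp_all add: fs)
  finally show "\<phi> (ff A s (x \<oplus> g \<otimes> y) (Suc n)) = \<phi> (\<Oplus>k\<in>{..Suc n}. of_nat (Suc n choose k) \<odot> (?X (Suc n - k) \<otimes> g [^] k \<otimes> ?Y k))"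
   by (simp only: t_def)
 qed
qed

end

lemma finsum_tensor_space [simp]: "finsum (tensor V W) = finsum (tensor_space V W)"
 by (rule add_monoid_cong(1)) simp_all

lemma a_minus_tensor_space [simp]: "x \<ominus>\<^bsub>tensor V W\<^esub> y = x \<ominus>\<^bsub>tensor_space V W\<^esub> y"
 by (simp add: a_minus_def a_inv_def m_inv_def)

subsection \<open>The product of the linear factors over the prime field\<close>

lemma ff_poly_aux:
 fixes P :: "nat \<Rightarrow> 'k::field poly"
 defines "P \<equiv> \<lambda>n. \<Prod>i<n. [:- of_nat i, 1:]"
 shows "Polynomial.degree (P n) = n" "lead_coeff (P n) = 1" "P (Suc n) = pCons 0 (P n) - smult (of_nat n) (P n)"
proof -
 show "P (Suc n) = pCons 0 (P n) - smult (of_nat n) (P n)" by (simp add: P_def mult.commute)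
 show "Polynomial.degree (P n) = n" unfolding P_def by (subst degree_prod_eq_sum_degree) auto
 show "lead_coeff (P n) = 1" unfolding P_def by (simp add: lead_coeff_prod)
qed

lemma of_nat_power_CHAR:
 assumes "CHAR('k) = p" "p > 0" shows "of_nat i ^ p = (of_nat i :: 'k::field)"
proof (induction i)
 case 0 then show ?case using assms by simp
next
 case (Suc i)
 have "Factorial_Ring.prime CHAR('k)" using assms prime_CHAR_semidom by blast
 then have "(1 + of_nat i) ^ p = 1 ^ p + (of_nat i :: 'k) ^ p"
  using assms(1) by (intro freshmans_dream) auto
 then show ?case using Suc by simp
qed

text \<open>Both polynomials are monic of degree p, and both vanish at the p distinct elements of
  the prime field, by Fermat's little theorem on the right. Their difference would have more roots
  than its degree allows.\<close>

lemma prod_linear_prime_field: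
 assumes "CHAR('k::field) = p" "p > 0"
 shows "(\<Prod>i<p. [:- of_nat i, 1:]) = Polynomial.monom 1 p - (Polynomial.monom 1 1 :: 'k poly)"
proof -
 let ?P = "(\<Prod>i<p. [:- of_nat i, 1:]) :: 'k poly"
 let ?D = "Polynomial.monom 1 p - Polynomial.monom 1 1 - ?P"
 have pr: "Factorial_Ring.prime p" using assms prime_CHAR_semidom by blast
 then have p1: "p > 1" by (rule prime_gt_1_nat)
 note a = ff_poly_aux[where 'k = 'k and n = p]
 have "Polynomial.degree ?D \<le> p"
  using a(1) p1 by (intro degree_diff_le) (auto simp: degree_monom_eq)
 moreover have "coeff ?D p = 0" using a(1,2) p1 by simp
 ultimately have dlt: "?D = 0 \<or> Polynomial.degree ?D < p"
  by (metis le_neq_implies_less leading_coeff_0_iff)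
 show ?thesis
 proof (rule ccontr)
  assume "?P \<noteq> Polynomial.monom 1 p - Polynomial.monom 1 1"
  then have D0: "?D \<noteq> 0" by auto
  have sub: "of_nat ` {..<p} \<subseteq> {x. poly ?D x = 0}"
  proof (rule image_subsetI)
   fix i assume i: "i \<in> {..<p}"
   have "poly ?P (of_nat i) = 0" using i by (auto simp: poly_prod)
   then show "of_nat i \<in> {x. poly ?D x = 0}" using of_nat_power_CHAR[OF assms, of i] by (simp add: poly_monom)
  qed
  have lt: "False" if "i < j" "j < p" "of_nat i = (of_nat j :: 'k)" for i j
  proof -
   have "of_nat (j - i) = (0 :: 'k)" using that by (simp add: of_nat_diff)
   then have "p dvd j - i" by (simp add: of_nat_eq_0_iff_char_dvd assms)
   then show False using that by (auto dest: dvd_imp_le)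
  qed
  have inj: "inj_on (of_nat :: nat \<Rightarrow> 'k) {..<p}"
   by (rule inj_onI) (metis lt lessThan_iff linorder_neqE_nat)
  have c1: "p = card ((of_nat :: nat \<Rightarrow> 'k) ` {..<p})" using card_image[OF inj] by simp
  also have "\<dots> \<le> card {x. poly ?D x = 0}" by (rule card_mono[OF poly_roots_finite[OF D0] sub])
  also have "\<dots> \<le> Polynomial.degree ?D" by (rule card_poly_roots_bound[OF D0])
  finally show False using dlt D0 by simp
 qed
qed

context k_algebra begin

text \<open>Powers of a single element commute, so \<open>ff A 1 x n\<close> is a polynomial in x,
  and the recursion of \<open>ff\<close> is multiplication of that polynomial by the next linear
  factor.\<close>

lemma ff_expand:
 assumes "x \<in> carrier A"
 shows "ff A 1 x n = (\<Oplus>j\<in>{..n}. Polynomial.coeff (\<Prod>i<n. [:- of_nat i, 1:]) j \<odot> x [^] j)"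
proof (induction n)
 case 0 then show ?case by (simp add: M.finsum_insert)
next
 case (Suc n)
 let ?P = "\<lambda>n. (\<Prod>i<n. [:- of_nat i, 1:]) :: 'k poly"
 have c: "(\<lambda>j. Polynomial.coeff (?P m) j \<odot> x [^] j) \<in> {..m} \<rightarrow> carrier A" for m using assms by auto
 show ?case
 proof (rule form_eqI)
  show "ff A 1 x (Suc n) \<in> carrier A" using assms by blast
  show "(\<Oplus>j\<in>{..Suc n}. Polynomial.coeff (?P (Suc n)) j \<odot> x [^] j) \<in> carrier A" by (rule M.finsum_closed[OF c])
  fix \<phi> assume f: "lin_form A \<phi>"
  note fs = form_simps[OF f]
  have lin: "lin_form A (\<lambda>z. \<phi> (z \<otimes> x))" by (rule k_linear_comp[OF rmult_linear[OF assms] f])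
  have z: "Polynomial.coeff (?P n) (Suc n) = 0" using ff_poly_aux(1)[where 'k='k and n = n] by (intro coeff_eq_0) simp
  have "\<phi> (ff A 1 x (Suc n)) = \<phi> (ff A 1 x n \<otimes> x) - of_nat n * \<phi> (ff A 1 x n)"
   using assms by (simp add: fs)
  also have "\<phi> (ff A 1 x n \<otimes> x) = (\<Sum>j\<le>n. Polynomial.coeff (?P n) j * \<phi> (x [^] Suc j))"
   unfolding Suc form_simps(6)[OF lin c] using assms by (simp add: form_simps(3)[OF lin])
  also have "\<phi> (ff A 1 x n) = (\<Sum>j\<le>n. Polynomial.coeff (?P n) j * \<phi> (x [^] j))"
   unfolding Suc fs(6)[OF c] using assms by (simp add: fs)
  also have "(\<Sum>j\<le>n. Polynomial.coeff (?P n) j * \<phi> (x [^] Suc j)) = (\<Sum>j\<le>Suc n. Polynomial.coeff (pCons 0 (?P n)) j * \<phi> (x [^] j))"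
   by (subst sum.atMost_Suc_shift) simp
  also have "(\<Sum>j\<le>n. Polynomial.coeff (?P n) j * \<phi> (x [^] j)) = (\<Sum>j\<le>Suc n. Polynomial.coeff (?P n) j * \<phi> (x [^] j))"
   using z by simp
  also have "(\<Sum>j\<le>Suc n. Polynomial.coeff (pCons 0 (?P n)) j * \<phi> (x [^] j)) - of_nat n * (\<Sum>j\<le>Suc n. Polynomial.coeff (?P n) j * \<phi> (x [^] j))
   = (\<Sum>j\<le>Suc n. Polynomial.coeff (pCons 0 (?P n) - smult (of_nat n) (?P n)) j * \<phi> (x [^] j))"
   by (simp only: sum_distrib_left sum_subtractf[symmetric] coeff_diff coeff_smult left_diff_distrib mult.assoc)
  also have "\<dots> = (\<Sum>j\<le>Suc n. Polynomial.coeff (?P (Suc n)) j * \<phi> (x [^] j))"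
   unfolding ff_poly_aux(3)[where 'k='k and n = n] ..
  also have "\<dots> = \<phi> (\<Oplus>j\<in>{..Suc n}. Polynomial.coeff (?P (Suc n)) j \<odot> x [^] j)"
   unfolding fs(6)[OF c] using assms by (intro sum.cong refl) (simp only: fs pow_c)
  finally show "\<phi> (ff A 1 x (Suc n)) = \<phi> (\<Oplus>j\<in>{..Suc n}. Polynomial.coeff (?P (Suc n)) j \<odot> x [^] j)" .
 qed
qed

text \<open>For s = 0 falling factorials are powers; for s = 1 this is
  \<open>prod_linear_prime_field\<close>. A general s would give x^p - s^(p-1) x, so the
  normalisation of s is what makes the same parameter appear in the commutator and in the relation
  for x^p.\<close>

lemma ff_prime:
 assumes "CHAR('k) = p" "p > 0" "s = 0 \<or> s = 1" "x \<in> carrier A"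
 shows "ff A s x p = x [^] p \<ominus> s \<odot> x"
proof (cases "s = 0")
 case True
 have "ff A 0 x n = x [^] n" for n by (induction n) (use assms in \<open>simp_all add: a_minus_def\<close>)
 then show ?thesis using True assms by (simp add: a_minus_def)
next
 case False
 have pr: "Factorial_Ring.prime p" using assms prime_CHAR_semidom by blast
 then have p1: "p > 1" by (rule prime_gt_1_nat)
 let ?c = "\<lambda>j. Polynomial.coeff (Polynomial.monom 1 p - Polynomial.monom 1 1 :: 'k poly) j"
 have c: "(\<lambda>j. ?c j \<odot> x [^] j) \<in> {..p} \<rightarrow> carrier A" using assms by auto
 have "ff A 1 x p = (\<Oplus>j\<in>{..p}. ?c j \<odot> x [^] j)"
  using ff_expand[OF assms(4), of p] by (simp only: prod_linear_prime_field[OF assms(1,2)])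
 also have "\<dots> = x [^] p \<ominus> x"
 proof (rule form_eqI)
  show "(\<Oplus>j\<in>{..p}. ?c j \<odot> x [^] j) \<in> carrier A" by (rule M.finsum_closed[OF c])
  fix \<phi> assume f: "lin_form A \<phi>"
  note fs = form_simps[OF f]
  have x1: "x [^] (1::nat) = x" using assms by simp
  have "\<phi> (\<Oplus>j\<in>{..p}. ?c j \<odot> x [^] j) = (\<Sum>j\<le>p. ?c j * \<phi> (x [^] j))"
   unfolding fs(6)[OF c] using assms by (intro sum.cong refl) (simp only: fs pow_c)
  also have "\<dots> = (\<Sum>j\<le>p. if j = p then \<phi> (x [^] p) else 0) - (\<Sum>j\<le>p. if j = 1 then \<phi> (x [^] (1::nat)) else 0)"
   unfolding sum_subtractf[symmetric] using p1 by (intro sum.cong refl) (auto simp: left_diff_distrib)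
  also have "\<dots> = \<phi> (x [^] p) - \<phi> x" using p1 x1 by simp
  finally show "\<phi> (\<Oplus>j\<in>{..p}. ?c j \<odot> x [^] j) = \<phi> (x [^] p \<ominus> x)" using assms by (simp add: fs)
 qed (use assms in auto)
 finally show ?thesis using False assms by simp
qed

end

context k_algebra begin

lemma ff_pure_left:
 assumes "u \<in> carrier A"
 shows "ff (tensor A A) s (pure_tensor A A u \<one>) n = pure_tensor A A (ff A s u n) \<one>"
proof -
 interpret AA: k_algebra_pair A A ..
 show ?thesis by (induction n)
  (use assms in \<open>simp_all add: AA.tensor_mult_pure k_linear_diff[OF AA.pure_linear_left AA.T_kvs] AA.pure_scale_left\<close>)
qed

lemma ff_pure_right:
 assumes "u \<in> carrier A"
 shows "ff (tensor A A) s (pure_tensor A A \<one> u) n = pure_tensor A A \<one> (ff A s u n)"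
proof -
 interpret AA: k_algebra_pair A A ..
 show ?thesis by (induction n)
  (use assms in \<open>simp_all add: AA.tensor_mult_pure k_linear_diff[OF AA.pure_linear_right AA.T_kvs] AA.pure_scale_right\<close>)
qed

lemma pow_pure:
 assumes "u \<in> carrier A" "v \<in> carrier A"
 shows "pure_tensor A A u v [^]\<^bsub>tensor A A\<^esub> (n::nat) = pure_tensor A A (u [^] n) (v [^] n)"
proof -
 interpret AA: k_algebra_pair A A ..
 show ?thesis by (induction n) (use assms in \<open>simp_all add: AA.tensor_mult_pure\<close>)
qed

lemma one_pow [simp]: "\<one> [^] (n::nat) = \<one>"
 by (induction n) simp_all

text \<open>The element x \<otimes> 1 + g \<otimes> x is X + G Y with X = x \<otimes> 1, G = g
  \<otimes> 1 and Y = 1 \<otimes> x. Here Y commutes with X and G, as \<open>binomial_ff\<close>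
  requires.\<close>

lemma ff_tensor:
 assumes c: "g \<in> carrier A" "x \<in> carrier A" and r: "g \<otimes> x = x \<otimes> g \<oplus> s \<odot> (g \<ominus> g \<otimes> g)"
 shows "ff (tensor A A) s (pure_tensor A A x \<one> \<oplus>\<^bsub>tensor_space A A\<^esub> pure_tensor A A g x) n =
  (\<Oplus>\<^bsub>tensor_space A A\<^esub>k\<in>{..n}. of_nat (n choose k) \<odot>\<^bsub>tensor_space A A\<^esub>
   pure_tensor A A (ff A s x (n - k) \<otimes> g [^] k) (ff A s x k))"
proof -
 interpret AA: k_algebra_pair A A ..
 interpret TA: k_algebra "tensor A A" by (rule AA.tensor_algebra)
 let ?x = "AA.pt x \<one>" and ?g = "AA.pt g \<one>" and ?y = "AA.pt \<one> x"
 have "ff (tensor A A) s (?x \<oplus>\<^bsub>AA.T\<^esub> AA.pt g x) n = ff (tensor A A) s (?x \<oplus>\<^bsub>tensor A A\<^esub> ?g \<otimes>\<^bsub>tensor A A\<^esub> ?y) n"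
  using c by (simp add: AA.tensor_mult_pure)
 also have "\<dots> = (\<Oplus>\<^bsub>tensor A A\<^esub>k\<in>{..n}. of_nat (n choose k) \<odot>\<^bsub>tensor A A\<^esub>
   (ff (tensor A A) s ?x (n - k) \<otimes>\<^bsub>tensor A A\<^esub> ?g [^]\<^bsub>tensor A A\<^esub> k \<otimes>\<^bsub>tensor A A\<^esub> ff (tensor A A) s ?y k))"
 proof (rule TA.binomial_ff)
  show "?g \<otimes>\<^bsub>tensor A A\<^esub> ?x = ?x \<otimes>\<^bsub>tensor A A\<^esub> ?g \<oplus>\<^bsub>tensor A A\<^esub> s \<odot>\<^bsub>tensor A A\<^esub> (?g \<ominus>\<^bsub>tensor A A\<^esub> ?g \<otimes>\<^bsub>tensor A A\<^esub> ?g)"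
   using c by (simp add: AA.tensor_mult_pure r AA.pure_add_left AA.pure_scale_left
    k_linear_diff[OF AA.pure_linear_left AA.T_kvs])
 qed (use c in \<open>simp_all add: AA.tensor_mult_pure\<close>)
 also have "\<dots> = (\<Oplus>\<^bsub>AA.T\<^esub>k\<in>{..n}. of_nat (n choose k) \<odot>\<^bsub>AA.T\<^esub> AA.pt (ff A s x (n - k) \<otimes> g [^] k) (ff A s x k))"
  using c by (simp add: ff_pure_left ff_pure_right pow_pure AA.tensor_mult_pure)
 finally show ?thesis .
qed

end

section \<open>Skew-primitive extensions of a group algebra\<close>

text \<open>Used twice: for the presented algebras, before the bialgebra axioms are established
  there, and for a given H in which suitable a, b, x have been found. Only what both situations
  share is assumed; in particular a relation for x^p is left out, since in a given H it has to be
  derived.\<close>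

locale lift_data = k_algebra H for H :: "('k::field, 'h) bialg" (structure) +
 fixes p e :: nat and s t :: 'k and a b x :: 'h
 assumes comult_linear: "k_linear H (tensor H H) (comult H)"
  and comult_mult: "comult H \<in> ring_hom H (tensor H H)"
  and counit_linear: "k_linear H ground_algebra (counit H)"
  and counit_mult: "counit H \<in> ring_hom H ground_algebra"
  and char: "CHAR('k) = p" "p > 0" and e: "e = 0 \<or> e = 1" and s: "s = 0 \<or> s = 1"
  and gens [simp]: "a \<in> carrier H" "b \<in> carrier H" "x \<in> carrier H"
  and pows: "a [^] p = \<one>" "b [^] p = \<one>" and ab: "a \<otimes> b = b \<otimes> a"
  and ax: "a \<otimes> x = x \<otimes> a \<oplus> s \<odot> (a \<ominus> a \<otimes> a [^] e)"
  and bx: "b \<otimes> x = x \<otimes> b \<oplus> t \<odot> (b \<ominus> b \<otimes> a [^] e)"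
  and comult_a: "comult H a = pure_tensor H H a a" and comult_b: "comult H b = pure_tensor H H b b"
  and comult_x: "comult H x = pure_tensor H H x \<one> \<oplus>\<^bsub>tensor H H\<^esub> pure_tensor H H (a [^] e) x"
  and counit_gens: "counit H a = 1" "counit H b = 1" "counit H x = 0"
begin

sublocale HH: k_algebra_pair H H ..
sublocale TA: k_algebra "tensor H H" by (rule HH.tensor_algebra)

abbreviation "g \<equiv> a [^] e"
definition hh :: "nat \<Rightarrow> nat \<Rightarrow> 'h" where "hh i j = a [^] i \<otimes> b [^] j"
definition xf :: "nat \<Rightarrow> 'h" where "xf n = ff H s x n"
definition B :: "nat \<Rightarrow> nat \<Rightarrow> nat \<Rightarrow> 'h" where "B n i j = xf n \<otimes> hh i j"
text \<open>The additive character of the group through which the commutator with x acts on group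
  monomials, see \<open>hh_x\<close>.\<close>

definition c :: "nat \<Rightarrow> nat \<Rightarrow> 'k" where "c i j = of_nat i * s + of_nat j * t"

lemma prime_p: "Factorial_Ring.prime p"
 using char prime_CHAR_semidom by blast

lemma p_gt_1: "p > 1" using prime_p by (rule prime_gt_1_nat)

lemma hh_c [simp, intro]: "hh i j \<in> carrier H" and X_c [simp, intro]: "xf n \<in> carrier H" and B_c [simp, intro]: "B n i j \<in> carrier H"
 by (auto simp: hh_def xf_def B_def)

lemma ab_pow: "b [^] (j::nat) \<otimes> a [^] (i::nat) = a [^] i \<otimes> b [^] j"
 by (rule pow_commute, simp, simp, rule pow_commute[symmetric]) (simp_all add: ab)

lemma hh_mult: "hh i j \<otimes> hh k l = hh (i + k) (j + l)"
proof -
 have "hh i j \<otimes> hh k l = a [^] i \<otimes> (b [^] j \<otimes> a [^] k) \<otimes> b [^] l" by (simp add: hh_def mult_assoc')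
 also have "\<dots> = a [^] i \<otimes> a [^] k \<otimes> (b [^] j \<otimes> b [^] l)" by (simp add: ab_pow mult_assoc')
 finally show ?thesis by (simp add: hh_def pow_add)
qed

lemma hh_simps: "hh 0 0 = \<one>" "hh (Suc 0) 0 = a" "hh 0 (Suc 0) = b" "hh i 0 = a [^] i"
 by (simp_all add: hh_def)

lemma hh_period: "hh (i + p) j = hh i j" "hh i (j + p) = hh i j"
 by (simp_all add: hh_def pow_add pows)

lemma hh_mod: "hh (i mod p) (j mod p) = hh i j"
proof -
 have 1: "hh (i + k * p) j = hh i j" for i j k
 proof (induction k)
  case (Suc k) then show ?case using hh_period(1)[of "i + k * p" j] by (simp add: algebra_simps)
 qed simp
 have 2: "hh i (j + k * p) = hh i j" for i j k
 proof (induction k)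
  case (Suc k) then show ?case using hh_period(2)[of i "j + k * p"] by (simp add: algebra_simps)
 qed simp
 have "hh i j = hh (i mod p + (i div p) * p) (j mod p + (j div p) * p)" by simp
 also have "\<dots> = hh (i mod p) (j mod p)" by (simp only: 1 2)
 finally show ?thesis ..
qed

lemma g_hh: "g = hh e 0" by (simp add: hh_simps)

text \<open>The commutator with x is a derivation, and the factor 1 - g can be moved past v. So the
  scalars \<alpha> and \<beta> add up.\<close>

lemma skew_mult:
 assumes c: "u \<in> carrier H" "v \<in> carrier H" and gv: "v \<otimes> g = g \<otimes> v"
  and u: "u \<otimes> x = x \<otimes> u \<oplus> \<alpha> \<odot> (u \<ominus> u \<otimes> g)" and v: "v \<otimes> x = x \<otimes> v \<oplus> \<beta> \<odot> (v \<ominus> v \<otimes> g)"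
 shows "(u \<otimes> v) \<otimes> x = x \<otimes> (u \<otimes> v) \<oplus> (\<alpha> + \<beta>) \<odot> (u \<otimes> v \<ominus> (u \<otimes> v) \<otimes> g)"
proof -
 have gc: "g \<in> carrier H" by simp
 let ?d = "u \<otimes> v \<ominus> (u \<otimes> v) \<otimes> g"
 have d: "?d \<in> carrier H" using c by simp
 have e1: "u \<otimes> (\<beta> \<odot> (v \<ominus> v \<otimes> g)) = \<beta> \<odot> ?d"
  using c gc by (simp add: smult_mult_right mult_linear mult_assoc')
 have "(u \<ominus> u \<otimes> g) \<otimes> v = ?d" using c gc gv by (simp add: mult_linear mult_assoc')
 then have e2: "(\<alpha> \<odot> (u \<ominus> u \<otimes> g)) \<otimes> v = \<alpha> \<odot> ?d" using c gc by (simp add: smult_mult_left)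
 have "(u \<otimes> v) \<otimes> x = u \<otimes> (x \<otimes> v) \<oplus> \<beta> \<odot> ?d"
  using c gc v by (simp add: mult_assoc' mult_linear(1) e1)
 also have "u \<otimes> (x \<otimes> v) = (x \<otimes> u \<oplus> \<alpha> \<odot> (u \<ominus> u \<otimes> g)) \<otimes> v" using c u by (simp add: mult_assoc'[symmetric])
 also have "\<dots> = x \<otimes> (u \<otimes> v) \<oplus> \<alpha> \<odot> ?d" using c gc by (simp add: mult_linear(2) e2 mult_assoc')
 finally show ?thesis using c d by (simp add: sm_add_l rr(7))
qed

lemma hh_g: "hh i j \<otimes> g = hh (i + e) j" "g \<otimes> hh i j = hh (i + e) j"
 by (simp_all add: g_hh hh_mult add.commute del: hh_simps(4))

lemma hh_x: "hh i j \<otimes> x = x \<otimes> hh i j \<oplus> c i j \<odot> (hh i j \<ominus> hh (i + e) j)"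
proof -
 have ga: "a \<otimes> g = g \<otimes> a" "b \<otimes> g = g \<otimes> b"
  using hh_g[of 1 0] hh_g[of 0 1] by (simp_all add: hh_def)
 have 1: "hh i 0 \<otimes> x = x \<otimes> hh i 0 \<oplus> c i 0 \<odot> (hh i 0 \<ominus> hh i 0 \<otimes> g)" for i
 proof (induction i)
  case 0 then show ?case by (simp add: hh_simps c_def a_minus_def M.r_neg)
 next
  case (Suc i)
  have "hh (Suc i) 0 = hh i 0 \<otimes> a" by (simp add: hh_def)
  then show ?case using skew_mult[OF hh_c gens(1) ga(1) Suc ax] by (simp add: c_def algebra_simps)
 qed
 have "hh i j \<otimes> x = x \<otimes> hh i j \<oplus> c i j \<odot> (hh i j \<ominus> hh i j \<otimes> g)"
 proof (induction j)
  case 0 show ?case by (rule 1)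
 next
  case (Suc j)
  have "hh i (Suc j) = hh i j \<otimes> b" by (simp add: hh_def mult_assoc')
  then show ?case using skew_mult[OF hh_c gens(2) ga(2) Suc bx] by (simp add: c_def algebra_simps)
 qed
 then show ?thesis by (simp add: hh_g)
qed

text \<open>For e = 0 the difference g - g^2 vanishes because g = 1, so the scalar s may be written
  in both cases. This is the hypothesis of \<open>binomial_ff\<close> in uniform shape.\<close>

lemma g_x: "g \<otimes> x = x \<otimes> g \<oplus> s \<odot> (g \<ominus> g \<otimes> g)"
proof -
 have "g \<otimes> x = x \<otimes> g \<oplus> (of_nat e * s) \<odot> (g \<ominus> g \<otimes> g)"
  using hh_x[of e 0] hh_g(1)[of e 0] by (simp add: hh_simps c_def)
 then show ?thesis using e by (auto simp: a_minus_def M.r_neg)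
qed

lemma B_hh: "B n i j \<otimes> hh k l = B n (i + k) (j + l)"
 by (simp add: B_def mult_assoc' hh_mult)

lemma B_mod: "B n (i mod p) (j mod p) = B n i j"
 by (simp add: B_def hh_mod)

lemma B_simps: "B 0 i j = hh i j" "B n 0 0 = xf n" "xf (Suc 0) = x" "xf 0 = \<one>"
 by (simp_all add: B_def xf_def hh_simps a_minus_def)

text \<open>The straightening rule: right multiplication by x raises the degree by one, up to
  monomials of the same degree. Spanning, the product in gr and the isomorphisms between liftings
  all rest on it.\<close>

lemma B_x: "B n i j \<otimes> x = B (Suc n) i j \<oplus> ((of_nat n * s + c i j) \<odot> B n i j \<ominus> c i j \<odot> B n (i + e) j)"
proof (rule form_eqI)
 fix \<phi> assume f: "lin_form H \<phi>"
 note fs = form_simps[OF f]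
 have "B n i j \<otimes> x = (xf n \<otimes> x) \<otimes> hh i j \<oplus> c i j \<odot> (B n i j \<ominus> B n (i + e) j)"
  by (simp add: B_def mult_assoc' hh_x mult_linear smult_mult_right)
 also have "xf n \<otimes> x = xf (Suc n) \<oplus> (of_nat n * s) \<odot> xf n" unfolding xf_def by (rule ff_mult) simp
 also have "(xf (Suc n) \<oplus> (of_nat n * s) \<odot> xf n) \<otimes> hh i j = B (Suc n) i j \<oplus> (of_nat n * s) \<odot> B n i j"
  by (simp add: B_def mult_linear smult_mult_left)
 finally show "\<phi> (B n i j \<otimes> x) = \<phi> (B (Suc n) i j \<oplus> ((of_nat n * s + c i j) \<odot> B n i j \<ominus> c i j \<odot> B n (i + e) j))"
  by (simp add: fs algebra_simps)
qed simp_all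

subsection \<open>The coproduct of the monomials\<close>

abbreviation "\<Delta> \<equiv> comult H"

lemma comult_closed [simp]: "h \<in> carrier H \<Longrightarrow> \<Delta> h \<in> carrier HH.T"
 using k_linearD(1)[OF comult_linear] by simp

lemma comult_lin: "k_linear H HH.T \<Delta>"
 using comult_linear by simp

lemma comult_prod: "u \<in> carrier H \<Longrightarrow> v \<in> carrier H \<Longrightarrow> \<Delta> (u \<otimes> v) = \<Delta> u \<otimes>\<^bsub>tensor H H\<^esub> \<Delta> v"
 using comult_mult by (simp add: ring_hom_def)

lemma comult_one: "\<Delta> \<one> = HH.pt \<one> \<one>"
 using comult_mult by (simp add: ring_hom_def)

lemma comult_pow: "u \<in> carrier H \<Longrightarrow> \<Delta> u = HH.pt u u \<Longrightarrow> \<Delta> (u [^] (n::nat)) = HH.pt (u [^] n) (u [^] n)"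
 by (induction n) (simp_all add: comult_one comult_prod HH.tensor_mult_pure)

lemma comult_hh: "\<Delta> (hh i j) = HH.pt (hh i j) (hh i j)"
 unfolding hh_def by (simp add: comult_prod comult_pow comult_a comult_b HH.tensor_mult_pure)

lemma comult_ff: "u \<in> carrier H \<Longrightarrow> \<Delta> (ff H s u n) = ff (tensor H H) s (\<Delta> u) n"
 by (induction n)
  (simp_all add: comult_one comult_prod k_linear_diff[OF comult_lin HH.T_kvs] k_linearD[OF comult_lin])

lemma comult_X:
 "\<Delta> (xf n) = (\<Oplus>\<^bsub>HH.T\<^esub>k\<in>{..n}. of_nat (n choose k) \<odot>\<^bsub>HH.T\<^esub> HH.pt (xf (n - k) \<otimes> g [^] k) (xf k))"
 using comult_ff[OF gens(3)] ff_tensor[OF _ gens(3) g_x] by (simp add: xf_def comult_x)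

lemma comult_B:
 "\<Delta> (B n i j) = (\<Oplus>\<^bsub>HH.T\<^esub>k\<in>{..n}. of_nat (n choose k) \<odot>\<^bsub>HH.T\<^esub> HH.pt (B (n - k) (i + e * k) j) (B k i j))"
proof -
 let ?f = "\<lambda>k. of_nat (n choose k) \<odot>\<^bsub>HH.T\<^esub> HH.pt (xf (n - k) \<otimes> g [^] k) (xf k)"
 have fc: "?f \<in> {..n} \<rightarrow> carrier (tensor H H)" by auto
 have gk: "g [^] k = hh (e * k) 0" for k
  by (simp add: hh_simps monoid.nat_pow_pow[OF ring.is_monoid[OF AR]])
 have "\<Delta> (B n i j) = finsum (tensor H H) ?f {..n} \<otimes>\<^bsub>tensor H H\<^esub> HH.pt (hh i j) (hh i j)"
  unfolding B_def by (simp add: comult_prod comult_X comult_hh)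
 also have "\<dots> = (\<Oplus>\<^bsub>tensor H H\<^esub>k\<in>{..n}. ?f k \<otimes>\<^bsub>tensor H H\<^esub> HH.pt (hh i j) (hh i j))"
  by (rule TA.k_linear_finsum[OF TA.rmult_linear TA.kvs_axioms fc]) simp
 also have "\<dots> = (\<Oplus>\<^bsub>tensor H H\<^esub>k\<in>{..n}. of_nat (n choose k) \<odot>\<^bsub>HH.T\<^esub> HH.pt (B (n - k) (i + e * k) j) (B k i j))"
 proof (rule TA.M.finsum_cong'[OF refl])
  fix k assume "k \<in> {..n}"
  have "?f k \<otimes>\<^bsub>tensor H H\<^esub> HH.pt (hh i j) (hh i j) =
   of_nat (n choose k) \<odot>\<^bsub>HH.T\<^esub> (HH.pt (xf (n - k) \<otimes> g [^] k) (xf k) \<otimes>\<^bsub>tensor H H\<^esub> HH.pt (hh i j) (hh i j))"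
   using TA.smult_mult_left[of "HH.pt (xf (n - k) \<otimes> g [^] k) (xf k)" "HH.pt (hh i j) (hh i j)" "of_nat (n choose k)"] by simp
  also have "HH.pt (xf (n - k) \<otimes> g [^] k) (xf k) \<otimes>\<^bsub>tensor H H\<^esub> HH.pt (hh i j) (hh i j) = HH.pt (B (n - k) (i + e * k) j) (B k i j)"
   unfolding gk by (simp add: HH.tensor_mult_pure B_def mult_assoc' hh_mult add.commute)
  finally show "?f k \<otimes>\<^bsub>tensor H H\<^esub> HH.pt (hh i j) (hh i j) = of_nat (n choose k) \<odot>\<^bsub>HH.T\<^esub> HH.pt (B (n - k) (i + e * k) j) (B k i j)" .
 qed simp
 finally show ?thesis by simp
qed

lemma rsl_B:
 assumes "lin_form H \<psi>"
 shows "HH.rsl \<psi> (\<Delta> (B n i j)) = (\<Oplus>k\<in>{..n}. (of_nat (n choose k) * \<psi> (B k i j)) \<odot> B (n - k) (i + e * k) j)"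
 unfolding comult_B
 by (subst HH.T.k_linear_finsum[OF HH.rsl_linear[OF assms] kvs_axioms])
  (auto simp: k_linearD(3)[OF HH.rsl_linear[OF assms]] HH.rsl_pure[OF assms] sm_assoc)

lemma tf_B:
 assumes "lin_form H \<phi>" "lin_form H \<psi>"
 shows "HH.tf \<phi> \<psi> (\<Delta> (B n i j)) = (\<Sum>k\<le>n. of_nat (n choose k) * (\<phi> (B (n - k) (i + e * k) j) * \<psi> (B k i j)))"
 unfolding comult_B
 by (subst HH.tf_simps[OF assms])
  (auto simp: HH.tf_simps[OF assms])

lemma counit_prod: "u \<in> carrier H \<Longrightarrow> v \<in> carrier H \<Longrightarrow> counit H (u \<otimes> v) = counit H u * counit H v" "counit H \<one> = 1"
 using counit_mult by (auto simp: ring_hom_def)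

lemma counit_hh: "counit H (hh i j) = 1"
proof -
 have "counit H (u [^] (n::nat)) = counit H u ^ n" if "u \<in> carrier H" for u n
  by (induction n) (use that in \<open>simp_all add: counit_prod\<close>)
 then show ?thesis by (simp add: hh_def counit_prod counit_gens)
qed

lemma counit_B: "counit H (B n i j) = (if n = 0 then 1 else 0)"
proof -
 have "counit H (xf n) = (if n = 0 then 1 else 0)"
 proof (induction n)
  case (Suc n)
  have "counit H (xf (Suc n)) = counit H (xf n) * counit H x - of_nat n * s * counit H (xf n)"
   by (simp add: xf_def form_simps[OF counit_linear] counit_prod)
  then show ?case using Suc by (simp add: counit_gens)
 qed (simp add: xf_def counit_prod)
 then show ?thesis by (simp add: B_def counit_prod counit_hh)
qed

lemma X_p: "xf p = x [^] p \<ominus> s \<odot> x"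
 unfolding xf_def by (rule ff_prime[OF char s gens(3)])

lemma choose_p_zero: "0 < k \<Longrightarrow> k < p \<Longrightarrow> of_nat (p choose k) = (0 :: 'k)"
 using dvd_choose_prime[of k p] prime_p by (simp add: of_nat_eq_0_iff_char_dvd char)

text \<open>The inner binomial coefficients are zero in characteristic p, and g^p = 1. So X_p is
  primitive and not merely skew primitive.\<close>

lemma comult_X_p: "\<Delta> (xf p) = HH.pt (xf p) \<one> \<oplus>\<^bsub>HH.T\<^esub> HH.pt \<one> (xf p)"
proof (rule HH.tf_eqI)
 fix \<phi> \<psi> assume f: "lin_form H \<phi>" "lin_form H \<psi>"
 have hp: "B n (e * p) 0 = B n 0 0" for n using B_mod[of n "e * p" 0] B_mod[of n 0 0] by simp
 have "HH.tf \<phi> \<psi> (\<Delta> (xf p)) = (\<Sum>k\<le>p. of_nat (p choose k) * (\<phi> (B (p - k) (e * k) 0) * \<psi> (B k 0 0)))"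
  using tf_B[OF f, of p 0 0] by (simp add: B_simps)
 also have "\<dots> = (\<Sum>k\<in>{0, p}. of_nat (p choose k) * (\<phi> (B (p - k) (e * k) 0) * \<psi> (B k 0 0)))"
  by (rule sum.mono_neutral_right) (auto simp: choose_p_zero)
 also have "\<dots> = \<phi> (xf p) * \<psi> \<one> + \<phi> \<one> * \<psi> (xf p)"
  using p_gt_1 by (simp add: hp B_simps hh_simps)
 also have "\<dots> = HH.tf \<phi> \<psi> (HH.pt (xf p) \<one> \<oplus>\<^bsub>HH.T\<^esub> HH.pt \<one> (xf p))"
  by (simp add: HH.tf_simps[OF f])
 finally show "HH.tf \<phi> \<psi> (\<Delta> (xf p)) = HH.tf \<phi> \<psi> (HH.pt (xf p) \<one> \<oplus>\<^bsub>HH.T\<^esub> HH.pt \<one> (xf p))" .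
qed simp_all

end

section \<open>Independence of the monomials\<close>

lemma lin_form_sum:
 assumes "kvs V" "\<And>z. z \<in> A \<Longrightarrow> lin_form V (\<epsilon> z)"
 shows "lin_form V (\<lambda>v. \<Sum>z\<in>A. k z * \<epsilon> z v)"
proof -
 interpret kvs V by fact
 show ?thesis
  by (rule k_linearI)
   (simp_all add: form_simps[OF assms(2)] sum.distrib[symmetric] sum_distrib_left algebra_simps)
qed

lemma k_linear_finsum_fun:
 assumes "kvs V" "kvs W" "finite A" "\<And>z. z \<in> A \<Longrightarrow> k_linear V W (f z)"
 shows "k_linear V W (\<lambda>v. finsum W (\<lambda>z. f z v) A)"
proof -
 interpret V: kvs V by fact
 interpret W: kvs W by fact
 show ?thesis using assms(3,4)
 proof (induction A)
  case empty
  show ?case by (rule k_linearI) simp_all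
 next
  case (insert z A)
  have l: "k_linear V W (\<lambda>v. f z v \<oplus>\<^bsub>W\<^esub> finsum W (\<lambda>z. f z v) A)"
   by (rule k_linear_add[OF assms(2)]) (use insert in auto)
  have e: "finsum W (\<lambda>z. f z v) (insert z A) = f z v \<oplus>\<^bsub>W\<^esub> finsum W (\<lambda>z. f z v) A" if "v \<in> carrier V" for v
   by (rule W.M.finsum_insert)
    (use insert.hyps k_linearD(1)[OF insert.prems that] in auto)
  show ?case
   by (rule k_linearI; subst e; (subst e)?; (subst e)?) (auto simp: k_linearD[OF l] e)
 qed
qed

lemma (in kvs) linear_span_eq:
 assumes "kvs W" "k_linear V W f" "k_linear V W g" "S \<subseteq> carrier V" "\<And>v. v \<in> S \<Longrightarrow> f v = g v" "v \<in> k_span V S"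
 shows "f v = g v"
proof -
 have "k_subspace V {v \<in> carrier V. f v = g v}"
  by (rule ksubI) (auto simp: k_linearD[OF assms(2)] k_linearD[OF assms(3)]
   k_linear_zero[OF assms(2,1)] k_linear_zero[OF assms(3,1)])
 then have "k_span V S \<subseteq> {v \<in> carrier V. f v = g v}"
  by (rule span_min) (use assms(4,5) in blast)
 then show ?thesis using assms(6) by blast
qed

text \<open>The two assumptions concern degrees 0 and 1 only: the group monomials are independent
  and x lies outside their span. The coproduct yields independence in all degrees below p.\<close>

locale lift_basis = lift_data H p e s t a b x
 for H :: "('k::field, 'h) bialg" (structure) and p e :: nat and s t :: 'k and a b x :: 'h +
 assumes indep0: "i < p \<Longrightarrow> j < p \<Longrightarrow>
   \<exists>\<phi>. lin_form H \<phi> \<and> (\<forall>k<p. \<forall>l<p. \<phi> (hh k l) = (if k = i \<and> l = j then 1 else 0))"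
  and x_notin: "x \<notin> k_span H {hh k l |k l. True}"
begin

definition "S0 = k_span H {hh k l |k l. True}"

lemma S0_ks: "k_subspace H S0"
 unfolding S0_def by (rule span_ksub) auto

lemma hh_S0: "hh k l \<in> S0"
 unfolding S0_def by (rule subsetD[OF span_incl]) blast

lemma S0_mult: "v \<in> S0 \<Longrightarrow> v \<otimes> hh k l \<in> S0"
proof -
 have "k_subspace H {v \<in> carrier H. v \<otimes> hh k l \<in> S0}"
  by (rule ksubI) (use ksubD[OF S0_ks] in \<open>auto simp: mult_linear smult_mult_left\<close>)
 moreover have "{hh k l |k l. True} \<subseteq> {v \<in> carrier H. v \<otimes> hh k l \<in> S0}"
  using hh_S0 by (auto simp: hh_mult)
 ultimately have "k_span H {hh k l |k l. True} \<subseteq> {v \<in> carrier H. v \<otimes> hh k l \<in> S0}" by (rule span_min)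
 then show "v \<in> S0 \<Longrightarrow> v \<otimes> hh k l \<in> S0" unfolding S0_def[symmetric] by blast
qed

text \<open>Multiplication by the inverse group element, whose exponents are p - 1 times the given
  ones, leads back to x.\<close>

lemma B1_notin: "B 1 i j \<notin> S0"
proof
 assume "B 1 i j \<in> S0"
 then have "B 1 i j \<otimes> hh ((p - 1) * i) ((p - 1) * j) \<in> S0" by (rule S0_mult)
 moreover have "n + (p - 1) * n = p * n" for n using p_gt_1 by (cases p) auto
 ultimately have "B 1 (p * i) (p * j) \<in> S0" by (simp add: B_hh)
 then have "x \<in> S0" using B_mod[of 1 "p * i" "p * j"] by (simp add: B_simps)
 then show False using x_notin by (simp add: S0_def)
qed

lemma of_nat_neq0: "0 < n \<Longrightarrow> n < p \<Longrightarrow> of_nat n \<noteq> (0 :: 'k)"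
 by (auto simp: of_nat_eq_0_iff_char_dvd char dest: dvd_imp_le)

text \<open>Let \<psi> be dual to B (N-1) i0 j0 in degrees below N. The slice (id \<otimes> \<psi>)
  \<Delta> sends every other monomial of degree at most N into the span S0 of the group, but B N i0
  j0 to N times a monomial of degree 1, modulo S0. Since N is invertible for 0 < N < p,
  \<open>B1_notin\<close> gives the contradiction.\<close>

lemma dual_step:
 assumes N: "0 < N" "N < p" and ij: "i0 < p" "j0 < p"
  and D: "\<exists>\<psi>. lin_form H \<psi> \<and> (\<forall>m<N. \<forall>k<p. \<forall>l<p. \<psi> (B m k l) = (if m = N - 1 \<and> k = i0 \<and> l = j0 then 1 else 0))"
 shows "B N i0 j0 \<notin> k_span H {B m k l |m k l. m \<le> N \<and> k < p \<and> l < p \<and> (m, k, l) \<noteq> (N, i0, j0)}"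
  (is "_ \<notin> k_span H ?S")
proof
 assume a: "B N i0 j0 \<in> k_span H ?S"
 obtain \<psi> where f: "lin_form H \<psi>"
  and psi: "\<And>m k l. m < N \<Longrightarrow> k < p \<Longrightarrow> l < p \<Longrightarrow> \<psi> (B m k l) = (if m = N - 1 \<and> k = i0 \<and> l = j0 then 1 else 0)"
  using D by blast
 let ?R = "\<lambda>v. HH.rsl \<psi> (\<Delta> v)"
 have Rl: "k_linear H H ?R" by (rule k_linear_comp[OF comult_lin HH.rsl_linear[OF f]])
 have K: "k_subspace H {v \<in> carrier H. ?R v \<in> S0}"
  by (rule ksubI) (use ksubD[OF S0_ks] in \<open>auto simp: k_linearD[OF Rl] k_linear_zero[OF Rl kvs_axioms]\<close>)
 have "?S \<subseteq> {v \<in> carrier H. ?R v \<in> S0}"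
 proof
  fix v assume "v \<in> ?S"
  then obtain m k l where v: "v = B m k l" and m: "m \<le> N" "k < p" "l < p" "(m, k, l) \<noteq> (N, i0, j0)" by blast
  \<comment> \<open>In degree N the values of \<psi> are unknown, but they occur only with r = m,
    where the left tensor factor is a group monomial and the term lies in S0 anyway.\<close>
  have "(of_nat (m choose r) * \<psi> (B r k l)) \<odot> B (m - r) (k + e * r) l \<in> S0" if r: "r \<in> {..m}" for r
  proof (cases "r = m")
   case True
   then show ?thesis using ksubD(4)[OF S0_ks hh_S0] by (simp add: B_simps)
  next
   case False
   then have "\<psi> (B r k l) = 0" using r m psi[of r k l] by auto
   then show ?thesis using ksubD(2)[OF S0_ks] by simp
  qed
  then have "?R (B m k l) \<in> S0"
   unfolding rsl_B[OF f] by (rule ksub_finsum[OF S0_ks])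
  then show "v \<in> {v \<in> carrier H. ?R v \<in> S0}" unfolding v by simp
 qed
 from span_min[OF K this] a have R: "?R (B N i0 j0) \<in> S0" by auto
 let ?f = "\<lambda>k. (of_nat (N choose k) * \<psi> (B k i0 j0)) \<odot> B (N - k) (i0 + e * k) j0"
 have fc: "?f \<in> A \<rightarrow> carrier H" for A by auto
 have i: "{..N} = insert (N - 1) ({..N} - {N - 1})" using N by auto
 have "?R (B N i0 j0) = finsum H ?f {..N}" by (rule rsl_B[OF f])
 also have "\<dots> = finsum H ?f (insert (N - 1) ({..N} - {N - 1}))" using i by simp
 also have "\<dots> = ?f (N - 1) \<oplus> finsum H ?f ({..N} - {N - 1})"
  by (rule M.finsum_insert) (use fc in auto)
 finally have e1: "?R (B N i0 j0) = ?f (N - 1) \<oplus> finsum H ?f ({..N} - {N - 1})" .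
 have rest: "finsum H ?f ({..N} - {N - 1}) \<in> S0"
 proof (rule ksub_finsum[OF S0_ks])
  fix k assume k: "k \<in> {..N} - {N - 1}"
  show "?f k \<in> S0"
  proof (cases "k = N")
   case True then show ?thesis using ksubD(4)[OF S0_ks hh_S0] by (simp add: B_simps)
  next
   case False
   then have "\<psi> (B k i0 j0) = 0" using k psi[of k i0 j0] ij by auto
   then show ?thesis using ksubD(2)[OF S0_ks] by simp
  qed
 qed
 have rc: "finsum H ?f ({..N} - {N - 1}) \<in> carrier H" by (rule M.finsum_closed[OF fc])
 have "?f (N - 1) = ?R (B N i0 j0) \<ominus> finsum H ?f ({..N} - {N - 1})"
  unfolding e1 using rc by (simp add: a_minus_def M.a_assoc M.r_neg)
 then have "?f (N - 1) \<in> S0" using ksubD(6)[OF S0_ks R rest] by simp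
 moreover have "N choose (N - 1) = N" using N binomial_symmetric[of "N - 1" N] by simp
 moreover have "\<psi> (B (N - 1) i0 j0) = 1" using psi[of "N - 1" i0 j0] ij N by simp
 moreover have "N - (N - 1) = 1" using N by simp
 ultimately have "of_nat N \<odot> B 1 (i0 + e * (N - 1)) j0 \<in> S0" by simp
 then have "inverse (of_nat N) \<odot> (of_nat N \<odot> B 1 (i0 + e * (N - 1)) j0) \<in> S0" by (rule ksubD(4)[OF S0_ks])
 then have "B 1 (i0 + e * (N - 1)) j0 \<in> S0" using of_nat_neq0[OF N] by (simp add: sm_assoc)
 then show False using B1_notin by blast
qed

text \<open>Induction on the number of degrees under control. In the new top degree dual forms come
  from \<open>dual_step\<close> by separation. Forms dual to lower monomials are kept, after their
  unknown values in the top degree have been subtracted.\<close>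

lemma dual_exists:
 assumes "N \<le> p" "n < N" "i < p" "j < p"
 shows "\<exists>\<phi>. lin_form H \<phi> \<and> (\<forall>m<N. \<forall>k<p. \<forall>l<p. \<phi> (B m k l) = (if m = n \<and> k = i \<and> l = j then 1 else 0))"
 using assms
proof (induction N arbitrary: n i j)
 case (Suc N)
 show ?case
 proof (cases "N = 0")
  case True
  then show ?thesis using indep0[OF Suc.prems(3,4)] Suc.prems(2) by (simp add: B_simps)
 next
  case False
  have N: "0 < N" "N < p" using False Suc.prems by auto
  have top: "\<exists>\<epsilon>. lin_form H \<epsilon> \<and> (\<forall>m\<le>N. \<forall>k<p. \<forall>l<p. \<epsilon> (B m k l) = (if m = N \<and> k = i0 \<and> l = j0 then 1 else 0))"
   if ij: "i0 < p" "j0 < p" for i0 j0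
  proof -
   let ?S = "{B m k l |m k l. m \<le> N \<and> k < p \<and> l < p \<and> (m, k, l) \<noteq> (N, i0, j0)}"
   have Sc: "?S \<subseteq> carrier H" by auto
   have "B N i0 j0 \<notin> k_span H ?S"
    by (rule dual_step[OF N ij]) (use Suc.IH[of "N - 1" i0 j0] N ij in auto)
   then obtain \<epsilon> where ep: "lin_form H \<epsilon>" "\<And>v. v \<in> k_span H ?S \<Longrightarrow> \<epsilon> v = 0" "\<epsilon> (B N i0 j0) = 1"
    using separate[OF span_ksub[OF Sc] B_c] by blast
   have "\<epsilon> (B m k l) = 0" if "m \<le> N" "k < p" "l < p" "(m, k, l) \<noteq> (N, i0, j0)" for m k l
   proof (rule ep(2), rule subsetD[OF span_incl])
    show "B m k l \<in> ?S" using that by blast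
   qed
   then show ?thesis using ep(1,3) by (intro exI[of _ \<epsilon>]) auto
  qed
  show ?thesis
  proof (cases "n = N")
   case True
   then show ?thesis using top[OF Suc.prems(3,4)] by (simp add: less_Suc_eq_le)
  next
   case False
   then obtain \<psi> where f: "lin_form H \<psi>"
    and psi: "\<And>m k l. m < N \<Longrightarrow> k < p \<Longrightarrow> l < p \<Longrightarrow> \<psi> (B m k l) = (if m = n \<and> k = i \<and> l = j then 1 else 0)"
    using Suc.IH[of n i j] Suc.prems by auto
   have "\<forall>z\<in>{..<p} \<times> {..<p}. \<exists>\<epsilon>. lin_form H \<epsilon> \<and> (\<forall>m\<le>N. \<forall>k<p. \<forall>l<p. \<epsilon> (B m k l) = (if m = N \<and> k = fst z \<and> l = snd z then 1 else 0))"
    using top by auto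
   from bchoice[OF this] obtain \<epsilon> where ep0: "\<forall>z\<in>{..<p} \<times> {..<p}. lin_form H (\<epsilon> z) \<and>
    (\<forall>m\<le>N. \<forall>k<p. \<forall>l<p. \<epsilon> z (B m k l) = (if m = N \<and> k = fst z \<and> l = snd z then 1 else 0))" ..
   have ep: "lin_form H (\<epsilon> z)"
    "m \<le> N \<Longrightarrow> k < p \<Longrightarrow> l < p \<Longrightarrow> \<epsilon> z (B m k l) = (if m = N \<and> k = fst z \<and> l = snd z then 1 else 0)"
    if "z \<in> {..<p} \<times> {..<p}" for z m k l
    using bspec[OF ep0 that] by simp_all
   \<comment> \<open>The top forms vanish in lower degrees, so this correction spoils nothing
     there.\<close>
   let ?\<phi> = "\<lambda>v. \<psi> v + (\<Sum>z\<in>{..<p} \<times> {..<p}. (- \<psi> (B N (fst z) (snd z))) * \<epsilon> z v)"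
   have sl: "lin_form H (\<lambda>v. \<Sum>z\<in>{..<p} \<times> {..<p}. (- \<psi> (B N (fst z) (snd z))) * \<epsilon> z v)"
    by (rule lin_form_sum[OF kvs_axioms ep(1)])
   have "lin_form H ?\<phi>" using k_linear_add[OF ground_kvs f sl] by simp
   moreover have "?\<phi> (B m k l) = (if m = n \<and> k = i \<and> l = j then 1 else 0)" if m: "m < Suc N" "k < p" "l < p" for m k l
   proof (cases "m = N")
    case True
    have "(\<Sum>z\<in>{..<p} \<times> {..<p}. (- \<psi> (B N (fst z) (snd z))) * \<epsilon> z (B m k l)) =
     (\<Sum>z\<in>{..<p} \<times> {..<p}. if z = (k, l) then - \<psi> (B N k l) else 0)"
     using m True by (intro sum.cong refl) (auto simp: ep(2))
    also have "\<dots> = - \<psi> (B N k l)" using m by simp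
    finally show ?thesis using True \<open>n \<noteq> N\<close> by simp
   next
    case False
    have "(\<Sum>z\<in>{..<p} \<times> {..<p}. (- \<psi> (B N (fst z) (snd z))) * \<epsilon> z (B m k l)) = 0"
     using m False by (intro sum.neutral ballI) (simp add: ep(2))
    then show ?thesis using psi[of m k l] m False by simp
   qed
   ultimately show ?thesis by (intro exI[of _ ?\<phi>]) blast
  qed
 qed
qed simp

text \<open>Coordinate functionals of the monomials. Away from the span of the monomials they are an
  arbitrary extension, so they are true coordinates only from \<open>lift_full\<close> on.\<close>

definition co :: "nat \<Rightarrow> nat \<Rightarrow> nat \<Rightarrow> 'h \<Rightarrow> 'k" where
 "co n i j = (SOME \<phi>. lin_form H \<phi> \<and> (\<forall>m<p. \<forall>k<p. \<forall>l<p. \<phi> (B m k l) = (if m = n \<and> k = i \<and> l = j then 1 else 0)))"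

lemma co_props:
 assumes "n < p" "i < p" "j < p"
 shows "lin_form H (co n i j)"
  "m < p \<Longrightarrow> k < p \<Longrightarrow> l < p \<Longrightarrow> co n i j (B m k l) = (if m = n \<and> k = i \<and> l = j then 1 else 0)"
 using someI_ex[OF dual_exists[OF order_refl assms]] unfolding co_def[symmetric] by auto

lemma co_B_mod:
 assumes "n < p" "i < p" "j < p" "m < p"
 shows "co n i j (B m k l) = (if m = n \<and> k mod p = i \<and> l mod p = j then 1 else 0)"
 using co_props(2)[OF assms(1-4), of "k mod p" "l mod p"] p_gt_1 by (simp add: B_mod)

abbreviation "Ix \<equiv> {..<p} \<times> {..<p} \<times> {..<p}"
definition bb :: "nat \<times> nat \<times> nat \<Rightarrow> 'h" where "bb z = (case z of (n, i, j) \<Rightarrow> B n i j)"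
definition cz :: "nat \<times> nat \<times> nat \<Rightarrow> 'h \<Rightarrow> 'k" where "cz z = (case z of (n, i, j) \<Rightarrow> co n i j)"

lemma bb_c [simp, intro]: "bb z \<in> carrier H" by (cases z) (simp add: bb_def)

lemma cz_form: "z \<in> Ix \<Longrightarrow> lin_form H (cz z)"
 by (auto simp: cz_def intro: co_props(1))

lemma cz_bb: "z \<in> Ix \<Longrightarrow> w \<in> Ix \<Longrightarrow> cz z (bb w) = (if w = z then 1 else 0)"
 by (auto simp: cz_def bb_def co_props(2) split: if_splits)

lemma bb_inj: "inj_on bb Ix"
 by (rule inj_onI) (metis cz_bb zero_neq_one)

end

section \<open>The Hopf algebra with basis the monomials\<close>

locale lift_full = lift_basis H p e s t a b x
 for H :: "('k::field, 'h) bialg" (structure) and p e :: nat and s t :: 'k and a b x :: 'h +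
 assumes spans: "carrier H = k_span H (bb ` Ix)"
begin

lemma bb_sub: "bb ` Ix \<subseteq> carrier H" by auto

lemma linear_basis_eq:
 assumes "kvs W" "k_linear H W f" "k_linear H W f'"
  and "\<And>n i j. n < p \<Longrightarrow> i < p \<Longrightarrow> j < p \<Longrightarrow> f (B n i j) = f' (B n i j)" "v \<in> carrier H"
 shows "f v = f' v"
 by (rule linear_span_eq[OF assms(1-3) bb_sub]) (use assms(4,5) spans in \<open>auto simp: bb_def\<close>)

text \<open>The linear map with prescribed values on the basis. The antipode and the linear maps
  between liftings are obtained in this way.\<close>

lemma expand_linear:
 assumes "kvs W" "\<And>z. z \<in> Ix \<Longrightarrow> w z \<in> carrier W"
 shows "k_linear H W (\<lambda>v. finsum W (\<lambda>z. cz z v \<odot>\<^bsub>W\<^esub> w z) Ix)"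
proof (rule k_linear_finsum_fun[OF kvs_axioms assms(1)])
 fix z assume z: "z \<in> Ix"
 interpret W: kvs W by fact
 show "k_linear H W (\<lambda>v. cz z v \<odot>\<^bsub>W\<^esub> w z)"
  by (rule k_linearI) (use assms(2)[OF z] in \<open>simp_all add: form_simps[OF cz_form[OF z]] W.sm_add_l W.sm_assoc\<close>)
qed simp

lemma expand_bb:
 assumes "kvs W" "\<And>z. z \<in> Ix \<Longrightarrow> w z \<in> carrier W" "y \<in> Ix"
 shows "finsum W (\<lambda>z. cz z (bb y) \<odot>\<^bsub>W\<^esub> w z) Ix = w y"
proof -
 interpret W: kvs W by fact
 have "finsum W (\<lambda>z. cz z (bb y) \<odot>\<^bsub>W\<^esub> w z) Ix = finsum W (\<lambda>z. if y = z then w z else \<zero>\<^bsub>W\<^esub>) Ix"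
  by (rule W.M.finsum_cong') (use assms cz_bb in auto)
 also have "\<dots> = w y" by (rule W.M.finsum_singleton) (use assms in auto)
 finally show ?thesis .
qed

lemma expand: "v \<in> carrier H \<Longrightarrow> v = (\<Oplus>z\<in>Ix. cz z v \<odot> bb z)"
proof (rule linear_basis_eq[OF kvs_axioms k_linear_id expand_linear[OF kvs_axioms]])
 fix n i j assume "n < p" "i < p" "j < p"
 then show "B n i j = (\<Oplus>z\<in>Ix. cz z (B n i j) \<odot> bb z)"
  using expand_bb[OF kvs_axioms bb_c, of "(n, i, j)"] by (simp add: bb_def)
qed auto

lemma form_expand: "v \<in> carrier H \<Longrightarrow> lin_form H \<phi> \<Longrightarrow> \<phi> v = (\<Sum>z\<in>Ix. cz z v * \<phi> (bb z))"
proof -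
 assume v: "v \<in> carrier H" and f: "lin_form H \<phi>"
 have "\<phi> v = \<phi> (\<Oplus>z\<in>Ix. cz z v \<odot> bb z)" using expand[OF v] by simp
 then show ?thesis by (simp add: form_simps(6)[OF f] form_simps(3)[OF f])
qed

lemma dimension: "has_dimension H (p ^ 3)"
proof -
 let ?B = "bb ` Ix"
 have "card ?B = p ^ 3" using card_image[OF bb_inj] by (simp add: card_cartesian_product power3_eq_cube)
 moreover have "\<exists>!k. k \<in> ?B \<rightarrow>\<^sub>E (UNIV :: 'k set) \<and> v = (\<Oplus>u\<in>?B. k u \<odot> u)" if v: "v \<in> carrier H" for v
 proof
  have re: "(\<Oplus>u\<in>?B. k u \<odot> u) = (\<Oplus>z\<in>Ix. k (bb z) \<odot> bb z)" for k
   by (rule M.finsum_reindex[OF _ bb_inj]) auto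
  let ?k = "\<lambda>u\<in>?B. cz (inv_into Ix bb u) v"
  have "(\<Oplus>z\<in>Ix. ?k (bb z) \<odot> bb z) = (\<Oplus>z\<in>Ix. cz z v \<odot> bb z)"
   by (rule M.finsum_cong') (auto simp: inv_into_f_f[OF bb_inj])
  then show "?k \<in> ?B \<rightarrow>\<^sub>E UNIV \<and> v = (\<Oplus>u\<in>?B. ?k u \<odot> u)" unfolding re using expand[OF v] by auto
  fix k assume k: "k \<in> ?B \<rightarrow>\<^sub>E (UNIV :: 'k set) \<and> v = (\<Oplus>u\<in>?B. k u \<odot> u)"
  then have vk: "v = (\<Oplus>z\<in>Ix. k (bb z) \<odot> bb z)" by (simp only: re)
  have "cz z v = k (bb z)" if z: "z \<in> Ix" for z
  proof -
   have "cz z v = (\<Sum>y\<in>Ix. k (bb y) * cz z (bb y))"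
    unfolding vk by (simp add: form_simps(6)[OF cz_form[OF z]] form_simps(3)[OF cz_form[OF z]])
   also have "\<dots> = (\<Sum>y\<in>Ix. if y = z then k (bb z) else 0)"
    by (intro sum.cong refl) (auto simp: cz_bb[OF z])
   finally show ?thesis using z by simp
  qed
  then show "k = ?k" using k by (intro extensionalityI[of _ ?B]) (auto simp: inv_into_f_f[OF bb_inj] PiE_def)
 qed
 ultimately show ?thesis unfolding has_dimension_def using bb_sub by (intro exI[of _ ?B]) auto
qed

subsection \<open>The Hopf algebra axioms\<close>

lemma cv_lin: "lin_form H \<phi> \<Longrightarrow> lin_form H \<psi> \<Longrightarrow> lin_form H (\<lambda>v. HH.tf \<phi> \<psi> (\<Delta> v))"
 by (rule k_linear_comp[OF comult_lin HH.tf_linear])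

text \<open>Both sides are sums over triples of degrees. They agree term by term after the
  substitution m = k + l, by the identity (n choose k)(n-k choose m-k) = (n choose m)(m choose k)
  and because the powers of g add up.\<close>

lemma coassoc_forms:
 assumes f: "lin_form H \<phi>" "lin_form H \<psi>" "lin_form H \<chi>" and v: "v \<in> carrier H"
 shows "HH.tf (\<lambda>v. HH.tf \<phi> \<psi> (\<Delta> v)) \<chi> (\<Delta> v) = HH.tf \<phi> (\<lambda>v. HH.tf \<psi> \<chi> (\<Delta> v)) (\<Delta> v)"
proof (rule linear_basis_eq[OF ground_kvs cv_lin[OF cv_lin[OF f(1,2)] f(3)] cv_lin[OF f(1) cv_lin[OF f(2,3)]] _ v])
 fix n i j
 define T where "T k l = of_nat ((n choose k) * ((n - k) choose l)) *
  (\<phi> (B (n - k - l) (i + e * k + e * l) j) * \<psi> (B l (i + e * k) j) * \<chi> (B k i j))" for k l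
 have "HH.tf (\<lambda>v. HH.tf \<phi> \<psi> (\<Delta> v)) \<chi> (\<Delta> (B n i j)) = (\<Sum>k\<le>n. \<Sum>l\<le>n - k. T k l)"
  unfolding tf_B[OF cv_lin[OF f(1,2)] f(3)] tf_B[OF f(1,2)] T_def
  by (simp add: sum_distrib_left sum_distrib_right algebra_simps)
 also have "\<dots> = (\<Sum>(k, l)\<in>{(k, l). k + l \<le> n}. T k l)"
  by (subst sum.Sigma) (auto intro!: sum.cong)
 also have "\<dots> = (\<Sum>m\<le>n. \<Sum>k\<le>m. T k (m - k))"
  by (rule sum.triangle_reindex_eq)
 also have "\<dots> = (\<Sum>m\<le>n. of_nat (n choose m) * (\<phi> (B (n - m) (i + e * m) j) * (\<Sum>k\<le>m. of_nat (m choose k) * (\<psi> (B (m - k) (i + e * k) j) * \<chi> (B k i j)))))"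
 proof (rule sum.cong[OF refl])
  fix m assume m: "m \<in> {..n}"
  have "T k (m - k) = of_nat (n choose m) * (\<phi> (B (n - m) (i + e * m) j) * (of_nat (m choose k) * (\<psi> (B (m - k) (i + e * k) j) * \<chi> (B k i j))))"
   if k: "k \<in> {..m}" for k
  proof -
   have i: "i + e * k + e * (m - k) = i + e * m" using k by (simp add: diff_mult_distrib2)
   have d: "n - k - (m - k) = n - m" using k m by simp
   have "(n choose k) * ((n - k) choose (m - k)) = (n choose m) * (m choose k)"
    using choose_mult[of k m n] k m by simp
   then show ?thesis unfolding T_def i d by (simp only: of_nat_mult mult.assoc mult.left_commute[of "of_nat (m choose k)"])
  qed
  then show "(\<Sum>k\<le>m. T k (m - k)) = of_nat (n choose m) * (\<phi> (B (n - m) (i + e * m) j) * (\<Sum>k\<le>m. of_nat (m choose k) * (\<psi> (B (m - k) (i + e * k) j) * \<chi> (B k i j))))"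
   by (simp add: sum_distrib_left)
 qed
 also have "\<dots> = HH.tf \<phi> (\<lambda>v. HH.tf \<psi> \<chi> (\<Delta> v)) (\<Delta> (B n i j))"
  unfolding tf_B[OF f(1) cv_lin[OF f(2,3)]] tf_B[OF f(2,3)] ..
 finally show "HH.tf (\<lambda>v. HH.tf \<phi> \<psi> (\<Delta> v)) \<chi> (\<Delta> (B n i j)) = HH.tf \<phi> (\<lambda>v. HH.tf \<psi> \<chi> (\<Delta> v)) (\<Delta> (B n i j))" .
qed

lemma is_bialgebra: "bialgebra H"
proof
 show "k_linear H (tensor H H) \<Delta>" by (rule comult_linear)
 show "k_linear H ground_algebra (counit H)" by (rule counit_linear)
 show "\<Delta> \<in> ring_hom H (tensor H H)" by (rule comult_mult)
 show "counit H \<in> ring_hom H ground_algebra" by (rule counit_mult)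
 interpret H3: kvs_triple H H H ..
 have idl: "k_linear H H id" using k_linear_id by (simp add: id_def)
 note kv = HH.tensor_kvs kvs_axioms
 fix h assume h: "h \<in> carrier H"
 have m1: "tensor_map (tensor H H) H \<Delta> id (\<Delta> h) \<in> carrier H3.L.T"
  using k_linearD(1)[OF tensor_map_linear(1)[OF kv(2,2) kv comult_linear idl]] h by simp
 have m2: "tensor_map H (tensor H H) id \<Delta> (\<Delta> h) \<in> carrier H3.R.T"
  using k_linearD(1)[OF tensor_map_linear(1)[OF kv(2,2) kv(2,1) idl comult_linear]] h by simp
 show "tensor_assoc H H H (tensor_map (tensor H H) H \<Delta> id (\<Delta> h)) = tensor_map H (tensor H H) id \<Delta> (\<Delta> h)"
 proof (rule H3.tf3_eqI[OF k_linearD(1)[OF H3.assoc_linear m1] m2])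
  fix \<phi> \<psi> \<chi> assume f: "lin_form H \<phi>" "lin_form H \<psi>" "lin_form H \<chi>"
  have f1: "lin_form (tensor H H) (HH.tf \<phi> \<psi>)" "lin_form (tensor H H) (HH.tf \<psi> \<chi>)"
   using HH.tf_linear f by simp_all
  show "H3.R.tf \<phi> (HH.tf \<psi> \<chi>) (tensor_assoc H H H (tensor_map (tensor H H) H \<Delta> id (\<Delta> h))) =
   H3.R.tf \<phi> (HH.tf \<psi> \<chi>) (tensor_map H (tensor H H) id \<Delta> (\<Delta> h))"
   using H3.tf_assoc[OF f m1] coassoc_forms[OF f h] h
    tf_tensor_map[OF kv(2,2) kv comult_linear idl f1(1) f(3), of "\<Delta> h"]
    tf_tensor_map[OF kv(2,2) kv(2,1) idl comult_linear f(1) f1(2), of "\<Delta> h"] by simp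
 qed
 note cl = counit_linear
 have "HH.lsl (counit H) (\<Delta> h) = h"
 proof (rule form_eqI)
  show "HH.lsl (counit H) (\<Delta> h) \<in> carrier H" using k_linearD(1)[OF HH.lsl_linear[OF cl]] h by simp
  fix \<psi> assume f: "lin_form H \<psi>"
  have "HH.tf (counit H) \<psi> (\<Delta> h) = \<psi> h"
  proof (rule linear_basis_eq[OF ground_kvs cv_lin[OF cl f] f _ h])
   fix n i j
   have "(\<Sum>k\<le>n. of_nat (n choose k) * (counit H (B (n - k) (i + e * k) j) * \<psi> (B k i j))) = (\<Sum>k\<le>n. if k = n then \<psi> (B n i j) else 0)"
    by (intro sum.cong refl) (auto simp: counit_B)
   then show "HH.tf (counit H) \<psi> (\<Delta> (B n i j)) = \<psi> (B n i j)" by (simp add: tf_B[OF cl f])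
  qed
  then show "\<psi> (HH.lsl (counit H) (\<Delta> h)) = \<psi> h" using HH.form_lsl[OF cl f] h by simp
 qed (rule h)
 then show "tensor_lift H (\<lambda>a b. counit H a \<odot> b) (\<Delta> h) = h" by (simp add: HH.lsl_def)
 have "HH.rsl (counit H) (\<Delta> h) = h"
 proof (rule form_eqI)
  show "HH.rsl (counit H) (\<Delta> h) \<in> carrier H" using k_linearD(1)[OF HH.rsl_linear[OF cl]] h by simp
  fix \<psi> assume f: "lin_form H \<psi>"
  have "HH.tf \<psi> (counit H) (\<Delta> h) = \<psi> h"
  proof (rule linear_basis_eq[OF ground_kvs cv_lin[OF f cl] f _ h])
   fix n i j
   have "(\<Sum>k\<le>n. of_nat (n choose k) * (\<psi> (B (n - k) (i + e * k) j) * counit H (B k i j))) = (\<Sum>k\<le>n. if k = 0 then \<psi> (B n i j) else 0)"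
    by (intro sum.cong refl) (auto simp: counit_B)
   then show "HH.tf \<psi> (counit H) (\<Delta> (B n i j)) = \<psi> (B n i j)" by (simp add: tf_B[OF f cl])
  qed
  then show "\<psi> (HH.rsl (counit H) (\<Delta> h)) = \<psi> h" using HH.form_rsl[OF f cl] h by simp
 qed (rule h)
 then show "tensor_lift H (\<lambda>a b. counit H b \<odot> a) (\<Delta> h) = h" by (simp add: HH.rsl_def)
qed

text \<open>The value of the antipode at \<open>B n i j\<close>: the inverse of a^i b^j g^n, with
  exponents multiplied by p - 1, times the falling factorial of - x. For n = 1 and i = j = 0 this is
  the usual value - g^(-1) x.\<close>

definition sb :: "nat \<Rightarrow> nat \<Rightarrow> nat \<Rightarrow> 'h" where
 "sb n i j = hh ((p - 1) * (i + e * n)) ((p - 1) * j) \<otimes> ff H s (\<ominus> x) n"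

definition antipode :: "'h \<Rightarrow> 'h" where
 "antipode v = (\<Oplus>z\<in>Ix. cz z v \<odot> (case z of (n, i, j) \<Rightarrow> sb n i j))"

lemma sb_c [simp, intro]: "sb n i j \<in> carrier H"
 by (auto simp: sb_def)

lemma sb_mod: "sb n (i mod p) (j mod p) = sb n i j"
proof -
 have m: "((p - 1) * (i mod p + e * n)) mod p = ((p - 1) * (i + e * n)) mod p" "((p - 1) * (j mod p)) mod p = ((p - 1) * j) mod p"
  by (metis mod_add_left_eq mod_mult_right_eq, metis mod_mult_right_eq)
 have "hh ((p - 1) * (i mod p + e * n)) ((p - 1) * (j mod p)) = hh ((p - 1) * (i + e * n)) ((p - 1) * j)"
  by (metis hh_mod m)
 then show ?thesis by (simp add: sb_def)
qed

lemma antipode_linear: "k_linear H H antipode"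
 unfolding antipode_def[abs_def] by (rule expand_linear[OF kvs_axioms]) auto

lemma antipode_B: "n < p \<Longrightarrow> antipode (B n i j) = sb n i j"
proof -
 assume n: "n < p"
 have "antipode (bb (n, i mod p, j mod p)) = sb n (i mod p) (j mod p)"
  unfolding antipode_def by (subst expand_bb[OF kvs_axioms]) (use n p_gt_1 in auto)
 then show ?thesis by (simp add: bb_def B_mod sb_mod)
qed

lemma inverse_index: "n + (p - 1) * n = p * n"
 using p_gt_1 by (cases p) auto

lemma hh_inverse: "hh i j \<otimes> hh ((p - 1) * i) ((p - 1) * j) = \<one>" "hh ((p - 1) * i) ((p - 1) * j) \<otimes> hh i j = \<one>"
proof -
 have "hh (p * i) (p * j) = \<one>" using hh_mod[of "p * i" "p * j"] hh_simps(1) by simp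
 then show "hh i j \<otimes> hh ((p - 1) * i) ((p - 1) * j) = \<one>" "hh ((p - 1) * i) ((p - 1) * j) \<otimes> hh i j = \<one>"
  by (simp_all only: hh_mult inverse_index add.commute[of "(p - 1) * i" i] add.commute[of "(p - 1) * j" j])
qed

lemma ff_zero: "n > 0 \<Longrightarrow> ff H s \<zero> n = \<zero>"
proof (induction n)
 case (Suc n) then show ?case by (cases n) (simp_all add: a_minus_def)
qed simp

text \<open>\<open>binomial_ff\<close> with g = 1 for the commuting elements x and - x, whose sum is
  zero.\<close>

lemma vandermonde:
 assumes "u = x \<and> v = \<ominus> x \<or> u = \<ominus> x \<and> v = x"
 shows "(\<Oplus>k\<in>{..n}. of_nat (n choose k) \<odot> (ff H s u (n - k) \<otimes> ff H s v k)) = (if n = 0 then \<one> else \<zero>)"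
proof -
 have uc: "u \<in> carrier H" "v \<in> carrier H" using assms by auto
 have uv: "u \<oplus> v = \<zero>" using assms by (auto simp: M.r_neg M.l_neg)
 have xx: "x \<otimes> (\<ominus> x) = \<ominus> (x \<otimes> x)" "(\<ominus> x) \<otimes> x = \<ominus> (x \<otimes> x)"
  using k_linear_neg[OF lmult_linear kvs_axioms] k_linear_neg[OF rmult_linear kvs_axioms] by auto
 have "v \<otimes> u = u \<otimes> v" using assms xx by auto
 then have "ff H s (u \<oplus> \<one> \<otimes> v) n = (\<Oplus>k\<in>{..n}. of_nat (n choose k) \<odot> (ff H s u (n - k) \<otimes> \<one> [^] k \<otimes> ff H s v k))"
  by (intro binomial_ff) (use uc in \<open>simp_all add: a_minus_def M.r_neg\<close>)
 moreover have "\<one> [^] k = \<one>" for k :: nat by (induction k) simp_all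
 ultimately show ?thesis using uc uv ff_zero[of n] by simp
qed

lemma lift_comult_B:
 assumes "k_bilinear H H H \<beta>"
 shows "tensor_lift H \<beta> (\<Delta> (B n i j)) = (\<Oplus>k\<in>{..n}. of_nat (n choose k) \<odot> \<beta> (B (n - k) (i + e * k) j) (B k i j))"
 unfolding comult_B
 by (subst HH.T.k_linear_finsum[OF HH.lift_linear[OF kvs_axioms assms] kvs_axioms])
  (auto simp: k_linearD(3)[OF HH.lift_linear[OF kvs_axioms assms]] HH.lift_pure[OF kvs_axioms assms])

text \<open>In each convolution of the antipode with the identity the group elements either combine
  to factors independent of the summation index or cancel. The remaining sum is
  \<open>vandermonde\<close>.\<close>

lemma is_hopf: "hopf_algebra H"
proof -
 let ?l = "\<lambda>u v. antipode u \<otimes> v" and ?r = "\<lambda>u v. u \<otimes> antipode v"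
 have lb: "k_bilinear H H H ?l"
  unfolding k_bilinear_def using k_linear_comp[OF antipode_linear rmult_linear] lmult_linear k_linearD(1)[OF antipode_linear] by blast
 have rb: "k_bilinear H H H ?r"
  unfolding k_bilinear_def using k_linear_comp[OF antipode_linear lmult_linear] rmult_linear k_linearD(1)[OF antipode_linear] by blast
 have ul: "k_linear H H (\<lambda>h. counit H h \<odot> \<one>)"
  by (rule k_linearI) (simp_all add: form_simps[OF counit_linear] sm_add_l sm_assoc)
 have l: "tensor_lift H ?l (\<Delta> h) = counit H h \<odot> \<one>" if h: "h \<in> carrier H" for h
 proof (rule linear_basis_eq[OF kvs_axioms k_linear_comp[OF comult_lin HH.lift_linear[OF kvs_axioms lb]] ul _ h])
  fix n i j assume n: "n < p" "i < p" "j < p"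
  let ?h = "hh ((p - 1) * (i + e * n)) ((p - 1) * j)"
  let ?f = "\<lambda>k. of_nat (n choose k) \<odot> (ff H s (\<ominus> x) (n - k) \<otimes> ff H s x k)"
  have mc: "\<ominus> x \<in> carrier H" by simp
  have L: "k_linear H H (\<lambda>v. ?h \<otimes> v \<otimes> hh i j)" by (rule k_linear_comp[OF lmult_linear rmult_linear]) auto
  have fc: "?f \<in> {..n} \<rightarrow> carrier H" using mc by auto
  have "tensor_lift H ?l (\<Delta> (B n i j)) = (\<Oplus>k\<in>{..n}. of_nat (n choose k) \<odot> (antipode (B (n - k) (i + e * k) j) \<otimes> B k i j))"
   by (rule lift_comult_B[OF lb])
  also have "\<dots> = (\<Oplus>k\<in>{..n}. ?h \<otimes> ?f k \<otimes> hh i j)"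
  proof (rule M.finsum_cong'[OF refl])
   fix k assume k: "k \<in> {..n}"
   have ik: "i + e * k + e * (n - k) = i + e * n" using k by (simp add: diff_mult_distrib2)
   have "antipode (B (n - k) (i + e * k) j) = ?h \<otimes> ff H s (\<ominus> x) (n - k)"
    using n by (subst antipode_B) (simp_all add: sb_def ik)
   then show "of_nat (n choose k) \<odot> (antipode (B (n - k) (i + e * k) j) \<otimes> B k i j) = ?h \<otimes> ?f k \<otimes> hh i j"
    using mc by (simp add: B_def xf_def mult_assoc' smult_mult_left smult_mult_right)
  qed (use mc in auto)
  also have "\<dots> = ?h \<otimes> finsum H ?f {..n} \<otimes> hh i j"
   using k_linear_finsum[OF L kvs_axioms fc] by simp
  also have "\<dots> = counit H (B n i j) \<odot> \<one>"
   using vandermonde[of "\<ominus> x" x n] hh_inverse(2)[of i j] by (simp add: counit_B)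
  finally show "tensor_lift H ?l (\<Delta> (B n i j)) = counit H (B n i j) \<odot> \<one>" .
 qed
 have r: "tensor_lift H ?r (\<Delta> h) = counit H h \<odot> \<one>" if h: "h \<in> carrier H" for h
 proof (rule linear_basis_eq[OF kvs_axioms k_linear_comp[OF comult_lin HH.lift_linear[OF kvs_axioms rb]] ul _ h])
  fix n i j assume n: "n < p" "i < p" "j < p"
  let ?f = "\<lambda>k. of_nat (n choose k) \<odot> (ff H s x (n - k) \<otimes> ff H s (\<ominus> x) k)"
  have mc: "\<ominus> x \<in> carrier H" by simp
  have "tensor_lift H ?r (\<Delta> (B n i j)) = (\<Oplus>k\<in>{..n}. of_nat (n choose k) \<odot> (B (n - k) (i + e * k) j \<otimes> antipode (B k i j)))"
   by (rule lift_comult_B[OF rb])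
  also have "\<dots> = finsum H ?f {..n}"
  proof (rule M.finsum_cong'[OF refl])
   fix k assume k: "k \<in> {..n}"
   let ?g = "hh ((p - 1) * (i + e * k)) ((p - 1) * j)"
   have A: "antipode (B k i j) = ?g \<otimes> ff H s (\<ominus> x) k" using n k by (subst antipode_B) (auto simp: sb_def)
   have "B (n - k) (i + e * k) j \<otimes> antipode (B k i j) = xf (n - k) \<otimes> (hh (i + e * k) j \<otimes> ?g) \<otimes> ff H s (\<ominus> x) k"
    unfolding A unfolding B_def using mc by (simp add: mult_assoc')
   also have "\<dots> = ff H s x (n - k) \<otimes> ff H s (\<ominus> x) k" using mc hh_inverse(1)[of "i + e * k" j] by (simp add: xf_def)
   finally show "of_nat (n choose k) \<odot> (B (n - k) (i + e * k) j \<otimes> antipode (B k i j)) = ?f k" by simp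
  qed (use mc in auto)
  also have "\<dots> = counit H (B n i j) \<odot> \<one>"
   using vandermonde[of x "\<ominus> x" n] by (simp add: counit_B)
  finally show "tensor_lift H ?r (\<Delta> (B n i j)) = counit H (B n i j) \<odot> \<one>" .
 qed
 show ?thesis
  by (rule hopf_algebra.intro[OF is_bialgebra], rule hopf_algebra_axioms.intro)
   (intro exI[of _ antipode] conjI ballI antipode_linear l r)
qed

end

section \<open>Slices of the coproduct at coefficients of top degree\<close>

context lift_full begin

text \<open>In each term of \<Delta> (B n i j) the right factor keeps the group part (i, j), so a
  coordinate functional in the second slot selects the monomials with group part (i0, j0) and one
  term of each.\<close>

lemma TF:
 assumes f: "lin_form H \<phi>" and v: "v \<in> carrier H" and r: "r < p" "i0 < p" "j0 < p"
 shows "HH.tf \<phi> (co r i0 j0) (\<Delta> v) = (\<Sum>n<p. (of_nat (n choose r) * \<phi> (B (n - r) (i0 + e * r) j0)) * co n i0 j0 v)"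
proof (rule linear_basis_eq[OF ground_kvs cv_lin[OF f co_props(1)[OF r]] lin_form_sum[OF kvs_axioms] _ v])
 show "lin_form H (co n i0 j0)" if "n \<in> {..<p}" for n using co_props(1) r that by simp
 fix n i j assume n: "n < p" "i < p" "j < p"
 let ?K = "\<lambda>n. of_nat (n choose r) * \<phi> (B (n - r) (i0 + e * r) j0)"
 have "HH.tf \<phi> (co r i0 j0) (\<Delta> (B n i j)) =
   (\<Sum>k\<le>n. if k = r then (if i = i0 \<and> j = j0 then ?K n else 0) else 0)"
  unfolding tf_B[OF f co_props(1)[OF r]]
  by (intro sum.cong refl) (use n r in \<open>auto simp: co_props(2)\<close>)
 also have "\<dots> = (if i = i0 \<and> j = j0 then ?K n else 0)" by (auto simp: binomial_eq_0)
 also have "\<dots> = (\<Sum>m<p. if m = n then (if i = i0 \<and> j = j0 then ?K n else 0) else 0)" using n by simp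
 also have "\<dots> = (\<Sum>m<p. ?K m * co m i0 j0 (B n i j))"
  by (intro sum.cong refl) (use n r in \<open>auto simp: co_props(2)\<close>)
 finally show "HH.tf \<phi> (co r i0 j0) (\<Delta> (B n i j)) = (\<Sum>m<p. ?K m * co m i0 j0 (B n i j))" .
qed

lemma top_exists:
 assumes "m0 < p" "k0 < p" "l0 < p" "co m0 k0 l0 v \<noteq> 0"
 shows "\<exists>m k l. m0 \<le> m \<and> m < p \<and> k < p \<and> l < p \<and> co m k l v \<noteq> 0 \<and>
  (\<forall>m' k' l'. m < m' \<longrightarrow> m' < p \<longrightarrow> k' < p \<longrightarrow> l' < p \<longrightarrow> co m' k' l' v = 0)"
proof -
 define M where "M = {m. m < p \<and> (\<exists>k<p. \<exists>l<p. co m k l v \<noteq> 0)}"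
 have M: "finite M" "m0 \<in> M" using assms by (auto simp: M_def)
 then have "Max M \<in> M" "m0 \<le> Max M" by (auto intro: Max_in)
 then obtain k l where "Max M < p" "k < p" "l < p" "co (Max M) k l v \<noteq> 0" by (auto simp: M_def)
 moreover have "co m' k' l' v = 0" if "Max M < m'" "m' < p" "k' < p" "l' < p" for m' k' l'
 proof (rule ccontr)
  assume "co m' k' l' v \<noteq> 0"
  then have "m' \<in> M" using that by (auto simp: M_def)
  then show False using Max_ge[OF M(1)] that(1) by fastforce
 qed
 ultimately show ?thesis using \<open>m0 \<le> Max M\<close> by blast
qed

lemma TF_top:
 assumes f: "lin_form H \<phi>" and v: "v \<in> carrier H" and m: "m < p" "k < p" "l < p"
  and top: "\<And>m'. m < m' \<Longrightarrow> m' < p \<Longrightarrow> co m' k l v = 0"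
 shows "HH.tf \<phi> (co m k l) (\<Delta> v) = co m k l v * \<phi> (hh (k + e * m) l)"
proof -
 have "HH.tf \<phi> (co m k l) (\<Delta> v) = (\<Sum>n<p. if n = m then co m k l v * \<phi> (hh (k + e * m) l) else 0)"
  unfolding TF[OF f v m]
 proof (intro sum.cong refl)
  fix n assume "n \<in> {..<p}"
  then show "of_nat (n choose m) * \<phi> (B (n - m) (k + e * m) l) * co n k l v = (if n = m then co m k l v * \<phi> (hh (k + e * m) l) else 0)"
   using top[of n] by (cases n m rule: linorder_cases) (auto simp: binomial_eq_0 B_simps)
 qed
 then show ?thesis using m by simp
qed

lemma zero_by_co:
 assumes "v \<in> carrier H" "\<And>m k l. m < p \<Longrightarrow> k < p \<Longrightarrow> l < p \<Longrightarrow> co m k l v = 0"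
 shows "v = \<zero>"
proof -
 have "v = (\<Oplus>z\<in>Ix. cz z v \<odot> bb z)" by (rule expand[OF assms(1)])
 also have "\<dots> = (\<Oplus>z\<in>Ix. \<zero>)" by (rule M.finsum_cong') (use assms(2) in \<open>auto simp: cz_def\<close>)
 finally show ?thesis by simp
qed

lemma nonzero_top:
 assumes "v \<in> carrier H" "v \<noteq> \<zero>"
 shows "\<exists>m k l. m < p \<and> k < p \<and> l < p \<and> co m k l v \<noteq> 0 \<and>
  (\<forall>m' k' l'. m < m' \<longrightarrow> m' < p \<longrightarrow> k' < p \<longrightarrow> l' < p \<longrightarrow> co m' k' l' v = 0)"
proof -
 obtain m k l where "m < p" "k < p" "l < p" "co m k l v \<noteq> 0"
  using zero_by_co[OF assms(1)] assms(2) by blast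
 from top_exists[OF this] show ?thesis by blast
qed

text \<open>At a coefficient of top degree nothing of positive degree is left in the first tensor
  factor, so the slice is a multiple of one group element. This is how nonzero subcoalgebras and
  grouplike elements are made to meet the group.\<close>

lemma rsl_top:
 assumes v: "v \<in> carrier H" and m: "m < p" "k < p" "l < p"
  and top: "\<And>m'. m < m' \<Longrightarrow> m' < p \<Longrightarrow> co m' k l v = 0"
 shows "HH.rsl (co m k l) (\<Delta> v) = co m k l v \<odot> hh (k + e * m) l"
proof (rule form_eqI)
 note f = co_props(1)[OF m]
 show "HH.rsl (co m k l) (\<Delta> v) \<in> carrier H" using k_linearD(1)[OF HH.rsl_linear[OF f]] v by simp
 fix \<phi> assume ph: "lin_form H \<phi>"
 show "\<phi> (HH.rsl (co m k l) (\<Delta> v)) = \<phi> (co m k l v \<odot> hh (k + e * m) l)"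
  using HH.form_rsl[OF ph f] v TF_top[OF ph v m top] by (simp add: form_simps[OF ph])
qed simp

subsection \<open>Subcoalgebras and grouplike elements\<close>

lemma sub_tensor_rsl:
 assumes C: "k_subspace H C" and f: "lin_form H \<psi>"
  and y: "y \<in> sub_tensor H C C"
 shows "HH.rsl \<psi> y \<in> C"
proof -
 note CD = ksubD[OF C]
 note rl = HH.rsl_linear[OF f]
 have "k_subspace (tensor H H) {t \<in> carrier (tensor H H). HH.rsl \<psi> t \<in> C}"
  by (rule TA.ksubI) (use CD in \<open>auto simp: k_linearD[OF rl] HH.T.k_linear_zero[OF rl kvs_axioms]\<close>)
 moreover have "{HH.pt v w |v w. v \<in> C \<and> w \<in> C} \<subseteq> {t \<in> carrier (tensor H H). HH.rsl \<psi> t \<in> C}"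
  using CD(1,4) f by (auto simp: HH.rsl_pure subset_iff)
 ultimately have "sub_tensor H C C \<subseteq> {t \<in> carrier (tensor H H). HH.rsl \<psi> t \<in> C}"
  unfolding sub_tensor_def by (rule TA.span_min)
 then show ?thesis using y by blast
qed

lemma subcoalgebra_hh:
 assumes "subcoalgebra C H" "C \<noteq> {\<zero>}"
 obtains i j where "hh i j \<in> C"
proof -
 have C: "k_subspace H C" "\<Delta> ` C \<subseteq> sub_tensor H C C"
  using assms by (auto simp: subcoalgebra_def)
 note CD = ksubD[OF C(1)]
 obtain v where v: "v \<in> C" "v \<noteq> \<zero>" "v \<in> carrier H" using assms(2) CD(1,2) by blast
 obtain m k l where m: "m < p" "k < p" "l < p" "co m k l v \<noteq> 0"
  "\<forall>m' k' l'. m < m' \<longrightarrow> m' < p \<longrightarrow> k' < p \<longrightarrow> l' < p \<longrightarrow> co m' k' l' v = 0"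
  using nonzero_top[OF v(3,2)] by blast
 have "HH.rsl (co m k l) (\<Delta> v) \<in> C"
  by (rule sub_tensor_rsl[OF C(1) co_props(1)[OF m(1-3)]]) (use v C(2) in blast)
 then have "co m k l v \<odot> hh (k + e * m) l \<in> C" using rsl_top[OF v(3) m(1-3) m(5)[rule_format]] m by simp
 then have "inverse (co m k l v) \<odot> (co m k l v \<odot> hh (k + e * m) l) \<in> C" by (rule CD(4))
 then have "hh (k + e * m) l \<in> C" using m(4) by (simp add: sm_assoc)
 then show ?thesis by (rule that)
qed

definition line :: "nat \<Rightarrow> nat \<Rightarrow> 'h set" where "line i j = {d \<odot> hh i j |d. True}"

lemma line_ks: "k_subspace H (line i j)"
proof (rule ksubI)
 show "\<zero> \<in> line i j" unfolding line_def using sm_0[OF hh_c, symmetric] by blast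
 show "u \<oplus> v \<in> line i j" if "u \<in> line i j" "v \<in> line i j" for u v
  using that sm_add_l[OF hh_c, symmetric] unfolding line_def by blast
 show "d \<odot> u \<in> line i j" if "u \<in> line i j" for d u
  using that sm_assoc[OF hh_c] unfolding line_def by blast
qed (auto simp: line_def)

lemma hh_line: "hh i j \<in> line i j"
 unfolding line_def using sm_one[OF hh_c, symmetric] by blast

lemma line_subcoalgebra: "subcoalgebra (line i j) H"
 unfolding subcoalgebra_def
proof (intro conjI line_ks subsetI)
 fix t assume "t \<in> \<Delta> ` line i j"
 then obtain d where t: "t = \<Delta> (d \<odot> hh i j)" unfolding line_def by blast
 have sub: "{HH.pt v w |v w. v \<in> line i j \<and> w \<in> line i j} \<subseteq> carrier (tensor H H)"
  using ksubD(1)[OF line_ks] by (auto intro!: HH.pure_closed dest: subsetD)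
 have "HH.pt (hh i j) (hh i j) \<in> sub_tensor H (line i j) (line i j)"
  unfolding sub_tensor_def by (rule subsetD[OF TA.span_incl]) (use hh_line in blast)
 from TA.ksubD(4)[OF TA.span_ksub[OF sub], folded sub_tensor_def, OF this, of d]
 show "t \<in> sub_tensor H (line i j) (line i j)"
  unfolding t by (simp add: k_linearD(3)[OF comult_lin] comult_hh)
qed

lemma hh_neq0: "hh i j \<noteq> \<zero>"
 using counit_hh[of i j] form_simps(1)[OF counit_linear] by auto

lemma line_sub:
 assumes "k_subspace H D" "hh i j \<in> D"
 shows "line i j \<subseteq> D"
 using ksubD(4)[OF assms(1,2)] by (auto simp: line_def)

lemma line_simple: "simple_subcoalgebra (line i j) H"
 unfolding simple_subcoalgebra_def
proof (intro conjI line_subcoalgebra allI impI)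
 show "line i j \<noteq> {\<zero>}" using hh_line hh_neq0 by blast
 fix D assume D: "subcoalgebra D H \<and> D \<subseteq> line i j"
 then have Dk: "k_subspace H D" by (simp add: subcoalgebra_def)
 show "D = {\<zero>} \<or> D = line i j"
 proof (rule disjCI)
  assume "D \<noteq> line i j"
  show "D = {\<zero>}"
  proof (rule ccontr)
   assume "D \<noteq> {\<zero>}"
   then obtain v where v: "v \<in> D" "v \<noteq> \<zero>" using ksubD(2)[OF Dk] by blast
   then obtain d where d: "v = d \<odot> hh i j" using D unfolding line_def by blast
   then have "d \<noteq> 0" using v by auto
   then have "inverse d \<odot> v = hh i j" unfolding d by (simp add: sm_assoc)
   then have "hh i j \<in> D" using ksubD(4)[OF Dk v(1), of "inverse d"] by simp
   then show False using line_sub[OF Dk] D \<open>D \<noteq> line i j\<close> by blast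
  qed
 qed
qed

lemma simple_is_line:
 assumes "simple_subcoalgebra C H" shows "\<exists>i j. C = line i j"
proof -
 have C: "subcoalgebra C H" "C \<noteq> {\<zero>}" using assms by (auto simp: simple_subcoalgebra_def)
 then obtain i j where "hh i j \<in> C" using subcoalgebra_hh by blast
 then have "line i j \<subseteq> C" using line_sub C by (auto simp: subcoalgebra_def)
 then have "line i j = {\<zero>} \<or> line i j = C" using assms line_subcoalgebra unfolding simple_subcoalgebra_def by blast
 then show ?thesis using hh_line[of i j] hh_neq0[of i j] by blast
qed

lemma coradical_S0: "coradical H = S0"
proof
 have lS: "line i j \<subseteq> S0" for i j by (rule line_sub[OF S0_ks hh_S0])
 show "coradical H \<subseteq> S0"
  unfolding coradical_def by (rule span_min[OF S0_ks]) (use simple_is_line lS in blast)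
 have sub: "\<Union>{C. simple_subcoalgebra C H} \<subseteq> carrier H"
  using simple_is_line ksubD(1)[OF line_ks] by blast
 show "S0 \<subseteq> coradical H"
  unfolding S0_def coradical_def
  by (rule span_mono) (use line_simple hh_line in blast)
qed

text \<open>For a grouplike v the slice of v \<otimes> v at a nonzero top coefficient is that
  coefficient times v; by \<open>rsl_top\<close> it is the same coefficient times a group
  monomial.\<close>

lemma grouplikes_hh: "grouplikes H = {hh i j |i j. True}"
proof
 show "{hh i j |i j. True} \<subseteq> grouplikes H" by (auto simp: grouplikes_def comult_hh counit_hh)
 show "grouplikes H \<subseteq> {hh i j |i j. True}"
 proof
  fix v assume "v \<in> grouplikes H"
  then have v: "v \<in> carrier H" "\<Delta> v = HH.pt v v" "counit H v = 1" by (auto simp: grouplikes_def)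
  then have "v \<noteq> \<zero>" using form_simps(1)[OF counit_linear] by auto
  then obtain m k l where m: "m < p" "k < p" "l < p" "co m k l v \<noteq> 0"
   "\<forall>m' k' l'. m < m' \<longrightarrow> m' < p \<longrightarrow> k' < p \<longrightarrow> l' < p \<longrightarrow> co m' k' l' v = 0"
   using nonzero_top[OF v(1)] by blast
  have "co m k l v \<odot> v = co m k l v \<odot> hh (k + e * m) l"
   using rsl_top[OF v(1) m(1-3) m(5)[rule_format]] m v HH.rsl_pure[OF co_props(1)[OF m(1-3)] v(1,1)] by simp
  then have "inverse (co m k l v) \<odot> (co m k l v \<odot> v) = inverse (co m k l v) \<odot> (co m k l v \<odot> hh (k + e * m) l)" by simp
  then have "v = hh (k + e * m) l" using m(4) v by (simp add: sm_assoc)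
  then show "v \<in> {hh i j |i j. True}" by blast
 qed
qed

lemma is_pointed: "coradical H = k_span H (grouplikes H)"
 by (simp add: coradical_S0 grouplikes_hh S0_def)

lemma is_pointed_bialgebra: "pointed_bialgebra H"
 by (rule pointed_bialgebra.intro[OF is_bialgebra], rule pointed_bialgebra_axioms.intro, rule is_pointed)

lemma is_pointed_hopf: "pointed_hopf_algebra H"
 by (simp add: pointed_hopf_algebra_def is_hopf is_pointed)

subsection \<open>The coradical filtration\<close>

definition Fn :: "nat \<Rightarrow> 'h set" where
 "Fn n = {v \<in> carrier H. \<forall>m k l. n < m \<longrightarrow> m < p \<longrightarrow> k < p \<longrightarrow> l < p \<longrightarrow> co m k l v = 0}"

lemma B_Fn: "m \<le> n \<Longrightarrow> m < p \<Longrightarrow> B m i j \<in> Fn n"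
 by (auto simp: Fn_def co_B_mod)

lemma Fn_ks: "k_subspace H (Fn n)"
 by (rule ksubI) (auto simp: Fn_def form_simps[OF co_props(1)])

lemma Fn_big: "p \<le> Suc n \<Longrightarrow> Fn n = carrier H"
 by (auto simp: Fn_def)

lemma Fn_0: "Fn 0 = S0"
proof
 show "S0 \<subseteq> Fn 0"
  unfolding S0_def by (rule span_min[OF Fn_ks]) (use B_Fn[of 0 0] p_gt_1 in \<open>auto simp: B_simps\<close>)
 show "Fn 0 \<subseteq> S0"
 proof
  fix v assume v: "v \<in> Fn 0"
  then have vc: "v \<in> carrier H" by (simp add: Fn_def)
  have "(\<Oplus>z\<in>Ix. cz z v \<odot> bb z) \<in> S0"
  proof (rule ksub_finsum[OF S0_ks])
   fix z assume z: "z \<in> Ix"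
   obtain n i j where n: "z = (n, i, j)" "n < p" "i < p" "j < p" using z by auto
   show "cz z v \<odot> bb z \<in> S0"
   proof (cases "n = 0")
    case True then show ?thesis using n ksubD(4)[OF S0_ks hh_S0] by (simp add: bb_def B_simps)
   next
    case False
    then have "cz z v = 0" using v n by (simp add: Fn_def cz_def)
    then show ?thesis using ksubD(2)[OF S0_ks] by simp
   qed
  qed
  then show "v \<in> S0" using expand[OF vc] by simp
 qed
qed

text \<open>In \<Delta> of a monomial of degree at most n + 1, each term has a left factor of degree
  0 or a right factor of degree at most n. Conversely, if v has top degree m > n + 1, then
  coordinate functionals of degrees 1 and m - 1 annihilate H_0 and H_n, but their product takes at v
  the value m times the top coefficient, and m is invertible.\<close>

lemma corad_filt_Fn: "corad_filt H n = Fn n"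
proof (induction n)
 case 0 then show ?case by (simp add: coradical_S0 Fn_0)
next
 case (Suc n)
 interpret P: pointed_bialgebra H by (rule is_pointed_bialgebra)
 have c0: "P.cf 0 = Fn 0" by (simp add: P.cf0 Fn_0 S0_def grouplikes_hh)
 show ?case
 proof
  show "Fn (Suc n) \<subseteq> P.cf (Suc n)"
  proof
   fix v assume v: "v \<in> Fn (Suc n)"
   then have vc: "v \<in> carrier H" by (simp add: Fn_def)
   have "P.cv \<alpha> \<beta> v = 0" if ab: "\<alpha> \<in> perp H (P.cf 0)" "\<beta> \<in> perp H (P.cf n)" for \<alpha> \<beta>
   proof -
    note l = perpD(1)[OF ab(1)] perpD(1)[OF ab(2)]
    have "P.cv \<alpha> \<beta> v = (\<Sum>z\<in>Ix. cz z v * HH.tf \<alpha> \<beta> (\<Delta> (bb z)))"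
     unfolding P.cv_def by (rule form_expand[OF vc cv_lin[OF l]])
    also have "\<dots> = 0"
    proof (rule sum.neutral, rule ballI)
     fix z assume z: "z \<in> Ix"
     obtain m i j where m: "z = (m, i, j)" "m < p" "i < p" "j < p" using z by auto
     show "cz z v * HH.tf \<alpha> \<beta> (\<Delta> (bb z)) = 0"
     proof (cases "m \<le> Suc n")
      case False
      then show ?thesis using v m by (simp add: Fn_def cz_def)
     next
      case True
      have "of_nat (m choose r) * (\<alpha> (B (m - r) (i + e * r) j) * \<beta> (B r i j)) = 0" if r: "r \<in> {..m}" for r
      proof (cases "r = m")
       case True
       have "B 0 (i + e * r) j \<in> P.cf 0" using B_Fn[of 0 0] p_gt_1 c0 by simp
       then show ?thesis using True perpD(2)[OF ab(1)] by simp
      next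
       case False
       then have "B r i j \<in> P.cf n" using B_Fn[of r n] Suc r \<open>m \<le> Suc n\<close> m by simp
       then show ?thesis using perpD(2)[OF ab(2)] by simp
      qed
      then have "HH.tf \<alpha> \<beta> (\<Delta> (bb z)) = 0" unfolding m(1) bb_def prod.case tf_B[OF l] by (intro sum.neutral) blast
      then show ?thesis by simp
     qed
    qed
    finally show ?thesis .
   qed
   then show "v \<in> P.cf (Suc n)" using vc by (auto simp: P.cf_mem)
  qed
  show "P.cf (Suc n) \<subseteq> Fn (Suc n)"
  proof
   fix v assume v: "v \<in> P.cf (Suc n)"
   then have vc: "v \<in> carrier H" by (rule P.cf_closed)
   show "v \<in> Fn (Suc n)"
   proof (rule ccontr)
    assume "v \<notin> Fn (Suc n)"
    then obtain m0 k0 l0 where "Suc n < m0" "m0 < p" "k0 < p" "l0 < p" "co m0 k0 l0 v \<noteq> 0"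
     using vc unfolding Fn_def by blast
    then obtain m k l where m: "Suc n < m" "m < p" "k < p" "l < p" "co m k l v \<noteq> 0"
     "\<forall>m' k' l'. m < m' \<longrightarrow> m' < p \<longrightarrow> k' < p \<longrightarrow> l' < p \<longrightarrow> co m' k' l' v = 0"
     using top_exists[of m0 k0 l0 v] less_le_trans by blast
    \<comment> \<open>The left factor of the term in bidegree (1, m - 1) carries the group part
      shifted by g^(m-1).\<close>
    let ?k = "(k + e * (m - 1)) mod p"
    have k': "?k < p" and m1: "m - 1 < p" using p_gt_1 m by auto
    note f1 = co_props(1)[OF p_gt_1 k' m(4)] and f2 = co_props(1)[OF m1 m(3,4)]
    have a: "co 1 ?k l \<in> perp H (P.cf 0)" using f1 k' m p_gt_1 unfolding c0 by (intro perpI) (auto simp: Fn_def)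
    have b: "co (m - 1) k l \<in> perp H (P.cf n)" using f2 m unfolding Suc by (intro perpI) (auto simp: Fn_def)
    have "(\<Sum>i<p. of_nat (i choose (m - 1)) * co 1 ?k l (B (i - (m - 1)) (k + e * (m - 1)) l) * co i k l v) =
     (\<Sum>i<p. if i = m then of_nat m * co m k l v else 0)"
    proof (intro sum.cong refl)
     fix i assume i: "i \<in> {..<p}"
     have ch: "m choose (m - 1) = m" using m binomial_symmetric[of "m - 1" m] by simp
     consider "i < m - 1" | "i = m - 1" | "i = m" | "i > m" by linarith
     then show "of_nat (i choose (m - 1)) * co 1 ?k l (B (i - (m - 1)) (k + e * (m - 1)) l) * co i k l v = (if i = m then of_nat m * co m k l v else 0)"
     proof cases
      case 3
      then have "i - (m - 1) = 1" using m by simp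
      then show ?thesis using 3 ch m k' p_gt_1 by (simp add: co_B_mod)
     qed (use i m k' p_gt_1 in \<open>auto simp: binomial_eq_0 co_B_mod\<close>)
    qed
    then have "P.cv (co 1 ?k l) (co (m - 1) k l) v = of_nat m * co m k l v"
     unfolding P.cv_def TF[OF f1 vc m1 m(3,4)] using m by simp
    moreover have "P.cv (co 1 ?k l) (co (m - 1) k l) v = 0" using v a b by (auto simp: P.cf_mem)
    moreover have "of_nat m \<noteq> (0 :: 'k)" using of_nat_neq0 m by simp
    ultimately show False using m(5) by simp
   qed
  qed
 qed
qed

subsection \<open>Primitive elements\<close>

text \<open>Coefficients of degree m > 1 vanish: the pairing in bidegree (1, m - 1) gives m times
  the top one, whereas v \<otimes> 1 + 1 \<otimes> v has no part there. In degrees 0 and 1 the group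
  part must be trivial, because the other tensor factor is 1, and the coefficient of 1 itself is
  zero.\<close>

lemma primitive_multiple:
 assumes v: "v \<in> carrier H" and prim: "\<Delta> v = HH.pt v \<one> \<oplus>\<^bsub>HH.T\<^esub> HH.pt \<one> v"
 shows "\<exists>d. v = d \<odot> x"
proof -
 have one: "\<one> = B 0 0 0" by (simp add: B_simps)
 have pr: "HH.tf \<phi> \<psi> (\<Delta> v) = \<phi> v * \<psi> \<one> + \<phi> \<one> * \<psi> v" if "lin_form H \<phi>" "lin_form H \<psi>" for \<phi> \<psi>
  unfolding prim using v that by (simp add: HH.tf_simps[OF that])
 have co1: "co m k l \<one> = (if m = 0 \<and> k = 0 \<and> l = 0 then 1 else 0)" if "m < p" "k < p" "l < p" for m k l
  unfolding one using that p_gt_1 by (auto simp: co_props(2))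
 have high: "co m k l v = 0" if h: "1 < m" "m < p" "k < p" "l < p" for m k l
 proof (rule ccontr)
  assume "co m k l v \<noteq> 0"
  then obtain m' k' l' where m: "m \<le> m'" "m' < p" "k' < p" "l' < p" "co m' k' l' v \<noteq> 0"
   "\<forall>m'' k'' l''. m' < m'' \<longrightarrow> m'' < p \<longrightarrow> k'' < p \<longrightarrow> l'' < p \<longrightarrow> co m'' k'' l'' v = 0"
   using top_exists[OF h(2-4)] by blast
  let ?k = "(k' + e * (m' - 1)) mod p"
  have k: "?k < p" and m1: "m' - 1 < p" using p_gt_1 m by auto
  note f1 = co_props(1)[OF p_gt_1 k m(4)] and f2 = co_props(1)[OF m1 m(3,4)]
  have "(\<Sum>i<p. of_nat (i choose (m' - 1)) * co 1 ?k l' (B (i - (m' - 1)) (k' + e * (m' - 1)) l') * co i k' l' v) =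
   (\<Sum>i<p. if i = m' then of_nat m' * co m' k' l' v else 0)"
  proof (intro sum.cong refl)
   fix i assume i: "i \<in> {..<p}"
   have ch: "m' choose (m' - 1) = m'" using m h binomial_symmetric[of "m' - 1" m'] by simp
   consider "i < m' - 1" | "i = m' - 1" | "i = m'" | "i > m'" by linarith
   then show "of_nat (i choose (m' - 1)) * co 1 ?k l' (B (i - (m' - 1)) (k' + e * (m' - 1)) l') * co i k' l' v = (if i = m' then of_nat m' * co m' k' l' v else 0)"
   proof cases
    case 3
    then have "i - (m' - 1) = 1" using m h by simp
    then show ?thesis using 3 ch m k p_gt_1 by (simp add: co_B_mod)
   qed (use i m h k p_gt_1 in \<open>auto simp: binomial_eq_0 co_B_mod\<close>)
  qed
  then have "HH.tf (co 1 ?k l') (co (m' - 1) k' l') (\<Delta> v) = of_nat m' * co m' k' l' v"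
   unfolding TF[OF f1 v m1 m(3,4)] using m by simp
  moreover have "HH.tf (co 1 ?k l') (co (m' - 1) k' l') (\<Delta> v) = 0"
   unfolding pr[OF f1 f2] using co1[OF p_gt_1 k m(4)] co1[OF m1 m(3,4)] m h by simp
  moreover have "of_nat m' \<noteq> (0 :: 'k)" using of_nat_neq0 m h by simp
  ultimately show False using m(5) by simp
 qed
 \<comment> \<open>With a functional of degree 0 in the second slot the pairing returns the
   coefficient itself.\<close>
 have low: "HH.tf (co m k l) (co 0 k l) (\<Delta> v) = co m k l v" if h: "m < p" "k < p" "l < p" for m k l
 proof -
  have p0: "0 < p" using p_gt_1 by simp
  have "HH.tf (co m k l) (co 0 k l) (\<Delta> v) = (\<Sum>n<p. if n = m then co m k l v else 0)"
   unfolding TF[OF co_props(1)[OF h] v p0 h(2,3)] by (intro sum.cong refl) (use h in \<open>auto simp: co_props(2)\<close>)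
  then show ?thesis using h by simp
 qed
 have c1: "co 1 k l v = 0" if h: "k < p" "l < p" "(k, l) \<noteq> (0, 0)" for k l
 proof -
  have p0: "0 < p" using p_gt_1 by simp
  have "co 1 k l v = co 1 k l v * co 0 k l \<one> + co 1 k l \<one> * co 0 k l v"
   using low[OF p_gt_1 h(1,2)] pr[OF co_props(1)[OF p_gt_1 h(1,2)] co_props(1)[OF p0 h(1,2)]] by simp
  then show ?thesis using co1[OF p0 h(1,2)] co1[OF p_gt_1 h(1,2)] h(3) by auto
 qed
 have c0: "co 0 k l v = 0" if h: "k < p" "l < p" for k l
 proof -
  have p0: "0 < p" using p_gt_1 by simp
  have "co 0 k l v = co 0 k l v * co 0 k l \<one> + co 0 k l \<one> * co 0 k l v"
   using low[OF p0 h(1,2)] pr[OF co_props(1)[OF p0 h(1,2)] co_props(1)[OF p0 h(1,2)]] by simp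
  \<comment> \<open>For the trivial group part both summands contribute: a coefficient that equals
    its own double is zero in every characteristic.\<close>
  then have "co 0 k l v = 0 \<or> co 0 k l v = co 0 k l v + co 0 k l v"
   using co1[OF p0 h(1,2)] by (cases "(k, l) = (0, 0)") auto
  then show ?thesis by (metis add_cancel_right_right)
 qed
 have "v \<ominus> co 1 0 0 v \<odot> x = \<zero>"
 proof (rule zero_by_co)
  show "v \<ominus> co 1 0 0 v \<odot> x \<in> carrier H" using v by simp
  fix m k l assume h: "m < p" "k < p" "l < p"
  have x1: "B 1 0 0 = x" by (simp add: B_simps)
  have "co m k l (B 1 0 0) = (if m = 1 \<and> k = 0 \<and> l = 0 then 1 else 0)"
   using h p_gt_1 by (auto simp: co_props(2))
  then have "co m k l x = (if m = 1 \<and> k = 0 \<and> l = 0 then 1 else 0)" unfolding x1 .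
  moreover consider "m = 0" | "m = 1" | "m > 1" by linarith
  ultimately show "co m k l (v \<ominus> co 1 0 0 v \<odot> x) = 0"
   using h v high[of m k l] c1[of k l] c0[of k l] by cases (auto simp: form_simps[OF co_props(1)[OF h]])
 qed
 then have "v = co 1 0 0 v \<odot> x" using v by simp
 then show ?thesis by blast
qed

end

section \<open>Linearity of product, coproduct and counit of the graded algebra\<close>

context pointed_bialgebra begin

lemma gr_mult_closed: "f \<in> carrier gr \<Longrightarrow> f' \<in> carrier gr \<Longrightarrow> f \<otimes>\<^bsub>gr\<^esub> f' \<in> carrier gr"
 by (auto simp: gr_carrier gr_mult intro: grs_mult)

lemma prod_c: "r \<in> grs \<Longrightarrow> r' \<in> grs \<Longrightarrow> (\<lambda>i. r i \<otimes> r' (n - i)) \<in> A \<rightarrow> carrier H"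
 using grsD(2) by auto

lemma gr_mult_linear_left:
 assumes "f' \<in> carrier gr" shows "k_linear gr gr (\<lambda>f. f \<otimes>\<^bsub>gr\<^esub> f')"
proof (rule k_linearI)
 obtain q where q: "f' = gr_of q" "q \<in> grs" using assms by (auto simp: gr_carrier)
 fix f1 f2 assume "f1 \<in> carrier gr" "f2 \<in> carrier gr"
 then obtain r1 r2 where r: "f1 = gr_of r1" "r1 \<in> grs" "f2 = gr_of r2" "r2 \<in> grs" by (auto simp: gr_carrier)
 have "(\<Oplus>i\<in>{..n}. (r1 i \<oplus> r2 i) \<otimes> q (n - i)) = (\<Oplus>i\<in>{..n}. r1 i \<otimes> q (n - i)) \<oplus> (\<Oplus>i\<in>{..n}. r2 i \<otimes> q (n - i))" for n
  unfolding M.finsum_addf[OF prod_c[OF r(2) q(2)] prod_c[OF r(4) q(2)], symmetric]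
  by (rule M.finsum_cong') (use r q in \<open>auto simp: mult_linear grsD\<close>)
 then show "(f1 \<oplus>\<^bsub>gr\<^esub> f2) \<otimes>\<^bsub>gr\<^esub> f' = f1 \<otimes>\<^bsub>gr\<^esub> f' \<oplus>\<^bsub>gr\<^esub> f2 \<otimes>\<^bsub>gr\<^esub> f'"
  using r q by (simp add: gr_add gr_mult grs_add grs_mult)
next
 obtain q where q: "f' = gr_of q" "q \<in> grs" using assms by (auto simp: gr_carrier)
 fix d f1 assume "f1 \<in> carrier gr"
 then obtain r1 where r: "f1 = gr_of r1" "r1 \<in> grs" by (auto simp: gr_carrier)
 have "(\<Oplus>i\<in>{..n}. (d \<odot> r1 i) \<otimes> q (n - i)) = d \<odot> (\<Oplus>i\<in>{..n}. r1 i \<otimes> q (n - i))" for n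
  unfolding finsum_sm[OF prod_c[OF r(2) q(2)]]
  by (rule M.finsum_cong') (use r q in \<open>auto simp: smult_mult_left grsD\<close>)
 then show "(d \<odot>\<^bsub>gr\<^esub> f1) \<otimes>\<^bsub>gr\<^esub> f' = d \<odot>\<^bsub>gr\<^esub> (f1 \<otimes>\<^bsub>gr\<^esub> f')"
  using r q by (simp add: gr_smult gr_mult grs_scale grs_mult)
qed (rule gr_mult_closed[OF _ assms])

lemma gr_mult_linear_right:
 assumes "f' \<in> carrier gr" shows "k_linear gr gr (\<lambda>f. f' \<otimes>\<^bsub>gr\<^esub> f)"
proof (rule k_linearI)
 obtain q where q: "f' = gr_of q" "q \<in> grs" using assms by (auto simp: gr_carrier)
 fix f1 f2 assume "f1 \<in> carrier gr" "f2 \<in> carrier gr"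
 then obtain r1 r2 where r: "f1 = gr_of r1" "r1 \<in> grs" "f2 = gr_of r2" "r2 \<in> grs" by (auto simp: gr_carrier)
 have "(\<Oplus>i\<in>{..n}. q i \<otimes> (r1 (n - i) \<oplus> r2 (n - i))) = (\<Oplus>i\<in>{..n}. q i \<otimes> r1 (n - i)) \<oplus> (\<Oplus>i\<in>{..n}. q i \<otimes> r2 (n - i))" for n
  unfolding M.finsum_addf[OF prod_c[OF q(2) r(2)] prod_c[OF q(2) r(4)], symmetric]
  by (rule M.finsum_cong') (use r q in \<open>auto simp: mult_linear grsD\<close>)
 then show "f' \<otimes>\<^bsub>gr\<^esub> (f1 \<oplus>\<^bsub>gr\<^esub> f2) = f' \<otimes>\<^bsub>gr\<^esub> f1 \<oplus>\<^bsub>gr\<^esub> f' \<otimes>\<^bsub>gr\<^esub> f2"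
  using r q by (simp add: gr_add gr_mult grs_add grs_mult)
next
 obtain q where q: "f' = gr_of q" "q \<in> grs" using assms by (auto simp: gr_carrier)
 fix d f1 assume "f1 \<in> carrier gr"
 then obtain r1 where r: "f1 = gr_of r1" "r1 \<in> grs" by (auto simp: gr_carrier)
 have "(\<Oplus>i\<in>{..n}. q i \<otimes> (d \<odot> r1 (n - i))) = d \<odot> (\<Oplus>i\<in>{..n}. q i \<otimes> r1 (n - i))" for n
  unfolding finsum_sm[OF prod_c[OF q(2) r(2)]]
  by (rule M.finsum_cong') (use r q in \<open>auto simp: smult_mult_right grsD\<close>)
 then show "f' \<otimes>\<^bsub>gr\<^esub> (d \<odot>\<^bsub>gr\<^esub> f1) = d \<odot>\<^bsub>gr\<^esub> (f' \<otimes>\<^bsub>gr\<^esub> f1)"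
  using r q by (simp add: gr_smult gr_mult grs_scale grs_mult)
qed (rule gr_mult_closed[OF assms])

lemma gr_rel_add:
 assumes r: "r \<in> grs" "r' \<in> grs" and rel: "gr_rel (gr_of r) xs" "gr_rel (gr_of r') ys"
 shows "gr_rel (gr_of (\<lambda>n. r n \<oplus> r' n)) (xs @ ys)"
proof -
 let ?P = "\<lambda>n (i, j, v, w). i + j = n" and ?pt = "\<lambda>(i :: nat, j :: nat, v, w). HH.pt v w"
 have c: "set (map ?pt (filter (?P n) zs)) \<subseteq> carrier HH.T" if "gr_rel f zs" for f zs n
  using gr_relD[OF that] by (auto intro!: HH.pure_closed cf_closed)
 have "\<exists>h\<in>gr_of (\<lambda>n. r n \<oplus> r' n) n. \<Delta> h = list_sum HH.T (map ?pt (filter (?P n) (xs @ ys)))" for n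
 proof -
  obtain h h' where h: "h \<in> gr_of r n" "\<Delta> h = list_sum HH.T (map ?pt (filter (?P n) xs))"
   "h' \<in> gr_of r' n" "\<Delta> h' = list_sum HH.T (map ?pt (filter (?P n) ys))"
   using rel unfolding gr_rel_def by blast
  have hc: "h \<in> carrier H" "h' \<in> carrier H"
   using coset_mem(1)[OF cb_ks grsD(2)[OF r(1)]] coset_mem(1)[OF cb_ks grsD(2)[OF r(2)]] h by (auto simp: gr_of_def)
  have "h \<oplus> h' \<in> (cb n +> r n) <+>\<^bsub>H\<^esub> (cb n +> r' n)" using h by (auto simp: gr_of_def set_add_def set_mult_def)
  then have "h \<oplus> h' \<in> gr_of (\<lambda>n. r n \<oplus> r' n) n" using coset_add[OF cb_ks grsD(2)[OF r(1)] grsD(2)[OF r(2)]] by (simp add: gr_of_def)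
  moreover have "\<Delta> (h \<oplus> h') = list_sum HH.T (map ?pt (filter (?P n) (xs @ ys)))"
   using h hc c[OF rel(1)] c[OF rel(2)] by (simp add: k_linearD(2)[OF comult_lin] HH.T.list_sum_append)
  ultimately show ?thesis by blast
 qed
 then show ?thesis using rel unfolding gr_rel_def by auto
qed

lemma gr_rel_scale:
 assumes r: "r \<in> grs" and rel: "gr_rel (gr_of r) xs"
 shows "gr_rel (gr_of (\<lambda>n. d \<odot> r n)) (map (\<lambda>(i, j, v, w). (i, j, d \<odot> v, w)) xs)"
proof -
 let ?P = "\<lambda>n (i, j, v, w). i + j = n" and ?pt = "\<lambda>(i :: nat, j :: nat, v, w). HH.pt v w"
  and ?s = "\<lambda>(i :: nat, j :: nat, v, w :: 'h). (i, j, d \<odot> v, w)"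
 have c: "set (map ?pt (filter (?P n) xs)) \<subseteq> carrier HH.T" for n
  using gr_relD[OF rel] by (auto intro!: HH.pure_closed cf_closed)
 have sl: "k_linear HH.T HH.T (\<lambda>t. d \<odot>\<^bsub>HH.T\<^esub> t)" by (rule k_linear_scale[OF HH.T_kvs k_linear_id])
 have "\<exists>h\<in>gr_of (\<lambda>n. d \<odot> r n) n. \<Delta> h = list_sum HH.T (map ?pt (filter (?P n) (map ?s xs)))" for n
 proof -
  obtain h where h: "h \<in> gr_of r n" "\<Delta> h = list_sum HH.T (map ?pt (filter (?P n) xs))"
   using rel unfolding gr_rel_def by blast
  have hc: "h \<in> carrier H" using coset_mem(1)[OF cb_ks grsD(2)[OF r]] h by (auto simp: gr_of_def)
  have "d \<odot> h \<in> cb n +> (d \<odot> h)" by (rule coset_self[OF cb_ks]) (use hc in simp)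
  then have "d \<odot> h \<in> (\<Union>y\<in>cb n +> r n. cb n +> (d \<odot> y))" using h(1) by (auto simp: gr_of_def)
  then have m: "d \<odot> h \<in> gr_of (\<lambda>n. d \<odot> r n) n" using coset_smult[OF cb_ks grsD(2)[OF r]] by (simp add: gr_of_def)
  have f: "filter (?P n) (map ?s xs) = map ?s (filter (?P n) xs)" by (induction xs) auto
  have "\<Delta> (d \<odot> h) = list_sum HH.T (map (\<lambda>t. d \<odot>\<^bsub>HH.T\<^esub> t) (map ?pt (filter (?P n) xs)))"
   using h(2) hc HH.T.k_linear_list_sum[OF sl HH.T_kvs c] by (simp add: k_linearD(3)[OF comult_lin])
  also have "map (\<lambda>t. d \<odot>\<^bsub>HH.T\<^esub> t) (map ?pt (filter (?P n) xs)) = map ?pt (map ?s (filter (?P n) xs))"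
   unfolding map_map by (rule map_cong) (auto simp: HH.pure_scale_left cf_closed dest!: gr_relD[OF rel])
  finally show ?thesis using m f by auto
 qed
 then show ?thesis using rel ksubD(4)[OF cf_ks] unfolding gr_rel_def by auto
qed

lemma gr_comult_linear: "k_linear gr GG.T (gr_comult H)"
proof (rule k_linearI)
 let ?pt = "\<lambda>(i, j, v, w). GG.pt (gr_class H i v) (gr_class H j w)"
 have c: "set (map ?pt zs) \<subseteq> carrier GG.T" if "gr_rel f zs" for f zs
  using gr_relD[OF that] by (auto intro!: GG.pure_closed gr_class_closed)
 show "gr_comult H f \<in> carrier GG.T" if "f \<in> carrier gr" for f by (rule gr_comult_closed[OF that])
 show "gr_comult H (f \<oplus>\<^bsub>gr\<^esub> f') = gr_comult H f \<oplus>\<^bsub>GG.T\<^esub> gr_comult H f'"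
  if ff: "f \<in> carrier gr" "f' \<in> carrier gr" for f f'
 proof -
  obtain r r' where r: "f = gr_of r" "r \<in> grs" "f' = gr_of r'" "r' \<in> grs" using ff by (auto simp: gr_carrier)
  obtain xs ys where rel: "gr_rel (gr_of r) xs" "gr_rel (gr_of r') ys" using gr_rel_exists r by blast
  show ?thesis
   unfolding r(1,3) gr_add[OF r(2,4)] gr_comult_eq[OF grs_add[OF r(2,4)] gr_rel_add[OF r(2,4) rel]]
    gr_comult_eq[OF r(2) rel(1)] gr_comult_eq[OF r(4) rel(2)]
   unfolding gr_val_def map_append by (rule GG.T.list_sum_append[OF c[OF rel(1)] c[OF rel(2)]])
 qed
 show "gr_comult H (d \<odot>\<^bsub>gr\<^esub> f) = d \<odot>\<^bsub>GG.T\<^esub> gr_comult H f" if ff: "f \<in> carrier gr" for d f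
 proof -
  obtain r where r: "f = gr_of r" "r \<in> grs" using ff by (auto simp: gr_carrier)
  obtain xs where rel: "gr_rel (gr_of r) xs" using gr_rel_exists r by blast
  have sl: "k_linear GG.T GG.T (\<lambda>t. d \<odot>\<^bsub>GG.T\<^esub> t)" by (rule k_linear_scale[OF GG.T_kvs k_linear_id])
  have m: "map ?pt (map (\<lambda>(i, j, v, w). (i, j, d \<odot> v, w)) xs) = map (\<lambda>t. d \<odot>\<^bsub>GG.T\<^esub> t) (map ?pt xs)"
   unfolding map_map by (rule map_cong)
    (auto simp: gr_class_linear(2) GG.pure_scale_left gr_class_closed dest!: gr_relD[OF rel])
  show ?thesis
   unfolding r(1) gr_smult[OF r(2)] gr_comult_eq[OF grs_scale[OF r(2)] gr_rel_scale[OF r(2) rel]] gr_comult_eq[OF r(2) rel]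
   unfolding gr_val_def m GG.T.k_linear_list_sum[OF sl GG.T_kvs c[OF rel]] ..
 qed
qed

lemma gr_counit: "r \<in> grs \<Longrightarrow> counit H (the_elem (gr_of r 0)) = counit H (r 0)"
proof -
 assume r: "r \<in> grs"
 have "gr_of r 0 = {r 0}" using grsD(2)[OF r] by (auto simp: gr_of_def a_r_coset_def r_coset_def)
 then show ?thesis by simp
qed

lemma gr_counit_linear: "lin_form gr (\<lambda>f. counit H (the_elem (f 0)))"
 by (rule k_linearI)
  (auto simp: gr_carrier gr_add gr_smult gr_counit grs_add grs_scale form_simps[OF counit_linear] grsD)

lemma gr_hopf_simps [simp]:
 "carrier (gr_hopf H) = carrier gr" "monoid.mult (gr_hopf H) = monoid.mult gr" "add (gr_hopf H) = add gr"
 "\<one>\<^bsub>gr_hopf H\<^esub> = \<one>\<^bsub>gr\<^esub>" "\<zero>\<^bsub>gr_hopf H\<^esub> = \<zero>\<^bsub>gr\<^esub>" "module.smult (gr_hopf H) = module.smult gr"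
 "comult (gr_hopf H) = gr_comult H" "counit (gr_hopf H) = (\<lambda>f. counit H (the_elem (f 0)))"
 by (simp_all add: gr_hopf_def module.extend_def bialg.fields_def)

lemma gr_hopf_linear [simp]: "k_linear (gr_hopf H) W = k_linear gr W"
 by (simp add: k_linear_def fun_eq_iff)

end

section \<open>The graded algebra of a lifting\<close>

context lift_full begin

sublocale P: pointed_bialgebra H by (rule is_pointed_bialgebra)

lemma cf_Fn: "P.cf n = Fn n" by (rule corad_filt_Fn)

lemma cb_big: "p \<le> n \<Longrightarrow> P.cb n = carrier H"
 using Fn_big[of "n - 1"] p_gt_1 by (cases n) (auto simp: cf_Fn)

lemma B_cf: "n < p \<Longrightarrow> B n i j \<in> P.cf n"
 by (simp add: cf_Fn B_Fn)

lemma cb_mem: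
 assumes "v \<in> P.cf n" "\<And>i j. n < p \<Longrightarrow> i < p \<Longrightarrow> j < p \<Longrightarrow> co n i j v = 0"
 shows "v \<in> P.cb n"
proof -
 have v: "v \<in> carrier H" "\<And>m i j. n < m \<Longrightarrow> m < p \<Longrightarrow> i < p \<Longrightarrow> j < p \<Longrightarrow> co m i j v = 0"
  using assms(1) by (auto simp: cf_Fn Fn_def)
 have all: "co m i j v = 0" if "n \<le> m" "m < p" "i < p" "j < p" for m i j
  using assms(2) v(2) that by (cases "m = n") auto
 show ?thesis
 proof (cases n)
  case 0
  then have "v = \<zero>" using zero_by_co[OF v(1)] all by auto
  then show ?thesis using 0 by simp
 next
  case (Suc m)
  then show ?thesis using v(1) all by (simp add: cf_Fn Fn_def)
 qed
qed

lemma co_perp: "n < p \<Longrightarrow> i < p \<Longrightarrow> j < p \<Longrightarrow> co n i j \<in> perp H (P.cb n)"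
 by (cases n) (auto intro!: perpI co_props(1) simp: form_simps(1)[OF co_props(1)] cf_Fn Fn_def)

text \<open>The corrections in \<open>B_x\<close> do not gain the degree that the factor x should
  contribute, so they fall into the lower filtration step. From total degree p on that step is the
  whole algebra.\<close>

lemma B_mult_mod:
 assumes "n < p"
 shows "B n i j \<otimes> B m k l \<ominus> B (n + m) (i + k) (j + l) \<in> P.cb (n + m)"
proof (cases "n + m < p")
 case False
 then show ?thesis by (simp add: cb_big)
next
 case True
 have x1: "x \<in> P.cf 1" using B_cf[of 1 0 0] p_gt_1 by (simp add: B_simps)
 have main: "B n i j \<otimes> xf m \<ominus> B (n + m) i j \<in> P.cb (n + m)" if "n + m < p" for m
  using that
 proof (induction m)
  case 0
  then show ?case using ksubD(2)[OF P.cb_ks] by (simp add: B_simps a_minus_def M.r_neg)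
 next
  case (Suc m)
  let ?u = "B n i j \<otimes> xf m" and ?v = "B (n + m) i j"
  define d where "d = ?u \<ominus> ?v"
  have d: "d \<in> P.cb (n + m)" "d \<in> carrier H" using Suc unfolding d_def by auto
  have ud: "?u = ?v \<oplus> d" unfolding d_def by (rule form_eqI) (auto simp: form_simps)
  have B1: "?v \<in> P.cb (n + Suc m)" "B (n + m) (i + e) j \<in> P.cb (n + Suc m)" using B_cf[of "n + m"] Suc.prems by auto
  have d1: "d \<otimes> x \<in> P.cb (n + Suc m)" using P.cb_cf_mult[OF d(1) x1] by simp
  have d2: "d \<in> P.cb (n + Suc m)" using d(1) P.cb_mono_Suc by auto
  have uS: "B n i j \<otimes> xf (Suc m) = ?u \<otimes> x \<ominus> (of_nat m * s) \<odot> ?u"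
   by (simp add: xf_def mult_linear smult_mult_right mult_assoc')
  have "?u \<otimes> x = ?v \<otimes> x \<oplus> d \<otimes> x" unfolding ud using d by (simp add: mult_linear)
  also have "?v \<otimes> x = B (Suc (n + m)) i j \<oplus> ((of_nat (n + m) * s + c i j) \<odot> ?v \<ominus> c i j \<odot> B (n + m) (i + e) j)"
   by (rule B_x)
  finally have eqn: "B n i j \<otimes> xf (Suc m) \<ominus> B (n + Suc m) i j =
   (((of_nat (n + m) * s + c i j) \<odot> ?v \<ominus> c i j \<odot> B (n + m) (i + e) j) \<oplus> d \<otimes> x) \<ominus> (of_nat m * s) \<odot> (?v \<oplus> d)"
   unfolding uS ud[symmetric] using d
   by (intro form_eqI) (auto simp: form_simps)
  show ?case
   unfolding eqn by (intro ksubD(3,4,6)[OF P.cb_ks] B1 d1 d2)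
 qed
 have h0: "hh k l \<in> P.cf 0" by (simp add: cf_Fn Fn_0 hh_S0)
 have e: "B n i j \<otimes> B m k l \<ominus> B (n + m) (i + k) (j + l) = (B n i j \<otimes> xf m \<ominus> B (n + m) i j) \<otimes> hh k l"
 proof -
  have 1: "B n i j \<otimes> B m k l = B n i j \<otimes> xf m \<otimes> hh k l" by (simp add: B_def[of m] mult_assoc')
  show ?thesis unfolding 1 by (simp add: mult_linear B_hh)
 qed
 show ?thesis unfolding e using P.cb_cf_mult[OF main[OF True] h0] by simp
qed

definition cls :: "nat \<times> nat \<times> nat \<Rightarrow> nat \<Rightarrow> 'h set" where
 "cls z = gr_class H (fst z) (bb z)"

lemma cls_c [simp]: "z \<in> Ix \<Longrightarrow> cls z \<in> carrier P.gr"
 by (auto simp: cls_def bb_def intro!: P.gr_class_closed B_cf)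

definition evz :: "nat \<times> nat \<times> nat \<Rightarrow> (nat \<Rightarrow> 'h set) \<Rightarrow> 'k" where
 "evz z = P.ev (fst z) (cz z)"

lemma cz_perp: "z \<in> Ix \<Longrightarrow> cz z \<in> perp H (P.cb (fst z))"
 using co_perp by (auto simp: cz_def)

lemma evz_linear: "z \<in> Ix \<Longrightarrow> lin_form P.gr (evz z)"
 unfolding evz_def by (rule P.ev_linear[OF cz_perp])

lemma evz_cls: "z \<in> Ix \<Longrightarrow> y \<in> Ix \<Longrightarrow> evz z (cls y) = (if y = z then 1 else 0)"
proof -
 assume z: "z \<in> Ix" and y: "y \<in> Ix"
 then have "bb y \<in> P.cf (fst y)" by (auto simp: bb_def intro!: B_cf)
 then show ?thesis using P.ev_class[OF cz_perp[OF z]] z y by (auto simp: evz_def cls_def cz_bb)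
qed

end

text \<open>H' stands for L(e, 0, 0), where falling factorials are powers; the assumption
  \<open>xp0\<close> then says that the p-th power of x' is zero.\<close>

locale gr_pair = L: lift_full H p e s t a b x + M: lift_full H' p e 0 0 a' b' x'
 for H :: "('k::field, 'h) bialg" and p e s t a b x and H' :: "('k, 'h2) bialg" and a' b' x' +
 assumes xp0: "M.xf p = \<zero>\<^bsub>H'\<^esub>"
begin

definition F :: "(nat \<Rightarrow> 'h set) \<Rightarrow> 'h2" where
 "F f = (\<Oplus>\<^bsub>H'\<^esub>z\<in>L.Ix. L.evz z f \<odot>\<^bsub>H'\<^esub> M.bb z)"

definition G :: "'h2 \<Rightarrow> nat \<Rightarrow> 'h set" where
 "G v = (\<Oplus>\<^bsub>L.P.gr\<^esub>z\<in>L.Ix. M.cz z v \<odot>\<^bsub>L.P.gr\<^esub> L.cls z)"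

lemma F_linear: "k_linear L.P.gr H' F"
 unfolding F_def[abs_def]
proof (rule k_linear_finsum_fun[OF L.P.gr_kvs M.kvs_axioms])
 fix z assume z: "z \<in> L.Ix"
 show "k_linear L.P.gr H' (\<lambda>f. L.evz z f \<odot>\<^bsub>H'\<^esub> M.bb z)"
  by (rule k_linearI) (simp_all add: L.P.GR.form_simps[OF L.evz_linear[OF z]] M.sm_add_l M.sm_assoc)
qed simp

lemma F_cls: "y \<in> L.Ix \<Longrightarrow> F (L.cls y) = M.bb y"
proof -
 assume y: "y \<in> L.Ix"
 have "F (L.cls y) = (\<Oplus>\<^bsub>H'\<^esub>z\<in>L.Ix. if y = z then M.bb z else \<zero>\<^bsub>H'\<^esub>)"
  unfolding F_def by (rule M.M.finsum_cong') (use y in \<open>auto simp: L.evz_cls\<close>)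
 also have "\<dots> = M.bb y" by (rule M.M.finsum_singleton) (use y in auto)
 finally show ?thesis .
qed

lemma F_class: "n < p \<Longrightarrow> F (gr_class H n (L.B n i j)) = M.B n i j"
proof -
 assume n: "n < p"
 have "F (L.cls (n, i mod p, j mod p)) = M.bb (n, i mod p, j mod p)"
  by (rule F_cls) (use n L.p_gt_1 in auto)
 then show ?thesis by (simp add: L.cls_def L.bb_def M.bb_def L.B_mod M.B_mod)
qed

lemma G_linear: "k_linear H' L.P.gr G"
 unfolding G_def[abs_def] by (rule M.expand_linear[OF L.P.gr_kvs]) simp

lemma F_G: "v \<in> carrier H' \<Longrightarrow> F (G v) = v"
proof (rule M.linear_basis_eq[OF M.kvs_axioms k_linear_comp[OF G_linear F_linear] k_linear_id])
 fix n i j assume "n < p" "i < p" "j < p"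
 then have z: "(n, i, j) \<in> L.Ix" by simp
 have "G (M.bb (n, i, j)) = L.cls (n, i, j)" unfolding G_def by (rule M.expand_bb[OF L.P.gr_kvs _ z]) simp
 then show "F (G (M.B n i j)) = M.B n i j" using F_cls[OF z] by (simp add: M.bb_def)
qed

lemma cz_F: "z \<in> L.Ix \<Longrightarrow> M.cz z (F f) = L.evz z f"
proof -
 assume z: "z \<in> L.Ix"
 note fs = M.form_simps[OF M.cz_form[OF z]]
 have "M.cz z (F f) = (\<Sum>y\<in>L.Ix. L.evz y f * M.cz z (M.bb y))" unfolding F_def by (subst fs(6)) (auto simp: fs(3))
 also have "\<dots> = (\<Sum>y\<in>L.Ix. if y = z then L.evz z f else 0)" by (intro sum.cong refl) (auto simp: M.cz_bb[OF z])
 finally show ?thesis using z by simp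
qed

text \<open>F records all coefficients of degree n in the n-th component. If they agree, the
  difference of the components has no coefficient of degree n left and lies in
  \<open>cb n\<close>.\<close>

lemma F_inj: "inj_on F (carrier L.P.gr)"
proof (rule inj_onI)
 fix f f' assume ff: "f \<in> carrier L.P.gr" "f' \<in> carrier L.P.gr" and eq: "F f = F f'"
 obtain r r' where r: "f = L.P.gr_of r" "r \<in> L.P.grs" "f' = L.P.gr_of r'" "r' \<in> L.P.grs"
  using ff by (auto simp: L.P.gr_carrier)
 have "r n \<ominus>\<^bsub>H\<^esub> r' n \<in> L.P.cb n" for n
 proof (rule L.cb_mem)
  show "r n \<ominus>\<^bsub>H\<^esub> r' n \<in> L.P.cf n" using L.ksubD(6)[OF L.P.cf_ks] L.P.grsD(1) r by blast
  fix i j assume h: "n < p" "i < p" "j < p"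
  then have z: "(n, i, j) \<in> L.Ix" by simp
  have "L.evz (n, i, j) f = L.evz (n, i, j) f'" using cz_F[OF z] eq by metis
  then have "L.co n i j (r n) = L.co n i j (r' n)"
   using L.P.ev_gr_of[OF L.co_perp[OF h]] r by (simp add: L.evz_def L.cz_def)
  then show "L.co n i j (r n \<ominus>\<^bsub>H\<^esub> r' n) = 0"
   using L.form_simps(5)[OF L.co_props(1)[OF h]] L.P.grsD(2) r by simp
 qed
 then show "f = f'" using L.P.gr_of_eq[OF r(2,4)] r by simp
qed

lemma F_bij: "bij_betw F (carrier L.P.gr) (carrier H')"
 unfolding bij_betw_def
proof (intro conjI F_inj equalityI subsetI)
 fix v assume "v \<in> F ` carrier L.P.gr" then show "v \<in> carrier H'" using k_linearD(1)[OF F_linear] by auto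
next
 fix v assume "v \<in> carrier H'" then show "v \<in> F ` carrier L.P.gr"
  using F_G[of v] k_linearD(1)[OF G_linear] by (intro image_eqI[of _ _ "G v"]) auto
qed

lemma G_F: "f \<in> carrier L.P.gr \<Longrightarrow> G (F f) = f"
 using F_G[of "F f"] k_linearD(1)[OF F_linear] k_linearD(1)[OF G_linear] inj_onD[OF F_inj] by blast

text \<open>Each f equals G (F f), which is a combination of the classes of the monomials. So these
  classes span gr H.\<close>

lemma gr_linear_eq:
 assumes "kvs W" "k_linear L.P.gr W f1" "k_linear L.P.gr W f2" "\<And>z. z \<in> L.Ix \<Longrightarrow> f1 (L.cls z) = f2 (L.cls z)"
  and f: "f \<in> carrier L.P.gr"
 shows "f1 f = f2 f"
proof -
 interpret W: kvs W by fact
 have c: "(\<lambda>z. M.cz z (F f) \<odot>\<^bsub>L.P.gr\<^esub> L.cls z) \<in> L.Ix \<rightarrow> carrier L.P.gr" by auto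
 have "f1 (G (F f)) = f2 (G (F f))"
  unfolding G_def L.P.GR.k_linear_finsum[OF assms(2,1) c] L.P.GR.k_linear_finsum[OF assms(3,1) c]
  by (rule W.M.finsum_cong'[OF refl])
   (use assms(4) k_linearD(1)[OF assms(3)] in \<open>auto simp: k_linearD(3)[OF assms(2)] k_linearD(3)[OF assms(3)]\<close>)
 then show ?thesis by (simp add: G_F[OF f])
qed

lemma M_xf_Suc: "M.xf (Suc n) = M.xf n \<otimes>\<^bsub>H'\<^esub> x'"
 by (simp add: M.xf_def a_minus_def)

lemma M_xf_big: "p \<le> n \<Longrightarrow> M.xf n = \<zero>\<^bsub>H'\<^esub>"
 by (induction n rule: dec_induct) (simp_all add: xp0 M_xf_Suc)

lemma M_B_big: "p \<le> n \<Longrightarrow> M.B n i j = \<zero>\<^bsub>H'\<^esub>"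
 by (simp add: M.B_def M_xf_big)

lemma M_B_mult: "M.B n i j \<otimes>\<^bsub>H'\<^esub> M.B m k l = M.B (n + m) (i + k) (j + l)"
proof -
 have "M.B n i j \<otimes>\<^bsub>H'\<^esub> M.xf m = M.B (n + m) i j"
 proof (induction m)
  case (Suc m)
  have "M.B n i j \<otimes>\<^bsub>H'\<^esub> M.xf (Suc m) = M.B n i j \<otimes>\<^bsub>H'\<^esub> M.xf m \<otimes>\<^bsub>H'\<^esub> x'"
   unfolding M_xf_Suc by (rule M.mult_assoc'[symmetric]) auto
  also have "\<dots> = M.B (n + Suc m) i j"
   unfolding Suc M.B_x by (simp add: M.c_def a_minus_def)
  finally show ?case .
 qed (simp add: M.B_simps)
 then have "M.B n i j \<otimes>\<^bsub>H'\<^esub> M.xf m \<otimes>\<^bsub>H'\<^esub> M.hh k l = M.B (n + m) (i + k) (j + l)" by (simp add: M.B_hh)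
 then show ?thesis by (simp add: M.B_def[of m] M.mult_assoc')
qed

text \<open>Below total degree p this is \<open>B_mult_mod\<close>. From p on both sides vanish: on
  the left because the filtration has reached all of H, on the right because the p-th power of x' is
  zero.\<close>

lemma F_mult_cls:
 assumes "y \<in> L.Ix" "z \<in> L.Ix"
 shows "F (L.cls y \<otimes>\<^bsub>L.P.gr\<^esub> L.cls z) = M.bb y \<otimes>\<^bsub>H'\<^esub> M.bb z"
proof -
 obtain n i j m k l where yz: "y = (n, i, j)" "z = (m, k, l)" "n < p" "m < p" using assms by auto
 note cf = L.B_cf[OF yz(3), of i j] L.B_cf[OF yz(4), of k l]
 have e: "L.cls y \<otimes>\<^bsub>L.P.gr\<^esub> L.cls z = gr_class H (n + m) (L.B n i j \<otimes>\<^bsub>H\<^esub> L.B m k l)"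
  using L.P.gr_class_mult[OF cf] by (simp add: L.cls_def L.bb_def yz)
 have pc: "L.B n i j \<otimes>\<^bsub>H\<^esub> L.B m k l \<in> L.P.cf (n + m)" by (rule L.P.cf_mult[OF cf])
 have bb: "M.bb y \<otimes>\<^bsub>H'\<^esub> M.bb z = M.B (n + m) (i + k) (j + l)" by (simp add: M.bb_def yz M_B_mult)
 show ?thesis
 proof (cases "n + m < p")
  case True
  have "gr_class H (n + m) (L.B n i j \<otimes>\<^bsub>H\<^esub> L.B m k l) = gr_class H (n + m) (L.B (n + m) (i + k) (j + l))"
   using L.P.gr_class_eq[OF pc L.B_cf[OF True]] L.B_mult_mod[OF yz(3)] by blast
  then show ?thesis unfolding e bb using F_class[OF True] by simp
 next
  case False
  have z0: "\<zero>\<^bsub>H\<^esub> \<in> L.P.cf (n + m)" using L.ksubD(2)[OF L.P.cf_ks] .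
  have "gr_class H (n + m) (L.B n i j \<otimes>\<^bsub>H\<^esub> L.B m k l) = gr_class H (n + m) \<zero>\<^bsub>H\<^esub>"
   using L.P.gr_class_eq[OF pc z0] L.cb_big[of "n + m"] False by simp
  also have "\<dots> = \<zero>\<^bsub>L.P.gr\<^esub>" unfolding L.P.gr_class_sgl L.P.gr_zero by (simp add: L.P.sgl_def)
  finally show ?thesis unfolding e bb using L.P.GR.k_linear_zero[OF F_linear M.kvs_axioms] M_B_big False by simp
 qed
qed

lemma F_mult:
 assumes f: "f \<in> carrier L.P.gr" and f': "f' \<in> carrier L.P.gr"
 shows "F (f \<otimes>\<^bsub>L.P.gr\<^esub> f') = F f \<otimes>\<^bsub>H'\<^esub> F f'"
proof -
 have Fc: "F u \<in> carrier H'" if "u \<in> carrier L.P.gr" for u using k_linearD(1)[OF F_linear that] .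
 have 1: "F (L.cls y \<otimes>\<^bsub>L.P.gr\<^esub> f') = F (L.cls y) \<otimes>\<^bsub>H'\<^esub> F f'" if y: "y \<in> L.Ix" for y
  by (rule gr_linear_eq[OF M.kvs_axioms k_linear_comp[OF L.P.gr_mult_linear_right F_linear]
     k_linear_comp[OF F_linear M.lmult_linear] _ f'])
   (use y Fc F_mult_cls F_cls in auto)
 show ?thesis
  by (rule gr_linear_eq[OF M.kvs_axioms k_linear_comp[OF L.P.gr_mult_linear_left[OF f'] F_linear]
     k_linear_comp[OF F_linear M.rmult_linear[OF Fc[OF f']]] 1 f])
qed

lemma F_comult_cls:
 assumes z: "z \<in> L.Ix"
 shows "comult H' (F (L.cls z)) = tensor_map H' H' F F (gr_comult H (L.cls z))"
proof -
 obtain n i j where nz: "z = (n, i, j)" "n < p" using z by auto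
 \<comment> \<open>The terms of \<open>comult_B\<close> are already homogeneous of total degree n,
   so they form an admissible list for the class.\<close>
 define xs where "xs = map (\<lambda>k. (n - k, k, of_nat (n choose k) \<odot>\<^bsub>H\<^esub> L.B (n - k) (i + e * k) j, L.B k i j)) [0..<Suc n]"
 let ?v = "\<lambda>k. of_nat (n choose k) \<odot>\<^bsub>H\<^esub> L.B (n - k) (i + e * k) j"
 have cls: "L.cls z = L.P.gr_of (L.P.sgl n (L.B n i j))" by (simp add: nz L.cls_def L.bb_def L.P.gr_class_sgl)
 note sg = L.P.sgl_grs[OF L.B_cf[OF nz(2)], of i j]
 have vc: "?v k \<in> L.P.cf (n - k)" "L.B k i j \<in> L.P.cf k" if "k \<le> n" for k
  using L.ksubD(4)[OF L.P.cf_ks L.B_cf] L.B_cf that nz(2) by auto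
 have ft: "filter (\<lambda>(i, j, v, w). i + j = m) xs = (if m = n then xs else [])" for m
  by (auto simp: xs_def filter_empty_conv filter_id_conv)
 have rel: "L.P.gr_rel (L.P.gr_of (L.P.sgl n (L.B n i j))) xs"
  unfolding L.P.gr_rel_def
 proof (intro conjI allI)
  show "\<forall>(i, j, v, w)\<in>set xs. v \<in> L.P.cf i \<and> w \<in> L.P.cf j"
   using vc L.B_cf[of 0] L.p_gt_1 by (auto simp: xs_def)
  fix m
  have "comult H (L.P.sgl n (L.B n i j) m) = list_sum L.HH.T (map (\<lambda>(i, j, v, w). L.HH.pt v w) (filter (\<lambda>(i, j, v, w). i + j = m) xs))"
  proof (cases "m = n")
   case True
   have "list_sum L.HH.T (map (\<lambda>(i, j, v, w). L.HH.pt v w) xs) = list_sum L.HH.T (map (\<lambda>k. L.HH.pt (?v k) (L.B k i j)) [0..<Suc n])"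
    by (simp add: xs_def comp_def del: upt_Suc)
   also have "\<dots> = finsum L.HH.T (\<lambda>k. L.HH.pt (?v k) (L.B k i j)) (set [0..<Suc n])"
    by (rule L.HH.T.list_sum_distinct) (auto simp del: upt_Suc)
   also have "set [0..<Suc n] = {..n}" by auto
   also have "finsum L.HH.T (\<lambda>k. L.HH.pt (?v k) (L.B k i j)) {..n} = comult H (L.B n i j)"
    unfolding L.comult_B by (rule L.HH.T.M.finsum_cong') (auto simp: L.HH.pure_scale_left)
   finally show ?thesis using True ft by (simp add: L.P.sgl_def)
  next
   case False
   then show ?thesis using ft L.k_linear_zero[OF L.comult_lin L.HH.T_kvs] by (simp add: L.P.sgl_def)
  qed
  moreover have "L.P.sgl n (L.B n i j) m \<in> L.P.gr_of (L.P.sgl n (L.B n i j)) m"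
   using L.coset_self[OF L.P.cb_ks L.P.grsD(2)[OF sg]] by (simp add: L.P.gr_of_def)
  ultimately show "\<exists>h\<in>L.P.gr_of (L.P.sgl n (L.B n i j)) m. comult H h = list_sum L.HH.T (map (\<lambda>(i, j, v, w). L.HH.pt v w) (filter (\<lambda>(i, j, v, w). i + j = m) xs))"
   by blast
 qed
 note tl = tensor_map_linear[OF L.P.gr_kvs L.P.gr_kvs M.kvs_axioms M.kvs_axioms F_linear F_linear]
 let ?pg = "\<lambda>k. L.P.GG.pt (gr_class H (n - k) (?v k)) (gr_class H k (L.B k i j))"
 have pgc: "?pg k \<in> carrier L.P.GG.T" if "k \<le> n" for k
  using vc[OF that] by (intro L.P.GG.pure_closed L.P.gr_class_closed)
 have "gr_comult H (L.cls z) = L.P.gr_val xs" unfolding cls by (rule L.P.gr_comult_eq[OF sg rel])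
 also have "\<dots> = list_sum L.P.GG.T (map ?pg [0..<Suc n])"
  by (simp add: L.P.gr_val_def xs_def comp_def del: upt_Suc)
 also have "\<dots> = finsum L.P.GG.T ?pg (set [0..<Suc n])"
  by (rule L.P.GG.T.list_sum_distinct) (use pgc in \<open>auto simp del: upt_Suc\<close>)
 also have "set [0..<Suc n] = {..n}" by auto
 finally have "tensor_map H' H' F F (gr_comult H (L.cls z)) = finsum M.HH.T (\<lambda>k. tensor_map H' H' F F (?pg k)) {..n}"
  using L.P.GG.T.k_linear_finsum[OF tl(1) M.HH.T_kvs, of ?pg "{..n}"] pgc by auto
 also have "\<dots> = finsum M.HH.T (\<lambda>k. of_nat (n choose k) \<odot>\<^bsub>M.HH.T\<^esub> M.HH.pt (M.B (n - k) (i + e * k) j) (M.B k i j)) {..n}"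
 proof (rule M.HH.T.M.finsum_cong'[OF refl])
  fix k assume k: "k \<in> {..n}"
  then have kl: "n - k < p" "k < p" using nz(2) by auto
  have "tensor_map H' H' F F (?pg k) = M.HH.pt (F (gr_class H (n - k) (?v k))) (F (gr_class H k (L.B k i j)))"
   by (rule tl(2)) (use vc k in \<open>auto intro!: L.P.gr_class_closed\<close>)
  also have "F (gr_class H (n - k) (?v k)) = of_nat (n choose k) \<odot>\<^bsub>H'\<^esub> M.B (n - k) (i + e * k) j"
   using L.B_cf[OF kl(1)] by (simp add: L.P.gr_class_linear(2) k_linearD(3)[OF F_linear] L.P.gr_class_closed F_class[OF kl(1)])
  finally show "tensor_map H' H' F F (?pg k) = of_nat (n choose k) \<odot>\<^bsub>M.HH.T\<^esub> M.HH.pt (M.B (n - k) (i + e * k) j) (M.B k i j)"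
   by (simp add: F_class[OF kl(2)] M.HH.pure_scale_left)
 qed auto
 also have "\<dots> = comult H' (F (L.cls z))" using F_cls[OF z] by (simp add: nz M.bb_def M.comult_B)
 finally show ?thesis by simp
qed

lemma gr_hopf_iso: "hopf_iso (gr_hopf H) H'"
 unfolding hopf_iso_def
proof (intro exI[of _ F] conjI ballI)
 have one: "F \<one>\<^bsub>L.P.gr\<^esub> = \<one>\<^bsub>H'\<^esub>"
  using F_class[of 0 0 0] L.p_gt_1 by (simp add: L.P.gr_one L.B_simps M.B_simps L.hh_simps M.hh_simps)
 have "F \<in> ring_hom (gr_hopf H) H'"
  by (rule ring_hom_memI) (simp_all add: k_linearD[OF F_linear] F_mult one)
 then show "F \<in> ring_iso (gr_hopf H) H'" using F_bij by (simp add: ring_iso_def)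
 show "k_linear (gr_hopf H) H' F" using F_linear by simp
 fix f assume "f \<in> carrier (gr_hopf H)"
 then have f: "f \<in> carrier L.P.gr" by simp
 note tl = tensor_map_linear[OF L.P.gr_kvs L.P.gr_kvs M.kvs_axioms M.kvs_axioms F_linear F_linear]
 show "comult H' (F f) = tensor_map H' H' F F (comult (gr_hopf H) f)"
  using gr_linear_eq[OF M.HH.T_kvs k_linear_comp[OF F_linear M.comult_lin]
   k_linear_comp[OF L.P.gr_comult_linear tl(1)] F_comult_cls f] by simp
next
 fix f assume "f \<in> carrier (gr_hopf H)"
 then have f: "f \<in> carrier L.P.gr" by simp
 have "counit H' (F f) = counit H (the_elem (f 0))"
 proof (rule gr_linear_eq[OF ground_kvs k_linear_comp[OF F_linear M.counit_linear] L.P.gr_counit_linear _ f])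
  fix z assume z: "z \<in> L.Ix"
  obtain n i j where nz: "z = (n, i, j)" "n < p" using z by auto
  have "counit H (the_elem (L.cls z 0)) = counit H (L.P.sgl n (L.B n i j) 0)"
   using L.P.gr_counit[OF L.P.sgl_grs[OF L.B_cf[OF nz(2)]]] by (simp add: L.cls_def L.bb_def nz L.P.gr_class_sgl)
  also have "\<dots> = counit H' (F (L.cls z))"
   using F_cls[OF z] L.form_simps(1)[OF L.counit_linear] by (simp add: nz M.bb_def M.counit_B L.counit_B L.P.sgl_def)
  finally show "counit H' (F (L.cls z)) = counit H (the_elem (L.cls z 0))" ..
 qed
 then show "counit H' (F f) = counit (gr_hopf H) f" by simp
qed

lemma lifting: "pointed_hopf_algebra H" "has_dimension H (p ^ 3)" "hopf_iso (gr_hopf H) H'"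
 using L.is_pointed_hopf L.dimension gr_hopf_iso by auto

end

section \<open>The presented Hopf algebras\<close>

lemma tensor_space_cong:
 assumes "carrier V' = carrier V" "add V' = add V" "module.smult V' = module.smult V"
  "carrier W' = carrier W" "add W' = add W" "module.smult W' = module.smult W"
 shows "tensor_space V' W' = tensor_space V W" "pure_tensor V' W' = pure_tensor V W"
 by (simp_all add: tensor_space_def tensor_null_def bilinear_relations_def pure_tensor_def fun_eq_iff assms)

lemma tensor_cong:
 assumes "carrier V' = carrier V" "add V' = add V" "module.smult V' = module.smult V"
  "monoid.mult V' = monoid.mult V" "one V' = one V"
  "carrier W' = carrier W" "add W' = add W" "module.smult W' = module.smult W"
  "monoid.mult W' = monoid.mult W" "one W' = one W"
 shows "tensor V' W' = tensor V W"
 unfolding tensor_def tensor_space_cong[OF assms(1-3,6-8)] by (simp add: assms)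

lemma k_algebra_cong:
 assumes A: "k_algebra A" and eq: "carrier B = carrier A" "add B = add A" "ring.zero B = ring.zero A"
  "module.smult B = module.smult A" "monoid.mult B = monoid.mult A" "one B = one A"
 shows "k_algebra B"
proof -
 interpret A: k_algebra A by (rule A)
 have k: "kvs B" by (rule kvs_cong[OF A.kvs_axioms]) (simp_all add: eq)
 interpret k: kvs B by (rule k)
 have "ring B"
  by (rule ringI[OF k.M.abelian_group_axioms])
   (auto intro!: monoidI simp: eq A.mult_assoc' A.mult_linear)
 then show ?thesis
  using k unfolding k_algebra_def kvs_def k_algebra_axioms_def
  by (simp add: eq A.smult_mult_left A.smult_mult_right)
qed

text \<open>The image under the coproduct of u x - x u = \<alpha> (u - u g). The two excess terms
  \<alpha> (u - u g) \<otimes> u and u g \<otimes> \<alpha> (u - u g) telescope to \<alpha> (u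
  \<otimes> u - u g \<otimes> u g).\<close>

lemma (in k_algebra) skew_tensor:
 assumes c [simp]: "u \<in> carrier A" "g \<in> carrier A" "x \<in> carrier A"
  and ug: "g \<otimes> u = u \<otimes> g" and ux: "u \<otimes> x = x \<otimes> u \<oplus> \<alpha> \<odot> (u \<ominus> u \<otimes> g)"
 defines "P \<equiv> pure_tensor A A" and "T \<equiv> tensor A A"
 shows "P u u \<otimes>\<^bsub>T\<^esub> (P x \<one> \<oplus>\<^bsub>T\<^esub> P g x) =
  (P x \<one> \<oplus>\<^bsub>T\<^esub> P g x) \<otimes>\<^bsub>T\<^esub> P u u \<oplus>\<^bsub>T\<^esub> \<alpha> \<odot>\<^bsub>T\<^esub> (P u u \<ominus>\<^bsub>T\<^esub> P u u \<otimes>\<^bsub>T\<^esub> P g g)"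
proof -
 interpret AA: k_algebra_pair A A ..
 interpret TA: k_algebra "tensor A A" by (rule AA.tensor_algebra)
 have m: "P a b \<otimes>\<^bsub>T\<^esub> P a' b' = P (a \<otimes> a') (b \<otimes> b')"
  if "a \<in> carrier A" "b \<in> carrier A" "a' \<in> carrier A" "b' \<in> carrier A" for a b a' b'
  using AA.tensor_mult_pure that by (simp add: P_def T_def)
 have pc [simp]: "P a b \<in> carrier T" if "a \<in> carrier A" "b \<in> carrier A" for a b
  using that by (simp add: P_def T_def)
 have 1: "P u u \<otimes>\<^bsub>T\<^esub> (P x \<one> \<oplus>\<^bsub>T\<^esub> P g x) = P (u \<otimes> x) u \<oplus>\<^bsub>T\<^esub> P (u \<otimes> g) (u \<otimes> x)"
  using TA.mult_linear(1)[of "P u u" "P x \<one>" "P g x"] pc by (simp add: T_def m[unfolded T_def])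
 have 2: "(P x \<one> \<oplus>\<^bsub>T\<^esub> P g x) \<otimes>\<^bsub>T\<^esub> P u u = P (x \<otimes> u) u \<oplus>\<^bsub>T\<^esub> P (u \<otimes> g) (x \<otimes> u)"
  using TA.mult_linear(2)[of "P u u" "P x \<one>" "P g x"] pc by (simp add: T_def m[unfolded T_def] ug)
 show ?thesis unfolding 1 2 m[OF c(1,1,2,2)]
 proof (unfold T_def tensor_simps a_minus_tensor_space P_def, rule AA.tf_eqI)
  fix \<phi> \<psi> assume f: "lin_form A \<phi>" "lin_form A \<psi>"
  show "AA.tf \<phi> \<psi> (AA.pt (u \<otimes> x) u \<oplus>\<^bsub>AA.T\<^esub> AA.pt (u \<otimes> g) (u \<otimes> x)) =
   AA.tf \<phi> \<psi> (AA.pt (x \<otimes> u) u \<oplus>\<^bsub>AA.T\<^esub> AA.pt (u \<otimes> g) (x \<otimes> u) \<oplus>\<^bsub>AA.T\<^esub>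
    \<alpha> \<odot>\<^bsub>AA.T\<^esub> (AA.pt u u \<ominus>\<^bsub>AA.T\<^esub> AA.pt (u \<otimes> g) (u \<otimes> g)))"
   by (simp add: AA.tf_simps[OF f] ux form_simps[OF f(1)] form_simps[OF f(2)] algebra_simps)
 qed simp_all
qed

subsection \<open>Endomorphism algebras\<close>

text \<open>Endomorphisms of the image of a projection \<open>P\<close> of a function space; the unit is \<open>P\<close>.\<close>

definition end_algebra :: "(('i \<Rightarrow> 'k::field) \<Rightarrow> 'i \<Rightarrow> 'k) \<Rightarrow> ('k, ('i \<Rightarrow> 'k) \<Rightarrow> 'i \<Rightarrow> 'k) module" where
 "end_algebra P = \<lparr>carrier = {f. (\<forall>u v. f (\<lambda>i. u i + v i) = (\<lambda>i. f u i + f v i)) \<and> (\<forall>c u. f (\<lambda>i. c * u i) = (\<lambda>i. c * f u i)) \<and>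
   (\<forall>u. P (f u) = f u) \<and> (\<forall>u. f (P u) = f u)},
  monoid.mult = (\<lambda>f g u. f (g u)), one = P, ring.zero = (\<lambda>u i. 0), add = (\<lambda>f g u i. f u i + g u i),
  module.smult = (\<lambda>c f u i. c * f u i)\<rparr>"

lemma end_algebra_simps [simp]:
 "monoid.mult (end_algebra P) = (\<lambda>f g u. f (g u))" "one (end_algebra P) = P" "ring.zero (end_algebra P) = (\<lambda>u i. 0)"
 "add (end_algebra P) = (\<lambda>f g u i. f u i + g u i)" "module.smult (end_algebra P) = (\<lambda>c f u i. c * f u i)"
 by (simp_all add: end_algebra_def)

lemma endD:
 assumes "f \<in> carrier (end_algebra P)"
 shows "f (\<lambda>i. u i + v i) = (\<lambda>i. f u i + f v i)" "f (\<lambda>i. c * u i) = (\<lambda>i. c * f u i)" "P (f u) = f u" "f (P u) = f u"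
 using assms by (simp_all add: end_algebra_def)

lemma endI:
 assumes "\<And>u v. f (\<lambda>i. u i + v i) = (\<lambda>i. f u i + f v i)" "\<And>c u. f (\<lambda>i. c * u i) = (\<lambda>i. c * f u i)"
  "\<And>u. P (f u) = f u" "\<And>u. f (P u) = f u"
 shows "f \<in> carrier (end_algebra P)"
 using assms by (simp add: end_algebra_def)

lemma end_algebra_k_algebra:
 assumes P: "P \<in> carrier (end_algebra P)"
 shows "k_algebra (end_algebra P)"
proof -
 note PD = endD[OF P]
 have z: "f (\<lambda>i. 0) = (\<lambda>i. 0)" if "f \<in> carrier (end_algebra P)" for f
  using endD(2)[OF that, of 0 "\<lambda>i. 0"] by simp
 have add: "(\<lambda>u i. f u i + g u i) \<in> carrier (end_algebra P)"
  if "f \<in> carrier (end_algebra P)" "g \<in> carrier (end_algebra P)" for f g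
  by (rule endI) (simp_all only: endD[OF that(1)] endD[OF that(2)] PD, simp_all add: algebra_simps)
 have scale: "(\<lambda>u i. c * f u i) \<in> carrier (end_algebra P)" if "f \<in> carrier (end_algebra P)" for f c
  by (rule endI) (simp_all only: endD[OF that] PD, simp_all add: algebra_simps)
 have mult: "(\<lambda>u. f (g u)) \<in> carrier (end_algebra P)"
  if "f \<in> carrier (end_algebra P)" "g \<in> carrier (end_algebra P)" for f g
  by (rule endI) (simp_all only: endD[OF that(1)] endD[OF that(2)])
 have zero: "(\<lambda>u i. 0) \<in> carrier (end_algebra P)" by (rule endI) (simp_all only: z[OF P], simp_all)
 have a: "abelian_group (end_algebra P)"
 proof (rule abelian_groupI)
  fix f assume "f \<in> carrier (end_algebra P)"
  then show "\<exists>y\<in>carrier (end_algebra P). y \<oplus>\<^bsub>end_algebra P\<^esub> f = \<zero>\<^bsub>end_algebra P\<^esub>"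
   by (intro bexI[OF _ scale[of f "- 1"]]) simp_all
 qed (simp_all add: add zero add.assoc, simp_all add: add.commute)
 have r: "ring (end_algebra P)"
 proof (rule ringI[OF a])
  show "monoid (end_algebra P)"
   by (rule monoidI) (simp_all add: mult P endD)
 qed (simp_all add: endD)
 have "kvs (end_algebra P)"
  by (rule kvsI[OF a]) (simp_all add: scale algebra_simps)
 then show ?thesis
  using r unfolding k_algebra_def kvs_def k_algebra_axioms_def by (simp add: endD)
qed

lemma end_pow: "f [^]\<^bsub>end_algebra P\<^esub> Suc n = (\<lambda>u. (f [^]\<^bsub>end_algebra P\<^esub> n) (f u))"
 by (simp add: nat_pow_def)

lemma end_minus:
 assumes P: "P \<in> carrier (end_algebra P)" and f: "f \<in> carrier (end_algebra P)" "g \<in> carrier (end_algebra P)"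
 shows "f \<ominus>\<^bsub>end_algebra P\<^esub> g = (\<lambda>u i. f u i - g u i)"
proof -
 interpret E: k_algebra "end_algebra P" by (rule end_algebra_k_algebra[OF P])
 have "\<ominus>\<^bsub>end_algebra P\<^esub> g = (\<lambda>u i. (-1) * g u i)" using E.sm_neg[OF f(2)] by simp
 then show ?thesis unfolding a_minus_def by (simp only: end_algebra_simps) (simp add: fun_eq_iff)
qed

section \<open>One presentation for all parameters\<close>

definition lift_rel :: "nat \<Rightarrow> nat \<Rightarrow> 'k \<Rightarrow> 'k \<Rightarrow> 'k::field free3 set" where
 "lift_rel p e s t = group_relations p \<union>
  {g1 * xx - xx * g1 - pm_scale s (g1 * (1 - g1 ^ e)), g2 * xx - xx * g2 - pm_scale t (g2 * (1 - g1 ^ e)),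
   xx ^ p - pm_scale s xx}"

text \<open>One family covers \<open>graded_model\<close>, \<open>lifting_primitive\<close> and
  \<open>lifting_skew\<close>: written with \<open>g1 ^ e\<close>, the right-hand sides of the
  commutators disappear by themselves for e = 0.\<close>

definition lift_alg :: "nat \<Rightarrow> nat \<Rightarrow> 'k \<Rightarrow> 'k \<Rightarrow> ('k::field, 'k free3 set) bialg" where
 "lift_alg p e s t = presented_bialgebra (lift_rel p e s t) (gen_comult e) gen_counit"

lemma graded_model_lift_alg: "(graded_model p e :: ('k::field, _) bialg) = lift_alg p e 0 0"
proof -
 have "group_relations p \<union> {xx ^ p, g1 * xx - xx * g1, g2 * xx - xx * g2} = lift_rel p e 0 (0::'k::field)"
  unfolding lift_rel_def by (auto simp: pm_scale_simps)
 then show ?thesis by (simp only: graded_model_def lift_alg_def)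
qed

lemma lifting_primitive_lift_alg: "lifting_primitive p (e2 :: 'k::field) = lift_alg p 0 e2 0"
proof -
 have "group_relations p \<union> {g1 * xx - xx * g1, g2 * xx - xx * g2, xx ^ p - pm_scale e2 xx} = lift_rel p 0 e2 (0::'k::field)"
  unfolding lift_rel_def by (auto simp: pm_scale_simps)
 then show ?thesis by (simp only: lifting_primitive_def lift_alg_def)
qed

lemma lifting_skew_lift_alg: "lifting_skew p e1 \<tau> = lift_alg p 1 e1 \<tau>"
 by (simp add: lifting_skew_def lift_alg_def lift_rel_def)

lemma (in k_algebra) free_eval_lift_rel:
 assumes c: "a \<in> carrier A" "b \<in> carrier A" "x \<in> carrier A"
  and pows: "a [^] p = \<one>" "b [^] p = \<one>" and ab: "a \<otimes> b = b \<otimes> a"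
  and ax: "a \<otimes> x = x \<otimes> a \<oplus> s \<odot> (a \<ominus> a \<otimes> a [^] e)"
  and bx: "b \<otimes> x = x \<otimes> b \<oplus> t \<odot> (b \<ominus> b \<otimes> a [^] e)"
  and xp: "x [^] p = s \<odot> x" and r: "r \<in> lift_rel p e s t"
 shows "free_eval A (case_gen a b x) r = \<zero>"
proof -
 have cl: "case_gen a b x z \<in> carrier A" for z using c by (cases z) simp_all
 note fe = free_eval_simps[OF cl]
 have gens: "free_eval A (case_gen a b x) g1 = a" "free_eval A (case_gen a b x) g2 = b"
  "free_eval A (case_gen a b x) xx = x"
  by (simp_all add: gen_elem_def free_eval_gen[OF cl])
 have z: "u \<ominus> u = \<zero>" if "u \<in> carrier A" for u using that by (simp add: a_minus_def M.r_neg)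
 have z2: "(u \<oplus> v) \<ominus> u \<ominus> v = \<zero>" if "u \<in> carrier A" "v \<in> carrier A" for u v
  by (rule form_eqI) (use that in \<open>auto simp: form_simps\<close>)
 from r consider "r = g1 ^ p - 1" | "r = g2 ^ p - 1" | "r = g1 * g2 - g2 * g1"
  | "r = g1 * xx - xx * g1 - pm_scale s (g1 * (1 - g1 ^ e))"
  | "r = g2 * xx - xx * g2 - pm_scale t (g2 * (1 - g1 ^ e))" | "r = xx ^ p - pm_scale s xx"
  unfolding lift_rel_def group_relations_def by blast
 then show ?thesis
 proof cases
  case 4 then show ?thesis using c by (simp only: fe gens ax) (simp add: mult_linear z2)
 next
  case 5 then show ?thesis using c by (simp only: fe gens bx) (simp add: mult_linear z2)
 qed (use c in \<open>simp_all only: fe gens pows ab xp, simp_all add: z\<close>)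
qed

lemma presented_bialgebra_simps [simp]:
 "carrier (presented_bialgebra R d e) = carrier (presented_algebra R)"
 "monoid.mult (presented_bialgebra R d e) = monoid.mult (presented_algebra R)"
 "one (presented_bialgebra R d e) = one (presented_algebra R)"
 "ring.zero (presented_bialgebra R d e) = ring.zero (presented_algebra R)"
 "add (presented_bialgebra R d e) = add (presented_algebra R)"
 "module.smult (presented_bialgebra R d e) = module.smult (presented_algebra R)"
 "counit (presented_bialgebra R d e) = presented_lift ground_algebra e"
 by (simp_all add: presented_bialgebra_def Let_def module.extend_def bialg.fields_def)

lemma presented_bialgebra_comult:
 "comult (presented_bialgebra R d e) = (let Q = presented_algebra R in presented_lift (tensor Q Q) (\<lambda>s. list_sum (tensor Q Q)
     (map (\<lambda>(u, v). pure_tensor Q Q (presented_class R u) (presented_class R v)) (d s))))"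
 by (simp_all add: presented_bialgebra_def Let_def module.extend_def bialg.fields_def)

locale lift_params =
 fixes p e :: nat and s t :: "'k::field"
 assumes char: "CHAR('k) = p" "p > 0" and e: "e = 0 \<or> e = 1" and s: "s = 0 \<or> s = 1"
begin

sublocale presentation "lift_rel p e s t" .

sublocale QA: k_algebra Q by (rule Q_k_algebra)
sublocale QQ: k_algebra_pair Q Q ..
sublocale TQ: k_algebra "tensor Q Q" by (rule QQ.tensor_algebra)

abbreviation "ga \<equiv> cl g1"
abbreviation "gb \<equiv> cl g2"
abbreviation "gx \<equiv> cl xx"

lemma cl_c [simp]: "cl f \<in> carrier Q" by (simp add: cl_simps)

lemma cl_pow: "cl f [^]\<^bsub>Q\<^esub> (n::nat) = cl (f ^ n)"
 by (induction n) (simp_all add: cl_simps power_Suc2 del: power_Suc)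

lemma cl_diff: "cl f \<ominus>\<^bsub>Q\<^esub> cl g = cl (f - g)"
proof -
 have "\<ominus>\<^bsub>Q\<^esub> cl g = cl (pm_scale (-1) g)" using QA.sm_neg[OF cl_c] by (simp add: cl_simps)
 moreover have "pm_scale (-1) g = - g" by (rule poly_mapping_eqI) simp
 ultimately show ?thesis by (simp add: a_minus_def cl_simps)
qed

lemma relations:
 "ga [^]\<^bsub>Q\<^esub> p = \<one>\<^bsub>Q\<^esub>" "gb [^]\<^bsub>Q\<^esub> p = \<one>\<^bsub>Q\<^esub>" "ga \<otimes>\<^bsub>Q\<^esub> gb = gb \<otimes>\<^bsub>Q\<^esub> ga"
 "ga \<otimes>\<^bsub>Q\<^esub> gx = gx \<otimes>\<^bsub>Q\<^esub> ga \<oplus>\<^bsub>Q\<^esub> s \<odot>\<^bsub>Q\<^esub> (ga \<ominus>\<^bsub>Q\<^esub> ga \<otimes>\<^bsub>Q\<^esub> ga [^]\<^bsub>Q\<^esub> e)"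
 "gb \<otimes>\<^bsub>Q\<^esub> gx = gx \<otimes>\<^bsub>Q\<^esub> gb \<oplus>\<^bsub>Q\<^esub> t \<odot>\<^bsub>Q\<^esub> (gb \<ominus>\<^bsub>Q\<^esub> gb \<otimes>\<^bsub>Q\<^esub> ga [^]\<^bsub>Q\<^esub> e)"
 "gx [^]\<^bsub>Q\<^esub> p = s \<odot>\<^bsub>Q\<^esub> gx"
 unfolding cl_pow cl_simps cl_diff
 by (rule cl_rel; simp add: lift_rel_def group_relations_def algebra_simps)+

definition "cmx = QQ.pt gx \<one>\<^bsub>Q\<^esub> \<oplus>\<^bsub>QQ.T\<^esub> QQ.pt (ga [^]\<^bsub>Q\<^esub> e) gx"

lemma cmx_c [simp]: "cmx \<in> carrier QQ.T" unfolding cmx_def by simp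

lemma ff_gx: "ff Q s gx p = \<zero>\<^bsub>Q\<^esub>"
 unfolding QA.ff_prime[OF char s cl_c] relations(6) by (simp add: a_minus_def QA.M.r_neg)

lemma p_gt_1: "p > 1"
proof -
 have "Factorial_Ring.prime p" using char prime_CHAR_semidom by blast
 then show ?thesis by (rule prime_gt_1_nat)
qed

lemma choose_p_zero: "0 < k \<Longrightarrow> k < p \<Longrightarrow> of_nat (p choose k) = (0 :: 'k)"
 using dvd_choose_prime[of k p] prime_CHAR_semidom[where 'a = 'k] by (simp add: of_nat_eq_0_iff_char_dvd char)

lemma pow01: "n = 1 \<Longrightarrow> ga [^]\<^bsub>Q\<^esub> n = ga" "n = 0 \<Longrightarrow> ga [^]\<^bsub>Q\<^esub> n = \<one>\<^bsub>Q\<^esub>" for n :: nat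
 by simp_all

lemma ga_e: "ga \<otimes>\<^bsub>Q\<^esub> ga [^]\<^bsub>Q\<^esub> e = ga [^]\<^bsub>Q\<^esub> e \<otimes>\<^bsub>Q\<^esub> ga" "ga [^]\<^bsub>Q\<^esub> e \<otimes>\<^bsub>Q\<^esub> gb = gb \<otimes>\<^bsub>Q\<^esub> ga [^]\<^bsub>Q\<^esub> e"
 "ga [^]\<^bsub>Q\<^esub> e \<otimes>\<^bsub>Q\<^esub> gx = gx \<otimes>\<^bsub>Q\<^esub> ga [^]\<^bsub>Q\<^esub> e \<oplus>\<^bsub>Q\<^esub> s \<odot>\<^bsub>Q\<^esub> (ga [^]\<^bsub>Q\<^esub> e \<ominus>\<^bsub>Q\<^esub> ga [^]\<^bsub>Q\<^esub> e \<otimes>\<^bsub>Q\<^esub> ga [^]\<^bsub>Q\<^esub> e)"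
proof -
 have z: "u \<ominus>\<^bsub>Q\<^esub> u = \<zero>\<^bsub>Q\<^esub>" if "u \<in> carrier Q" for u using that by (simp only: a_minus_def QA.M.r_neg)
 show "ga \<otimes>\<^bsub>Q\<^esub> ga [^]\<^bsub>Q\<^esub> e = ga [^]\<^bsub>Q\<^esub> e \<otimes>\<^bsub>Q\<^esub> ga" by (rule QA.pow_commute[symmetric]) simp_all
 show "ga [^]\<^bsub>Q\<^esub> e \<otimes>\<^bsub>Q\<^esub> gb = gb \<otimes>\<^bsub>Q\<^esub> ga [^]\<^bsub>Q\<^esub> e" by (rule QA.pow_commute) (simp_all add: relations(3))
 show "ga [^]\<^bsub>Q\<^esub> e \<otimes>\<^bsub>Q\<^esub> gx = gx \<otimes>\<^bsub>Q\<^esub> ga [^]\<^bsub>Q\<^esub> e \<oplus>\<^bsub>Q\<^esub> s \<odot>\<^bsub>Q\<^esub> (ga [^]\<^bsub>Q\<^esub> e \<ominus>\<^bsub>Q\<^esub> ga [^]\<^bsub>Q\<^esub> e \<otimes>\<^bsub>Q\<^esub> ga [^]\<^bsub>Q\<^esub> e)"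
  using e
 proof
  assume "e = 0" then have g: "ga [^]\<^bsub>Q\<^esub> e = \<one>\<^bsub>Q\<^esub>" by (rule pow01)
  show ?thesis unfolding g by (simp add: z)
 next
  assume "e = 1" then have g: "ga [^]\<^bsub>Q\<^esub> e = ga" by (rule pow01)
  show ?thesis using relations(4) unfolding g .
 qed
qed

text \<open>For the commutators this is \<open>skew_tensor\<close>. For the power of x,
  \<open>ff_tensor\<close> expands the p-th falling factorial of the intended coproduct: the inner
  terms have zero binomial coefficients and the two outer ones contain X_p = 0.\<close>

lemma comult_rel:
 assumes "r \<in> lift_rel p e s t"
 shows "free_eval (tensor Q Q) (case_gen (QQ.pt ga ga) (QQ.pt gb gb) cmx) r = \<zero>\<^bsub>tensor Q Q\<^esub>"
proof (rule TQ.free_eval_lift_rel[OF _ _ _ _ _ _ _ _ _ assms])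
 let ?T = "tensor Q Q"
 have xT: "cmx = QQ.pt gx \<one>\<^bsub>Q\<^esub> \<oplus>\<^bsub>?T\<^esub> QQ.pt (ga [^]\<^bsub>Q\<^esub> e) gx" by (simp add: cmx_def)
 have pe: "QQ.pt ga ga [^]\<^bsub>?T\<^esub> e = QQ.pt (ga [^]\<^bsub>Q\<^esub> e) (ga [^]\<^bsub>Q\<^esub> e)" by (rule QA.pow_pure) simp_all
 show "QQ.pt ga ga [^]\<^bsub>?T\<^esub> p = \<one>\<^bsub>?T\<^esub>" "QQ.pt gb gb [^]\<^bsub>?T\<^esub> p = \<one>\<^bsub>?T\<^esub>"
  by (simp_all add: QA.pow_pure relations)
 show "QQ.pt ga ga \<otimes>\<^bsub>?T\<^esub> QQ.pt gb gb = QQ.pt gb gb \<otimes>\<^bsub>?T\<^esub> QQ.pt ga ga"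
  by (simp add: QQ.tensor_mult_pure relations(3))
 show "QQ.pt ga ga \<otimes>\<^bsub>?T\<^esub> cmx = cmx \<otimes>\<^bsub>?T\<^esub> QQ.pt ga ga \<oplus>\<^bsub>?T\<^esub> s \<odot>\<^bsub>?T\<^esub>
   (QQ.pt ga ga \<ominus>\<^bsub>?T\<^esub> QQ.pt ga ga \<otimes>\<^bsub>?T\<^esub> QQ.pt ga ga [^]\<^bsub>?T\<^esub> e)"
  unfolding xT pe by (rule QA.skew_tensor) (use ga_e relations in simp_all)
 show "QQ.pt gb gb \<otimes>\<^bsub>?T\<^esub> cmx = cmx \<otimes>\<^bsub>?T\<^esub> QQ.pt gb gb \<oplus>\<^bsub>?T\<^esub> t \<odot>\<^bsub>?T\<^esub>
   (QQ.pt gb gb \<ominus>\<^bsub>?T\<^esub> QQ.pt gb gb \<otimes>\<^bsub>?T\<^esub> QQ.pt ga ga [^]\<^bsub>?T\<^esub> e)"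
  unfolding xT pe by (rule QA.skew_tensor) (use ga_e relations in simp_all)
 have gp: "(ga [^]\<^bsub>Q\<^esub> e) [^]\<^bsub>Q\<^esub> p = \<one>\<^bsub>Q\<^esub>" using e
 proof
  assume "e = 0" then have "ga [^]\<^bsub>Q\<^esub> e = \<one>\<^bsub>Q\<^esub>" by (rule pow01)
  then show ?thesis by simp
 next
  assume "e = 1" then have "ga [^]\<^bsub>Q\<^esub> e = ga" by (rule pow01)
  then show ?thesis by (simp only: relations)
 qed
 let ?f = "\<lambda>k. of_nat (p choose k) \<odot>\<^bsub>QQ.T\<^esub> QQ.pt (ff Q s gx (p - k) \<otimes>\<^bsub>Q\<^esub> (ga [^]\<^bsub>Q\<^esub> e) [^]\<^bsub>Q\<^esub> k) (ff Q s gx k)"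
 have "?f k = \<zero>\<^bsub>QQ.T\<^esub>" if kp: "k \<le> p" for k
 proof -
  consider "k = 0" | "0 < k" "k < p" | "k = p" using kp by linarith
  then show ?thesis
  proof cases
   case 2 then show ?thesis by (simp add: choose_p_zero)
  qed (simp_all add: ff_gx)
 qed
 then have "(\<Oplus>\<^bsub>QQ.T\<^esub>k\<in>{..p}. ?f k) = (\<Oplus>\<^bsub>QQ.T\<^esub>k\<in>{..p}. \<zero>\<^bsub>QQ.T\<^esub>)"
  by (intro QQ.T.M.finsum_cong') auto
 then have "ff ?T s cmx p = \<zero>\<^bsub>QQ.T\<^esub>"
  unfolding cmx_def QA.ff_tensor[OF _ cl_c ga_e(3), simplified] by simp
 then have "cmx [^]\<^bsub>?T\<^esub> p \<ominus>\<^bsub>?T\<^esub> s \<odot>\<^bsub>?T\<^esub> cmx = \<zero>\<^bsub>?T\<^esub>"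
  using TQ.ff_prime[OF char s, of cmx] by simp
 then show "cmx [^]\<^bsub>?T\<^esub> p = s \<odot>\<^bsub>?T\<^esub> cmx"
  using TQ.M.minus_equality TQ.M.r_neg TQ.pow_c[of cmx p] TQ.sm_closed[of cmx s] cmx_c
  by (metis TQ.M.add.inv_equality TQ.M.minus_minus a_minus_def tensor_simps(1) TQ.M.a_inv_closed)
qed simp_all

lemma counit_rel:
 assumes "r \<in> lift_rel p e s t"
 shows "free_eval ground_algebra gen_counit r = 0"
proof -
 interpret G: k_algebra "ground_algebra :: ('k, 'k) module" by (rule ground_k_algebra)
 have gc: "gen_counit = case_gen 1 1 (0::'k)" by (rule ext) (simp add: gen_counit_def split: gen.split)
 have pw: "y [^]\<^bsub>(ground_algebra :: ('k, 'k) module)\<^esub> (n::nat) = y ^ n" for y n by (induction n) (simp_all add: mult.commute)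
 have "free_eval ground_algebra (case_gen 1 1 (0::'k)) r = \<zero>\<^bsub>(ground_algebra :: ('k, 'k) module)\<^esub>"
  by (rule G.free_eval_lift_rel[OF _ _ _ _ _ _ _ _ _ assms]) (use char in \<open>simp_all add: pw\<close>)
 then show ?thesis by (simp add: gc)
qed

abbreviation "LL \<equiv> lift_alg p e s t"

lemma LL_simps [simp]:
 "carrier LL = carrier Q" "monoid.mult LL = monoid.mult Q" "one LL = one Q" "ring.zero LL = ring.zero Q"
 "add LL = add Q" "module.smult LL = module.smult Q" "counit LL = presented_lift ground_algebra gen_counit"
 by (simp_all add: lift_alg_def)

lemma LL_k_algebra: "k_algebra LL" by (rule k_algebra_cong[OF Q_k_algebra]) simp_all

lemma LL_tensor: "tensor LL LL = tensor Q Q" "pure_tensor LL LL = QQ.pt"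
 by (rule tensor_cong; simp) (rule tensor_space_cong; simp)

lemma LL_comult: "comult LL = presented_lift (tensor Q Q) (case_gen (QQ.pt ga ga) (QQ.pt gb gb) cmx)"
proof -
 have "list_sum (tensor Q Q) (map (\<lambda>(u, v). QQ.pt (cl u) (cl v)) (gen_comult e z)) = case_gen (QQ.pt ga ga) (QQ.pt gb gb) cmx z" for z
  by (cases z) (simp_all add: gen_comult_def cmx_def cl_pow cl_simps)
 then show ?thesis by (simp add: lift_alg_def presented_bialgebra_comult Let_def)
qed

lemma LL_pow: "x [^]\<^bsub>LL\<^esub> (n::nat) = x [^]\<^bsub>Q\<^esub> n" by (simp add: nat_pow_def)

lemma LL_minus: "x \<ominus>\<^bsub>LL\<^esub> y = x \<ominus>\<^bsub>Q\<^esub> y" by (simp add: a_minus_def a_inv_def m_inv_def)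

lemma case_gen_c: "case_gen (QQ.pt ga ga) (QQ.pt gb gb) cmx z \<in> carrier (tensor Q Q)" by (cases z) simp_all

lemma comult_cl: "comult LL (cl f) = free_eval (tensor Q Q) (case_gen (QQ.pt ga ga) (QQ.pt gb gb) cmx) f"
 unfolding LL_comult by (rule TQ.presented_lift_cl[OF case_gen_c comult_rel])

lemma counit_cl: "counit LL (cl f) = free_eval ground_algebra gen_counit f"
 using k_algebra.presented_lift_cl[OF ground_k_algebra, of gen_counit "lift_rel p e s t" f] counit_rel by simp

lemma LL_lift_data: "lift_data LL p e s t ga gb gx"
proof -
 interpret LA: k_algebra LL by (rule LL_k_algebra)
 interpret G: k_algebra "ground_algebra :: ('k, 'k) module" by (rule ground_k_algebra)
 have 1: "comult LL \<in> ring_hom Q (tensor Q Q)" "k_linear Q (tensor Q Q) (comult LL)"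
  unfolding LL_comult by (rule TQ.presented_lift_hom[OF case_gen_c comult_rel]; assumption)+
 have 2: "counit LL \<in> ring_hom Q ground_algebra" "k_linear Q ground_algebra (counit LL)"
  using G.presented_lift_hom[of gen_counit "lift_rel p e s t"] counit_rel by simp_all
 have kl: "k_linear LL W = k_linear Q W" for W :: "('k, 'w, 'x) module_scheme" by (simp add: k_linear_def fun_eq_iff)
 have rh: "ring_hom LL W = ring_hom Q W" for W :: "('w, 'x) ring_scheme" by (simp add: ring_hom_def)
 have fe: "free_eval (tensor Q Q) (case_gen (QQ.pt ga ga) (QQ.pt gb gb) cmx) (gen_elem z) =
   case_gen (QQ.pt ga ga) (QQ.pt gb gb) cmx z" for z
  using TQ.free_eval_gen[OF case_gen_c] unfolding gen_elem_def .
 show ?thesis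
 proof (unfold_locales, unfold LL_tensor kl rh LL_pow LL_minus LL_simps)
  show "comult LL ga = QQ.pt ga ga" "comult LL gb = QQ.pt gb gb" "comult LL gx = QQ.pt gx \<one>\<^bsub>Q\<^esub> \<oplus>\<^bsub>tensor Q Q\<^esub> QQ.pt (ga [^]\<^bsub>Q\<^esub> e) gx"
   unfolding comult_cl fe by (simp_all add: cmx_def)
  show "presented_lift ground_algebra gen_counit ga = 1" "presented_lift ground_algebra gen_counit gb = 1"
   "presented_lift ground_algebra gen_counit gx = 0"
   using counit_cl[of g1] counit_cl[of g2] counit_cl[of xx] by (simp_all add: gen_elem_def G.free_eval_gen gen_counit_def)
 qed (use 1 2 char e s relations in simp_all)
qed

end

lemma (in kvs) eq_of_diff_zero: "x \<in> carrier V \<Longrightarrow> y \<in> carrier V \<Longrightarrow> x \<ominus> y = \<zero> \<Longrightarrow> x = y"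
proof (rule form_eqI)
 fix \<phi> assume "x \<in> carrier V" "y \<in> carrier V" "x \<ominus> y = \<zero>" and f: "lin_form V \<phi>"
 then show "\<phi> x = \<phi> y" using form_simps(1,5)[OF f] by (metis eq_iff_diff_eq_0)
qed

text \<open>The difference of order n + 1 of a sequence is the difference of order n of its first
  differences.\<close>

lemma alt_binomial_sum:
 "(\<Sum>r\<le>Suc n. (-1) ^ (Suc n + r) * of_nat (Suc n choose r) * U r) =
 (\<Sum>r\<le>n. (-1) ^ (n + r) * of_nat (n choose r) * (U (Suc r) - U r :: 'k::comm_ring_1))"
proof -
 let ?a = "\<lambda>r. (-1) ^ (n + r) * of_nat (n choose r) :: 'k"
 have "(\<Sum>r\<le>Suc n. (-1) ^ (Suc n + r) * of_nat (Suc n choose r) * U r) =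
  - ?a 0 * U 0 + (\<Sum>r\<le>n. (-1) ^ (Suc n + Suc r) * of_nat (Suc n choose Suc r) * U (Suc r))"
  by (subst sum.atMost_Suc_shift) simp
 also have "(\<Sum>r\<le>n. (-1) ^ (Suc n + Suc r) * of_nat (Suc n choose Suc r) * U (Suc r)) =
  (\<Sum>r\<le>n. ?a r * U (Suc r)) - (\<Sum>r\<le>n. ?a (Suc r) * U (Suc r))"
  unfolding sum_subtractf[symmetric] by (intro sum.cong) (simp_all add: algebra_simps)
 also have "- ?a 0 * U 0 + ((\<Sum>r\<le>n. ?a r * U (Suc r)) - (\<Sum>r\<le>n. ?a (Suc r) * U (Suc r))) =
  (\<Sum>r\<le>n. ?a r * U (Suc r)) - (\<Sum>r\<le>Suc n. ?a r * U r)"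
  by (subst sum.atMost_Suc_shift) (simp add: algebra_simps)
 also have "(\<Sum>r\<le>Suc n. ?a r * U r) = (\<Sum>r\<le>n. ?a r * U r)" by (simp add: binomial_eq_0)
 finally show ?thesis by (simp add: sum_subtractf right_diff_distrib)
qed

section \<open>Independence in the presented algebra by means of representations\<close>

context lift_params begin

sublocale LD: lift_data LL p e s t ga gb gx by (rule LL_lift_data)

lemma hh_cl: "LD.hh k l = cl (g1 ^ k * g2 ^ l)"
 unfolding LD.hh_def LL_pow cl_pow by (simp add: cl_simps)

text \<open>Operators that satisfy the relations give a representation of the presented algebra, and
  its matrix coefficient at a vector u and a point z is the form.\<close>

lemma representation_form:
 assumes P: "P \<in> carrier (end_algebra P)"
  and c: "a \<in> carrier (end_algebra P)" "b \<in> carrier (end_algebra P)" "x \<in> carrier (end_algebra P)"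
  and rels: "a [^]\<^bsub>end_algebra P\<^esub> p = P" "b [^]\<^bsub>end_algebra P\<^esub> p = P" "\<And>u. a (b u) = b (a u)"
   "\<And>u z. a (x u) z = x (a u) z + s * (a u z - a ((a [^]\<^bsub>end_algebra P\<^esub> e) u) z)"
   "\<And>u z. b (x u) z = x (b u) z + t * (b u z - b ((a [^]\<^bsub>end_algebra P\<^esub> e) u) z)"
   "x [^]\<^bsub>end_algebra P\<^esub> p = (\<lambda>u z. s * x u z)"
 shows "\<exists>\<phi>. lin_form LL \<phi> \<and> \<phi> gx = x u z \<and>
  (\<forall>k l. \<phi> (LD.hh k l) = (a [^]\<^bsub>end_algebra P\<^esub> k) ((b [^]\<^bsub>end_algebra P\<^esub> l) u) z)"
proof -
 let ?E = "end_algebra P" and ?f = "case_gen a b x"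
 interpret E: k_algebra ?E by (rule end_algebra_k_algebra[OF P])
 have cl: "?f y \<in> carrier ?E" for y using c by (cases y) simp_all
 have mc: "f \<otimes>\<^bsub>?E\<^esub> g \<in> carrier ?E" if "f \<in> carrier ?E" "g \<in> carrier ?E" for f g using E.mult_c[OF that] .
 have aec: "a [^]\<^bsub>?E\<^esub> e \<in> carrier ?E" using E.pow_c[OF c(1)] .
 have rel0: "free_eval ?E ?f r = \<zero>\<^bsub>?E\<^esub>" if "r \<in> lift_rel p e s t" for r
 proof (rule E.free_eval_lift_rel[OF c _ _ _ _ _ _ that])
  show "a \<otimes>\<^bsub>?E\<^esub> x = x \<otimes>\<^bsub>?E\<^esub> a \<oplus>\<^bsub>?E\<^esub> s \<odot>\<^bsub>?E\<^esub> (a \<ominus>\<^bsub>?E\<^esub> a \<otimes>\<^bsub>?E\<^esub> a [^]\<^bsub>?E\<^esub> e)"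
   unfolding end_minus[OF P c(1) mc[OF c(1) aec]] by (simp add: fun_eq_iff rels(4))
  show "b \<otimes>\<^bsub>?E\<^esub> x = x \<otimes>\<^bsub>?E\<^esub> b \<oplus>\<^bsub>?E\<^esub> t \<odot>\<^bsub>?E\<^esub> (b \<ominus>\<^bsub>?E\<^esub> b \<otimes>\<^bsub>?E\<^esub> a [^]\<^bsub>?E\<^esub> e)"
   unfolding end_minus[OF P c(2) mc[OF c(2) aec]] by (simp add: fun_eq_iff rels(5))
 qed (simp_all add: rels)
 let ?\<rho> = "presented_lift ?E ?f"
 have \<rho>: "?\<rho> (cl g) = free_eval ?E ?f g" for g by (rule E.presented_lift_cl[OF cl rel0])
 have lin: "k_linear Q ?E ?\<rho>" by (rule E.presented_lift_hom(2)[OF cl rel0])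
 have gens: "free_eval ?E ?f (gen_elem y) = ?f y" for y
  using E.free_eval_gen[OF cl] unfolding gen_elem_def .
 have "lin_form LL (\<lambda>q. ?\<rho> q u z)"
  by (rule k_linearI) (use k_linearD[OF lin] in simp_all)
 moreover have "?\<rho> gx u z = x u z" by (simp add: \<rho> gens)
 moreover have "?\<rho> (LD.hh k l) u z = (a [^]\<^bsub>?E\<^esub> k) ((b [^]\<^bsub>?E\<^esub> l) u) z" for k l
  unfolding hh_cl \<rho> E.free_eval_mult[OF cl] E.free_eval_power[OF cl] gens by simp
 ultimately show ?thesis by blast
qed

text \<open>A two-dimensional module: the group acts trivially, so the commutator relations hold as
  soon as both sides are zero, and x acts by a nonzero N with N^2 = s N, hence N^p = s N. The
  off-diagonal matrix coefficient is 0 on the group and 1 on x.\<close>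

lemma x_not_in_group_span: "gx \<notin> k_span LL {LD.hh k l |k l. True}"
proof -
 let ?P = "\<lambda>u :: bool \<Rightarrow> 'k. u" and ?N = "\<lambda>(u :: bool \<Rightarrow> 'k) z. if z then s * u True else u True"
 let ?E = "end_algebra ?P"
 have P: "?P \<in> carrier ?E" by (rule endI) simp_all
 interpret E: k_algebra ?E by (rule end_algebra_k_algebra[OF P])
 have N: "?N \<in> carrier ?E" by (rule endI) (auto simp: fun_eq_iff algebra_simps)
 have P1: "?P [^]\<^bsub>?E\<^esub> n = ?P" for n :: nat using E.one_pow[of n] by simp
 have Np: "?N [^]\<^bsub>?E\<^esub> Suc n = (\<lambda>u z. if z then s ^ Suc n * u True else s ^ n * u True)" for n
 proof (induction n)
  case 0 then show ?case by (simp add: end_pow fun_eq_iff)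
 next
  case (Suc n) show ?case unfolding end_pow[of _ _ "Suc n"] Suc.IH by (simp add: fun_eq_iff algebra_simps)
 qed
 have "p = Suc (Suc (p - 2))" using p_gt_1 by simp
 then obtain m where m: "p = Suc (Suc m)" ..
 have ss: "s ^ Suc (Suc m) = s * s" "s ^ Suc m = s" using s by (elim disjE, simp, simp)+
 have "?N [^]\<^bsub>?E\<^esub> p = (\<lambda>u z. s * ?N u z)"
  unfolding m Np ss by (simp add: fun_eq_iff)
 from representation_form[OF P P P N P1 P1 refl _ _ this, where u = "\<lambda>y. of_bool y" and z = False]
 obtain \<phi> where f: "lin_form LL \<phi>" "\<phi> gx = 1" "\<And>k l. \<phi> (LD.hh k l) = 0"
  unfolding P1 by auto
 have "\<phi> \<in> perp LL (k_span LL {LD.hh k l |k l. True})"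
  by (rule LD.perp_spanI[OF f(1)]) (auto simp: f(3) simp del: LL_simps)
 then show ?thesis using perpD(2)[of \<phi> LL "k_span LL {LD.hh k l |k l. True}" gx] f(2) by auto
qed

abbreviation "zm \<equiv> int p"

definition cc :: "int \<Rightarrow> int \<Rightarrow> 'k" where "cc i j = of_int i * s + of_int j * t"
text \<open>Functions on (Z/p)^2 are encoded as periodic functions of two integers.
  \<open>shift 0 0\<close> reduces both arguments, so it is the projection onto periodic functions
  and thereby the unit of the endomorphism algebra in use.\<close>

definition shift :: "int \<Rightarrow> int \<Rightarrow> (int \<times> int \<Rightarrow> 'k) \<Rightarrow> int \<times> int \<Rightarrow> 'k" where
 "shift q r u z = u ((fst z - q) mod zm, (snd z - r) mod zm)"
text \<open>The action of x on L / L x, identified with the group algebra: for a group element h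
  with character value c, x h = h x - c (h - h g) becomes c (h g - h). Read in terms of coefficient
  functions, this is the formula.\<close>

definition skew :: "(int \<times> int \<Rightarrow> 'k) \<Rightarrow> int \<times> int \<Rightarrow> 'k" where
 "skew u z = cc (fst z - int e) (snd z) * shift (int e) 0 u z - cc (fst z) (snd z) * shift 0 0 u z"

lemma of_int_mod: "of_int (i mod zm) = (of_int i :: 'k)"
proof -
 have "(of_int i :: 'k) = of_int (zm * (i div zm) + i mod zm)" by simp
 also have "\<dots> = of_nat p * of_int (i div zm) + of_int (i mod zm)" by (simp only: of_int_add of_int_mult of_int_of_nat_eq)
 also have "(of_nat p :: 'k) = 0" using char by (simp add: of_nat_eq_0_iff_char_dvd)
 finally show ?thesis by simp
qed

lemma cc_mod: "cc (i mod zm - n) j = cc (i - n) j" "cc (i mod zm) j = cc i j" "cc i (j mod zm) = cc i j" "cc i ((j - n) mod zm) = cc i (j - n)"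
 "cc ((i - n) mod zm) j = cc (i - n) j"  "cc ((i - n) mod zm - n') j = cc (i - n - n') j"
 by (simp_all add: cc_def of_int_mod)

lemma shift_shift: "shift q r (shift q' r' u) = shift (q + q') (r + r') u"
 by (rule ext) (simp add: shift_def mod_simps algebra_simps)

lemma shift_end: "shift q r \<in> carrier (end_algebra (shift 0 0))"
 by (rule endI) (simp_all only: shift_shift, simp_all add: shift_def fun_eq_iff)

lemma skew_end: "skew \<in> carrier (end_algebra (shift 0 0))"
proof (rule endI)
 show "shift 0 0 (skew u) = skew u" for u
  by (rule ext) (simp add: skew_def shift_def mod_simps cc_mod)
 show "skew (shift 0 0 u) = skew u" for u
  by (rule ext) (simp only: skew_def shift_shift, simp)
qed (simp_all add: skew_def shift_def algebra_simps fun_eq_iff)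

lemma shift_pow: "shift q r [^]\<^bsub>end_algebra (shift 0 0)\<^esub> n = shift (int n * q) (int n * r)"
proof (induction n)
 case (Suc n) then show ?case unfolding end_pow by (simp add: shift_shift algebra_simps)
qed simp

lemma shift_period: "shift zm 0 = shift 0 0" "shift 0 zm = shift 0 0"
 by (simp_all add: shift_def fun_eq_iff)

text \<open>On a group element h with character value c the falling factorial X_n acts as
  multiplication by c (c + s) ... (c + (n - 1) s) (g - 1)^n, since the character grows by s with
  each factor g. The formula is the binomial expansion of this, in terms of coefficient
  functions.\<close>

lemma ff_skew:
 assumes "e = 1"
 shows "ff (end_algebra (shift 0 0)) s skew n u (i, j) =
  (\<Sum>r\<le>n. (-1) ^ (n + r) * of_nat (n choose r) * ((\<Prod>k<n. cc (i - int r) j + of_nat k * s) * shift (int r) 0 u (i, j)))"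
proof (induction n arbitrary: u)
 case 0 then show ?case by simp
next
 case (Suc n)
 let ?E = "end_algebra (shift 0 0)" and ?c = "\<lambda>r. (-1) ^ (n + r) * of_nat (n choose r) :: 'k"
 define Pn where "Pn n i = (\<Prod>k<n. cc i j + of_nat k * s)" for n i
 interpret E: k_algebra ?E by (rule end_algebra_k_algebra[OF shift_end])
 have P1: "Pn (Suc n) i = Pn n i * (cc i j + of_nat n * s)" for i by (simp add: Pn_def)
 have P2: "Pn (Suc n) (i - 1) = Pn n i * cc (i - 1) j" for i
 proof -
  have "cc (i - 1) j + of_nat (Suc k) * s = cc i j + of_nat k * s" for k by (simp add: cc_def algebra_simps)
  then show ?thesis unfolding Pn_def by (subst prod.lessThan_Suc_shift) simp
 qed
 have e1: "int e = 1" using assms by simp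
 have sh: "shift (int r) 0 (skew u) (i, j) = cc (i - int (Suc r)) j * shift (int (Suc r)) 0 u (i, j) - cc (i - int r) j * shift (int r) 0 u (i, j)" for r
  unfolding shift_def skew_def e1 by (simp add: mod_simps cc_mod algebra_simps)
 have ex: "ff ?E s skew (Suc n) u (i, j) = ff ?E s skew n (skew u) (i, j) - of_nat n * s * ff ?E s skew n u (i, j)"
 proof -
  have c: "ff ?E s skew n \<otimes>\<^bsub>?E\<^esub> skew \<in> carrier ?E" "(of_nat n * s) \<odot>\<^bsub>?E\<^esub> ff ?E s skew n \<in> carrier ?E"
   using skew_end E.ff_c by blast+
  show ?thesis unfolding ff.simps end_minus[OF shift_end c] by simp
 qed
 let ?U = "\<lambda>r. Pn (Suc n) (i - int r) * shift (int r) 0 u (i, j)"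
 have "ff ?E s skew (Suc n) u (i, j) = (\<Sum>r\<le>n. ?c r * (Pn n (i - int r) * shift (int r) 0 (skew u) (i, j))
   - of_nat n * s * (?c r * (Pn n (i - int r) * shift (int r) 0 u (i, j))))"
  unfolding ex Suc Pn_def by (simp only: sum_subtractf sum_distrib_left)
 also have "\<dots> = (\<Sum>r\<le>n. ?c r * (?U (Suc r) - ?U r))"
 proof (rule sum.cong[OF refl])
  fix r
  have "Pn (Suc n) (i - int (Suc r)) = Pn n (i - int r) * cc (i - int (Suc r)) j"
   using P2[of "i - int r"] by (simp add: algebra_simps)
  then show "?c r * (Pn n (i - int r) * shift (int r) 0 (skew u) (i, j))
   - of_nat n * s * (?c r * (Pn n (i - int r) * shift (int r) 0 u (i, j))) = ?c r * (?U (Suc r) - ?U r)"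
   unfolding sh P1[of "i - int r"] by (simp add: algebra_simps)
 qed
 also have "\<dots> = (\<Sum>r\<le>Suc n. (-1) ^ (Suc n + r) * of_nat (Suc n choose r) * ?U r)"
  by (rule alt_binomial_sum[symmetric])
 finally show ?case unfolding Pn_def .
qed

text \<open>For e = 0 the operator is zero. For e = 1 the falling factorial X_p acts through (g -
  1)^p = g^p - 1 = 0.\<close>

lemma skew_pow: "skew [^]\<^bsub>end_algebra (shift 0 0)\<^esub> p = (\<lambda>u z. s * skew u z)"
proof -
 let ?E = "end_algebra (shift 0 0)"
 interpret E: k_algebra ?E by (rule end_algebra_k_algebra[OF shift_end])
 show ?thesis using e
 proof
  assume "e = 0"
  then have "int e = 0" by simp
  then have z: "skew = \<zero>\<^bsub>?E\<^esub>" unfolding fun_eq_iff skew_def by simp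
  have "skew [^]\<^bsub>?E\<^esub> Suc m = \<zero>\<^bsub>?E\<^esub>" for m
   unfolding E.pow_Suc'(1) using E.mult_0(2)[OF E.pow_c[OF skew_end, of m]] z by (simp only:)
  from this[of "p - 1"] have "skew [^]\<^bsub>?E\<^esub> p = \<zero>\<^bsub>?E\<^esub>" using Suc_pred'[of p] char(2) by (simp only: One_nat_def)
  moreover have "(\<lambda>u z. s * skew u z) = \<zero>\<^bsub>?E\<^esub>" unfolding z by simp
  ultimately show ?thesis by (rule trans[OF _ sym])
 next
  assume e1: "e = 1"
  have "ff ?E s skew p u z = 0" for u z
  proof -
   obtain i j where z: "z = (i, j)" by (cases z)
   let ?U = "\<lambda>r. (\<Prod>k<p. cc (i - int r) j + of_nat k * s) * shift (int r) 0 u (i, j)"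
   have p0: "(of_nat p :: 'k) = 0" using char by (simp add: of_nat_eq_0_iff_char_dvd)
   have "ff ?E s skew p u z = (\<Sum>r\<le>p. (-1) ^ (p + r) * of_nat (p choose r) * ?U r)"
    unfolding z by (rule ff_skew[OF e1])
   also have "\<dots> = (\<Sum>r\<in>{0, p}. (-1) ^ (p + r) * of_nat (p choose r) * ?U r)"
    by (rule sum.mono_neutral_right) (auto simp: choose_p_zero)
   also have "\<dots> = ((-1) ^ p + 1) * ?U 0"
   proof -
    have "(-1 :: 'k) ^ (p + p) = 1" by (simp add: power_add flip: power_mult_distrib)
    moreover have "?U p = ?U 0" using p0 shift_period by (simp add: cc_def)
    ultimately show ?thesis using p_gt_1 by (simp add: algebra_simps)
   qed
   \<comment> \<open>By Fermat's theorem for - 1, which treats p = 2 along with odd p.\<close>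
   also have "(-1 :: 'k) ^ p + 1 = 0"
   proof -
    have "(-1 :: 'k) = of_nat (p - 1)" using p0 p_gt_1 by (simp add: of_nat_diff)
    then show ?thesis using of_nat_power_CHAR[OF char, of "p - 1"] by (metis add.left_inverse)
   qed
   finally show ?thesis by simp
  qed
  then have "skew [^]\<^bsub>?E\<^esub> p \<ominus>\<^bsub>?E\<^esub> s \<odot>\<^bsub>?E\<^esub> skew = \<zero>\<^bsub>?E\<^esub>"
   using E.ff_prime[OF char s skew_end] by (simp add: fun_eq_iff)
  then have "skew [^]\<^bsub>?E\<^esub> p = s \<odot>\<^bsub>?E\<^esub> skew"
   by (rule E.eq_of_diff_zero[OF E.pow_c[OF skew_end] E.sm_closed[OF skew_end]])
  then show ?thesis by simp
 qed
qed

text \<open>The group monomial with exponents (k, l) moves the delta function at the origin to (k,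
  l). The matrix coefficient at the point (i, j) therefore separates it from the others.\<close>

lemma group_dual:
 assumes "i < p" "j < p"
 shows "\<exists>\<phi>. lin_form LL \<phi> \<and> (\<forall>k<p. \<forall>l<p. \<phi> (LD.hh k l) = (if k = i \<and> l = j then 1 else 0))"
proof -
 let ?E = "end_algebra (shift 0 0)"
 let ?u = "\<lambda>z. if z = (0, 0) then 1 else 0"
 have ae: "shift 1 0 [^]\<^bsub>?E\<^esub> e = shift (int e) 0" unfolding shift_pow by simp
 have "\<exists>\<phi>. lin_form LL \<phi> \<and> \<phi> gx = skew ?u (int i, int j) \<and>
  (\<forall>k l. \<phi> (LD.hh k l) = (shift 1 0 [^]\<^bsub>?E\<^esub> k) ((shift 0 1 [^]\<^bsub>?E\<^esub> l) ?u) (int i, int j))"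
 proof (rule representation_form[OF shift_end shift_end shift_end skew_end])
  show "shift 1 0 [^]\<^bsub>?E\<^esub> p = shift 0 0" "shift 0 1 [^]\<^bsub>?E\<^esub> p = shift 0 0"
   unfolding shift_pow by (simp_all add: shift_period)
  show "shift 1 0 (shift 0 1 u) = shift 0 1 (shift 1 0 u)" for u by (simp add: shift_shift)
  show "shift 1 0 (skew u) z = skew (shift 1 0 u) z +
   s * (shift 1 0 u z - shift 1 0 ((shift 1 0 [^]\<^bsub>?E\<^esub> e) u) z)" for u z
   unfolding ae skew_def shift_shift
   by (simp add: shift_def mod_simps cc_mod) (simp add: cc_def algebra_simps)
  show "shift 0 1 (skew u) z = skew (shift 0 1 u) z +
   t * (shift 0 1 u z - shift 0 1 ((shift 1 0 [^]\<^bsub>?E\<^esub> e) u) z)" for u z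
   unfolding ae skew_def shift_shift
   by (simp add: shift_def mod_simps cc_mod) (simp add: cc_def algebra_simps)
  show "skew [^]\<^bsub>?E\<^esub> p = (\<lambda>u z. s * skew u z)" by (rule skew_pow)
 qed
 then obtain \<phi> where f: "lin_form LL \<phi>"
  "\<And>k l. \<phi> (LD.hh k l) = (shift 1 0 [^]\<^bsub>?E\<^esub> k) ((shift 0 1 [^]\<^bsub>?E\<^esub> l) ?u) (int i, int j)" by blast
 have m: "(int a - int b) mod zm = 0 \<longleftrightarrow> b = a" if "a < p" "b < p" for a b
 proof -
  have "(int a - int b) mod zm = 0 \<longleftrightarrow> int a mod zm = int b mod zm" by (simp add: mod_eq_dvd_iff dvd_eq_mod_eq_0)
  then show ?thesis using that by auto
 qed
 have "\<phi> (LD.hh k l) = (if k = i \<and> l = j then 1 else 0)" if "k < p" "l < p" for k l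
  unfolding f(2) shift_pow shift_shift using m[OF assms(1) that(1)] m[OF assms(2) that(2)]
  by (simp add: shift_def)
 then show ?thesis using f(1) by blast
qed

lemma LL_lift_basis: "lift_basis LL p e s t ga gb gx"
 by unfold_locales (rule group_dual x_not_in_group_span; assumption?)+

sublocale LB: lift_basis LL p e s t ga gb gx by (rule LL_lift_basis)

lemma xf_p: "LD.xf p = \<zero>\<^bsub>LL\<^esub>"
 unfolding LD.X_p LL_pow LL_minus LL_simps relations(6) by (simp add: a_minus_def QA.M.r_neg)

text \<open>By \<open>B_x\<close> right multiplication by x leads at most to degree p, where the
  monomials vanish because X_p = 0. This is why \<open>BW'\<close> includes the degree p.\<close>

lemma span_right_mult:
 assumes "v \<in> k_span LL (LB.bb ` LB.Ix)"
 shows "v \<otimes>\<^bsub>LL\<^esub> cl (gen_elem y) \<in> k_span LL (LB.bb ` LB.Ix)"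
proof -
 let ?S = "LB.bb ` LB.Ix" and ?W = "k_span LL (LB.bb ` LB.Ix)"
 have Ssub: "?S \<subseteq> carrier LL" by (intro image_subsetI) (rule LB.bb_c)
 note W = LD.ksubD[OF LD.span_ksub[OF Ssub]]
 have Wc: "z \<in> ?W \<Longrightarrow> z \<in> carrier LL" for z using W(1) by blast
 have yc: "cl (gen_elem y) \<in> carrier LL" unfolding LL_simps by simp
 note lin = k_linearD[OF LD.rmult_linear[OF yc]]
 let ?N = "{v \<in> carrier LL. v \<otimes>\<^bsub>LL\<^esub> cl (gen_elem y) \<in> ?W}"
 have BW: "LD.B n k l \<in> ?W" if "n < p" for n k l
 proof -
  have "LD.B n k l = LB.bb (n, k mod p, l mod p)" by (simp add: LB.bb_def LD.B_mod)
  moreover have "(n, k mod p, l mod p) \<in> LB.Ix" using that p_gt_1 by simp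
  ultimately have "LD.B n k l \<in> ?S" by simp
  then show ?thesis by (rule subsetD[OF LD.span_incl])
 qed
 have BW': "LD.B n k l \<in> ?W" if "n \<le> p" for n k l
 proof (cases "n = p")
  case True then show ?thesis using W(2) by (simp add: LD.B_def xf_p LD.mult_0(1)[OF LD.hh_c, simplified])
 next
  case False then show ?thesis using BW that by simp
 qed
 have "k_subspace LL ?N"
  by (rule LD.ksubI) (auto simp: lin W yc simp del: LL_simps)
 moreover have "?S \<subseteq> ?N"
 proof (rule image_subsetI)
  fix z assume z: "z \<in> LB.Ix"
  obtain n k l where nkl: "z = (n, k, l)" by (cases z)
  have n: "n < p" using z nkl by simp
  have "LD.B n k l \<otimes>\<^bsub>LL\<^esub> cl (gen_elem y) \<in> ?W"
  proof (cases y)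
   case Gen_g1 then show ?thesis using LD.B_hh[of n k l 1 0] BW[OF n, of "k + 1" l] by (simp add: LD.hh_simps)
  next
   case Gen_g2 then show ?thesis using LD.B_hh[of n k l 0 1] BW[OF n, of k "l + 1"] by (simp add: LD.hh_simps)
  next
   case Gen_x
   have "LD.B n k l \<otimes>\<^bsub>LL\<^esub> gx \<in> ?W"
    unfolding LD.B_x by (intro W(3,4,6) BW[OF n] BW') (use n in simp)
   then show ?thesis using Gen_x by simp
  qed
  then show "LB.bb z \<in> ?N" using LB.bb_c[of z] by (simp add: LB.bb_def nkl)
 qed
 ultimately have "?W \<subseteq> ?N" by (rule LD.span_min)
 then show ?thesis using assms by blast
qed

lemma LL_spans: "carrier LL = k_span LL (LB.bb ` LB.Ix)"
proof
 let ?S = "LB.bb ` LB.Ix" and ?W = "k_span LL (LB.bb ` LB.Ix)"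
 have Ssub: "?S \<subseteq> carrier LL" by (intro image_subsetI) (rule LB.bb_c)
 note W = LD.ksubD[OF LD.span_ksub[OF Ssub]]
 show "?W \<subseteq> carrier LL" by (rule W(1))
 have word: "cl (single w 1) \<in> ?W" for w
 proof (induction w rule: rev_induct)
  case Nil
  have "LB.bb (0, 0, 0) \<in> ?S" using p_gt_1 by (intro imageI) simp
  then have "LB.bb (0, 0, 0) \<in> ?W" by (rule subsetD[OF LD.span_incl])
  moreover have "LB.bb (0, 0, 0) = \<one>\<^bsub>LL\<^esub>" unfolding LB.bb_def by (simp only: prod.case LD.B_simps LD.hh_simps)
  ultimately have "\<one>\<^bsub>LL\<^esub> \<in> ?W" by (simp only:)
  moreover have "(1 :: 'k free3) = single [] 1" by (simp add: zero_list_def[symmetric])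
  ultimately show ?case by (simp add: cl_simps)
 next
  case (snoc y w)
  have "single (w @ [y]) (1::'k) = single w 1 * gen_elem y"
   by (simp add: gen_elem_def mult_single plus_list_def)
  then have "cl (single (w @ [y]) 1) = cl (single w 1) \<otimes>\<^bsub>LL\<^esub> cl (gen_elem y)"
   by (simp add: cl_simps)
  then show ?case using span_right_mult[OF snoc] by (simp only:)
 qed
 have "cl f \<in> ?W" for f
 proof -
  have "keys f \<subseteq> UNIV" by simp
  then show ?thesis
  proof (induction f rule: pm_keys_induct)
   case zero then show ?case using W(2) by (simp add: cl_simps)
  next
   case (single w d)
   have "cl (single w d) = d \<odot>\<^bsub>LL\<^esub> cl (single w 1)" by (simp add: cl_simps)
   then show ?case using W(4)[OF word] by (simp only:)
  next
   case (add f g)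
   have "cl (f + g) = cl f \<oplus>\<^bsub>LL\<^esub> cl g" by (simp add: cl_simps)
   then show ?case using W(3)[OF add(3,4)] by (simp only:)
  qed
 qed
 then show "carrier LL \<subseteq> ?W" by (auto simp: cl_simps)
qed

lemma LL_lift_full: "lift_full LL p e s t ga gb gx"
 by unfold_locales (rule LL_spans)

end

theorem lift_alg_pointed_lifting:
 assumes "CHAR('k::field) = p" "p > 0" "e = 0 \<or> e = 1" "s = 0 \<or> s = (1::'k)"
 shows "pointed_lifting p e (lift_alg p e s t)"
proof -
 interpret A: lift_params p e s t using assms by (simp add: lift_params_def)
 interpret B: lift_params p e 0 "0 :: 'k" using assms by (simp add: lift_params_def)
 interpret A: lift_full "lift_alg p e s t" p e s t A.ga A.gb A.gx by (rule A.LL_lift_full)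
 interpret B: lift_full "lift_alg p e 0 0" p e 0 0 B.ga B.gb B.gx by (rule B.LL_lift_full)
 interpret gr_pair "lift_alg p e s t" p e s t A.ga A.gb A.gx "lift_alg p e 0 0" B.ga B.gb B.gx
  by unfold_locales (rule B.xf_p)
 show ?thesis unfolding pointed_lifting_def graded_model_lift_alg using lifting by blast
qed

section \<open>Liftings\<close>

subsection \<open>Skew primitive elements\<close>

lemma lin_form_diff:
 assumes "kvs V" "lin_form V \<phi>" "lin_form V \<psi>"
 shows "lin_form V (\<lambda>v. \<phi> v - \<psi> v)"
proof -
 interpret kvs V by fact
 show ?thesis
  by (rule k_linearI) (simp_all add: form_simps[OF assms(2)] form_simps[OF assms(3)] algebra_simps)
qed

lemma (in pointed_bialgebra) cf0_formI:
 assumes "lin_form H \<phi>" "lin_form H \<psi>" "\<And>a. a \<in> grouplikes H \<Longrightarrow> \<phi> a = \<psi> a" "y \<in> cf 0"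
 shows "\<phi> y = \<psi> y"
proof -
 have "(\<lambda>v. \<phi> v - \<psi> v) \<in> perp H (cf 0)"
  by (rule cf0_perpI[OF lin_form_diff[OF kvs_axioms assms(1,2)]]) (simp add: assms(3))
 from perpD(2)[OF this assms(4)] show ?thesis by simp
qed

text \<open>The forms \<open>E a\<close> are coordinates on H_0 with respect to the grouplikes;
  elsewhere on H their values are unspecified, so forms are compared only through their values at
  grouplikes.\<close>

locale finite_pointed = pointed_bialgebra H for H :: "('k::field, 'h) bialg" (structure) +
 fixes E :: "'h \<Rightarrow> 'h \<Rightarrow> 'k"
 assumes finite_G: "finite (grouplikes H)"
  and E_form: "a \<in> grouplikes H \<Longrightarrow> lin_form H (E a)"
  and E_dual: "a \<in> grouplikes H \<Longrightarrow> b \<in> grouplikes H \<Longrightarrow> E a b = (if a = b then 1 else 0)"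
begin

abbreviation "\<Gamma> \<equiv> grouplikes H"

text \<open>The combination of the \<open>E a\<close> that agrees with \<phi> on the grouplikes,
  hence on H_0.\<close>

definition ex :: "('h \<Rightarrow> 'k) \<Rightarrow> 'h \<Rightarrow> 'k" where "ex \<phi> v = (\<Sum>a\<in>\<Gamma>. \<phi> a * E a v)"

lemma ex_form: "lin_form H (ex \<phi>)"
 unfolding ex_def by (rule lin_form_sum[OF kvs_axioms E_form])

lemma ex_grouplike: "b \<in> \<Gamma> \<Longrightarrow> ex \<phi> b = \<phi> b"
proof -
 assume b: "b \<in> \<Gamma>"
 have "ex \<phi> b = (\<Sum>a\<in>\<Gamma>. if a = b then \<phi> a else 0)"
  unfolding ex_def by (intro sum.cong) (auto simp: E_dual b)
 then show ?thesis using b finite_G by simp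
qed

lemma cf0_expand: "lin_form H \<phi> \<Longrightarrow> y \<in> cf 0 \<Longrightarrow> \<phi> y = (\<Sum>a\<in>\<Gamma>. \<phi> a * E a y)"
 unfolding ex_def[symmetric] by (rule cf0_formI[OF _ ex_form]) (simp_all add: ex_grouplike)

text \<open>Comparing the coefficients at a \<otimes> b of both expressions for \<Delta> y gives a
  Kronecker-delta equation. It kills every coefficient of y except those at u and w and makes these
  two opposite to each other.\<close>

lemma skew_primitive_coradical:
 assumes y: "y \<in> cf 0" and u: "u \<in> \<Gamma>" "w \<in> \<Gamma>"
  and D: "\<Delta> y = HH.pt y u \<oplus>\<^bsub>HH.T\<^esub> HH.pt w y"
 shows "\<exists>d. y = d \<odot> (u \<ominus> w)"
proof -
 have yc: "y \<in> carrier H" by (rule cf_closed[OF y])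
 note uc = grouplikesD(1)[OF u(1)] grouplikesD(1)[OF u(2)]
 have cvy: "cv \<phi> \<psi> y = \<phi> y * \<psi> u + \<phi> w * \<psi> y" if "lin_form H \<phi>" "lin_form H \<psi>" for \<phi> \<psi>
  unfolding cv_def D using that yc uc by (simp add: HH.tf_simps[OF that])
 have rel: "(if a = b then E a y else 0) = E a y * (if b = u then 1 else 0) + (if a = w then 1 else 0) * E b y"
  if ab: "a \<in> \<Gamma>" "b \<in> \<Gamma>" for a b
 proof -
  have lf: "lin_form H (\<lambda>v. (if a = b then 1 else 0) * E a v)"
   by (rule k_linearI) (simp_all add: form_simps[OF E_form[OF ab(1)]])
  have "cv (E a) (E b) y = (if a = b then 1 else 0) * E a y"
   by (rule cf0_formI[OF cv_linear[OF E_form[OF ab(1)] E_form[OF ab(2)]] lf _ y])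
    (simp add: cv_grouplike E_form E_dual ab)
  then show ?thesis unfolding cvy[OF E_form[OF ab(1)] E_form[OF ab(2)]] by (simp add: E_dual ab u if_distrib[of "\<lambda>z. z * _"] cong: if_cong)
 qed
 define d where "d = (if u = w then 0 else E u y)"
 have c: "E a y = d * ((if a = u then 1 else 0) - (if a = w then 1 else 0))" if a: "a \<in> \<Gamma>" for a
 proof (cases "u = w")
  case True
  \<comment> \<open>If u = w, the coefficient at u equals its own double and vanishes, also in
    characteristic 2.\<close>
  have "(2::'k) \<noteq> 1" by (metis one_add_one add_cancel_right_right zero_neq_one)
  then show ?thesis using True rel[OF a a] by (cases "a = u") (auto simp: d_def)
 next
  case False
  have "E w y = - E u y" using rel[OF u(2,1)] False by (simp add: eq_neg_iff_add_eq_0 add.commute)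
  then show ?thesis using rel[OF a a] False by (auto simp: d_def split: if_splits)
 qed
 have "y = d \<odot> (u \<ominus> w)"
 proof (rule form_eqI[OF yc])
  fix \<phi> assume f: "lin_form H \<phi>"
  have "\<phi> y = (\<Sum>a\<in>\<Gamma>. d * (if a = u then \<phi> a else 0) - d * (if a = w then \<phi> a else 0))"
   unfolding cf0_expand[OF f y] by (intro sum.cong refl) (auto simp: c algebra_simps)
  also have "\<dots> = d * \<phi> u - d * \<phi> w" using u finite_G by (simp add: sum_subtractf flip: sum_distrib_left)
  finally show "\<phi> y = \<phi> (d \<odot> (u \<ominus> w))" using uc by (simp add: form_simps[OF f] algebra_simps)
 qed (use uc in auto)
 then show ?thesis ..
qed

text \<open>
 The failure \<open>\<tau>\<close> of \<open>h\<close> to be skew primitive lives on \<open>H\<^sub>0 \<otimes> H\<^sub>0\<close> and is a 2-cocycle by coassociativity;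
 the coefficients \<open>l\<close> below make it a coboundary.
\<close>

lemma skew_primitive_exists:
 assumes g: "g \<in> \<Gamma>" and h: "h \<in> carrier H"
  and left: "\<And>\<phi> \<psi>. \<phi> \<in> perp H (cf 0) \<Longrightarrow> lin_form H \<psi> \<Longrightarrow> cv \<phi> \<psi> h = \<phi> h * \<psi> \<one>"
  and right: "\<And>\<phi> \<psi>. lin_form H \<phi> \<Longrightarrow> \<psi> \<in> perp H (cf 0) \<Longrightarrow> cv \<phi> \<psi> h = \<phi> g * \<psi> h"
 shows "\<exists>x\<in>carrier H. \<Delta> x = HH.pt x \<one> \<oplus>\<^bsub>HH.T\<^esub> HH.pt g x \<and> x \<ominus> h \<in> cf 0"
proof -
 define \<tau> where "\<tau> \<phi> \<psi> = cv \<phi> \<psi> h - \<phi> h * \<psi> \<one> - \<phi> g * \<psi> h" for \<phi> \<psi>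
 note gc = grouplikesD(1)[OF g]
 have g0: "g \<in> cf 0" "\<one> \<in> cf 0" using grouplike_cf0[OF g] grouplike_cf0[OF one_grouplike] by auto
 have hD: "\<Delta> h \<in> carrier HH.T" using h by simp
 \<comment> \<open>By \<open>left\<close>, \<tau> vanishes when its first argument annihilates H_0,
   so only the values at grouplikes matter there; \<open>tr\<close> does the same for the second
   argument. Thus \<tau> is given by the finite matrix T below.\<close>
 have tl: "\<tau> \<phi> \<psi> = \<tau> \<phi>' \<psi>" if f: "lin_form H \<phi>" "lin_form H \<phi>'" "lin_form H \<psi>"
  and eq: "\<And>a. a \<in> \<Gamma> \<Longrightarrow> \<phi> a = \<phi>' a" for \<phi> \<phi>' \<psi>
 proof -
  have p: "(\<lambda>v. \<phi> v - \<phi>' v) \<in> perp H (cf 0)"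
   by (rule cf0_perpI[OF lin_form_diff[OF kvs_axioms f(1,2)]]) (simp add: eq)
  have "cv (\<lambda>v. \<phi> v - \<phi>' v) \<psi> h = cv \<phi> \<psi> h - cv \<phi>' \<psi> h"
   unfolding cv_def HH.form_rsl[OF f(1,3) hD, symmetric] HH.form_rsl[OF f(2,3) hD, symmetric]
    HH.form_rsl[OF perpD(1)[OF p] f(3) hD, symmetric] ..
  then show ?thesis using left[OF p f(3)] eq[OF g] by (simp add: \<tau>_def algebra_simps)
 qed
 have tr: "\<tau> \<phi> \<psi> = \<tau> \<phi> \<psi>'" if f: "lin_form H \<psi>" "lin_form H \<psi>'" "lin_form H \<phi>"
  and eq: "\<And>a. a \<in> \<Gamma> \<Longrightarrow> \<psi> a = \<psi>' a" for \<phi> \<psi> \<psi>'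
 proof -
  have p: "(\<lambda>v. \<psi> v - \<psi>' v) \<in> perp H (cf 0)"
   by (rule cf0_perpI[OF lin_form_diff[OF kvs_axioms f(1,2)]]) (simp add: eq)
  have "cv \<phi> (\<lambda>v. \<psi> v - \<psi>' v) h = cv \<phi> \<psi> h - cv \<phi> \<psi>' h"
   unfolding cv_def HH.form_lsl[OF f(3,1) hD, symmetric] HH.form_lsl[OF f(3,2) hD, symmetric]
    HH.form_lsl[OF f(3) perpD(1)[OF p] hD, symmetric] ..
  then show ?thesis using right[OF f(3) p] eq[OF one_grouplike] by (simp add: \<tau>_def algebra_simps)
 qed
 have exl: "\<tau> (ex \<phi>) \<psi> = (\<Sum>a\<in>\<Gamma>. \<phi> a * \<tau> (E a) \<psi>)" if f: "lin_form H \<psi>" for \<phi> \<psi>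
 proof -
  have "cv (ex \<phi>) \<psi> h = (\<Sum>a\<in>\<Gamma>. \<phi> a * cv (E a) \<psi> h)"
   unfolding cv_def HH.form_rsl[OF ex_form f hD, symmetric] ex_def
   by (intro sum.cong refl) (simp add: HH.form_rsl[OF E_form f hD])
  then show ?thesis
   by (simp add: \<tau>_def ex_def right_diff_distrib sum_subtractf sum_distrib_right mult.assoc)
 qed
 have exr: "\<tau> \<phi> (ex \<psi>) = (\<Sum>a\<in>\<Gamma>. \<psi> a * \<tau> \<phi> (E a))" if f: "lin_form H \<phi>" for \<phi> \<psi>
 proof -
  have "cv \<phi> (ex \<psi>) h = (\<Sum>a\<in>\<Gamma>. \<psi> a * cv \<phi> (E a) h)"
   unfolding cv_def HH.form_lsl[OF f ex_form hD, symmetric] ex_def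
   by (intro sum.cong refl) (simp add: HH.form_lsl[OF f E_form hD])
  then show ?thesis
   by (simp add: \<tau>_def ex_def right_diff_distrib sum_subtractf sum_distrib_left mult.assoc mult.left_commute)
 qed
 define T where "T a b = \<tau> (E a) (E b)" for a b
 have tau: "\<tau> \<phi> \<psi> = (\<Sum>a\<in>\<Gamma>. \<Sum>b\<in>\<Gamma>. \<phi> a * \<psi> b * T a b)" if f: "lin_form H \<phi>" "lin_form H \<psi>" for \<phi> \<psi>
 proof -
  have "\<tau> \<phi> \<psi> = \<tau> (ex \<phi>) \<psi>" by (rule tl[OF f(1) ex_form f(2)]) (simp add: ex_grouplike)
  also have "\<dots> = (\<Sum>a\<in>\<Gamma>. \<phi> a * \<tau> (E a) \<psi>)" by (rule exl[OF f(2)])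
  also have "\<dots> = (\<Sum>a\<in>\<Gamma>. \<Sum>b\<in>\<Gamma>. \<phi> a * \<psi> b * T a b)"
  proof (rule sum.cong[OF refl])
   fix a assume a: "a \<in> \<Gamma>"
   have "\<tau> (E a) \<psi> = \<tau> (E a) (ex \<psi>)" by (rule tr[OF f(2) ex_form E_form[OF a]]) (simp add: ex_grouplike)
   then show "\<phi> a * \<tau> (E a) \<psi> = (\<Sum>b\<in>\<Gamma>. \<phi> a * \<psi> b * T a b)"
    by (simp add: exr[OF E_form[OF a]] T_def sum_distrib_left mult.assoc)
  qed
  finally show ?thesis .
 qed
 \<comment> \<open>Associativity of convolution at h, rewritten in terms of \<tau>; the
   contributions of the skew primitive shape cancel.\<close>
 have cocycle: "\<tau> \<phi> \<psi> * \<chi> \<one> + \<tau> (cv \<phi> \<psi>) \<chi> = \<phi> g * \<tau> \<psi> \<chi> + \<tau> \<phi> (cv \<psi> \<chi>)"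
  if f: "lin_form H \<phi>" "lin_form H \<psi>" "lin_form H \<chi>" for \<phi> \<psi> \<chi>
  using cv_assoc[OF f h] by (simp add: \<tau>_def cv_grouplike[OF g] cv_grouplike[OF one_grouplike] f algebra_simps)
 define del where "del a b = (if a = b then 1 else 0 :: 'k)" for a b :: 'h
 \<comment> \<open>On grouplikes the forms \<open>E a\<close> multiply like orthogonal idempotents,
   and \<tau> sees nothing else of its arguments.\<close>
 have Tc: "T a b * del c \<one> + del a b * T a c = del a g * T b c + del b c * T a b"
  if abc: "a \<in> \<Gamma>" "b \<in> \<Gamma>" "c \<in> \<Gamma>" for a b c
 proof -
  note f = E_form[OF abc(1)] E_form[OF abc(2)] E_form[OF abc(3)]
  have sc: "lin_form H (\<lambda>v. k * E c v)" if "c \<in> \<Gamma>" for k c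
   by (rule k_linearI) (simp_all add: form_simps[OF E_form[OF that]] algebra_simps)
  have 1: "\<tau> (cv (E a) (E b)) (E c) = del a b * T a c"
  proof -
   have "\<tau> (cv (E a) (E b)) (E c) = \<tau> (\<lambda>v. del a b * E a v) (E c)"
    by (rule tl[OF cv_linear[OF f(1,2)] sc[OF abc(1)] f(3)]) (simp add: cv_grouplike f E_dual abc del_def)
   also have "\<dots> = del a b * T a c"
    unfolding \<tau>_def T_def cv_def HH.form_rsl[OF sc[OF abc(1)] f(3) hD, symmetric] HH.form_rsl[OF f(1,3) hD, symmetric]
    by (simp add: algebra_simps)
   finally show ?thesis .
  qed
  have 2: "\<tau> (E a) (cv (E b) (E c)) = del b c * T a b"
  proof -
   have "\<tau> (E a) (cv (E b) (E c)) = \<tau> (E a) (\<lambda>v. del b c * E b v)"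
    by (rule tr[OF cv_linear[OF f(2,3)] sc[OF abc(2)] f(1)]) (simp add: cv_grouplike f E_dual abc del_def)
   also have "\<dots> = del b c * T a b"
    unfolding \<tau>_def T_def cv_def HH.form_lsl[OF f(1) sc[OF abc(2)] hD, symmetric] HH.form_lsl[OF f(1,2) hD, symmetric]
    by (simp add: algebra_simps)
   finally show ?thesis .
  qed
  show ?thesis using cocycle[OF f] by (simp add: 1 2 T_def[symmetric] E_dual abc g one_grouplike del_def)
 qed
 \<comment> \<open>The values suggested by the coboundary equation \<open>Tl\<close>: its entries
   (a, a) with a \<noteq> g give - l a, and its entry (g, 1) gives l g.\<close>
 define l where "l a = (if a = g then T g \<one> else - T a a)" for a
 have Tl: "T a b = - l a * del a b + l a * del b \<one> + del a g * l b" if ab: "a \<in> \<Gamma>" "b \<in> \<Gamma>" for a b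
 proof (cases "a = g")
  case False
  then show ?thesis using Tc[OF ab(1,1,2)] by (auto simp: l_def del_def algebra_simps split: if_splits)
 next
  case True
  show ?thesis
  proof (cases "b = g")
   case True
   then show ?thesis using \<open>a = g\<close> Tc[OF g g one_grouplike] by (auto simp: l_def del_def algebra_simps split: if_splits)
  next
   case False
   then show ?thesis using \<open>a = g\<close> Tc[OF g ab(2,2)] by (auto simp: l_def del_def algebra_simps eq_neg_iff_add_eq_0 split: if_splits)
  qed
 qed
 \<comment> \<open>By \<open>Tl\<close> the failure of y to be skew primitive is the negative of
   that of h, so h + y has none.\<close>
 define y where "y = (\<Oplus>a\<in>\<Gamma>. l a \<odot> a)"
 have y0: "y \<in> cf 0" unfolding y_def by (rule ksub_finsum[OF cf_ks]) (rule ksubD(4)[OF cf_ks grouplike_cf0])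
 have yc: "y \<in> carrier H" by (rule cf_closed[OF y0])
 have \<phi>y: "\<phi> y = (\<Sum>a\<in>\<Gamma>. l a * \<phi> a)" if f: "lin_form H \<phi>" for \<phi>
  unfolding y_def using grouplikesD(1) by (simp add: form_simps[OF f] Pi_def)
 have xc: "h \<oplus> y \<in> carrier H" using h yc by simp
 have "\<Delta> (h \<oplus> y) = HH.pt (h \<oplus> y) \<one> \<oplus>\<^bsub>HH.T\<^esub> HH.pt g (h \<oplus> y)"
 proof (rule HH.tf_eqI)
  fix \<phi> \<psi> assume f: "lin_form H \<phi>" "lin_form H \<psi>"
  have cy: "cv \<phi> \<psi> y = (\<Sum>a\<in>\<Gamma>. l a * (\<phi> a * \<psi> a))"
   unfolding \<phi>y[OF cv_linear[OF f]] by (intro sum.cong refl) (simp add: cv_grouplike f)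
  have in_sum: "(\<Sum>b\<in>\<Gamma>. \<phi> a * \<psi> b * T a b) = - (l a * (\<phi> a * \<psi> a)) + l a * \<phi> a * \<psi> \<one> + (if a = g then \<phi> g * \<psi> y else 0)"
   if a: "a \<in> \<Gamma>" for a
  proof -
   have "(\<Sum>b\<in>\<Gamma>. \<phi> a * \<psi> b * T a b) = (\<Sum>b\<in>\<Gamma>. (if b = a then - (l a * (\<phi> a * \<psi> a)) else 0)
     + (if b = \<one> then l a * \<phi> a * \<psi> \<one> else 0) + (if a = g then \<phi> g * (l b * \<psi> b) else 0))"
    by (intro sum.cong refl) (auto simp: Tl[OF a] del_def algebra_simps)
   also have "\<dots> = - (l a * (\<phi> a * \<psi> a)) + l a * \<phi> a * \<psi> \<one> + (if a = g then \<phi> g * \<psi> y else 0)"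
    using a finite_G one_grouplike by (simp add: sum.distrib \<phi>y[OF f(2)] sum_distrib_left)
   finally show ?thesis .
  qed
  have "\<tau> \<phi> \<psi> = (\<Sum>a\<in>\<Gamma>. - (l a * (\<phi> a * \<psi> a)) + l a * \<phi> a * \<psi> \<one> + (if a = g then \<phi> g * \<psi> y else 0))"
   unfolding tau[OF f] by (intro sum.cong refl in_sum)
  also have "\<dots> = - cv \<phi> \<psi> y + \<phi> y * \<psi> \<one> + \<phi> g * \<psi> y"
   using g finite_G by (simp add: sum.distrib cy \<phi>y[OF f(1)] sum_negf sum_subtractf sum_distrib_right)
  finally have "cv \<phi> \<psi> h + cv \<phi> \<psi> y = (\<phi> h + \<phi> y) * \<psi> \<one> + \<phi> g * (\<psi> h + \<psi> y)"
   by (simp add: \<tau>_def algebra_simps)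
  then have "cv \<phi> \<psi> (h \<oplus> y) = \<phi> (h \<oplus> y) * \<psi> \<one> + \<phi> g * \<psi> (h \<oplus> y)"
   using h yc by (simp add: form_simps[OF cv_linear[OF f]] form_simps[OF f(1)] form_simps[OF f(2)])
  then show "HH.tf \<phi> \<psi> (\<Delta> (h \<oplus> y)) = HH.tf \<phi> \<psi> (HH.pt (h \<oplus> y) \<one> \<oplus>\<^bsub>HH.T\<^esub> HH.pt g (h \<oplus> y))"
   using xc gc by (simp add: cv_def HH.tf_simps[OF f])
 qed (use xc gc in simp_all)
 moreover have "(h \<oplus> y) \<ominus> h = y" by (rule form_eqI) (use h yc in \<open>auto simp: form_simps\<close>)
 ultimately show ?thesis using xc y0 by (intro bexI[of _ "h \<oplus> y"]) simp_all
qed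

end

subsection \<open>Independent families and dimension\<close>

text \<open>Coordinates over B place W among the formal combinations of elements of B. The dual
  forms make these coordinate vectors independent, so the exchange bound for independent sets inside
  a span applies.\<close>

lemma (in kvs) card_le_of_dual_forms:
 assumes B: "finite B" "B \<subseteq> carrier V" and W: "W \<subseteq> carrier V"
  and ex: "\<And>w. w \<in> W \<Longrightarrow> \<exists>c. w = (\<Oplus>b\<in>B. c b \<odot> b)"
  and dual: "\<And>w. w \<in> W \<Longrightarrow> \<exists>\<phi>. lin_form V \<phi> \<and> (\<forall>w'\<in>W. \<phi> w' = (if w' = w then 1 else 0))"
 shows "finite W \<and> card W \<le> card B"
proof -
 have "\<forall>w\<in>W. \<exists>c. w = (\<Oplus>b\<in>B. c b \<odot> b)" using ex by blast
 from bchoice[OF this] obtain c where c: "\<And>w. w \<in> W \<Longrightarrow> w = (\<Oplus>b\<in>B. c w b \<odot> b)" by auto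
 define C where "C w = (\<Sum>b\<in>B. single b (c w b))" for w
 have keys: "keys (C w) \<subseteq> B" for w
  unfolding C_def using keys_sum[of "\<lambda>b. single b (c w b)" B] by fastforce
 have look: "lookup (C w) b = c w b" if "b \<in> B" for w b
 proof -
  have "lookup (C w) b = (\<Sum>b'\<in>B. if b' = b then c w b' else 0)"
   unfolding C_def lookup_sum by (intro sum.cong refl) (auto simp: lookup_single when_def)
  then show ?thesis using that B(1) by simp
 qed
 have ev: "pm_eval V (\<lambda>b. b) (C w) = w" if w: "w \<in> W" for w
 proof -
  have "pm_eval V (\<lambda>b. b) (C w) = (\<Oplus>b\<in>B. lookup (C w) b \<odot> b)"
   by (rule pm_eval_superset[OF B(1) keys]) (use B(2) in auto)
  also have "\<dots> = (\<Oplus>b\<in>B. c w b \<odot> b)" by (rule M.finsum_cong') (use B(2) look in auto)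
  finally show ?thesis using c[OF w] by simp
 qed
 have inj: "inj_on C W" by (rule inj_onI) (metis ev)
 have sp: "C ` W \<subseteq> pmvs.span ((\<lambda>b. single b 1) ` B)"
 proof (rule image_subsetI)
  fix w assume "w \<in> W"
  have "single b (c w b) \<in> pmvs.span ((\<lambda>b. single b 1) ` B)" if "b \<in> B" for b
   using pmvs.span_scale[OF pmvs.span_base[OF imageI[OF that, of "\<lambda>b. single b 1"]], of "c w b"] by simp
  then show "C w \<in> pmvs.span ((\<lambda>b. single b 1) ` B)" unfolding C_def by (intro pmvs.span_sum)
 qed
 have ind: "pmvs.independent (C ` W)"
  unfolding pmvs.dependent_def
 proof (rule notI, elim bexE)
  fix f assume "f \<in> C ` W" and f: "f \<in> pmvs.span (C ` W - {f})"
  then obtain w where w: "w \<in> W" "f = C w" by blast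
  obtain \<phi> where \<phi>: "lin_form V \<phi>" "\<And>w'. w' \<in> W \<Longrightarrow> \<phi> w' = (if w' = w then 1 else 0)" using dual[OF w(1)] by blast
  \<comment> \<open>A subspace that contains the coordinates of all other members of W but not those
    of w.\<close>
  let ?N = "{h. keys h \<subseteq> B \<and> \<phi> (pm_eval V (\<lambda>b. b) h) = 0}"
  have pc: "pm_eval V (\<lambda>b. b) h \<in> carrier V" if "keys h \<subseteq> B" for h
   by (rule pm_eval_closed) (use that B(2) in auto)
  have sub: "pmvs.subspace ?N"
  proof (rule pmvs.subspaceI)
   show "0 \<in> ?N" by (simp add: form_simps(1)[OF \<phi>(1)])
  next
   fix h h' assume hh: "h \<in> ?N" "h' \<in> ?N"
   then have k: "keys h \<subseteq> B" "keys h' \<subseteq> B" by auto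
   have "pm_eval V (\<lambda>b. b) (h + h') = pm_eval V (\<lambda>b. b) h \<oplus> pm_eval V (\<lambda>b. b) h'"
    by (rule pm_eval_add[OF k]) (use B(2) in auto)
   then show "h + h' \<in> ?N" using hh keys_add_sub[OF k] by (simp add: form_simps(2)[OF \<phi>(1)] pc k)
  next
   fix a h assume hh: "h \<in> ?N"
   then have k: "keys h \<subseteq> B" by auto
   have "pm_eval V (\<lambda>b. b) (pm_scale a h) = a \<odot> pm_eval V (\<lambda>b. b) h"
    by (rule pm_eval_scale) (use k B(2) in auto)
   then show "pm_scale a h \<in> ?N" using hh keys_scale_sub[OF k] by (simp add: form_simps(3)[OF \<phi>(1)] pc k)
  qed
  have "C ` W - {f} \<subseteq> ?N"
  proof
   fix h assume "h \<in> C ` W - {f}"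
   then obtain w' where w': "w' \<in> W" "h = C w'" "w' \<noteq> w" using w by blast
   show "h \<in> ?N" using ev[OF w'(1)] \<phi>(2)[OF w'(1)] w'(3) keys by (simp add: w'(2))
  qed
  then have "f \<in> ?N" using pmvs.span_minimal[OF _ sub] f by blast
  then show False using ev[OF w(1)] \<phi>(2)[OF w(1)] by (simp add: w(2))
 qed
 have fin: "finite ((\<lambda>b. single b (1::'k)) ` B)" using B(1) by simp
 have "finite (C ` W) \<and> card (C ` W) \<le> card ((\<lambda>b. single b (1::'k)) ` B)"
  by (rule pmvs.independent_span_bound[OF fin ind sp])
 then show ?thesis using inj card_image_le[OF B(1), of "\<lambda>b. single b (1::'k)"]
  by (simp add: card_image finite_image_iff)
qed

text \<open>A vector outside the span of the monomials would, together with them, give p^3 + 1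
  vectors with dual forms, more than a basis has.\<close>

lemma (in lift_basis) lift_full_of_dimension:
 assumes "has_dimension H (p ^ 3)" shows "lift_full H p e s t a b x"
proof
 have Ssub: "bb ` Ix \<subseteq> carrier H" by auto
 note W = ksubD[OF span_ksub[OF Ssub]]
 show "carrier H = k_span H (bb ` Ix)"
 proof (rule ccontr)
  assume "carrier H \<noteq> k_span H (bb ` Ix)"
  then obtain v where v: "v \<in> carrier H" "v \<notin> k_span H (bb ` Ix)" using W(1) by blast
  obtain \<theta> where \<theta>: "lin_form H \<theta>" "\<And>y. y \<in> k_span H (bb ` Ix) \<Longrightarrow> \<theta> y = 0" "\<theta> v = 1"
   using separate[OF span_ksub[OF Ssub] v] by metis
  have \<theta>b: "\<theta> (bb z) = 0" if "z \<in> Ix" for z by (rule \<theta>(2)[OF subsetD[OF span_incl imageI[OF that]]])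
  have vb: "v \<notin> bb ` Ix" using v(2) subsetD[OF span_incl[of "bb ` Ix"]] by metis
  from assms obtain B where "finite B \<and> card B = p ^ 3 \<and> B \<subseteq> carrier H \<and>
   (\<forall>w\<in>carrier H. \<exists>!c. c \<in> B \<rightarrow>\<^sub>E (UNIV :: 'k set) \<and> w = (\<Oplus>u\<in>B. c u \<odot> u))"
   unfolding has_dimension_def ..
  then have B: "finite B" "card B = p ^ 3" "B \<subseteq> carrier H"
   and Bex: "\<forall>w\<in>carrier H. \<exists>!c. c \<in> B \<rightarrow>\<^sub>E (UNIV :: 'k set) \<and> w = (\<Oplus>u\<in>B. c u \<odot> u)" by simp_all
  have "finite (insert v (bb ` Ix)) \<and> card (insert v (bb ` Ix)) \<le> card B"
  proof (rule card_le_of_dual_forms[OF B(1,3)])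
   show "insert v (bb ` Ix) \<subseteq> carrier H" using v(1) by auto
   show "\<exists>c. w = (\<Oplus>u\<in>B. c u \<odot> u)" if "w \<in> insert v (bb ` Ix)" for w
   proof -
    have "w \<in> carrier H" using that v(1) by auto
    from ex1_implies_ex[OF bspec[OF Bex this]] show ?thesis by (elim exE conjE) (rule exI)
   qed
   fix w assume w: "w \<in> insert v (bb ` Ix)"
   show "\<exists>\<phi>. lin_form H \<phi> \<and> (\<forall>w'\<in>insert v (bb ` Ix). \<phi> w' = (if w' = w then 1 else 0))"
   proof (cases "w = v")
    case True
    then show ?thesis using \<theta> \<theta>b vb by (intro exI[of _ \<theta>]) auto
   next
    case False
    then obtain z where z: "z \<in> Ix" "w = bb z" using w by blast
    \<comment> \<open>The coordinate form may have any value at v, which lies outside the span; the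
      multiple of \<theta> removes it without touching the monomials.\<close>
    let ?\<phi> = "\<lambda>y. cz z y - cz z v * \<theta> y"
    have "lin_form H (\<lambda>y. cz z v * \<theta> y)" by (rule k_linearI) (simp_all add: form_simps[OF \<theta>(1)] algebra_simps)
    then have "lin_form H ?\<phi>" by (rule lin_form_diff[OF kvs_axioms cz_form[OF z(1)]])
    moreover have "?\<phi> (bb y) = (if bb y = w then 1 else 0)" if "y \<in> Ix" for y
     using that z cz_bb[OF z(1) that] \<theta>b[OF that] inj_on_eq_iff[OF bb_inj that z(1)] by simp
    moreover have "?\<phi> v = 0" using \<theta>(3) by simp
    ultimately show ?thesis using False by (intro exI[of _ ?\<phi>]) auto
   qed
  qed
  moreover have "card (insert v (bb ` Ix)) = Suc (p ^ 3)"
   using vb card_image[OF bb_inj] by (simp add: card_cartesian_product power3_eq_cube)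
  ultimately show False using B(2) by simp
 qed
qed

subsection \<open>Isomorphisms between liftings\<close>

text \<open>With equal parameters and X_p = 0 on both sides, the two algebras have the same
  structure constants with respect to their monomials.\<close>

locale lift_iso = L: lift_full H p e s t a b x + M: lift_full H' p e s t a' b' x'
 for H :: "('k::field, 'h) bialg" and p e s t a b x and H' :: "('k, 'h2) bialg" and a' b' x' +
 assumes xp: "L.xf p = \<zero>\<^bsub>H\<^esub>" "M.xf p = \<zero>\<^bsub>H'\<^esub>"
begin

definition F :: "'h \<Rightarrow> 'h2" where
 "F v = (\<Oplus>\<^bsub>H'\<^esub>z\<in>L.Ix. L.cz z v \<odot>\<^bsub>H'\<^esub> M.bb z)"
definition G :: "'h2 \<Rightarrow> 'h" where
 "G v = (\<Oplus>\<^bsub>H\<^esub>z\<in>L.Ix. M.cz z v \<odot>\<^bsub>H\<^esub> L.bb z)"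

lemma F_linear: "k_linear H H' F"
 unfolding F_def by (rule L.expand_linear[OF M.kvs_axioms]) simp

lemma G_linear: "k_linear H' H G"
 unfolding G_def by (rule M.expand_linear[OF L.kvs_axioms]) simp

lemmas F_lin = k_linearD[OF F_linear]

lemma F_B_small: assumes "n < p" shows "F (L.B n i j) = M.B n i j"
proof -
 have z: "(n, i mod p, j mod p) \<in> L.Ix" using assms by simp
 have "F (L.bb (n, i mod p, j mod p)) = M.bb (n, i mod p, j mod p)"
  unfolding F_def by (rule L.expand_bb[OF M.kvs_axioms _ z]) simp
 then show ?thesis by (simp add: L.bb_def M.bb_def L.B_mod M.B_mod)
qed

text \<open>The degree p is included because \<open>B_x\<close> leads there from degree p -
  1.\<close>

lemma F_B: assumes "n \<le> p" shows "F (L.B n i j) = M.B n i j"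
proof (cases "n = p")
 case True
 have "L.B p i j = \<zero>\<^bsub>H\<^esub>" "M.B p i j = \<zero>\<^bsub>H'\<^esub>" by (simp_all add: L.B_def M.B_def xp)
 then show ?thesis using L.k_linear_zero[OF F_linear M.kvs_axioms] True by simp
next
 case False then show ?thesis using assms F_B_small by simp
qed

lemma G_B_small: assumes "n < p" shows "G (M.B n i j) = L.B n i j"
proof -
 have z: "(n, i mod p, j mod p) \<in> L.Ix" using assms by simp
 have "G (M.bb (n, i mod p, j mod p)) = L.bb (n, i mod p, j mod p)"
  unfolding G_def by (rule M.expand_bb[OF L.kvs_axioms _ z]) simp
 then show ?thesis by (simp add: L.bb_def M.bb_def L.B_mod M.B_mod)
qed

lemma G_F: "v \<in> carrier H \<Longrightarrow> G (F v) = v"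
 by (rule L.linear_basis_eq[OF L.kvs_axioms k_linear_comp[OF F_linear G_linear] k_linear_id])
  (simp_all add: F_B_small G_B_small)

lemma F_G: "v \<in> carrier H' \<Longrightarrow> F (G v) = v"
 by (rule M.linear_basis_eq[OF M.kvs_axioms k_linear_comp[OF G_linear F_linear] k_linear_id])
  (simp_all add: F_B_small G_B_small)

lemma F_bij: "bij_betw F (carrier H) (carrier H')"
 by (rule bij_betwI[of _ _ _ G]) (use k_linearD(1)[OF F_linear] k_linearD(1)[OF G_linear] F_G G_F in auto)

text \<open>The elements on the right of which F is multiplicative. They form a subalgebra, so it is
  enough to treat the generators, and for these \<open>B_x\<close> and \<open>B_hh\<close> give the
  products with all monomials.\<close>

definition ml :: "'h \<Rightarrow> bool" where
 "ml w \<longleftrightarrow> w \<in> carrier H \<and> (\<forall>v\<in>carrier H. F (v \<otimes>\<^bsub>H\<^esub> w) = F v \<otimes>\<^bsub>H'\<^esub> F w)"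

lemma mlI:
 assumes w: "w \<in> carrier H" and B: "\<And>n i j. n < p \<Longrightarrow> F (L.B n i j \<otimes>\<^bsub>H\<^esub> w) = M.B n i j \<otimes>\<^bsub>H'\<^esub> F w"
 shows "ml w"
 unfolding ml_def
proof (intro conjI ballI w)
 fix v assume v: "v \<in> carrier H"
 show "F (v \<otimes>\<^bsub>H\<^esub> w) = F v \<otimes>\<^bsub>H'\<^esub> F w"
  by (rule L.linear_basis_eq[OF M.kvs_axioms k_linear_comp[OF L.rmult_linear[OF w] F_linear]
   k_linear_comp[OF F_linear M.rmult_linear[OF F_lin(1)[OF w]]] _ v]) (simp add: B F_B_small)
qed

lemma F_gens: "F a = a'" "F b = b'" "F x = x'" "F \<one>\<^bsub>H\<^esub> = \<one>\<^bsub>H'\<^esub>"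
 using F_B_small[of 0 1 0] F_B_small[of 0 0 1] F_B_small[of 1 0 0] F_B_small[of 0 0 0] L.p_gt_1
 by (simp_all add: L.B_simps M.B_simps L.hh_simps M.hh_simps)

lemma ml_gens: "ml a" "ml b" "ml x" "ml \<one>\<^bsub>H\<^esub>"
proof -
 show "ml \<one>\<^bsub>H\<^esub>" by (rule mlI) (simp_all add: F_gens F_B_small)
 show "ml a"
 proof (rule mlI)
  fix n i j assume "n < p"
  then show "F (L.B n i j \<otimes>\<^bsub>H\<^esub> a) = M.B n i j \<otimes>\<^bsub>H'\<^esub> F a"
   using L.B_hh[of n i j 1 0] M.B_hh[of n i j 1 0] by (simp add: F_gens F_B_small L.hh_simps M.hh_simps)
 qed simp
 show "ml b"
 proof (rule mlI)
  fix n i j assume "n < p"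
  then show "F (L.B n i j \<otimes>\<^bsub>H\<^esub> b) = M.B n i j \<otimes>\<^bsub>H'\<^esub> F b"
   using L.B_hh[of n i j 0 1] M.B_hh[of n i j 0 1] by (simp add: F_gens F_B_small L.hh_simps M.hh_simps)
 qed simp
 show "ml x"
 proof (rule mlI)
  fix n i j assume n: "n < p"
  show "F (L.B n i j \<otimes>\<^bsub>H\<^esub> x) = M.B n i j \<otimes>\<^bsub>H'\<^esub> F x"
   unfolding L.B_x F_gens M.B_x using n
   by (simp add: F_lin L.k_linear_diff[OF F_linear M.kvs_axioms] F_B L.c_def M.c_def)
 qed simp
qed

lemma ml_mult: assumes "ml v" "ml w" shows "ml (v \<otimes>\<^bsub>H\<^esub> w)"
proof -
 have c: "v \<in> carrier H" "w \<in> carrier H" using assms by (auto simp: ml_def)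
 have "F (u \<otimes>\<^bsub>H\<^esub> (v \<otimes>\<^bsub>H\<^esub> w)) = F u \<otimes>\<^bsub>H'\<^esub> F (v \<otimes>\<^bsub>H\<^esub> w)" if u: "u \<in> carrier H" for u
 proof -
  have "F (u \<otimes>\<^bsub>H\<^esub> (v \<otimes>\<^bsub>H\<^esub> w)) = F (u \<otimes>\<^bsub>H\<^esub> v \<otimes>\<^bsub>H\<^esub> w)" using u c by (simp add: L.mult_assoc')
  also have "\<dots> = F u \<otimes>\<^bsub>H'\<^esub> F v \<otimes>\<^bsub>H'\<^esub> F w" using assms u c by (simp add: ml_def)
  also have "\<dots> = F u \<otimes>\<^bsub>H'\<^esub> (F v \<otimes>\<^bsub>H'\<^esub> F w)" using u c by (simp add: M.mult_assoc' F_lin)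
  also have "F v \<otimes>\<^bsub>H'\<^esub> F w = F (v \<otimes>\<^bsub>H\<^esub> w)" using assms c by (simp add: ml_def)
  finally show ?thesis .
 qed
 then show ?thesis using c by (simp add: ml_def)
qed

lemma ml_ksub: "k_subspace H {w \<in> carrier H. ml w}"
proof -
 have z: "F \<zero>\<^bsub>H\<^esub> = \<zero>\<^bsub>H'\<^esub>" by (rule L.k_linear_zero[OF F_linear M.kvs_axioms])
 show ?thesis
  by (rule L.ksubI)
   (auto simp: ml_def z F_lin L.mult_linear M.mult_linear L.smult_mult_right M.smult_mult_right)
qed

lemma ml_all: assumes "v \<in> carrier H" shows "ml v"
proof -
 note K = L.ksubD[OF ml_ksub]
 have c: "ml w \<Longrightarrow> w \<in> carrier H" for w by (simp add: ml_def)
 have pw: "ml (w [^]\<^bsub>H\<^esub> (n::nat))" if "ml w" for w n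
  by (induction n) (simp_all add: ml_gens ml_mult that)
 have xf: "ml (L.xf n)" for n
 proof (induction n)
  case (Suc n)
  have "ml (L.xf n \<otimes>\<^bsub>H\<^esub> x)" using Suc ml_gens(3) by (rule ml_mult)
  then show ?case using K(6)[of "L.xf n \<otimes>\<^bsub>H\<^esub> x" "(of_nat n * s) \<odot>\<^bsub>H\<^esub> L.xf n"] K(4)[of "L.xf n"] Suc
   by (simp add: L.xf_def)
 qed (simp add: L.xf_def ml_gens)
 have B: "ml (L.B n i j)" for n i j
  unfolding L.B_def L.hh_def by (intro ml_mult xf pw ml_gens)
 have "k_span H (L.bb ` L.Ix) \<subseteq> {w \<in> carrier H. ml w}"
  by (rule L.span_min[OF ml_ksub]) (auto simp: L.bb_def B)
 then show ?thesis using assms L.spans by blast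
qed

lemma iso: "hopf_iso H H'"
 unfolding hopf_iso_def
proof (intro exI[of _ F] conjI ballI F_linear)
 show "F \<in> ring_iso H H'"
  unfolding ring_iso_def using F_bij ml_all
  by (auto intro!: ring_hom_memI simp: F_lin F_gens ml_def)
 fix v assume v: "v \<in> carrier H"
 note TM = tensor_map_linear[OF L.kvs_axioms L.kvs_axioms M.kvs_axioms M.kvs_axioms F_linear F_linear]
 show "comult H' (F v) = tensor_map H' H' F F (comult H v)"
 proof (rule L.linear_basis_eq[OF M.HH.T_kvs k_linear_comp[OF F_linear M.comult_lin] k_linear_comp[OF L.comult_lin TM(1)] _ v])
  fix n i j assume n: "n < p" "i < p" "j < p"
  show "comult H' (F (L.B n i j)) = tensor_map H' H' F F (comult H (L.B n i j))"
  proof (rule M.HH.tf_eqI)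
   show "comult H' (F (L.B n i j)) \<in> carrier M.HH.T" by (simp add: F_lin)
   show "tensor_map H' H' F F (comult H (L.B n i j)) \<in> carrier M.HH.T"
    by (rule k_linearD(1)[OF TM(1)]) simp
   fix \<phi> \<psi> assume f: "lin_form H' \<phi>" "lin_form H' \<psi>"
   note f' = k_linear_comp[OF F_linear f(1)] k_linear_comp[OF F_linear f(2)]
   have "M.HH.tf \<phi> \<psi> (tensor_map H' H' F F (comult H (L.B n i j))) = L.HH.tf (\<lambda>v. \<phi> (F v)) (\<lambda>v. \<psi> (F v)) (comult H (L.B n i j))"
    by (rule tf_tensor_map[OF L.kvs_axioms L.kvs_axioms M.kvs_axioms M.kvs_axioms F_linear F_linear f]) simp
   also have "\<dots> = (\<Sum>k\<le>n. of_nat (n choose k) * (\<phi> (F (L.B (n - k) (i + e * k) j)) * \<psi> (F (L.B k i j))))"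
    by (rule L.tf_B[OF f'])
   also have "\<dots> = (\<Sum>k\<le>n. of_nat (n choose k) * (\<phi> (M.B (n - k) (i + e * k) j) * \<psi> (M.B k i j)))"
    using n by (intro sum.cong refl) (simp add: F_B_small)
   also have "\<dots> = M.HH.tf \<phi> \<psi> (comult H' (F (L.B n i j)))"
    unfolding F_B_small[OF n(1)] by (rule M.tf_B[OF f, symmetric])
   finally show "M.HH.tf \<phi> \<psi> (comult H' (F (L.B n i j))) = M.HH.tf \<phi> \<psi> (tensor_map H' H' F F (comult H (L.B n i j)))" ..
  qed
 qed
 show "counit H' (F v) = counit H v"
  by (rule L.linear_basis_eq[OF ground_kvs k_linear_comp[OF F_linear M.counit_linear] L.counit_linear _ v])
   (simp add: F_B_small L.counit_B M.counit_B)
qed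

end

subsection \<open>Lifting the generators\<close>

text \<open>Forms are functions on a whole type and may differ off the carrier. Equality on the
  carrier is all that is available after composing with a map and its inverse.\<close>

lemma (in kvs_pair) tf_cong:
 assumes "lin_form V \<phi>" "lin_form V \<phi>'" "lin_form W \<psi>" "lin_form W \<psi>'"
  and "\<And>v. v \<in> carrier V \<Longrightarrow> \<phi> v = \<phi>' v" "\<And>w. w \<in> carrier W \<Longrightarrow> \<psi> w = \<psi>' w" and "y \<in> carrier T"
 shows "tf \<phi> \<psi> y = tf \<phi>' \<psi>' y"
 by (rule linear_eqI[OF tf_linear[OF assms(1,3)] tf_linear[OF assms(2,4)] _ assms(7)]) (simp add: tf_pure assms)

text \<open>N stands for L(e, 0, 0) and F for the given isomorphism of gr H with it. Generators of H
  itself still have to be found.\<close>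

locale gr_lifting = pointed_bialgebra H + N: lift_full N p e 0 0 a b x
 for H :: "('k::field, 'h) bialg" (structure) and N :: "('k, 'n) bialg" and p e :: nat and a b x :: 'n +
 fixes F :: "(nat \<Rightarrow> 'h set) \<Rightarrow> 'n"
 assumes F_iso: "F \<in> ring_iso (gr_hopf H) N" and F_linear: "k_linear gr N F"
  and F_comult: "f \<in> carrier gr \<Longrightarrow> comult N (F f) = tensor_map N N F F (gr_comult H f)"
  and F_counit: "f \<in> carrier gr \<Longrightarrow> counit N (F f) = counit H (the_elem (f 0))"
begin

lemmas F_lin = k_linearD[OF F_linear]

lemma F_bij: "bij_betw F (carrier gr) (carrier N)"
 using F_iso by (simp add: ring_iso_def)

lemma F_mult: "f \<in> carrier gr \<Longrightarrow> f' \<in> carrier gr \<Longrightarrow> F (f \<otimes>\<^bsub>gr\<^esub> f') = F f \<otimes>\<^bsub>N\<^esub> F f'"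
 and F_one: "F \<one>\<^bsub>gr\<^esub> = \<one>\<^bsub>N\<^esub>"
 using F_iso by (simp_all add: ring_iso_def ring_hom_def)

definition "K = inv_into (carrier gr) F"

lemma K_c: "v \<in> carrier N \<Longrightarrow> K v \<in> carrier gr" and F_K: "v \<in> carrier N \<Longrightarrow> F (K v) = v"
 and K_F: "f \<in> carrier gr \<Longrightarrow> K (F f) = f"
proof -
 have im: "F ` carrier gr = carrier N" and inj: "inj_on F (carrier gr)" using F_bij by (simp_all add: bij_betw_def)
 show "v \<in> carrier N \<Longrightarrow> K v \<in> carrier gr" unfolding K_def im[symmetric] by (rule inv_into_into)
 show "v \<in> carrier N \<Longrightarrow> F (K v) = v" using f_inv_into_f[of v F "carrier gr"] by (simp add: im K_def)
 show "f \<in> carrier gr \<Longrightarrow> K (F f) = f" unfolding K_def by (rule inv_into_f_f[OF inj])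
qed

lemma K_linear: "k_linear N gr K"
proof (rule k_linearI)
 fix u v assume uv: "u \<in> carrier N" "v \<in> carrier N"
 have "K u \<oplus>\<^bsub>gr\<^esub> K v \<in> carrier gr" using K_c uv by simp
 from K_F[OF this] show "K (u \<oplus>\<^bsub>N\<^esub> v) = K u \<oplus>\<^bsub>gr\<^esub> K v" using uv by (simp add: F_lin K_c F_K)
next
 fix d u assume u: "u \<in> carrier N"
 have "d \<odot>\<^bsub>gr\<^esub> K u \<in> carrier gr" using K_c u by simp
 from K_F[OF this] show "K (d \<odot>\<^bsub>N\<^esub> u) = d \<odot>\<^bsub>gr\<^esub> K u" using u by (simp add: F_lin K_c F_K)
qed (rule K_c)

text \<open>Homogeneous forms evaluate the coproduct of gr H by convolution in H, and F carries that
  coproduct to N. So the known coproduct of N determines convolutions in H, for forms that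
  annihilate the lower filtration steps.\<close>

lemma cv_model:
 assumes r: "r \<in> grs" and p: "\<phi> \<in> perp H (cb i)" "\<psi> \<in> perp H (cb j)"
 shows "cv \<phi> \<psi> (r (i + j)) = N.HH.tf (\<lambda>v. ev i \<phi> (K v)) (\<lambda>v. ev j \<psi> (K v)) (comult N (F (gr_of r)))"
proof -
 note rc = gr_ofI[OF r]
 note e = ev_linear[OF p(1)] ev_linear[OF p(2)]
 note e' = k_linear_comp[OF K_linear e(1)] k_linear_comp[OF K_linear e(2)]
 note e'' = k_linear_comp[OF F_linear e'(1)] k_linear_comp[OF F_linear e'(2)]
 have "N.HH.tf (\<lambda>v. ev i \<phi> (K v)) (\<lambda>v. ev j \<psi> (K v)) (comult N (F (gr_of r))) =
   GG.tf (\<lambda>f. ev i \<phi> (K (F f))) (\<lambda>f. ev j \<psi> (K (F f))) (gr_comult H (gr_of r))"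
  unfolding F_comult[OF rc]
  by (rule tf_tensor_map[OF gr_kvs gr_kvs N.kvs_axioms N.kvs_axioms F_linear F_linear e' gr_comult_closed[OF rc]])
 also have "\<dots> = GG.tf (ev i \<phi>) (ev j \<psi>) (gr_comult H (gr_of r))"
  by (rule GG.tf_cong[OF e''(1) e(1) e''(2) e(2) _ _ gr_comult_closed[OF rc]]) (simp_all add: K_F)
 finally show ?thesis by (simp add: tf_gr_comult[OF r p])
qed

text \<open>F in degree 0, where H_0 embeds in gr H because the step below it is zero.\<close>

definition "\<theta> v = F (gr_class H 0 v)"

lemma theta_c: "v \<in> cf 0 \<Longrightarrow> \<theta> v \<in> carrier N"
 by (simp add: \<theta>_def F_lin gr_class_closed)

lemma theta_inj: "u \<in> cf 0 \<Longrightarrow> v \<in> cf 0 \<Longrightarrow> \<theta> u = \<theta> v \<Longrightarrow> u = v"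
proof -
 assume uv: "u \<in> cf 0" "v \<in> cf 0" "\<theta> u = \<theta> v"
 have "K (\<theta> u) = gr_class H 0 u" "K (\<theta> v) = gr_class H 0 v"
  unfolding \<theta>_def by (rule K_F[OF gr_class_closed[OF uv(1)]], rule K_F[OF gr_class_closed[OF uv(2)]])
 then have "gr_class H 0 u = gr_class H 0 v" unfolding uv(3) by (rule trans[OF sym])
 then have "u \<ominus> v = \<zero>" using gr_class_eq[OF uv(1,2)] by simp
 then show "u = v" by (rule eq_of_diff_zero[OF cf_closed[OF uv(1)] cf_closed[OF uv(2)]])
qed

lemma theta_linear:
 "u \<in> cf 0 \<Longrightarrow> v \<in> cf 0 \<Longrightarrow> \<theta> (u \<oplus> v) = \<theta> u \<oplus>\<^bsub>N\<^esub> \<theta> v" "u \<in> cf 0 \<Longrightarrow> \<theta> (d \<odot> u) = d \<odot>\<^bsub>N\<^esub> \<theta> u"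
 by (simp_all add: \<theta>_def gr_class_linear F_lin gr_class_closed)

lemma theta_mult: "u \<in> cf 0 \<Longrightarrow> v \<in> cf 0 \<Longrightarrow> \<theta> (u \<otimes> v) = \<theta> u \<otimes>\<^bsub>N\<^esub> \<theta> v"
 using gr_class_mult[of u 0 v 0] F_mult[OF gr_class_closed[of u 0] gr_class_closed[of v 0]] by (simp add: \<theta>_def)

lemma theta_one: "\<theta> \<one> = \<one>\<^bsub>N\<^esub>"
 using F_one gr_one by (simp add: \<theta>_def)

lemma gr_comult_grouplike:
 assumes g: "g \<in> grouplikes H"
 shows "gr_comult H (gr_class H 0 g) = GG.pt (gr_class H 0 g) (gr_class H 0 g)"
proof -
 note g0 = grouplike_cf0[OF g] and gc = grouplikesD(1)[OF g]
 have "gr_rel (gr_of (sgl 0 g)) [(0, 0, g, g)]"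
  unfolding gr_rel_def
 proof (intro conjI allI)
  fix n
  show "\<exists>h\<in>gr_of (sgl 0 g) n. \<Delta> h = list_sum HH.T (map (\<lambda>(i, j, v, w). HH.pt v w) (filter (\<lambda>(i, j, v, w). i + j = n) [(0, 0, g, g)]))"
  proof (cases "n = 0")
   case True
   have "g \<in> gr_of (sgl 0 g) n" using coset_self[OF cb_ks[of 0] gc] True by (simp add: gr_of_def sgl_def)
   then show ?thesis using True grouplikesD(2)[OF g] gc by (intro bexI[of _ g]) simp_all
  next
   case False
   have "\<zero> \<in> gr_of (sgl 0 g) n" using coset_self[OF cb_ks[of n], of \<zero>] False by (simp add: gr_of_def sgl_def)
   then show ?thesis using False k_linear_zero[OF comult_lin HH.T_kvs] by (intro bexI[of _ \<zero>]) simp_all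
  qed
 qed (use g0 in simp)
 from gr_comult_eq[OF sgl_grs[OF g0] this] show ?thesis
  using gr_class_closed[OF g0] by (simp add: gr_val_def gr_class_sgl)
qed

lemma theta_grouplike:
 assumes g: "g \<in> grouplikes H" shows "\<theta> g \<in> grouplikes N"
proof -
 note g0 = grouplike_cf0[OF g]
 note c = gr_class_closed[OF g0]
 note TM = tensor_map_linear[OF gr_kvs gr_kvs N.kvs_axioms N.kvs_axioms F_linear F_linear]
 have "comult N (\<theta> g) = pure_tensor N N (\<theta> g) (\<theta> g)"
  unfolding \<theta>_def F_comult[OF c] gr_comult_grouplike[OF g] by (rule TM(2)[OF c c])
 moreover have "counit N (\<theta> g) = 1"
  using F_counit[OF c] gr_counit[OF sgl_grs[OF g0]] grouplikesD(3)[OF g] by (simp add: \<theta>_def gr_class_sgl sgl_def)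
 ultimately show ?thesis using theta_c[OF g0] by (simp add: grouplikes_def)
qed

text \<open>The components of positive degree of a grouplike element of \<open>gr H\<close> vanish: look at the top one.\<close>

lemma theta_surj:
 assumes m: "m \<in> grouplikes N" shows "\<exists>g\<in>grouplikes H. \<theta> g = m"
proof -
 have mc: "m \<in> carrier N" and mD: "comult N m = N.HH.pt m m" and m1: "counit N m = 1"
  using m by (simp_all add: grouplikes_def)
 obtain r where r: "r \<in> grs" "K m = gr_of r" using K_c[OF mc] unfolding gr_carrier by blast
 have Fr: "F (gr_of r) = m" using F_K[OF mc] r(2) by simp
 have cvr: "cv \<phi> \<psi> (r (i + j)) = \<phi> (r i) * \<psi> (r j)" if p: "\<phi> \<in> perp H (cb i)" "\<psi> \<in> perp H (cb j)" for \<phi> \<psi> i j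
  unfolding cv_model[OF r(1) p] Fr mD using mc
  by (simp add: N.HH.tf_pure[OF k_linear_comp[OF K_linear ev_linear[OF p(1)]] k_linear_comp[OF K_linear ev_linear[OF p(2)]]]
   r(2) ev_gr_of p r(1))
 let ?S = "{n. n \<ge> 1 \<and> r n \<notin> cb n}"
 have fin: "finite ?S"
  by (rule finite_subset[OF _ grsD(3)[OF r(1)]]) (use ksubD(2)[OF cb_ks] in auto)
 have S: "?S = {}"
 proof (rule ccontr)
  assume ne: "?S \<noteq> {}"
  define n where "n = Max ?S"
  have n: "n \<in> ?S" unfolding n_def by (rule Max_in[OF fin ne])
  \<comment> \<open>Since m is grouplike, \<phi>\<phi> takes at the component of degree 2n the
    square of the value of \<phi> in degree n. But 2n lies beyond the top degree n, so that
    component is in the lower filtration step and \<phi>\<phi> vanishes on it.\<close>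
  have "n + n \<notin> ?S"
  proof
   assume "n + n \<in> ?S"
   then have "n + n \<le> n" unfolding n_def by (rule Max_ge[OF fin])
   then show False using n by simp
  qed
  then have r2: "r (n + n) \<in> cb (n + n)" using n by simp
  have "r n \<notin> cb n" using n by simp
  from separate[OF cb_ks grsD(2)[OF r(1)] this] obtain \<phi>
   where \<phi>: "lin_form H \<phi>" "\<And>y. y \<in> cb n \<Longrightarrow> \<phi> y = 0" "\<phi> (r n) = 1" by metis
  have pp: "\<phi> \<in> perp H (cb n)" by (rule perpI[OF \<phi>(1,2)])
  show False using cvr[OF pp pp] cv_vanish[OF pp pp r2] \<phi>(3) by simp
 qed
 have rn: "r n \<in> cb n" if "n \<noteq> 0" for n using S that by (cases n) auto
 have r0: "r 0 \<in> cf 0" by (rule grsD(1)[OF r(1)])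
 have "gr_of r = gr_class H 0 (r 0)"
  unfolding gr_class_sgl gr_of_eq[OF r(1) sgl_grs[OF r0]]
 proof
  fix n
  have z: "r n \<ominus> \<zero> = r n" using grsD(2)[OF r(1)] by (simp add: a_minus_def)
  show "r n \<ominus> sgl 0 (r 0) n \<in> cb n"
   using rn[of n] grsD(2)[OF r(1), of 0] z by (cases "n = 0") (simp_all add: sgl_def a_minus_def M.r_neg)
 qed
 then have th: "\<theta> (r 0) = m" using Fr by (simp add: \<theta>_def)
 have rc: "r 0 \<in> carrier H" by (rule grsD(2)[OF r(1)])
 have "\<Delta> (r 0) = HH.pt (r 0) (r 0)"
 proof (rule HH.tf_eqI)
  fix \<phi> \<psi> assume f: "lin_form H \<phi>" "lin_form H \<psi>"
  have pp: "\<phi> \<in> perp H (cb 0)" "\<psi> \<in> perp H (cb 0)"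
   by (rule perpI, rule f, simp add: form_simps(1)[OF f(1)] form_simps(1)[OF f(2)])+
  show "HH.tf \<phi> \<psi> (\<Delta> (r 0)) = HH.tf \<phi> \<psi> (HH.pt (r 0) (r 0))"
   using cvr[OF pp] rc by (simp add: cv_def HH.tf_pure[OF f])
 qed (use rc in simp_all)
 moreover have "counit H (r 0) = 1"
  using F_counit[OF gr_ofI[OF r(1)]] gr_counit[OF r(1)] m1 by (simp add: Fr)
 ultimately show ?thesis using th rc by (intro bexI[of _ "r 0"]) (simp_all add: grouplikes_def)
qed

lemma finite_grouplikes: "finite (grouplikes H)"
proof -
 have "grouplikes N \<subseteq> (\<lambda>(i, j). N.hh i j) ` ({..<p} \<times> {..<p})"
 proof
  fix m assume "m \<in> grouplikes N"
  then obtain i j where "m = N.hh i j" unfolding N.grouplikes_hh by blast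
  then have "m = N.hh (i mod p) (j mod p)" by (simp add: N.hh_mod)
  then show "m \<in> (\<lambda>(i, j). N.hh i j) ` ({..<p} \<times> {..<p})" using N.char(2) by (intro image_eqI[of _ _ "(i mod p, j mod p)"]) simp_all
 qed
 then have "finite (grouplikes N)" by (rule finite_subset) simp
 moreover have "inj_on \<theta> (grouplikes H)" by (rule inj_onI) (rule theta_inj[OF grouplike_cf0 grouplike_cf0])
 ultimately show ?thesis by (intro inj_on_finite[of \<theta> _ "grouplikes N"]) (auto intro: theta_grouplike)
qed

lemma grouplike_dual:
 assumes g: "g \<in> grouplikes H"
 shows "\<exists>\<phi>. lin_form H \<phi> \<and> (\<forall>h\<in>grouplikes H. \<phi> h = (if g = h then 1 else 0))"
proof -
 obtain i j where "\<theta> g = N.hh i j" using theta_grouplike[OF g] unfolding N.grouplikes_hh by blast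
 then have ij: "\<theta> g = N.hh (i mod p) (j mod p)" by (simp add: N.hh_mod)
 define k l where "k = i mod p" and "l = j mod p"
 have kl: "k < p" "l < p" "0 < p" using N.char(2) by (simp_all add: k_def l_def)
 note co = N.co_props[OF kl(3,1,2)]
 obtain \<phi> where \<phi>: "\<phi> \<in> perp H (cb 0)" "\<forall>v\<in>cf 0. \<phi> v = N.co 0 k l (F (gr_class H 0 v))"
  using gr_form_extends[OF k_linear_comp[OF F_linear co(1)], of 0] by blast
 have "\<phi> h = (if g = h then 1 else 0)" if h: "h \<in> grouplikes H" for h
 proof -
  obtain i' j' where "\<theta> h = N.hh i' j'" using theta_grouplike[OF h] unfolding N.grouplikes_hh by blast
  then have ij': "\<theta> h = N.B 0 (i' mod p) (j' mod p)" by (simp add: N.hh_mod N.B_simps)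
  have "\<phi> h = N.co 0 k l (\<theta> h)" using \<phi>(2) grouplike_cf0[OF h] by (simp add: \<theta>_def)
  also have "\<dots> = (if i' mod p = k \<and> j' mod p = l then 1 else 0)"
   unfolding ij' using co(2)[of 0 "i' mod p" "j' mod p"] N.char(2) by simp
  also have "\<dots> = (if g = h then 1 else 0)"
  proof -
   have "i' mod p = k \<and> j' mod p = l \<longleftrightarrow> g = h"
   proof
    assume "i' mod p = k \<and> j' mod p = l"
    then have "\<theta> h = \<theta> g" using ij ij' by (simp add: N.B_simps k_def l_def)
    then show "g = h" using theta_inj[OF grouplike_cf0[OF h] grouplike_cf0[OF g]] by simp
   next
    assume "g = h"
    then have "N.B 0 (i' mod p) (j' mod p) = N.B 0 k l" using ij ij' by (simp add: N.B_simps k_def l_def)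
    then have "N.co 0 k l (N.B 0 (i' mod p) (j' mod p)) = 1" using co(2)[OF kl(3,1,2)] by simp
    then show "i' mod p = k \<and> j' mod p = l"
     using co(2)[of 0 "i' mod p" "j' mod p"] N.char(2) by (simp split: if_splits)
   qed
   then show ?thesis by simp
  qed
  finally show ?thesis .
 qed
 then show ?thesis using perpD(1)[OF \<phi>(1)] by blast
qed

definition "ed g = (SOME \<phi>. lin_form H \<phi> \<and> (\<forall>h\<in>grouplikes H. \<phi> h = (if g = h then 1 else 0)))"

lemma ed_props: "g \<in> grouplikes H \<Longrightarrow> lin_form H (ed g) \<and> (\<forall>h\<in>grouplikes H. ed g h = (if g = h then 1 else 0))"
 unfolding ed_def by (rule someI_ex[OF grouplike_dual])

lemma finite_pointed: "finite_pointed H ed"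
 by unfold_locales (use finite_grouplikes ed_props in auto)

sublocale finite_pointed H ed by (rule finite_pointed)

definition "\<gamma>a = (SOME g. g \<in> \<Gamma> \<and> \<theta> g = a)"
definition "\<gamma>b = (SOME g. g \<in> \<Gamma> \<and> \<theta> g = b)"

lemma gamma: "\<gamma>a \<in> \<Gamma>" "\<theta> \<gamma>a = a" "\<gamma>b \<in> \<Gamma>" "\<theta> \<gamma>b = b"
proof -
 have "a \<in> grouplikes N" "b \<in> grouplikes N"
  unfolding N.grouplikes_hh using N.hh_simps(2,3) by (metis (mono_tags, lifting) mem_Collect_eq)+
 from theta_surj[OF this(1)] theta_surj[OF this(2)]
 have "\<exists>g. g \<in> \<Gamma> \<and> \<theta> g = a" "\<exists>g. g \<in> \<Gamma> \<and> \<theta> g = b" by blast+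
 from someI_ex[OF this(1)] someI_ex[OF this(2)]
 show "\<gamma>a \<in> \<Gamma>" "\<theta> \<gamma>a = a" "\<gamma>b \<in> \<Gamma>" "\<theta> \<gamma>b = b" by (simp_all add: \<gamma>a_def \<gamma>b_def)
qed

lemmas gamma_c [simp] = grouplikesD(1)[OF gamma(1)] grouplikesD(1)[OF gamma(3)]

lemma pow_grouplike: "g \<in> \<Gamma> \<Longrightarrow> g [^] (n::nat) \<in> \<Gamma>"
 by (induction n) (simp_all add: one_grouplike mult_grouplike)

lemma theta_pow: "g \<in> \<Gamma> \<Longrightarrow> \<theta> (g [^] (n::nat)) = \<theta> g [^]\<^bsub>N\<^esub> n"
 by (induction n) (simp_all add: theta_one theta_mult pow_grouplike grouplike_cf0)

definition "gh i j = \<gamma>a [^] (i::nat) \<otimes> \<gamma>b [^] (j::nat)"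

lemma gh_grouplike: "gh i j \<in> \<Gamma>"
 by (simp add: gh_def mult_grouplike pow_grouplike gamma)

lemma theta_gh: "\<theta> (gh i j) = N.hh i j"
 by (simp add: gh_def N.hh_def theta_mult theta_pow gamma pow_grouplike grouplike_cf0)

lemma grouplike_eqI: "g \<in> \<Gamma> \<Longrightarrow> h \<in> \<Gamma> \<Longrightarrow> \<theta> g = \<theta> h \<Longrightarrow> g = h"
 using theta_inj grouplike_cf0 by blast

lemma grouplikes_gh: "\<Gamma> = {gh i j |i j. True}"
proof
 show "\<Gamma> \<subseteq> {gh i j |i j. True}"
 proof
  fix g assume g: "g \<in> \<Gamma>"
  obtain i j where "\<theta> g = N.hh i j" using theta_grouplike[OF g] unfolding N.grouplikes_hh by blast
  then have "g = gh i j" by (intro grouplike_eqI[OF g gh_grouplike]) (simp add: theta_gh)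
  then show "g \<in> {gh i j |i j. True}" by blast
 qed
qed (use gh_grouplike in blast)

lemma gamma_relations:
 "\<gamma>a [^] p = \<one>" "\<gamma>b [^] p = \<one>" "\<gamma>a \<otimes> \<gamma>b = \<gamma>b \<otimes> \<gamma>a"
 by (rule grouplike_eqI;
   simp add: pow_grouplike gamma one_grouplike mult_grouplike theta_pow theta_one theta_mult grouplike_cf0 N.pows N.ab)+

lemma grouplike_commute: "g \<in> \<Gamma> \<Longrightarrow> h \<in> \<Gamma> \<Longrightarrow> g \<otimes> h = h \<otimes> g"
proof -
 assume gh: "g \<in> \<Gamma>" "h \<in> \<Gamma>"
 obtain i j k l where "\<theta> g = N.hh i j" "\<theta> h = N.hh k l"
  using theta_grouplike[OF gh(1)] theta_grouplike[OF gh(2)] unfolding N.grouplikes_hh by blast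
 then show ?thesis using gh
  by (intro grouplike_eqI) (simp_all add: mult_grouplike theta_mult grouplike_cf0 N.hh_mult add.commute)
qed

lemma theta_S0: assumes "v \<in> cf 0" shows "\<theta> v \<in> N.S0"
proof -
 note S = N.ksubD[OF N.S0_ks]
 have "k_subspace H {v \<in> cf 0. \<theta> v \<in> N.S0}"
 proof (rule ksubI)
  have "\<theta> \<zero> = \<zero>\<^bsub>N\<^esub>" using theta_linear(2)[OF ksubD(2)[OF cf_ks], of 0] theta_c[OF ksubD(2)[OF cf_ks]] by simp
  then show "\<zero> \<in> {v \<in> cf 0. \<theta> v \<in> N.S0}" using ksubD(2)[OF cf_ks] S(2) by simp
 qed (use cf_closed ksubD(3,4)[OF cf_ks] S(3,4) theta_linear in auto)
 then have "k_span H \<Gamma> \<subseteq> {v \<in> cf 0. \<theta> v \<in> N.S0}"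
 proof (rule span_min)
  show "\<Gamma> \<subseteq> {v \<in> cf 0. \<theta> v \<in> N.S0}"
  proof
   fix g assume g: "g \<in> \<Gamma>"
   obtain i j where "\<theta> g = N.hh i j" using theta_grouplike[OF g] unfolding N.grouplikes_hh by blast
   then show "g \<in> {v \<in> cf 0. \<theta> v \<in> N.S0}" using grouplike_cf0[OF g] N.hh_S0 by simp
  qed
 qed
 then show ?thesis using assms cf0 by blast
qed

abbreviation "\<gamma> \<equiv> \<gamma>a [^] e"

lemma gamma_e: "\<gamma> \<in> \<Gamma>" "\<theta> \<gamma> = a [^]\<^bsub>N\<^esub> e"
 by (simp_all add: pow_grouplike gamma theta_pow)

text \<open>Take a family r of representatives of the class that F maps to x. The bidegrees (1, 0)
  and (0, 1) of \<open>cvr\<close> are the one-sided hypotheses of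
  \<open>skew_primitive_exists\<close> for h = r 1.\<close>

lemma skew_primitive_lift:
 "\<exists>y\<in>carrier H. \<Delta> y = HH.pt y \<one> \<oplus>\<^bsub>HH.T\<^esub> HH.pt \<gamma> y \<and> y \<notin> cf 0"
proof -
 obtain r where r: "r \<in> grs" "K x = gr_of r" using K_c[OF N.gens(3)] unfolding gr_carrier by blast
 have Fr: "F (gr_of r) = x" using F_K[OF N.gens(3)] r(2) by simp
 have K1: "K \<one>\<^bsub>N\<^esub> = gr_class H 0 \<one>" "K (a [^]\<^bsub>N\<^esub> e) = gr_class H 0 \<gamma>"
  using K_F[OF gr_class_closed[OF grouplike_cf0[OF one_grouplike]]] K_F[OF gr_class_closed[OF grouplike_cf0[OF gamma_e(1)]]]
   theta_one gamma_e(2) by (simp_all add: \<theta>_def)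
 have cvr: "cv \<phi> \<psi> (r (i + j)) = \<phi> (r i) * (if j = 0 then \<psi> \<one> else 0) + (if i = 0 then \<phi> \<gamma> else 0) * \<psi> (r j)"
  if p: "\<phi> \<in> perp H (cb i)" "\<psi> \<in> perp H (cb j)" for \<phi> \<psi> i j
 proof -
  note f = k_linear_comp[OF K_linear ev_linear[OF p(1)]] k_linear_comp[OF K_linear ev_linear[OF p(2)]]
  have ac: "a [^]\<^bsub>N\<^esub> e \<in> carrier N" by simp
  show ?thesis
   unfolding cv_model[OF r(1) p] Fr N.comult_x
   using ac by (simp add: N.HH.tf_simps[OF f] K1 r(2)
    ev_gr_of[OF p(1) r(1)] ev_gr_of[OF p(2) r(1)] ev_class[OF p(1) grouplike_cf0[OF gamma_e(1)]]
    ev_class[OF p(2) grouplike_cf0[OF one_grouplike]])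
 qed
 have p0: "\<phi> \<in> perp H (cb 0)" if "lin_form H \<phi>" for \<phi>
  by (rule perpI[OF that]) (simp add: form_simps(1)[OF that])
 \<comment> \<open>In bidegree (1, n - 1) the coproduct of x has no part when n is at least 2, and
   this is the test for lying one step lower.\<close>
 have high: "r n \<in> cb n" if n: "2 \<le> n" for n
 proof -
  obtain m where m: "n = Suc (Suc m)" using n by (metis add_2_eq_Suc le_Suc_ex)
  have "cv \<alpha> \<beta> (r n) = 0" if "\<alpha> \<in> perp H (cf 0)" "\<beta> \<in> perp H (cf m)" for \<alpha> \<beta>
   using cvr[of \<alpha> 1 \<beta> "Suc m"] that by (simp add: m)
  then have "r n \<in> cf (Suc m)" unfolding cf_mem using grsD(2)[OF r(1)] by blast
  then show ?thesis by (simp add: m)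
 qed
 have h: "r 1 \<in> carrier H" by (rule grsD(2)[OF r(1)])
 \<comment> \<open>Otherwise only the degree 0 component of the class would survive, and x would lie
   in the span of the group.\<close>
 have h0: "r 1 \<notin> cf 0"
 proof
  assume 1: "r 1 \<in> cf 0"
  have r0: "r 0 \<in> cf 0" by (rule grsD(1)[OF r(1)])
  have "gr_of r = gr_class H 0 (r 0)"
   unfolding gr_class_sgl gr_of_eq[OF r(1) sgl_grs[OF r0]]
  proof
   fix n
   have z: "r n \<ominus> \<zero> = r n" using grsD(2)[OF r(1)] by (simp add: a_minus_def)
   consider "n = 0" | "n = 1" | "2 \<le> n" by linarith
   then show "r n \<ominus> sgl 0 (r 0) n \<in> cb n"
   proof cases
    case 1 then show ?thesis using grsD(2)[OF r(1), of 0] by (simp add: sgl_def a_minus_def M.r_neg)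
   next
    case 2 then show ?thesis using 1 z by (simp add: sgl_def)
   next
    case 3 then show ?thesis using high[OF 3] z by (simp add: sgl_def)
   qed
  qed
  then have "x = \<theta> (r 0)" using Fr by (simp add: \<theta>_def)
  then show False using theta_S0[OF r0] N.x_notin by (simp add: N.S0_def)
 qed
 have left: "cv \<phi> \<psi> (r 1) = \<phi> (r 1) * \<psi> \<one>" if "\<phi> \<in> perp H (cf 0)" "lin_form H \<psi>" for \<phi> \<psi>
  using cvr[of \<phi> 1 \<psi> 0] that p0 by simp
 have right: "cv \<phi> \<psi> (r 1) = \<phi> \<gamma> * \<psi> (r 1)" if "lin_form H \<phi>" "\<psi> \<in> perp H (cf 0)" for \<phi> \<psi>
  using cvr[of \<phi> 0 \<psi> 1] that p0 by simp
 obtain y where y: "y \<in> carrier H" "\<Delta> y = HH.pt y \<one> \<oplus>\<^bsub>HH.T\<^esub> HH.pt \<gamma> y" "y \<ominus> r 1 \<in> cf 0"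
  using skew_primitive_exists[OF gamma_e(1) h left right] by blast
 have "y \<notin> cf 0"
 proof
  assume "y \<in> cf 0"
  then have "y \<ominus> (y \<ominus> r 1) \<in> cf 0" by (rule ksubD(6)[OF cf_ks _ y(3)])
  moreover have "y \<ominus> (y \<ominus> r 1) = r 1" by (rule form_eqI) (use y(1) h in \<open>auto simp: form_simps\<close>)
  ultimately show False using h0 by simp
 qed
 then show ?thesis using y by blast
qed

text \<open>In L(e, 0, 0) the commutators vanish, so the group is central.\<close>

lemma N_commute: assumes "v \<in> carrier N" shows "v \<otimes>\<^bsub>N\<^esub> N.hh k l = N.hh k l \<otimes>\<^bsub>N\<^esub> v"
proof (rule N.linear_basis_eq[OF N.kvs_axioms N.rmult_linear[OF N.hh_c] N.lmult_linear[OF N.hh_c] _ assms])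
 fix n i j
 have "N.hh k l \<otimes>\<^bsub>N\<^esub> x = x \<otimes>\<^bsub>N\<^esub> N.hh k l" using N.hh_x[of k l] by (simp add: N.c_def)
 then have c: "N.xf n \<otimes>\<^bsub>N\<^esub> N.hh k l = N.hh k l \<otimes>\<^bsub>N\<^esub> N.xf n"
  unfolding N.xf_def by (intro N.ff_commute) simp_all
 have "N.hh k l \<otimes>\<^bsub>N\<^esub> N.B n i j = N.hh k l \<otimes>\<^bsub>N\<^esub> N.xf n \<otimes>\<^bsub>N\<^esub> N.hh i j"
  unfolding N.B_def by (rule N.mult_assoc'[symmetric]) (rule N.hh_c N.X_c)+
 also have "\<dots> = N.xf n \<otimes>\<^bsub>N\<^esub> (N.hh k l \<otimes>\<^bsub>N\<^esub> N.hh i j)"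
  unfolding c[symmetric] by (rule N.mult_assoc') (rule N.hh_c N.X_c)+
 also have "\<dots> = N.B n i j \<otimes>\<^bsub>N\<^esub> N.hh k l"
  unfolding N.B_hh unfolding N.B_def N.hh_mult by (simp only: add.commute)
 finally show "N.B n i j \<otimes>\<^bsub>N\<^esub> N.hh k l = N.hh k l \<otimes>\<^bsub>N\<^esub> N.B n i j" ..
qed

text \<open>The group is central in N, so u y and y u have the same class in degree 1 and differ by
  an element of H_0. That difference is skew primitive with respect to u and u \<gamma>, and
  \<open>skew_primitive_coradical\<close> applies.\<close>

lemma skew_commutator:
 assumes y: "y \<in> carrier H" "\<Delta> y = HH.pt y \<one> \<oplus>\<^bsub>HH.T\<^esub> HH.pt \<gamma> y" and u: "u \<in> \<Gamma>"
 shows "\<exists>d. u \<otimes> y = y \<otimes> u \<oplus> d \<odot> (u \<ominus> u \<otimes> \<gamma>)"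
proof -
 interpret TA: k_algebra "tensor H H" by (rule HH.tensor_algebra)
 have uc: "u \<in> carrier H" and gc: "\<gamma> \<in> carrier H" using grouplikesD(1) u gamma_e by auto
 have y1: "y \<in> cf 1"
 proof -
  have "cv \<alpha> \<beta> y = 0" if ab: "\<alpha> \<in> perp H (cf 0)" "\<beta> \<in> perp H (cf 0)" for \<alpha> \<beta>
  proof -
   note f = perpD(1)[OF ab(1)] perpD(1)[OF ab(2)]
   have "cv \<alpha> \<beta> y = \<alpha> y * \<beta> \<one> + \<alpha> \<gamma> * \<beta> y"
    unfolding cv_def y(2) using y(1) gc by (simp add: HH.tf_simps[OF f])
   then show ?thesis using perpD(2)[OF ab(1) grouplike_cf0[OF gamma_e(1)]] perpD(2)[OF ab(2) grouplike_cf0[OF one_grouplike]] by simp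
  qed
  then have "y \<in> cf (Suc 0)" unfolding cf_mem using y(1) by (intro conjI ballI)
  then show ?thesis by (simp only: One_nat_def)
 qed
 note u0 = grouplike_cf0[OF u]
 have uy: "u \<otimes> y \<in> cf 1" "y \<otimes> u \<in> cf 1" using cf_mult[OF u0 y1] cf_mult[OF y1 u0] by simp_all
 obtain k l where kl: "\<theta> u = N.hh k l" using theta_grouplike[OF u] unfolding N.grouplikes_hh by blast
 have "F (gr_class H 0 u \<otimes>\<^bsub>gr\<^esub> gr_class H 1 y) = F (gr_class H 1 y \<otimes>\<^bsub>gr\<^esub> gr_class H 0 u)"
  unfolding F_mult[OF gr_class_closed[OF u0] gr_class_closed[OF y1]] F_mult[OF gr_class_closed[OF y1] gr_class_closed[OF u0]]
  using N_commute[OF F_lin(1)[OF gr_class_closed[OF y1]], of k l] kl by (simp add: \<theta>_def)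
 then have "F (gr_class H 1 (u \<otimes> y)) = F (gr_class H 1 (y \<otimes> u))"
  using gr_class_mult[OF u0 y1] gr_class_mult[OF y1 u0] by simp
 then have "gr_class H 1 (u \<otimes> y) = gr_class H 1 (y \<otimes> u)"
  using K_F[OF gr_class_closed[OF uy(1)]] K_F[OF gr_class_closed[OF uy(2)]] by simp
 then have z0: "u \<otimes> y \<ominus> y \<otimes> u \<in> cf 0" using gr_class_eq[OF uy] by simp
 have c: "u \<otimes> y \<in> carrier H" "y \<otimes> u \<in> carrier H" "u \<otimes> \<gamma> \<in> carrier H" using uc y(1) gc by simp_all
 have D1: "\<Delta> (u \<otimes> y) = HH.pt (u \<otimes> y) u \<oplus>\<^bsub>HH.T\<^esub> HH.pt (u \<otimes> \<gamma>) (u \<otimes> y)"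
  using TA.mult_linear(1)[of "HH.pt u u" "HH.pt y \<one>" "HH.pt \<gamma> y"] uc y gc
  by (simp add: comult_mult' grouplikesD(2)[OF u] HH.tensor_mult_pure)
 have D2: "\<Delta> (y \<otimes> u) = HH.pt (y \<otimes> u) u \<oplus>\<^bsub>HH.T\<^esub> HH.pt (u \<otimes> \<gamma>) (y \<otimes> u)"
  using TA.mult_linear(2)[of "HH.pt u u" "HH.pt y \<one>" "HH.pt \<gamma> y"] uc y gc
  by (simp add: comult_mult' grouplikesD(2)[OF u] HH.tensor_mult_pure grouplike_commute[OF u gamma_e(1)])
 have "\<Delta> (u \<otimes> y \<ominus> y \<otimes> u) = HH.pt (u \<otimes> y \<ominus> y \<otimes> u) u \<oplus>\<^bsub>HH.T\<^esub> HH.pt (u \<otimes> \<gamma>) (u \<otimes> y \<ominus> y \<otimes> u)"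
 proof (rule HH.tf_eqI)
  fix \<phi> \<psi> assume f: "lin_form H \<phi>" "lin_form H \<psi>"
  show "HH.tf \<phi> \<psi> (\<Delta> (u \<otimes> y \<ominus> y \<otimes> u)) =
   HH.tf \<phi> \<psi> (HH.pt (u \<otimes> y \<ominus> y \<otimes> u) u \<oplus>\<^bsub>HH.T\<^esub> HH.pt (u \<otimes> \<gamma>) (u \<otimes> y \<ominus> y \<otimes> u))"
   unfolding k_linear_diff[OF comult_lin HH.T_kvs c(1,2)] D1 D2 using c uc
   by (simp add: HH.tf_simps[OF f] form_simps[OF f(1)] form_simps[OF f(2)] algebra_simps)
 qed (use c uc in simp_all)
 from skew_primitive_coradical[OF z0 u mult_grouplike[OF u gamma_e(1)] this]
 obtain d where d: "u \<otimes> y \<ominus> y \<otimes> u = d \<odot> (u \<ominus> u \<otimes> \<gamma>)" by blast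
 have "u \<otimes> y = y \<otimes> u \<oplus> (u \<otimes> y \<ominus> y \<otimes> u)" by (rule form_eqI) (use c in \<open>auto simp: form_simps\<close>)
 then show ?thesis unfolding d by blast
qed

end

lemma (in k_algebra) pow_scale: "y \<in> carrier A \<Longrightarrow> (d \<odot> y) [^] (n::nat) = d ^ n \<odot> y [^] n"
 by (induction n) (simp_all add: smult_mult_left smult_mult_right sm_assoc mult.commute)

text \<open>X_p is primitive, so it is d x by \<open>primitive_multiple\<close>. For e = 1 its
  coproduct is d (x \<otimes> 1 + a \<otimes> x) as well as d (x \<otimes> 1 + 1 \<otimes> x); the
  coordinates at a and x tell a from 1 and give d = 0.\<close>

lemma (in lift_full) xf_p_multiple: "\<exists>d. xf p = d \<odot> x \<and> (e = 1 \<longrightarrow> d = 0)"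
proof -
 obtain d where d: "xf p = d \<odot> x" using primitive_multiple[OF X_c comult_X_p] by blast
 have "d = 0" if e1: "e = 1"
 proof -
  have p: "0 < p" "1 < p" using p_gt_1 by simp_all
  let ?\<phi> = "co 0 (Suc 0) 0" and ?\<psi> = "co (Suc 0) 0 0"
  note f = co_props(1)[OF p(1,2,1), unfolded One_nat_def] co_props(1)[OF p(2,1,1), unfolded One_nat_def]
  have v: "?\<phi> \<one> = 0" "?\<phi> x = 0" "?\<phi> a = 1" "?\<psi> \<one> = 0" "?\<psi> x = 1"
   using co_props(2)[OF p(1,2,1), of 0 0 0] co_props(2)[OF p(1,2,1), of 1 0 0] co_props(2)[OF p(1,2,1), of 0 1 0]
    co_props(2)[OF p(2,1,1), of 0 0 0] co_props(2)[OF p(2,1,1), of 1 0 0] p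
   by (simp_all add: B_simps hh_simps)
  have "\<Delta> (xf p) = d \<odot>\<^bsub>HH.T\<^esub> (HH.pt x \<one> \<oplus>\<^bsub>HH.T\<^esub> HH.pt a x)"
   unfolding d using comult_x e1 by (simp add: k_linearD(3)[OF comult_lin])
  then have "HH.tf ?\<phi> ?\<psi> (\<Delta> (xf p)) = d"
   by (simp add: HH.tf_simps[OF f] v)
  moreover have "HH.tf ?\<phi> ?\<psi> (\<Delta> (xf p)) = 0"
   unfolding comult_X_p unfolding d
   by (simp add: HH.tf_simps[OF f] v form_simps[OF f(1)] form_simps[OF f(2)])
  ultimately show ?thesis by simp
 qed
 then show ?thesis using d by blast
qed

context gr_lifting begin

definition sprim :: "'h \<Rightarrow> bool" where
 "sprim y \<longleftrightarrow> y \<in> carrier H \<and> \<Delta> y = HH.pt y \<one> \<oplus>\<^bsub>HH.T\<^esub> HH.pt \<gamma> y \<and> y \<notin> cf 0"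

definition twist :: "'k \<Rightarrow> 'h \<Rightarrow> 'h \<Rightarrow> bool" where
 "twist d u y \<longleftrightarrow> u \<otimes> y = y \<otimes> u \<oplus> d \<odot> (u \<ominus> u \<otimes> \<gamma>)"

lemma sprim_scale: assumes "sprim y" "k \<noteq> 0" shows "sprim (k \<odot> y)"
proof -
 have y: "y \<in> carrier H" "\<Delta> y = HH.pt y \<one> \<oplus>\<^bsub>HH.T\<^esub> HH.pt \<gamma> y" "y \<notin> cf 0"
  using assms by (simp_all add: sprim_def)
 have gc: "\<gamma> \<in> carrier H" by simp
 have "\<Delta> (k \<odot> y) = HH.pt (k \<odot> y) \<one> \<oplus>\<^bsub>HH.T\<^esub> HH.pt \<gamma> (k \<odot> y)"
  using y(1) gc by (simp add: k_linearD(3)[OF comult_lin] y(2) HH.pure_scale_left HH.pure_scale_right HH.T.sm_add_r)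
 moreover have "k \<odot> y \<notin> cf 0"
 proof
  assume "k \<odot> y \<in> cf 0"
  from ksubD(4)[OF cf_ks this, of "inverse k"] show False using y assms(2) by (simp add: sm_assoc)
 qed
 ultimately show ?thesis using y(1) by (simp add: sprim_def)
qed

lemma twist_scale:
 assumes "twist d u y" "u \<in> carrier H" "y \<in> carrier H"
 shows "twist (k * d) u (k \<odot> y)"
 using assms by (simp add: twist_def smult_mult_left smult_mult_right sm_add_r sm_assoc)

text \<open>With \<gamma> = 1 the correction term is zero whatever its scalar. For e = 0 the
  parameter s is therefore free to be adapted to the relation for the p-th power.\<close>

lemma twist_trivial:
 assumes "e = 0" "u \<in> carrier H" "y \<in> carrier H" "twist d u y" shows "twist d' u y"
proof -
 have "\<gamma> = \<one>" using assms(1) by simp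
 then show ?thesis using assms(2-4) by (simp add: twist_def a_minus_def M.r_neg)
qed

lemma lift_data_H:
 assumes y: "sprim y" and s: "s = 0 \<or> s = 1" and tw: "twist s \<gamma>a y" "twist t \<gamma>b y"
 shows "lift_data H p e s t \<gamma>a \<gamma>b y"
proof -
 have yc: "y \<in> carrier H" and yD: "\<Delta> y = HH.pt y \<one> \<oplus>\<^bsub>HH.T\<^esub> HH.pt \<gamma> y" using y by (simp_all add: sprim_def)
 have gc: "\<gamma> \<in> carrier H" and g1: "counit H \<gamma> = 1" using grouplikesD[OF gamma_e(1)] by simp_all
 \<comment> \<open>The right counit law gives y = y + \<epsilon>(y) \<gamma>, where \<epsilon> is
   the counit; applying \<epsilon> once more shows \<epsilon>(y) = 0.\<close>
 have "HH.rsl (counit H) (\<Delta> y) = y" using counit_right[OF yc] by (simp add: HH.rsl_def)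
 moreover have "HH.rsl (counit H) (\<Delta> y) = y \<oplus> counit H y \<odot> \<gamma>"
  unfolding yD using yc gc
  by (simp add: k_linearD(2)[OF HH.rsl_linear[OF counit_linear]] HH.rsl_pure[OF counit_linear] grouplikesD(3)[OF one_grouplike])
 ultimately have "counit H (y \<oplus> counit H y \<odot> \<gamma>) = counit H y" by simp
 moreover have "(2::'k) \<noteq> 1" by (metis one_add_one add_cancel_right_right zero_neq_one)
 ultimately have cy: "counit H y = 0" using yc gc g1 by (simp add: form_simps[OF counit_linear])
 show ?thesis
 proof unfold_locales
  show "comult H y = pure_tensor H H y \<one> \<oplus>\<^bsub>tensor H H\<^esub> pure_tensor H H (\<gamma>a [^] e) y" using yD by simp
 qed (use comult_linear comult_mult counit_linear counit_mult N.char N.e s yc gamma_relations tw cy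
   grouplikesD[OF gamma(1)] grouplikesD[OF gamma(3)] in \<open>simp_all add: twist_def\<close>)
qed

lemma lift_basis_H:
 assumes y: "sprim y" and s: "s = 0 \<or> s = 1" and tw: "twist s \<gamma>a y" "twist t \<gamma>b y"
 shows "lift_basis H p e s t \<gamma>a \<gamma>b y"
proof -
 interpret L: lift_data H p e s t \<gamma>a \<gamma>b y by (rule lift_data_H[OF assms])
 have hh: "L.hh = gh" by (intro ext) (simp add: L.hh_def gh_def)
 show ?thesis
 proof unfold_locales
  fix i j assume ij: "i < p" "j < p"
  have "ed (gh i j) (gh k l) = (if k = i \<and> l = j then 1 else 0)" if kl: "k < p" "l < p" for k l
  proof -
   have "gh i j = gh k l \<longleftrightarrow> k = i \<and> l = j"
   proof
    assume "gh i j = gh k l"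
    then have "N.hh i j = N.hh k l" by (simp flip: theta_gh)
    then have "N.bb (0, i, j) = N.bb (0, k, l)" by (simp add: N.bb_def N.B_simps)
    moreover have "(0, i, j) \<in> N.Ix" "(0, k, l) \<in> N.Ix" using ij kl by simp_all
    ultimately show "k = i \<and> l = j" using inj_onD[OF N.bb_inj] by blast
   qed simp
   then show ?thesis using E_dual[OF gh_grouplike gh_grouplike] by simp
  qed
  then show "\<exists>\<phi>. lin_form H \<phi> \<and> (\<forall>k<p. \<forall>l<p. \<phi> (L.hh k l) = (if k = i \<and> l = j then 1 else 0))"
   unfolding hh using E_form[OF gh_grouplike] by (intro exI[of _ "ed (gh i j)"]) simp
 next
  show "y \<notin> k_span H {L.hh k l |k l. True}"
   unfolding hh grouplikes_gh[symmetric] cf0[symmetric] using y by (simp add: sprim_def)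
 qed
qed

lemma generators:
 assumes dim: "has_dimension H (p ^ 3)" and root: "\<And>c :: 'k. \<exists>z. z ^ (p - 1) = c"
 shows "\<exists>s t y. lift_full H p e s t \<gamma>a \<gamma>b y \<and> ff H s y p = \<zero> \<and> (e = 0 \<longrightarrow> t = 0) \<and>
  (e = 1 \<longrightarrow> s = 0 \<and> t \<in> {0, 1} \<or> s = 1)"
proof -
 obtain y0 where y0: "sprim y0" using skew_primitive_lift unfolding sprim_def by blast
 have y0c: "y0 \<in> carrier H" and y0D: "\<Delta> y0 = HH.pt y0 \<one> \<oplus>\<^bsub>HH.T\<^esub> HH.pt \<gamma> y0" using y0 by (simp_all add: sprim_def)
 obtain da db where tw: "twist da \<gamma>a y0" "twist db \<gamma>b y0"
  using skew_commutator[OF y0c y0D gamma(1)] skew_commutator[OF y0c y0D gamma(3)] unfolding twist_def by blast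
 note sc = twist_scale[OF tw(1) gamma_c(1) y0c] twist_scale[OF tw(2) gamma_c(2) y0c]
 have "\<exists>s t y. sprim y \<and> twist s \<gamma>a y \<and> twist t \<gamma>b y \<and> (s = 0 \<or> s = 1) \<and> (e = 0 \<longrightarrow> s = 0 \<and> t = 0) \<and>
   (e = 1 \<longrightarrow> s = 0 \<and> t \<in> {0, 1} \<or> s = 1)"
 \<comment> \<open>Rescaling y multiplies both commutator scalars by the same factor. A nonzero
   scalar of the first generator is normalised to 1, which leaves that of the second arbitrary; only
   if the first is zero can the second be normalised.\<close>
 proof (cases "e = 0")
  case True
  show ?thesis
   using True y0 twist_trivial[OF True gamma_c(1) y0c tw(1), of 0] twist_trivial[OF True gamma_c(2) y0c tw(2), of 0]
   by (intro exI[of _ "0::'k"] exI[of _ y0]) simp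
 next
  case False
  consider "da \<noteq> 0" | "da = 0" "db \<noteq> 0" | "da = 0" "db = 0" by blast
  then show ?thesis
  proof cases
   case 1
   then show ?thesis using sprim_scale[OF y0, of "inverse da"] sc[of "inverse da"] False
    by (intro exI[of _ "1::'k"] exI[of _ "inverse da * db"] exI[of _ "inverse da \<odot> y0"]) simp
  next
   case 2
   then show ?thesis using sprim_scale[OF y0, of "inverse db"] sc[of "inverse db"] False
    by (intro exI[of _ "0::'k"] exI[of _ "1::'k"] exI[of _ "inverse db \<odot> y0"]) simp
  next
   case 3
   then show ?thesis using y0 tw False by (intro exI[of _ "0::'k"] exI[of _ y0]) simp
  qed
 qed
 then obtain s t y where y: "sprim y" "twist s \<gamma>a y" "twist t \<gamma>b y" and s: "s = 0 \<or> s = 1"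
  and st: "e = 0 \<longrightarrow> s = 0 \<and> t = 0" "e = 1 \<longrightarrow> s = 0 \<and> t \<in> {0, 1} \<or> s = 1" by blast
 have yc: "y \<in> carrier H" using y(1) by (simp add: sprim_def)
 have full: "lift_full H p e s t \<gamma>a \<gamma>b y"
  by (rule lift_basis.lift_full_of_dimension[OF lift_basis_H[OF y(1) s y(2,3)] dim])
 have xf: "lift_data.xf H s y p = ff H s y p"
  by (rule lift_data.xf_def[OF lift_data_H[OF y(1) s y(2,3)]])
 obtain d where d: "ff H s y p = d \<odot> y" "e = 1 \<longrightarrow> d = 0"
  using lift_full.xf_p_multiple[OF full] unfolding xf by blast
 show ?thesis
 proof (cases "d = 0")
  case True
  then have "ff H s y p = \<zero>" using d(1) yc by simp
  then show ?thesis using full st by blast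
 next
  case False
  \<comment> \<open>A nonzero d survives only for trivial \<gamma>, where both commutators vanish
    and y may still be rescaled.\<close>
  then have e0: "e = 0" using d(2) N.e by blast
  then have s0: "s = 0" "t = 0" using st(1) by simp_all
  \<comment> \<open>The constant is chosen so that k^p d = k, which turns y^p = d y into the
    relation (k y)^p = k y.\<close>
  obtain k where k: "k ^ (p - 1) = inverse d" using root by blast
  have k0: "k \<noteq> 0" using k False N.p_gt_1 by (auto simp: zero_power)
  have y': "sprim (k \<odot> y)" by (rule sprim_scale[OF y(1) k0])
  have yc': "k \<odot> y \<in> carrier H" using yc by simp
  have tw': "twist 1 \<gamma>a (k \<odot> y)" "twist 0 \<gamma>b (k \<odot> y)"
   using twist_trivial[OF e0 gamma_c(1) yc' twist_scale[OF y(2) gamma_c(1) yc]]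
    twist_trivial[OF e0 gamma_c(2) yc' twist_scale[OF y(3) gamma_c(2) yc]] by blast+
  have full': "lift_full H p e 1 0 \<gamma>a \<gamma>b (k \<odot> y)"
   by (rule lift_basis.lift_full_of_dimension[OF lift_basis_H[OF y' _ tw'] dim]) simp
  have yp: "y [^] p = d \<odot> y"
   using ff_prime[OF N.char s yc] d(1) yc by (simp add: s0 a_minus_def)
  have "k ^ p * d = k"
  proof -
   have "k ^ p = k * k ^ (p - 1)" using N.char(2) by (simp add: power_eq_if)
   then show ?thesis using k False by simp
  qed
  then have "(k \<odot> y) [^] p = k \<odot> y" using yc yp by (simp add: pow_scale sm_assoc)
  then have "ff H 1 (k \<odot> y) p = \<zero>"
   using ff_prime[OF N.char _ yc', of 1] yc' by (simp add: a_minus_def M.r_neg)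
  then show ?thesis using full' e0 by (intro exI[of _ "1::'k"] exI[of _ "0::'k"] exI[of _ "k \<odot> y"]) simp
 qed
qed

end

lemma pointed_lifting_classification:
 fixes H :: "('k::alg_closed_field, 'h) bialg"
 assumes char: "CHAR('k) = p" "p > 0" and e: "e = 0 \<or> e = 1" and H: "pointed_lifting p e H"
 shows "\<exists>s t. (s = 0 \<or> s = 1) \<and> (e = 0 \<longrightarrow> t = 0) \<and> (e = 1 \<longrightarrow> s = 0 \<and> t \<in> {0, 1} \<or> s = 1) \<and>
  hopf_iso H (lift_alg p e s t)"
proof -
 have ph: "pointed_hopf_algebra H" and dim: "has_dimension H (p ^ 3)"
  and iso: "hopf_iso (gr_hopf H) (lift_alg p e 0 0)"
  using H by (simp_all add: pointed_lifting_def graded_model_lift_alg)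
 interpret B: lift_params p e 0 "0 :: 'k" using char e by (simp add: lift_params_def)
 have PB: "pointed_bialgebra H"
  using ph unfolding pointed_hopf_algebra_def hopf_algebra_def pointed_bialgebra_def pointed_bialgebra_axioms_def by blast
 interpret PB: pointed_bialgebra H by (rule PB)
 obtain F where F: "F \<in> ring_iso (gr_hopf H) (lift_alg p e 0 0)" "k_linear (gr_hopf H) (lift_alg p e 0 0) F"
  "\<forall>f\<in>carrier (gr_hopf H). comult (lift_alg p e 0 0) (F f) =
   tensor_map (lift_alg p e 0 0) (lift_alg p e 0 0) F F (comult (gr_hopf H) f)"
  "\<forall>f\<in>carrier (gr_hopf H). counit (lift_alg p e 0 0) (F f) = counit (gr_hopf H) f"
  using iso unfolding hopf_iso_def by blast
 have gl: "gr_lifting H (lift_alg p e 0 0) p e B.ga B.gb B.gx F"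
  unfolding gr_lifting_def gr_lifting_axioms_def
  using PB B.LL_lift_full F[unfolded PB.gr_hopf_simps PB.gr_hopf_linear] by blast
 \<comment> \<open>Algebraic closedness of k enters here, through the second rescaling in
   \<open>generators\<close>.\<close>
 have "\<exists>z :: 'k. z ^ (p - 1) = c" for c
  using nth_root_exists[of "p - 1" c] B.p_gt_1 by auto
 from gr_lifting.generators[OF gl dim this] obtain s t y a b where
  full: "lift_full H p e s t a b y" and xp: "ff H s y p = \<zero>\<^bsub>H\<^esub>"
  and st: "e = 0 \<longrightarrow> t = 0" "e = 1 \<longrightarrow> s = 0 \<and> t \<in> {0, 1} \<or> s = 1" by blast
 interpret L: lift_full H p e s t a b y by (rule full)
 interpret A: lift_params p e s t using char e L.s by (simp add: lift_params_def)
 interpret A: lift_full "lift_alg p e s t" p e s t A.ga A.gb A.gx by (rule A.LL_lift_full)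
 interpret I: lift_iso H p e s t a b y "lift_alg p e s t" A.ga A.gb A.gx
  by unfold_locales (use xp A.xf_p in \<open>simp_all only: L.xf_def\<close>)
 show ?thesis using I.iso L.s st by blast
qed

theorem mainTheorem7:
  fixes H :: "('k::alg_closed_field, 'h) bialg" and p e :: nat
  assumes char: "CHAR('k) = p" "p > 0"
    and e: "e \<in> {0, 1}"
  shows
    "(pointed_lifting p e H \<longrightarrow>
        (e = 0 \<longrightarrow> (\<exists>e2\<in>{0, 1}. hopf_iso H (lifting_primitive p e2))) \<and>
        (e = 1 \<longrightarrow> (\<exists>e1 \<tau>. (e1 = 0 \<and> \<tau> \<in> {0, 1} \<or> e1 = 1) \<and> hopf_iso H (lifting_skew p e1 \<tau>)))) \<and>
     (e = 0 \<longrightarrow> (\<forall>e2\<in>{0, 1}. pointed_lifting p e (lifting_primitive p e2 :: ('k, _) bialg))) \<and>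
     (e = 1 \<longrightarrow> (\<forall>e1 \<tau>. (e1 = 0 \<and> \<tau> \<in> {0, 1} \<or> e1 = 1) \<longrightarrow>
        pointed_lifting p e (lifting_skew p e1 \<tau> :: ('k, _) bialg)))"
proof -
  have e': "e = 0 \<or> e = 1" using e by simp
  have A: "(e = 0 \<longrightarrow> (\<exists>e2\<in>{0, 1}. hopf_iso H (lifting_primitive p e2))) \<and>
      (e = 1 \<longrightarrow> (\<exists>e1 \<tau>. (e1 = 0 \<and> \<tau> \<in> {0, 1} \<or> e1 = 1) \<and> hopf_iso H (lifting_skew p e1 \<tau>)))"
    if "pointed_lifting p e H"
    using pointed_lifting_classification[OF char e' that]
    unfolding lifting_primitive_lift_alg lifting_skew_lift_alg by auto
  have B: "pointed_lifting p e (lift_alg p e s t :: ('k, _) bialg)" if "s = 0 \<or> s = 1" for s t :: 'k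
    by (rule lift_alg_pointed_lifting[OF char e' that])
  have "pointed_lifting p e (lifting_primitive p e2 :: ('k, _) bialg)" if "e = 0" "e2 \<in> {0, 1}" for e2
    using B[of e2 0] that by (simp add: lifting_primitive_lift_alg)
  moreover have "pointed_lifting p e (lifting_skew p e1 \<tau> :: ('k, _) bialg)"
    if "e = 1" "e1 = 0 \<and> \<tau> \<in> {0, 1} \<or> e1 = 1" for e1 \<tau>
    using B[of e1 \<tau>] that by (auto simp: lifting_skew_lift_alg)
  ultimately show ?thesis using A by blast
qed

end
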